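(* Let $(\mathbf{u}^{m+1},p^{m+1},\phi^{m+1},\mu^{m+1})$ be any solution of the discrete scheme (S1)--(S4) (described in the context) for the data $(\mathbf{u}^m,\phi^m,\mu^m)$. Then $$\delta_tE(\mathbf u^{m+1},\Pi^h_1\phi^{m+1})+2\big(\eta(\phi^{m})\mathbf D\mathbf u^{m+1},\mathbf D\mathbf u^{m+1}\big)+b_h^{\mathrm{upw}}\big(-\nabla^0_{\mathbf n}\mu^{m+1};M(\phi^{m+1}),\Pi_0\mu^{m+1}\big)\le 0,$$ where $$E(\mathbf u,\phi)=\int_\Omega\rho(\phi)\frac{|\mathbf u|^2}{2}+\frac{\lambda\varepsilon}{2}\int_\Omega|\nabla\phi|^2+\frac\lambda\varepsilon\int_\Omega F(\phi),\qquad F(\phi)=\tfrac14(\phi^2-1)^2 ,$$ and $\delta_tE(\mathbf u^{m+1},\Pi^h_1\phi^{m+1})=\big(E(\mathbf u^{m+1},\Pi^h_1\phi^{m+1})-E(\mathbf u^{m},\Pi^h_1\phi^{m})\big)/\Delta t$. In particular, the scheme is unconditionally energy stable, i.e. $\delta_tE(\mathbf u^{m+1},\Pi^h_1\phi^{m+1})\le0$.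
   Context: **Constants and functions.** $\Omega\subset\mathbb{R}^d$ ($d\in\{2,3\}$) is a bounded polygonal (polyhedral) domain; $0<\rho_1<\rho_2$, $\lambda>0$, $\varepsilon>0$, $\Delta t>0$; $\eta\in C^0([-1,1])$ with $\eta\ge C>0$. For a real-valued function $v$, $v_\oplus=\max\{v,0\}$, $v_\ominus=-\min\{v,0\}$. Put $\rho_{\mathrm{avg}}=\frac{\rho_1+\rho_2}{2}$, $\rho_{\mathrm{dif}}=\frac{\rho_2-\rho_1}{2}$, $\rho(\phi)=\rho_{\mathrm{avg}}+\rho_{\mathrm{dif}}\phi$, $M(\phi)=(1-\phi^2)_\oplus$, and $f(\phi_1,\phi_0)=F_i'(\phi_1)+F_e'(\phi_0)$ with $F_i(\phi)=\phi^2+\frac14$, $F_e(\phi)=\frac14\phi^4-\frac32\phi^2$ (so $F=F_i+F_e$ for $F(\phi)=\frac14(\phi^2-1)^2$). $M^\uparrow(z)=M(z)$ if $z\le0$ and $M(0)$ if $z>0$; $M^\downarrow(z)=0$ if $z\le 0$ and $M(z)-M(0)$ if $z>0$. $\mathbf{D}\mathbf{u}=\frac12(\nabla\mathbf{u}+\nabla\mathbf{u}^t)$. $(\cdot,\cdot)$ is the $L^2(\Omega)$ scalar product (Frobenius product for tensors). $\delta_t v^{m+1}=(v^{m+1}-v^m)/\Delta t$. **Mesh.** $\mathcal{T}_h$ is a shape-regular simplicial mesh of $\overline\Omega$ such that for every interior edge (face) $e=K\cap L$ the line between the barycenters of $K$ and $L$ is orthogonal to $e$; $\mathcal{D}_e(\mathcal{T}_h)>0$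 is the distance between these barycenters. $\mathcal{E}_h^{\mathrm i}$ is the set of interior edges (faces); each $e\in\mathcal{E}_h^{\mathrm i}$ has a fixed unit normal $\mathbf{n}_e$, and we write $e=K\cap L$ with $\mathbf{n}_e$ exterior to $K$ and pointing to $L$. On such $e$, $\{\!\{v\}\!\}=\frac{v_K+v_L}{2}$ and $[\![v]\!]=v_K-v_L$. **Spaces and projections.** $\mathbb{P}^{\mathrm{disc}}_k(\mathcal{T}_h)$ (resp. $\mathbb{P}^{\mathrm{cont}}_k(\mathcal{T}_h)$) is the space of discontinuous (resp. continuous) functions that are polynomials of degree at most $k$ on each $K\in\mathcal{T}_h$. $(\mathcal{U}_h,\mathcal{P}_h)$ is an inf-sup compatible (velocity, pressure) pair of finite-dimensional spaces with $\mathcal{U}_h\subset(C^0(\overline\Omega)\cap H^1_0(\Omega))^d$ and $\mathbb{P}^{\mathrm{disc}}_0(\mathcal{T}_h)\subset\mathcal{P}_h$. The mass-lumping product on $\mathbb{P}^{\mathrm{cont}}_1(\mathcal{T}_h)$ is $(\varphi,\psi)_h=\frac1{d+1}\sum_{K}|K|\sum_{j=1}^{d+1}\varphi(x_{j,K})\psi(x_{j,K})$, $x_{j,K}$ being the vertices of $K$. For $g\in L^1(\Omega)$: $\Pi_0g\in\mathbb{P}^{\mathrm{disc}}_0(\mathcal{T}_h)$ with $(\Pi_0g,\overline w)=(g,\overline w)$ for all $\overline w\in\mathbb{P}^{\mathrm{disc}}_0(\mathcal{T}_h)$; $\Pi_1g\in\mathbb{P}^{\mathrm{cont}}_1(\mathcal{T}_h)$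 with $(\Pi_1g,\overline v)=(g,\overline v)$ for all $\overline v\in\mathbb{P}^{\mathrm{cont}}_1(\mathcal{T}_h)$ (applied componentwise to vector fields); $\Pi^h_1g\in\mathbb{P}^{\mathrm{cont}}_1(\mathcal{T}_h)$ with $(\Pi^h_1g,\overline v)_h=(g,\overline v)$ for all $\overline v\in\mathbb{P}^{\mathrm{cont}}_1(\mathcal{T}_h)$. **Forms** (differential operators are taken elementwise where needed): - $c_h(\phi,\mu,\overline{\mathbf u})=-\int_\Omega\nabla\cdot(\phi\overline{\mathbf u})\mu-\sum_{e\in\mathcal{E}_h^{\mathrm i}}\int_e(\overline{\mathbf u}\cdot\mathbf{n}_e)\{\!\{\phi\}\!\}[\![\mu]\!]$; - $a_h^{\mathrm{upw}}(\mathbf u;\phi,\overline\phi)=\sum_{e\in\mathcal{E}_h^{\mathrm i},e=K\cap L}\int_e\big((\mathbf u\cdot\mathbf n_e)_\oplus\phi_K-(\mathbf u\cdot\mathbf n_e)_\ominus\phi_L\big)[\![\overline\phi]\!]$; - $b_h^{\mathrm{upw}}(-\nabla^0_{\mathbf n}\mu;M(\phi),\overline\phi)=\sum_{e\in\mathcal{E}_h^{\mathrm i},e=K\cap L}\frac1{\mathcal{D}_e(\mathcal{T}_h)}\int_e\big([\![\Pi_0\mu]\!]_\oplus(M^\uparrow(\phi_K)+M^\downarrow(\phi_L))_\oplus-[\![\Pi_0\mu]\!]_\ominus(M^\uparrow(\phi_L)+M^\downarrow(\phi_K))_\oplus\big)[\![\overline\phi]\!]$, where $\nabla^0_{\mathbf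 n}\mu|_e=-[\![\Pi_0\mu]\!]/\mathcal{D}_e(\mathcal{T}_h)$; - $s_h^1(\mathbf u_1,\mathbf u_0,\phi_1,\phi_0,\mu,\overline{\mathbf u})=\frac12\Big\{\big(\tfrac{\rho(\phi_1)-\rho(\phi_0)}{\Delta t},\mathbf u_1\cdot\overline{\mathbf u}\big)-\big(\rho(\phi_0)\mathbf u_0-\rho_{\mathrm{dif}}M(\phi_0)\Pi_1(\nabla\mu),\nabla(\mathbf u_1\cdot\overline{\mathbf u})\big)\Big\}$; - $s_h^2(\mathbf u,\phi,\mu,\overline{\mathbf u})=-\frac12\sum_{e\in\mathcal{E}_h^{\mathrm i}}\int_e(\overline{\mathbf u}\cdot\mathbf n_e)\,\mathrm{sign}(\mathbf u\cdot\mathbf n_e)[\![\phi]\!][\![\mu]\!]$. **Scheme (one time step).** Given $\mathbf u^m\in\mathcal{U}_h$, $\phi^m\in\mathbb{P}^{\mathrm{disc}}_0(\mathcal{T}_h)$ with values in $[-1,1]$, $\mu^m\in\mathbb{P}^{\mathrm{cont}}_1(\mathcal{T}_h)$, and $\mathbf J_h^m=\rho_{\mathrm{dif}}M(\Pi^h_1\phi^m)\Pi_1(\nabla\mu^m)$, find $\mathbf u^{m+1}\in\mathcal{U}_h$, $p^{m+1}\in\mathcal{P}_h$ with $\int_\Omega p^{m+1}=0$, $\phi^{m+1}\in\mathbb{P}^{\mathrm{disc}}_0(\mathcal{T}_h)$, $\mu^{m+1}\in\mathbb{P}^{\mathrm{cont}}_1(\mathcal{T}_h)$ such that, for all $\overline{\mathbf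 u}\in\mathcal{U}_h$, $\overline p\in\mathcal{P}_h$, $\overline\phi\in\mathbb{P}^{\mathrm{disc}}_0(\mathcal{T}_h)$, $\overline\mu\in\mathbb{P}^{\mathrm{cont}}_1(\mathcal{T}_h)$: (S1) $(\rho(\Pi^h_1\phi^m)\delta_t\mathbf u^{m+1},\overline{\mathbf u})+([(\rho(\Pi^h_1\phi^m)\mathbf u^m-\mathbf J^m_h)\cdot\nabla]\mathbf u^{m+1},\overline{\mathbf u})+2(\eta(\phi^m)\mathbf D\mathbf u^{m+1},\mathbf D\overline{\mathbf u})-(p^{m+1},\nabla\cdot\overline{\mathbf u})+c_h(\phi^{m+1},\Pi_0\mu^{m+1},\overline{\mathbf u})+s_h^1(\mathbf u^{m+1},\mathbf u^m,\Pi^h_1\phi^{m+1},\Pi^h_1\phi^m,\mu^m,\overline{\mathbf u})+s_h^2(\mathbf u^{m+1},\phi^{m+1},\Pi_0\mu^{m+1},\overline{\mathbf u})=0$; (S2) $(\nabla\cdot\mathbf u^{m+1},\overline p)=0$; (S3) $(\delta_t\phi^{m+1},\overline\phi)+a_h^{\mathrm{upw}}(\mathbf u^{m+1};\phi^{m+1},\overline\phi)+b_h^{\mathrm{upw}}(-\nabla^0_{\mathbf n}\mu^{m+1};M(\phi^{m+1}),\overline\phi)=0$; (S4) $\lambda\varepsilon(\nabla\Pi^h_1\phi^{m+1},\nabla\overline\mu)+\frac\lambda\varepsilon(f(\Pi^h_1\phi^{m+1},\Pi^h_1\phi^m),\overline\mu)-(\mu^{m+1},\overline\mu)_h=0$.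 *)

theory Defs
  imports "HOL-Analysis.Analysis"
begin

section \<open>Lebesgue and Sobolev spaces\<close>

text \<open>The \<open>L\<^sup>2\<close> product of scalar, vector and matrix fields; on \<^typ>\<open>real ^ 'd ^ 'd\<close> the
  library's inner product is the Frobenius product.\<close>

definition L2_prod ::
    "'a::euclidean_space set \<Rightarrow> ('a \<Rightarrow> 'b::euclidean_space) \<Rightarrow> ('a \<Rightarrow> 'b) \<Rightarrow> real" where
  "L2_prod \<Omega> f g = (LINT x:\<Omega>|lebesgue. f x \<bullet> g x)"

definition L2_nrm :: "'a::euclidean_space set \<Rightarrow> ('a \<Rightarrow> 'b::euclidean_space) \<Rightarrow> real" where
  "L2_nrm \<Omega> f = sqrt (L2_prod \<Omega> f f)"

definition L2_space :: "'a::euclidean_space set \<Rightarrow> ('a \<Rightarrow> 'b::euclidean_space) set" where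
  "L2_space \<Omega> = {f. set_borel_measurable lebesgue \<Omega> f \<and>
                     set_integrable lebesgue \<Omega> (\<lambda>x. (norm (f x))\<^sup>2)}"

text \<open>\<open>\<psi> \<in> C\<^sup>1\<^sub>c(S)\<close> with gradient \<open>\<psi>'\<close>. As in Brezis' textbook, \<open>C\<^sup>1\<^sub>c\<close> serves as the space of test
  functions; by mollification \<open>C\<^sup>\<infinity>\<^sub>c\<close> yields the same weak gradients and the same \<open>H\<^sup>1\<^sub>0\<close>.\<close>

definition test_function ::
    "'a::euclidean_space set \<Rightarrow> ('a \<Rightarrow> real) \<Rightarrow> ('a \<Rightarrow> 'a) \<Rightarrow> bool" where
  "test_function S \<psi> \<psi>' \<longleftrightarrow>
     (\<forall>x. GDERIV \<psi> x :> \<psi>' x) \<and> continuous_on UNIV \<psi>' \<and>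
     (\<exists>C. compact C \<and> C \<subseteq> S \<and> (\<forall>x. x \<notin> C \<longrightarrow> \<psi> x = 0))"

definition has_weak_grad ::
    "'a::euclidean_space set \<Rightarrow> ('a \<Rightarrow> real) \<Rightarrow> ('a \<Rightarrow> 'a) \<Rightarrow> bool" where
  "has_weak_grad S f g \<longleftrightarrow>
     (\<forall>C. compact C \<and> C \<subseteq> S \<longrightarrow> set_integrable lebesgue C f \<and> set_integrable lebesgue C g) \<and>
     (\<forall>\<psi> \<psi>'. test_function S \<psi> \<psi>' \<longrightarrow>
        (LINT x:S|lebesgue. f x *\<^sub>R \<psi>' x) = - (LINT x:S|lebesgue. \<psi> x *\<^sub>R g x))"

text \<open>A representative of the weak gradient, which is determined up to null sets.\<close>

definition weak_grad :: "'a::euclidean_space set \<Rightarrow> ('a \<Rightarrow> real) \<Rightarrow> 'a \<Rightarrow> 'a" where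
  "weak_grad S f = (SOME g. has_weak_grad S f g)"

definition H1_space :: "'a::euclidean_space set \<Rightarrow> ('a \<Rightarrow> real) set" where
  "H1_space \<Omega> = {f \<in> L2_space \<Omega>. \<exists>g \<in> L2_space \<Omega>. has_weak_grad \<Omega> f g}"

definition H1_nrm :: "'a::euclidean_space set \<Rightarrow> ('a \<Rightarrow> real) \<Rightarrow> real" where
  "H1_nrm \<Omega> f = sqrt ((L2_nrm \<Omega> f)\<^sup>2 + (L2_nrm \<Omega> (weak_grad \<Omega> f))\<^sup>2)"

definition H10_space :: "'a::euclidean_space set \<Rightarrow> ('a \<Rightarrow> real) set" where
  "H10_space \<Omega> = {f \<in> H1_space \<Omega>. \<exists>\<psi> \<psi>'. (\<forall>k. test_function \<Omega> (\<psi> k) (\<psi>' k)) \<and>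
                     (\<lambda>k::nat. H1_nrm \<Omega> (\<lambda>x. \<psi> k x - f x)) \<longlonglongrightarrow> 0}"

definition fin_dim_space :: "('a \<Rightarrow> 'b::real_vector) set \<Rightarrow> bool" where
  "fin_dim_space V \<longleftrightarrow> (\<exists>B. finite B \<and> V = {\<lambda>x. \<Sum>b\<in>B. c b *\<^sub>R b x |c. True})"


section \<open>Domain and mesh\<close>

text \<open>Being the interior of a closed set, such a set lies locally on one side of its boundary
  faces (no slits); openness and boundedness follow from the definition.\<close>

definition polyhedral_domain :: "'a::euclidean_space set \<Rightarrow> bool" where
  "polyhedral_domain \<Omega> \<longleftrightarrow> \<Omega> \<noteq> {} \<and> connected \<Omega> \<and>
     (\<exists>P. finite P \<and> (\<forall>p\<in>P. polytope p) \<and> \<Omega> = interior (\<Union>P))"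

text \<open>\<^const>\<open>triangulation\<close> already contains finiteness and conformity: any two cells meet in
  a common (possibly empty) face.\<close>

definition simplicial_mesh :: "'a::euclidean_space set \<Rightarrow> 'a set set \<Rightarrow> bool" where
  "simplicial_mesh \<Omega> \<T> \<longleftrightarrow>
     triangulation \<T> \<and> (\<forall>K\<in>\<T>. int DIM('a) simplex K) \<and> \<Union>\<T> = closure \<Omega>"

definition inradius :: "'a::euclidean_space set \<Rightarrow> real" where
  "inradius K = Sup {r. \<exists>x. cball x r \<subseteq> K}"

definition shape_regular :: "real \<Rightarrow> 'a::euclidean_space set set \<Rightarrow> bool" where
  "shape_regular \<sigma> \<T> \<longleftrightarrow> (\<forall>K\<in>\<T>. diameter K \<le> \<sigma> * inradius K)"

definition vertices :: "'a::euclidean_space set \<Rightarrow> 'a set" where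
  "vertices K = {x. x extreme_point_of K}"

definition barycenter :: "'a::euclidean_space set \<Rightarrow> 'a" where
  "barycenter K = (1 / real (card (vertices K))) *\<^sub>R (\<Sum>x\<in>vertices K. x)"

definition interior_faces :: "'a::euclidean_space set set \<Rightarrow> 'a set set" where
  "interior_faces \<T> = {K \<inter> L |K L. K \<in> \<T> \<and> L \<in> \<T> \<and> K \<noteq> L \<and>
                                   aff_dim (K \<inter> L) = int DIM('a) - 1}"

definition barycenters_orthogonal :: "'a::euclidean_space set set \<Rightarrow> bool" where
  "barycenters_orthogonal \<T> \<longleftrightarrow>
     (\<forall>K\<in>\<T>. \<forall>L\<in>\<T>. K \<inter> L \<in> interior_faces \<T> \<longrightarrow>
        (\<forall>x \<in> K \<inter> L. \<forall>y \<in> K \<inter> L. (barycenter L - barycenter K) \<bullet> (x - y) = 0))"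

text \<open>A choice \<open>\<nu>\<close> of one unit normal per interior face; it orients every face.\<close>

definition face_normals :: "'a::euclidean_space set set \<Rightarrow> ('a set \<Rightarrow> 'a) \<Rightarrow> bool" where
  "face_normals \<T> \<nu> \<longleftrightarrow>
     (\<forall>e \<in> interior_faces \<T>. norm (\<nu> e) = 1 \<and> (\<forall>x\<in>e. \<forall>y\<in>e. \<nu> e \<bullet> (x - y) = 0))"

text \<open>The cells \<open>K\<close> and \<open>L\<close> with \<open>e = K \<inter> L\<close> and \<open>\<nu> e\<close> pointing from \<open>K\<close> to \<open>L\<close>.\<close>

definition cell_K :: "'a::euclidean_space set set \<Rightarrow> ('a set \<Rightarrow> 'a) \<Rightarrow> 'a set \<Rightarrow> 'a set" where
  "cell_K \<T> \<nu> e = (THE K. K \<in> \<T> \<and> e \<subseteq> K \<and> (\<forall>x\<in>K. \<forall>y\<in>e. (x - y) \<bullet> \<nu> e \<le> 0))"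

definition cell_L :: "'a::euclidean_space set set \<Rightarrow> ('a set \<Rightarrow> 'a) \<Rightarrow> 'a set \<Rightarrow> 'a set" where
  "cell_L \<T> \<nu> e = (THE L. L \<in> \<T> \<and> e \<subseteq> L \<and> (\<forall>x\<in>L. \<forall>y\<in>e. (x - y) \<bullet> \<nu> e \<ge> 0))"

definition bary_dist :: "'a::euclidean_space set set \<Rightarrow> ('a set \<Rightarrow> 'a) \<Rightarrow> 'a set \<Rightarrow> real" where
  "bary_dist \<T> \<nu> e = dist (barycenter (cell_K \<T> \<nu> e)) (barycenter (cell_L \<T> \<nu> e))"

text \<open>Surface measure on the hyperplane through \<open>a\<close> with unit normal \<open>n\<close>: a subset \<open>A\<close> of the
  hyperplane receives the Lebesgue measure of the cylinder \<open>{x + t n | x \<in> A, 0 \<le> t \<le> 1}\<close> of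
  height 1 over \<open>A\<close>, which is the \<open>(d-1)\<close>-dimensional measure of \<open>A\<close>.\<close>

definition hyperplane_measure :: "'a::euclidean_space \<Rightarrow> 'a \<Rightarrow> 'a measure" where
  "hyperplane_measure a n =
     distr (restrict_space lborel {x. 0 \<le> (x - a) \<bullet> n \<and> (x - a) \<bullet> n \<le> 1}) borel
           (\<lambda>x. x - ((x - a) \<bullet> n) *\<^sub>R n)"

definition face_int ::
    "('a::euclidean_space set \<Rightarrow> 'a) \<Rightarrow> 'a set \<Rightarrow> ('a \<Rightarrow> real) \<Rightarrow> real" where
  "face_int \<nu> e g = (LINT x:e|hyperplane_measure (SOME a. a \<in> e) (\<nu> e). g x)"

definition trace_from :: "'a::euclidean_space set \<Rightarrow> ('a \<Rightarrow> real) \<Rightarrow> 'a \<Rightarrow> real" where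
  "trace_from K v x = Lim (at x within interior K) v"

definition avg ::
    "'a::euclidean_space set set \<Rightarrow> ('a set \<Rightarrow> 'a) \<Rightarrow> 'a set \<Rightarrow> ('a \<Rightarrow> real) \<Rightarrow> 'a \<Rightarrow> real" where
  "avg \<T> \<nu> e v x = (trace_from (cell_K \<T> \<nu> e) v x + trace_from (cell_L \<T> \<nu> e) v x) / 2"

definition jump ::
    "'a::euclidean_space set set \<Rightarrow> ('a set \<Rightarrow> 'a) \<Rightarrow> 'a set \<Rightarrow> ('a \<Rightarrow> real) \<Rightarrow> 'a \<Rightarrow> real" where
  "jump \<T> \<nu> e v x = trace_from (cell_K \<T> \<nu> e) v x - trace_from (cell_L \<T> \<nu> e) v x"


section \<open>Elementwise differential operators\<close>

text \<open>Weak derivatives on the union of the open cells. On functions of \<open>H\<^sup>1(\<Omega>)\<close> they agree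
  almost everywhere with the weak derivatives on \<open>\<Omega>\<close>.\<close>

definition grad_h :: "'a::euclidean_space set set \<Rightarrow> ('a \<Rightarrow> real) \<Rightarrow> 'a \<Rightarrow> 'a" where
  "grad_h \<T> = weak_grad (\<Union>K\<in>\<T>. interior K)"

text \<open>Entry \<open>(i, j)\<close> is the \<open>j\<close>-th partial derivative of the \<open>i\<close>-th component.\<close>

definition jac_h ::
    "(real ^ 'd) set set \<Rightarrow> (real ^ 'd \<Rightarrow> real ^ 'd) \<Rightarrow> real ^ 'd \<Rightarrow> real ^ 'd ^ 'd" where
  "jac_h \<T> v x = (\<chi> i. grad_h \<T> (\<lambda>y. v y $ i) x)"

definition div_h ::
    "(real ^ 'd) set set \<Rightarrow> (real ^ 'd \<Rightarrow> real ^ 'd) \<Rightarrow> real ^ 'd \<Rightarrow> real" where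
  "div_h \<T> v x = trace (jac_h \<T> v x)"

definition symgrad_h ::
    "(real ^ 'd) set set \<Rightarrow> (real ^ 'd \<Rightarrow> real ^ 'd) \<Rightarrow> real ^ 'd \<Rightarrow> real ^ 'd ^ 'd" where
  "symgrad_h \<T> v x = (1 / 2) *\<^sub>R (jac_h \<T> v x + transpose (jac_h \<T> v x))"


section \<open>Discrete spaces and projections\<close>

text \<open>Elements of these spaces are functions on the whole space. The values of a discontinuous
  one off the open cells, and those of a continuous one outside \<open>\<Union>\<T>\<close>, are unconstrained and
  irrelevant to all the forms.\<close>

definition P0disc :: "'a::euclidean_space set set \<Rightarrow> ('a \<Rightarrow> real) set" where
  "P0disc \<T> = {w. \<forall>K\<in>\<T>. \<exists>c. \<forall>x\<in>interior K. w x = c}"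

definition P1cont :: "'a::euclidean_space set set \<Rightarrow> ('a \<Rightarrow> real) set" where
  "P1cont \<T> = {v. continuous_on (\<Union>\<T>) v \<and> (\<forall>K\<in>\<T>. \<exists>a b. \<forall>x\<in>K. v x = a \<bullet> x + b)}"

definition lumped_prod ::
    "'a::euclidean_space set set \<Rightarrow> ('a \<Rightarrow> real) \<Rightarrow> ('a \<Rightarrow> real) \<Rightarrow> real" where
  "lumped_prod \<T> \<phi> \<psi> =
     1 / (real DIM('a) + 1) * (\<Sum>K\<in>\<T>. measure lebesgue K * (\<Sum>x\<in>vertices K. \<phi> x * \<psi> x))"

definition Pi0 :: "'a::euclidean_space set \<Rightarrow> 'a set set \<Rightarrow> ('a \<Rightarrow> real) \<Rightarrow> 'a \<Rightarrow> real" where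
  "Pi0 \<Omega> \<T> g =
     (SOME q. q \<in> P0disc \<T> \<and> (\<forall>w \<in> P0disc \<T>. L2_prod \<Omega> q w = L2_prod \<Omega> g w))"

definition Pi1 :: "'a::euclidean_space set \<Rightarrow> 'a set set \<Rightarrow> ('a \<Rightarrow> real) \<Rightarrow> 'a \<Rightarrow> real" where
  "Pi1 \<Omega> \<T> g =
     (SOME q. q \<in> P1cont \<T> \<and> (\<forall>v \<in> P1cont \<T>. L2_prod \<Omega> q v = L2_prod \<Omega> g v))"

definition Pi1_vec ::
    "(real ^ 'd) set \<Rightarrow> (real ^ 'd) set set \<Rightarrow> (real ^ 'd \<Rightarrow> real ^ 'd) \<Rightarrow> real ^ 'd \<Rightarrow> real ^ 'd"
  where "Pi1_vec \<Omega> \<T> g x = (\<chi> i. Pi1 \<Omega> \<T> (\<lambda>y. g y $ i) x)"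

definition Pi1h :: "'a::euclidean_space set \<Rightarrow> 'a set set \<Rightarrow> ('a \<Rightarrow> real) \<Rightarrow> 'a \<Rightarrow> real" where
  "Pi1h \<Omega> \<T> g =
     (SOME q. q \<in> P1cont \<T> \<and> (\<forall>v \<in> P1cont \<T>. lumped_prod \<T> q v = L2_prod \<Omega> g v))"

text \<open>The inf-sup condition ranges over pressures of zero mean, as constants are orthogonal to
  the divergences of \<open>H\<^sup>1\<^sub>0\<close> velocities.\<close>

definition inf_sup_compatible ::
    "(real ^ 'd) set \<Rightarrow> (real ^ 'd) set set \<Rightarrow> (real ^ 'd \<Rightarrow> real ^ 'd) set \<Rightarrow>
     (real ^ 'd \<Rightarrow> real) set \<Rightarrow> bool" where
  "inf_sup_compatible \<Omega> \<T> U P \<longleftrightarrow>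
     (\<exists>\<beta>>0. ereal \<beta> \<le>
        (INF p \<in> {p \<in> P. (LINT x:\<Omega>|lebesgue. p x) = 0 \<and> L2_nrm \<Omega> p \<noteq> 0}.
         SUP v \<in> {v \<in> U. L2_nrm \<Omega> (jac_h \<T> v) \<noteq> 0}.
           ereal (L2_prod \<Omega> p (div_h \<T> v) / (L2_nrm \<Omega> p * L2_nrm \<Omega> (jac_h \<T> v)))))"

text \<open>The inclusion of the piecewise constants in the pressure space is one of subspaces of
  \<open>L\<^sup>2(\<Omega>)\<close>, hence up to null sets.\<close>

definition velocity_pressure_pair ::
    "(real ^ 'd) set \<Rightarrow> (real ^ 'd) set set \<Rightarrow> (real ^ 'd \<Rightarrow> real ^ 'd) set \<Rightarrow>
     (real ^ 'd \<Rightarrow> real) set \<Rightarrow> bool" where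
  "velocity_pressure_pair \<Omega> \<T> U P \<longleftrightarrow>
     fin_dim_space U \<and> fin_dim_space P \<and>
     (\<forall>u\<in>U. continuous_on (closure \<Omega>) u \<and> (\<forall>i. (\<lambda>x. u x $ i) \<in> H10_space \<Omega>)) \<and>
     P \<subseteq> L2_space \<Omega> \<and>
     (\<forall>w \<in> P0disc \<T>. \<exists>p\<in>P. AE x in lebesgue. x \<in> \<Omega> \<longrightarrow> p x = w x) \<and>
     inf_sup_compatible \<Omega> \<T> U P"


section \<open>Constitutive functions\<close>

definition pos_part :: "real \<Rightarrow> real" where "pos_part v = max v 0"

definition neg_part :: "real \<Rightarrow> real" where "neg_part v = - min v 0"

definition rho_avg :: "real \<Rightarrow> real \<Rightarrow> real" where "rho_avg \<rho>1 \<rho>2 = (\<rho>1 + \<rho>2) / 2"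

definition rho_dif :: "real \<Rightarrow> real \<Rightarrow> real" where "rho_dif \<rho>1 \<rho>2 = (\<rho>2 - \<rho>1) / 2"

definition rho :: "real \<Rightarrow> real \<Rightarrow> real \<Rightarrow> real" where
  "rho \<rho>1 \<rho>2 z = rho_avg \<rho>1 \<rho>2 + rho_dif \<rho>1 \<rho>2 * z"

definition mobility :: "real \<Rightarrow> real" where "mobility z = pos_part (1 - z\<^sup>2)"

definition mobility_up :: "real \<Rightarrow> real" where
  "mobility_up z = (if z \<le> 0 then mobility z else mobility 0)"

definition mobility_down :: "real \<Rightarrow> real" where
  "mobility_down z = (if z \<le> 0 then 0 else mobility z - mobility 0)"

definition F_pot :: "real \<Rightarrow> real" where "F_pot z = 1/4 * (z\<^sup>2 - 1)\<^sup>2"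

definition F_i :: "real \<Rightarrow> real" where "F_i z = z\<^sup>2 + 1/4"

definition F_e :: "real \<Rightarrow> real" where "F_e z = 1/4 * z^4 - 3/2 * z\<^sup>2"

definition f_split :: "real \<Rightarrow> real \<Rightarrow> real" where "f_split z1 z0 = deriv F_i z1 + deriv F_e z0"


section \<open>Forms\<close>

definition c_h ::
    "(real ^ 'd) set \<Rightarrow> (real ^ 'd) set set \<Rightarrow> ((real ^ 'd) set \<Rightarrow> real ^ 'd) \<Rightarrow>
     (real ^ 'd \<Rightarrow> real) \<Rightarrow> (real ^ 'd \<Rightarrow> real) \<Rightarrow> (real ^ 'd \<Rightarrow> real ^ 'd) \<Rightarrow> real" where
  "c_h \<Omega> \<T> \<nu> \<phi> \<mu> ub =
     - (LINT x:\<Omega>|lebesgue. div_h \<T> (\<lambda>y. \<phi> y *\<^sub>R ub y) x * \<mu> x)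
     - (\<Sum>e\<in>interior_faces \<T>.
          face_int \<nu> e (\<lambda>x. (ub x \<bullet> \<nu> e) * avg \<T> \<nu> e \<phi> x * jump \<T> \<nu> e \<mu> x))"

definition a_upw ::
    "(real ^ 'd) set set \<Rightarrow> ((real ^ 'd) set \<Rightarrow> real ^ 'd) \<Rightarrow>
     (real ^ 'd \<Rightarrow> real ^ 'd) \<Rightarrow> (real ^ 'd \<Rightarrow> real) \<Rightarrow> (real ^ 'd \<Rightarrow> real) \<Rightarrow> real" where
  "a_upw \<T> \<nu> u \<phi> \<phi>b =
     (\<Sum>e\<in>interior_faces \<T>.
        face_int \<nu> e (\<lambda>x. (pos_part (u x \<bullet> \<nu> e) * trace_from (cell_K \<T> \<nu> e) \<phi> x
                          - neg_part (u x \<bullet> \<nu> e) * trace_from (cell_L \<T> \<nu> e) \<phi> x)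
                         * jump \<T> \<nu> e \<phi>b x))"

text \<open>\<open>b_upw \<Omega> \<T> \<nu> \<mu> \<phi> \<phi>b\<close> stands for \<open>b\<^sub>h(-\<nabla>\<^sub>n\<mu>; M(\<phi>), \<phi>b)\<close>, the discrete normal derivative
  being \<open>-[[\<Pi>\<^sub>0\<mu>]] / D\<^sub>e\<close>.\<close>

definition b_upw ::
    "(real ^ 'd) set \<Rightarrow> (real ^ 'd) set set \<Rightarrow> ((real ^ 'd) set \<Rightarrow> real ^ 'd) \<Rightarrow>
     (real ^ 'd \<Rightarrow> real) \<Rightarrow> (real ^ 'd \<Rightarrow> real) \<Rightarrow> (real ^ 'd \<Rightarrow> real) \<Rightarrow> real" where
  "b_upw \<Omega> \<T> \<nu> \<mu> \<phi> \<phi>b =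
     (\<Sum>e\<in>interior_faces \<T>. 1 / bary_dist \<T> \<nu> e *
        face_int \<nu> e (\<lambda>x.
          let \<phi>K = trace_from (cell_K \<T> \<nu> e) \<phi> x;
              \<phi>L = trace_from (cell_L \<T> \<nu> e) \<phi> x;
              j = jump \<T> \<nu> e (Pi0 \<Omega> \<T> \<mu>) x
          in (pos_part j * pos_part (mobility_up \<phi>K + mobility_down \<phi>L)
              - neg_part j * pos_part (mobility_up \<phi>L + mobility_down \<phi>K))
             * jump \<T> \<nu> e \<phi>b x))"

definition s1_h ::
    "(real ^ 'd) set \<Rightarrow> (real ^ 'd) set set \<Rightarrow> real \<Rightarrow> real \<Rightarrow> real \<Rightarrow>
     (real ^ 'd \<Rightarrow> real ^ 'd) \<Rightarrow> (real ^ 'd \<Rightarrow> real ^ 'd) \<Rightarrow>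
     (real ^ 'd \<Rightarrow> real) \<Rightarrow> (real ^ 'd \<Rightarrow> real) \<Rightarrow> (real ^ 'd \<Rightarrow> real) \<Rightarrow>
     (real ^ 'd \<Rightarrow> real ^ 'd) \<Rightarrow> real" where
  "s1_h \<Omega> \<T> \<rho>1 \<rho>2 dt u1 u0 \<phi>1 \<phi>0 \<mu> ub =
     1/2 * (L2_prod \<Omega> (\<lambda>x. (rho \<rho>1 \<rho>2 (\<phi>1 x) - rho \<rho>1 \<rho>2 (\<phi>0 x)) / dt) (\<lambda>x. u1 x \<bullet> ub x)
          - L2_prod \<Omega>
              (\<lambda>x. rho \<rho>1 \<rho>2 (\<phi>0 x) *\<^sub>R u0 x
                   - (rho_dif \<rho>1 \<rho>2 * mobility (\<phi>0 x)) *\<^sub>R Pi1_vec \<Omega> \<T> (grad_h \<T> \<mu>) x)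
              (grad_h \<T> (\<lambda>x. u1 x \<bullet> ub x)))"

definition s2_h ::
    "(real ^ 'd) set set \<Rightarrow> ((real ^ 'd) set \<Rightarrow> real ^ 'd) \<Rightarrow>
     (real ^ 'd \<Rightarrow> real ^ 'd) \<Rightarrow> (real ^ 'd \<Rightarrow> real) \<Rightarrow> (real ^ 'd \<Rightarrow> real) \<Rightarrow>
     (real ^ 'd \<Rightarrow> real ^ 'd) \<Rightarrow> real" where
  "s2_h \<T> \<nu> u \<phi> \<mu> ub =
     - (1/2) * (\<Sum>e\<in>interior_faces \<T>.
        face_int \<nu> e (\<lambda>x. (ub x \<bullet> \<nu> e) * sgn (u x \<bullet> \<nu> e) *
                            jump \<T> \<nu> e \<phi> x * jump \<T> \<nu> e \<mu> x))"


section \<open>Scheme and energy\<close>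

definition flux_J ::
    "(real ^ 'd) set \<Rightarrow> (real ^ 'd) set set \<Rightarrow> real \<Rightarrow> real \<Rightarrow>
     (real ^ 'd \<Rightarrow> real) \<Rightarrow> (real ^ 'd \<Rightarrow> real) \<Rightarrow> real ^ 'd \<Rightarrow> real ^ 'd" where
  "flux_J \<Omega> \<T> \<rho>1 \<rho>2 \<phi>0 \<mu>0 x =
     (rho_dif \<rho>1 \<rho>2 * mobility (Pi1h \<Omega> \<T> \<phi>0 x)) *\<^sub>R Pi1_vec \<Omega> \<T> (grad_h \<T> \<mu>0) x"

definition viscous_form ::
    "(real ^ 'd) set \<Rightarrow> (real ^ 'd) set set \<Rightarrow> (real \<Rightarrow> real) \<Rightarrow> (real ^ 'd \<Rightarrow> real) \<Rightarrow>
     (real ^ 'd \<Rightarrow> real ^ 'd) \<Rightarrow> (real ^ 'd \<Rightarrow> real ^ 'd) \<Rightarrow> real" where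
  "viscous_form \<Omega> \<T> \<eta> \<phi> u v =
     L2_prod \<Omega> (\<lambda>x. \<eta> (\<phi> x) *\<^sub>R symgrad_h \<T> u x) (symgrad_h \<T> v)"

definition momentum_eq where
  "momentum_eq \<Omega> \<T> \<nu> \<rho>1 \<rho>2 dt \<eta> u0 \<phi>0 \<mu>0 u1 p1 \<phi>1 \<mu>1 ub \<longleftrightarrow>
     L2_prod \<Omega> (\<lambda>x. rho \<rho>1 \<rho>2 (Pi1h \<Omega> \<T> \<phi>0 x) *\<^sub>R ((1 / dt) *\<^sub>R (u1 x - u0 x))) ub
     + L2_prod \<Omega>
         (\<lambda>x. jac_h \<T> u1 x *v
                (rho \<rho>1 \<rho>2 (Pi1h \<Omega> \<T> \<phi>0 x) *\<^sub>R u0 x - flux_J \<Omega> \<T> \<rho>1 \<rho>2 \<phi>0 \<mu>0 x)) ub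
     + 2 * viscous_form \<Omega> \<T> \<eta> \<phi>0 u1 ub
     - L2_prod \<Omega> p1 (div_h \<T> ub)
     + c_h \<Omega> \<T> \<nu> \<phi>1 (Pi0 \<Omega> \<T> \<mu>1) ub
     + s1_h \<Omega> \<T> \<rho>1 \<rho>2 dt u1 u0 (Pi1h \<Omega> \<T> \<phi>1) (Pi1h \<Omega> \<T> \<phi>0) \<mu>0 ub
     + s2_h \<T> \<nu> u1 \<phi>1 (Pi0 \<Omega> \<T> \<mu>1) ub = 0"

definition incompressibility_eq where
  "incompressibility_eq \<Omega> \<T> u1 pb \<longleftrightarrow> L2_prod \<Omega> (div_h \<T> u1) pb = 0"

definition phase_eq where
  "phase_eq \<Omega> \<T> \<nu> dt \<phi>0 u1 \<phi>1 \<mu>1 \<phi>b \<longleftrightarrow>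
     L2_prod \<Omega> (\<lambda>x. (\<phi>1 x - \<phi>0 x) / dt) \<phi>b
     + a_upw \<T> \<nu> u1 \<phi>1 \<phi>b + b_upw \<Omega> \<T> \<nu> \<mu>1 \<phi>1 \<phi>b = 0"

definition potential_eq where
  "potential_eq \<Omega> \<T> lam eps \<phi>0 \<phi>1 \<mu>1 \<mu>b \<longleftrightarrow>
     lam * eps * L2_prod \<Omega> (grad_h \<T> (Pi1h \<Omega> \<T> \<phi>1)) (grad_h \<T> \<mu>b)
     + lam / eps * L2_prod \<Omega> (\<lambda>x. f_split (Pi1h \<Omega> \<T> \<phi>1 x) (Pi1h \<Omega> \<T> \<phi>0 x)) \<mu>b
     - lumped_prod \<T> \<mu>1 \<mu>b = 0"

definition scheme_solution ::
    "(real ^ 'd) set \<Rightarrow> (real ^ 'd) set set \<Rightarrow> ((real ^ 'd) set \<Rightarrow> real ^ 'd) \<Rightarrow>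
     (real ^ 'd \<Rightarrow> real ^ 'd) set \<Rightarrow> (real ^ 'd \<Rightarrow> real) set \<Rightarrow>
     real \<Rightarrow> real \<Rightarrow> real \<Rightarrow> real \<Rightarrow> real \<Rightarrow> (real \<Rightarrow> real) \<Rightarrow>
     (real ^ 'd \<Rightarrow> real ^ 'd) \<Rightarrow> (real ^ 'd \<Rightarrow> real) \<Rightarrow> (real ^ 'd \<Rightarrow> real) \<Rightarrow>
     (real ^ 'd \<Rightarrow> real ^ 'd) \<Rightarrow> (real ^ 'd \<Rightarrow> real) \<Rightarrow> (real ^ 'd \<Rightarrow> real) \<Rightarrow>
     (real ^ 'd \<Rightarrow> real) \<Rightarrow> bool" where
  "scheme_solution \<Omega> \<T> \<nu> U P \<rho>1 \<rho>2 lam eps dt \<eta> u0 \<phi>0 \<mu>0 u1 p1 \<phi>1 \<mu>1 \<longleftrightarrow>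
     u1 \<in> U \<and> p1 \<in> P \<and> (LINT x:\<Omega>|lebesgue. p1 x) = 0 \<and> \<phi>1 \<in> P0disc \<T> \<and> \<mu>1 \<in> P1cont \<T> \<and>
     (\<forall>ub\<in>U. momentum_eq \<Omega> \<T> \<nu> \<rho>1 \<rho>2 dt \<eta> u0 \<phi>0 \<mu>0 u1 p1 \<phi>1 \<mu>1 ub) \<and>
     (\<forall>pb\<in>P. incompressibility_eq \<Omega> \<T> u1 pb) \<and>
     (\<forall>\<phi>b \<in> P0disc \<T>. phase_eq \<Omega> \<T> \<nu> dt \<phi>0 u1 \<phi>1 \<mu>1 \<phi>b) \<and>
     (\<forall>\<mu>b \<in> P1cont \<T>. potential_eq \<Omega> \<T> lam eps \<phi>0 \<phi>1 \<mu>1 \<mu>b)"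

definition energy ::
    "(real ^ 'd) set \<Rightarrow> (real ^ 'd) set set \<Rightarrow> real \<Rightarrow> real \<Rightarrow> real \<Rightarrow> real \<Rightarrow>
     (real ^ 'd \<Rightarrow> real ^ 'd) \<Rightarrow> (real ^ 'd \<Rightarrow> real) \<Rightarrow> real" where
  "energy \<Omega> \<T> \<rho>1 \<rho>2 lam eps u \<phi> =
     (LINT x:\<Omega>|lebesgue. rho \<rho>1 \<rho>2 (\<phi> x) * ((norm (u x))\<^sup>2 / 2))
     + lam * eps / 2 * (LINT x:\<Omega>|lebesgue. (norm (grad_h \<T> \<phi> x))\<^sup>2)
     + lam / eps * (LINT x:\<Omega>|lebesgue. F_pot (\<phi> x))"

end

theory Submission
  imports Defs
begin

text \<open>
  Test (S1) with \<open>u\<^sup>m\<^sup>+\<^sup>1\<close>, (S2) with \<open>p\<^sup>m\<^sup>+\<^sup>1\<close>, (S3) with \<open>\<Pi>\<^sub>0 \<mu>\<^sup>m\<^sup>+\<^sup>1\<close> and (S4) with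
  \<open>\<delta>\<^sub>t \<Pi>\<^sub>1\<^sup>h \<phi>\<^sup>m\<^sup>+\<^sup>1\<close>. The centered coupling \<open>c\<^sub>h\<close> together with \<open>s\<^sub>h\<^sup>2\<close> is
  exactly minus the upwind form of (S3), because \<open>\<nabla>\<cdot>u\<close> vanishes against piecewise constants,
  and \<open>s\<^sub>h\<^sup>1\<close> makes the convection skew symmetric. What remains are squares of increments, with
  a sign, and the convex splitting \<open>F = F\<^sub>i + F\<^sub>e\<close>.

  Two of these signs need a bound on the phase field: the density \<open>\<rho>(\<Pi>\<^sub>1\<^sup>h \<phi>\<^sup>m)\<close> weighs the squared
  velocity increment, and \<open>F\<^sub>e\<close> is concave only on \<open>[-1, 1]\<close>. Both follow from the discrete maximum
  principle: in a cell where \<open>\<phi>\<^sup>m\<^sup>+\<^sup>1\<close> is extremal the upwind fluxes have a sign, provided that the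
  total flux of \<open>u\<^sup>m\<^sup>+\<^sup>1\<close> through the boundary of the cell vanishes. This needs the divergence
  theorem on a cell for fields that are only continuous and in \<open>H\<^sub>0\<^sup>1\<close>; it is obtained by testing
  the weak gradient with Lipschitz cutoffs of the cell whose layers of decay shrink to its facets.\<close>

section \<open>Lebesgue integrals and test functions\<close>

text \<open>Weak gradients, projections, traces and the cells at a face are defined by choice or
  description operators: each must first be shown to have its defining property, and gradients are
  known only almost everywhere. Uniqueness of weak gradients, hence the fundamental lemma for C^1
  test functions, is therefore basic. Passing from the bound on \<phi> to a bound on its lumped
  projection rests on |K|/(d+1) being the integral of every barycentric coordinate of a simplex K:
  the vertex values of the projection are then averages of \<phi>. That integral comes from the
  symmetry that swaps two vertices. Face integrals are defined through a cylinder of height 1,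
  whereas the cutoffs produce layers of width 1/N; cutting the cylinder into N translated layers
  turns the layer integrals into integrals over the fixed cylinder. In the mobility flux, the
  splitting into \<open>mobility_up\<close> and \<open>mobility_down\<close> is what gives the sign:
  above 1 nothing can flow into a cell, below -1 nothing can flow out.\<close>

lemma measurable_lebesgue_AE_cong:
  fixes f g :: "'a::euclidean_space \<Rightarrow> 'b::topological_space"
  assumes "AE x in lebesgue. f x = g x" "f \<in> borel_measurable lebesgue"
  shows "g \<in> borel_measurable lebesgue"
proof (rule measurableI)
  fix A :: "'b set" assume A: "A \<in> sets borel"
  have "f -` A \<inter> space lebesgue \<in> sets lebesgue"
    using assms(2) A by (rule measurable_sets)
  moreover have "AE x in lebesgue. x \<in> f -` A \<inter> space lebesgue \<longleftrightarrow> x \<in> g -` A \<inter> space lebesgue"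
    using assms(1) by eventually_elim auto
  ultimately show "g -` A \<inter> space lebesgue \<in> sets lebesgue"
    using completion.in_sets_AE by blast
qed auto

text \<open>No measurability is required: as Lebesgue measure is complete, either both functions are
  measurable or both integrals take the junk value 0.\<close>

lemma lebesgue_integral_cong_AE:
  fixes f g :: "'a::euclidean_space \<Rightarrow> 'b::euclidean_space"
  assumes "AE x in lebesgue. f x = g x"
  shows "integral\<^sup>L lebesgue f = integral\<^sup>L lebesgue g"
proof (cases "f \<in> borel_measurable lebesgue")
  case True
  then show ?thesis
    using integral_cong_AE assms measurable_lebesgue_AE_cong by blast
next
  case False
  moreover have "g \<notin> borel_measurable lebesgue"
    using False measurable_lebesgue_AE_cong[of g f] AE_symmetric[OF assms] by blast
  ultimately show ?thesis
    by (metis borel_measurable_integrable not_integrable_integral_eq)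
qed

lemma lebesgue_integrable_cong_AE:
  fixes f g :: "'a::euclidean_space \<Rightarrow> 'b::euclidean_space"
  assumes "AE x in lebesgue. f x = g x" "integrable lebesgue f"
  shows "integrable lebesgue g"
proof -
  have "g \<in> borel_measurable lebesgue"
    using assms measurable_lebesgue_AE_cong borel_measurable_integrable by blast
  then show ?thesis
    using integrable_cong_AE[of f lebesgue g] assms borel_measurable_integrable by blast
qed

lemma set_lint_cong_AE:
  fixes f g :: "'a::euclidean_space \<Rightarrow> 'b::euclidean_space"
  assumes "AE x in lebesgue. x \<in> S \<longrightarrow> f x = g x"
  shows "(LINT x:S|lebesgue. f x) = (LINT x:S|lebesgue. g x)"
  unfolding set_lebesgue_integral_def using assms
  by (intro lebesgue_integral_cong_AE) (auto elim!: eventually_mono simp: indicator_def)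

lemma set_integrable_lebesgue_cong_AE:
  fixes f g :: "'a::euclidean_space \<Rightarrow> 'b::euclidean_space"
  assumes "AE x in lebesgue. x \<in> S \<longrightarrow> f x = g x" "set_integrable lebesgue S f"
  shows "set_integrable lebesgue S g"
  using assms(2) unfolding set_integrable_def
  by (rule lebesgue_integrable_cong_AE[rotated])
    (use assms(1) in \<open>auto elim!: eventually_mono simp: indicator_def\<close>)

text \<open>The two products with indicators are equal as functions, whatever the measurability of
  \<open>A\<close>, \<open>B\<close> and \<open>f\<close>. This moves integrals of compactly
  supported integrands between an open set and the whole space.\<close>

lemma set_lint_supported:
  assumes "\<And>x. x \<in> A \<Longrightarrow> x \<notin> B \<Longrightarrow> f x = 0" "\<And>x. x \<in> B \<Longrightarrow> x \<notin> A \<Longrightarrow> f x = 0"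
  shows "(LINT x:A|M. f x) = (LINT x:B|M. f x)"
  unfolding set_lebesgue_integral_def using assms
  by (intro Bochner_Integration.integral_cong) (auto simp: indicator_def)

lemma set_integrable_supported:
  assumes "\<And>x. x \<in> A \<Longrightarrow> x \<notin> B \<Longrightarrow> f x = 0" "\<And>x. x \<in> B \<Longrightarrow> x \<notin> A \<Longrightarrow> f x = 0"
  shows "set_integrable M A f \<longleftrightarrow> set_integrable M B f"
  unfolding set_integrable_def using assms
  by (intro Bochner_Integration.integrable_cong) (auto simp: indicator_def)

lemma set_integrable_scaleR_bounded:
  fixes f :: "'a \<Rightarrow> 'b::euclidean_space" and h :: "'a \<Rightarrow> real"
  assumes "set_integrable M S f" "h \<in> borel_measurable M" "\<And>x. x \<in> S \<Longrightarrow> \<bar>h x\<bar> \<le> B"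
  shows "set_integrable M S (\<lambda>x. h x *\<^sub>R f x)"
proof -
  have "integrable M (\<lambda>x. h x *\<^sub>R (indicator S x *\<^sub>R f x))"
  proof (rule Bochner_Integration.integrable_bound)
    show "integrable M (\<lambda>x. B *\<^sub>R (indicator S x *\<^sub>R f x))"
      using assms(1) unfolding set_integrable_def by (rule integrable_scaleR_right)
    show "(\<lambda>x. h x *\<^sub>R (indicator S x *\<^sub>R f x)) \<in> borel_measurable M"
      using assms(2) borel_measurable_integrable[OF assms(1)[unfolded set_integrable_def]]
      by (rule borel_measurable_scaleR)
    have "norm (h x *\<^sub>R (indicator S x *\<^sub>R f x)) \<le> norm (B *\<^sub>R (indicator S x *\<^sub>R f x))" for x
    proof (cases "x \<in> S")
      case True
      then show ?thesis
        using assms(3)[OF True] by (auto intro!: mult_right_mono)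
    qed auto
    then show "AE x in M. norm (h x *\<^sub>R (indicator S x *\<^sub>R f x)) \<le> norm (B *\<^sub>R (indicator S x *\<^sub>R f x))"
      by blast
  qed
  then show ?thesis
    unfolding set_integrable_def by (simp add: mult.commute)
qed

lemma set_integrable_continuous_compact:
  fixes f :: "'a::euclidean_space \<Rightarrow> 'b::euclidean_space"
  assumes "compact C" "continuous_on C f" "S \<subseteq> C" "S \<in> sets lebesgue"
  shows "set_integrable lebesgue S f"
proof -
  have "set_integrable lebesgue C f"
    using borel_integrable_compact[OF assms(1,2)] borel_measurable_integrable
      integrable_completion[of "\<lambda>x. indicator C x *\<^sub>R f x" lborel]
    unfolding set_integrable_def by blast
  then show ?thesis
    using set_integrable_subset assms(3,4) by blast
qed

lemma compact_support_lebesgue_integrable: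
  fixes f :: "'a::euclidean_space \<Rightarrow> 'b::euclidean_space"
  assumes "compact C" "continuous_on UNIV f" "\<And>x. x \<notin> C \<Longrightarrow> f x = 0"
  shows "integrable lebesgue f"
proof -
  have "set_integrable lebesgue C f"
    by (rule set_integrable_continuous_compact[of C])
      (use assms in \<open>auto intro: continuous_on_subset dest: compact_imp_closed\<close>)
  also have "?this \<longleftrightarrow> integrable lebesgue f"
    unfolding set_integrable_def
    by (intro Bochner_Integration.integrable_cong) (use assms(3) in \<open>auto simp: indicator_def\<close>)
  finally show ?thesis .
qed

lemma compact_support_bounded:
  fixes f :: "'a::euclidean_space \<Rightarrow> 'b::real_normed_vector"
  assumes "compact C" "continuous_on UNIV f" "\<And>x. x \<notin> C \<Longrightarrow> f x = 0"
  obtains B where "B > 0" "\<And>x. norm (f x) \<le> B"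
proof -
  have "compact (f ` C)"
    by (rule compact_continuous_image) (use assms in \<open>auto intro: continuous_on_subset\<close>)
  then obtain B where B: "B > 0" "\<forall>y \<in> f ` C. norm y \<le> B"
    using compact_imp_bounded bounded_pos by blast
  have "norm (f x) \<le> B" for x
    by (cases "x \<in> C") (use B assms(3) in auto)
  then show ?thesis
    using that B(1) by blast
qed

lemma lebesgue_integral_translate:
  fixes f :: "'a::euclidean_space \<Rightarrow> 'b::euclidean_space"
  assumes "f \<in> borel_measurable borel"
  shows "integral\<^sup>L lebesgue (\<lambda>x. f (c + x)) = integral\<^sup>L lebesgue f"
proof -
  have "integral\<^sup>L lborel f = integral\<^sup>L (distr lborel borel ((+) c)) f"
    by (simp add: lborel_distr_plus)
  also have "\<dots> = integral\<^sup>L lborel (\<lambda>x. f (c + x))"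
    by (rule integral_distr) (use assms in auto)
  finally show ?thesis
    using assms by (simp add: integral_completion)
qed

lemma lebesgue_integrable_translate:
  fixes f :: "'a::euclidean_space \<Rightarrow> 'b::euclidean_space"
  assumes "f \<in> borel_measurable borel"
  shows "integrable lebesgue (\<lambda>x. f (c + x)) \<longleftrightarrow> integrable lebesgue f"
proof -
  have "integrable lborel f \<longleftrightarrow> integrable (distr lborel borel ((+) c)) f"
    by (simp add: lborel_distr_plus)
  also have "\<dots> \<longleftrightarrow> integrable lborel (\<lambda>x. f (c + x))"
    by (rule integrable_distr_eq) (use assms in auto)
  finally show ?thesis
    using assms by (simp add: integrable_completion)
qed

section \<open>Test functions: support, algebra, Lipschitz bound\<close>

lemma gderiv_zero_off_support:
  assumes "GDERIV \<psi> x :> \<psi>'" "closed C" "\<And>y. y \<notin> C \<Longrightarrow> \<psi> y = 0" "x \<notin> C"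
  shows "\<psi>' = 0"
proof -
  have "FDERIV \<psi> x :> (\<lambda>h. 0)"
    by (rule has_derivative_transform_within_open[of "\<lambda>_. 0" _ _ _ "- C"])
      (use assms in auto)
  with assms(1) have "(\<lambda>h. h \<bullet> \<psi>') = (\<lambda>h. 0)"
    unfolding gderiv_def by (rule has_derivative_unique)
  then have "\<psi>' \<bullet> \<psi>' = 0"
    by (rule fun_cong)
  then show ?thesis
    by simp
qed

text \<open>The definition constrains the support of \<psi> only; the gradient vanishes off the same
  compact set because \<psi> is zero on its open complement.\<close>

lemma test_functionE:
  assumes "test_function S \<psi> \<psi>'"
  obtains C where "compact C" "C \<subseteq> S" "\<And>x. x \<notin> C \<Longrightarrow> \<psi> x = 0" "\<And>x. x \<notin> C \<Longrightarrow> \<psi>' x = 0"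
proof -
  obtain C where C: "compact C" "C \<subseteq> S" "\<And>x. x \<notin> C \<Longrightarrow> \<psi> x = 0"
    using assms unfolding test_function_def by blast
  moreover have "\<psi>' x = 0" if "x \<notin> C" for x
    using assms gderiv_zero_off_support[of \<psi> x "\<psi>' x" C] C that compact_imp_closed
    unfolding test_function_def by blast
  ultimately show ?thesis using that by blast
qed

lemma test_functionD:
  assumes "test_function S \<psi> \<psi>'"
  shows "GDERIV \<psi> x :> \<psi>' x" "continuous_on UNIV \<psi>'" "continuous_on UNIV \<psi>"
proof -
  show g: "GDERIV \<psi> x :> \<psi>' x" for x
    using assms unfolding test_function_def by blast
  show "continuous_on UNIV \<psi>'"
    using assms unfolding test_function_def by blast
  show "continuous_on UNIV \<psi>"
    using g unfolding gderiv_def continuous_on_eq_continuous_at[OF open_UNIV]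
    using has_derivative_continuous by blast
qed

lemma test_function_mono:
  assumes "test_function S \<psi> \<psi>'" "S \<subseteq> T"
  shows "test_function T \<psi> \<psi>'"
  using assms unfolding test_function_def by blast

lemma test_function_mult:
  assumes "test_function S \<psi> \<psi>'" "test_function T \<zeta> \<zeta>'"
  shows "test_function (S \<inter> T) (\<lambda>x. \<psi> x * \<zeta> x) (\<lambda>x. \<psi> x *\<^sub>R \<zeta>' x + \<zeta> x *\<^sub>R \<psi>' x)"
proof -
  obtain C where C: "compact C" "C \<subseteq> S" "\<And>x. x \<notin> C \<Longrightarrow> \<psi> x = 0"
    using test_functionE[OF assms(1)] by metis
  obtain D where D: "compact D" "D \<subseteq> T" "\<And>x. x \<notin> D \<Longrightarrow> \<zeta> x = 0"
    using test_functionE[OF assms(2)] by metis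
  note d = test_functionD[OF assms(1)] test_functionD[OF assms(2)]
  have "compact (C \<inter> D)" "C \<inter> D \<subseteq> S \<inter> T" "\<And>x. x \<notin> C \<inter> D \<Longrightarrow> \<psi> x * \<zeta> x = 0"
    using C D compact_Int by auto
  then show ?thesis
    unfolding test_function_def using d
    by (intro conjI allI GDERIV_mult continuous_intros exI[of _ "C \<inter> D"]) auto
qed

text \<open>The derivative of q is required on the range of \<psi> only: the function q used later
  has a pole at -1 and is applied to nonnegative \<psi>.\<close>

lemma test_function_compose:
  assumes "test_function S \<psi> \<psi>'" "\<And>y. y \<in> range \<psi> \<Longrightarrow> DERIV q y :> q' y" "q 0 = 0"
    "continuous_on (range \<psi>) q'"
  shows "test_function S (\<lambda>x. q (\<psi> x)) (\<lambda>x. q' (\<psi> x) *\<^sub>R \<psi>' x)"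
proof -
  obtain C where C: "compact C" "C \<subseteq> S" "\<And>x. x \<notin> C \<Longrightarrow> \<psi> x = 0"
    using test_functionE[OF assms(1)] by metis
  note d = test_functionD[OF assms(1)]
  have "continuous_on UNIV (\<lambda>x. q' (\<psi> x))"
    using continuous_on_compose[OF d(3) assms(4)] by (simp add: o_def)
  then show ?thesis
    unfolding test_function_def using C d assms
    by (intro conjI allI GDERIV_DERIV_compose continuous_intros exI[of _ C]) auto
qed

text \<open>The gradient is continuous with compact support, hence bounded, and the mean value
  inequality applies on the whole space.\<close>

lemma test_function_lipschitz:
  assumes "test_function S \<psi> \<psi>'"
  obtains B where "B > 0" "\<And>x y. \<bar>\<psi> x - \<psi> y\<bar> \<le> B * norm (x - y)"
proof -
  obtain C where C: "compact C" "\<And>x. x \<notin> C \<Longrightarrow> \<psi>' x = 0"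
    using test_functionE[OF assms] by metis
  note d = test_functionD[OF assms]
  obtain B where B: "B > 0" "\<And>x. norm (\<psi>' x) \<le> B"
    using compact_support_bounded[OF C(1) d(2) C(2)] by metis
  have "norm (\<psi> x - \<psi> y) \<le> B * norm (x - y)" for x y
  proof (rule differentiable_bound[of UNIV \<psi> "\<lambda>x h. h \<bullet> \<psi>' x"])
    show "onorm (\<lambda>h. h \<bullet> \<psi>' x) \<le> B" for x
    proof (rule onorm_bound)
      fix h :: 'a
      have "\<bar>h \<bullet> \<psi>' x\<bar> \<le> norm h * norm (\<psi>' x)"
        by (rule Cauchy_Schwarz_ineq2)
      also have "\<dots> \<le> norm h * B"
        using B(2)[of x] by (simp add: mult_left_mono)
      finally show "norm (h \<bullet> \<psi>' x) \<le> B * norm h"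
        by (simp add: mult.commute)
    qed (use B(1) in simp)
  qed (use d(1) in \<open>auto simp: gderiv_def\<close>)
  then show ?thesis using that B(1) by auto
qed

text \<open>Both difference quotients of the identity
  \<open>\<integral> (\<psi>(x + t v) - \<psi>(x)) \<zeta>(x) = \<integral> \<psi>(x) (\<zeta>(x - t v) - \<zeta>(x))\<close> converge dominatedly.\<close>

lemma integration_by_parts_lipschitz:
  fixes \<psi> \<zeta> :: "'a::euclidean_space \<Rightarrow> real"
  assumes tf: "test_function S \<psi> \<psi>'"
    and lip: "\<And>x y. \<bar>\<zeta> x - \<zeta> y\<bar> \<le> L * norm (x - y)"
    and der: "AE x in lebesgue. ((\<lambda>t. (\<zeta> (x + t *\<^sub>R v) - \<zeta> x) / t) \<longlongrightarrow> d x) (at 0)"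
  shows "(LINT x|lebesgue. (\<psi>' x \<bullet> v) * \<zeta> x) = - (LINT x|lebesgue. \<psi> x * d x)"
proof -
  obtain C where C: "compact C" "C \<subseteq> S" "\<And>x. x \<notin> C \<Longrightarrow> \<psi> x = 0"
    using test_functionE[OF tf] by metis
  obtain B where B: "B > 0" "\<And>x y. \<bar>\<psi> x - \<psi> y\<bar> \<le> B * norm (x - y)"
    using test_function_lipschitz[OF tf] by metis
  note d = test_functionD[OF tf]
  \<comment> \<open>\<open>lipschitz_on\<close> demands a nonnegative constant, and \<open>L\<close>
    is not assumed to be one.\<close>
  have "\<bar>\<zeta> x - \<zeta> y\<bar> \<le> max L 0 * norm (x - y)" for x y
    using lip[of x y] mult_right_mono[of L "max L 0" "norm (x - y)"] by simp
  then have "(max L 0)-lipschitz_on UNIV \<zeta>"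
    by (intro lipschitz_onI) (auto simp: dist_norm)
  then have cchi: "continuous_on UNIV \<zeta>"
    by (rule lipschitz_on_continuous_on)
  have [measurable]: "\<psi> \<in> borel_measurable borel" "\<zeta> \<in> borel_measurable borel"
    using d(3) cchi by (auto intro: borel_measurable_continuous_onI)
  define t :: "nat \<Rightarrow> real" where "t k = 1 / real (Suc k)" for k
  have t: "t k > 0" "t k \<le> 1" for k
    by (auto simp: t_def)
  have t0: "t \<longlonglongrightarrow> 0"
    unfolding t_def using LIMSEQ_inverse_real_of_nat by (simp add: inverse_eq_divide)
  have tlim: "filterlim t (at 0) sequentially"
    unfolding filterlim_at using t(1) t0 by (simp add: less_imp_neq[THEN not_sym])
  have tlim': "filterlim (\<lambda>k. - t k) (at 0) sequentially"
    unfolding filterlim_at using t(1) tendsto_minus[OF t0] by (simp add: less_imp_neq[THEN not_sym])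
  \<comment> \<open>Contains the supports of all shifts of \<psi> by t v with 0 \<le> t \<le> 1, so
    that one dominating function serves every difference quotient.\<close>
  define K where "K = {y - z |y z. y \<in> C \<and> z \<in> cball 0 (norm v)}"
  have K: "compact K"
    unfolding K_def by (rule compact_differences[OF C(1) compact_cball])
  define F where "F k x = (\<psi> (x + t k *\<^sub>R v) - \<psi> x) / t k * \<zeta> x" for k x
  define G where "G k x = \<psi> x * ((\<zeta> (x - t k *\<^sub>R v) - \<zeta> x) / t k)" for k x
  have inK: "x \<in> K" if "\<psi> (x + t k *\<^sub>R v) \<noteq> 0 \<or> \<psi> x \<noteq> 0" for x k
  proof -
    have "x + t k *\<^sub>R v \<in> C \<or> x \<in> C" using that C(3) by blast
    moreover have "norm (t k *\<^sub>R v) \<le> norm v" using t[of k] by (simp add: mult_left_le_one_le)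
    moreover have "x = (x + t k *\<^sub>R v) - t k *\<^sub>R v" "x = x - 0" by auto
    ultimately show ?thesis unfolding K_def mem_Collect_eq
      by (metis mem_cball_0 norm_ge_zero norm_zero)
  qed
  have eq: "(LINT x|lebesgue. F k x) = (LINT x|lebesgue. G k x)" for k
  proof -
    have i1: "integrable lebesgue (\<lambda>x. \<psi> x * \<zeta> x / t k)"
      by (rule compact_support_lebesgue_integrable[OF C(1)])
        (use C(3) d(3) cchi t(1)[of k] in \<open>auto intro!: continuous_intros\<close>)
    have i2: "integrable lebesgue (\<lambda>x. \<psi> x * \<zeta> (x - t k *\<^sub>R v) / t k)"
      by (rule compact_support_lebesgue_integrable[OF C(1)])
        (use C(3) d(3) t(1)[of k] in \<open>auto intro!: continuous_intros continuous_on_compose2[OF cchi]\<close>)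
    have i3: "integrable lebesgue (\<lambda>x. \<psi> (x + t k *\<^sub>R v) * \<zeta> x / t k)"
      using i2 lebesgue_integrable_translate[of "\<lambda>x. \<psi> x * \<zeta> (x - t k *\<^sub>R v) / t k" "t k *\<^sub>R v"]
      by (simp add: add.commute)
    have "(LINT x|lebesgue. \<psi> (x + t k *\<^sub>R v) * \<zeta> x / t k) = (LINT x|lebesgue. \<psi> x * \<zeta> (x - t k *\<^sub>R v) / t k)"
      using lebesgue_integral_translate[of "\<lambda>x. \<psi> x * \<zeta> (x - t k *\<^sub>R v) / t k" "t k *\<^sub>R v"]
      by (simp add: add.commute)
    moreover have "(LINT x|lebesgue. F k x) = (LINT x|lebesgue. \<psi> (x + t k *\<^sub>R v) * \<zeta> x / t k) - (LINT x|lebesgue. \<psi> x * \<zeta> x / t k)"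
      unfolding Bochner_Integration.integral_diff[OF i3 i1, symmetric]
      by (intro Bochner_Integration.integral_cong) (auto simp: F_def diff_divide_distrib left_diff_distrib)
    moreover have "(LINT x|lebesgue. G k x) = (LINT x|lebesgue. \<psi> x * \<zeta> (x - t k *\<^sub>R v) / t k) - (LINT x|lebesgue. \<psi> x * \<zeta> x / t k)"
      unfolding Bochner_Integration.integral_diff[OF i2 i1, symmetric]
      by (intro Bochner_Integration.integral_cong) (auto simp: G_def diff_divide_distrib right_diff_distrib)
    ultimately show ?thesis by simp
  qed
  have intK: "integrable lebesgue (\<lambda>x. indicator K x *\<^sub>R h x)" if "continuous_on UNIV h" for h :: "'a \<Rightarrow> real"
  proof -
    have "K \<in> sets lebesgue" "continuous_on K h"
      using lmeasurable_compact[OF K] continuous_on_subset[OF that] by auto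
    then show ?thesis
      using set_integrable_continuous_compact[OF K, of h K] unfolding set_integrable_def by blast
  qed
  have limF: "(\<lambda>k. LINT x|lebesgue. F k x) \<longlonglongrightarrow> (LINT x|lebesgue. (\<psi>' x \<bullet> v) * \<zeta> x)"
  proof (rule integral_dominated_convergence)
    show "integrable lebesgue (\<lambda>x. indicator K x *\<^sub>R (B * norm v * \<bar>\<zeta> x\<bar>))"
      using cchi by (intro intK continuous_intros)
    show "(\<lambda>x. \<psi>' x \<bullet> v * \<zeta> x) \<in> borel_measurable lebesgue"
      using d(2) by (intro borel_measurable_times borel_measurable_inner measurable_completion)
       (auto intro: borel_measurable_continuous_onI)
    show "F k \<in> borel_measurable lebesgue" for k
      unfolding F_def using d(3) cchi by (intro measurable_completion) measurable
    show "AE x in lebesgue. norm (F k x) \<le> indicator K x *\<^sub>R (B * norm v * \<bar>\<zeta> x\<bar>)" for k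
    proof (rule AE_I2)
      fix x
      have "\<bar>\<psi> (x + t k *\<^sub>R v) - \<psi> x\<bar> / t k \<le> B * norm v"
        using B(2)[of "x + t k *\<^sub>R v" x] t(1)[of k] by (simp add: field_simps)
      then have "norm (F k x) \<le> B * norm v * \<bar>\<zeta> x\<bar>"
        using t(1)[of k] mult_right_mono[of "\<bar>\<psi> (x + t k *\<^sub>R v) - \<psi> x\<bar> / t k" "B * norm v" "\<bar>\<zeta> x\<bar>"]
        unfolding F_def by (simp add: abs_mult)
      moreover have "F k x = 0" if "x \<notin> K"
        using inK[of x k] that by (auto simp: F_def)
      ultimately show "norm (F k x) \<le> indicator K x *\<^sub>R (B * norm v * \<bar>\<zeta> x\<bar>)"
        by (auto simp: indicator_def)
    qed
    show "AE x in lebesgue. (\<lambda>k. F k x) \<longlonglongrightarrow> \<psi>' x \<bullet> v * \<zeta> x"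
    proof (rule AE_I2)
      fix x
      have 1: "((\<lambda>s. x + s *\<^sub>R v) has_derivative (\<lambda>s. s *\<^sub>R v)) (at 0)"
        by (auto intro!: derivative_eq_intros)
      have 2: "(\<psi> has_derivative (\<lambda>h. h \<bullet> \<psi>' x)) (at (x + 0 *\<^sub>R v))"
        using d(1)[of x] unfolding gderiv_def by simp
      have "((\<lambda>s. \<psi> (x + s *\<^sub>R v)) has_derivative (\<lambda>s. (s *\<^sub>R v) \<bullet> \<psi>' x)) (at 0)"
        by (rule has_derivative_compose[OF 1 2])
      then have "((\<lambda>s. \<psi> (x + s *\<^sub>R v)) has_real_derivative (\<psi>' x \<bullet> v)) (at 0)"
        unfolding has_field_derivative_def
        by (rule has_derivative_eq_rhs) (rule ext, simp add: inner_commute[of v])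
      then have "((\<lambda>s. (\<psi> (x + s *\<^sub>R v) - \<psi> x) / s) \<longlongrightarrow> \<psi>' x \<bullet> v) (at 0)"
        unfolding DERIV_def by simp
      then have "(\<lambda>k. (\<psi> (x + t k *\<^sub>R v) - \<psi> x) / t k) \<longlonglongrightarrow> \<psi>' x \<bullet> v"
        using tlim by (rule filterlim_compose)
      then show "(\<lambda>k. F k x) \<longlonglongrightarrow> \<psi>' x \<bullet> v * \<zeta> x"
        unfolding F_def by (intro tendsto_intros)
    qed
  qed
  have dlim: "AE x in lebesgue. (\<lambda>k. G k x) \<longlonglongrightarrow> - (\<psi> x * d x)"
    using der
  proof eventually_elim
    fix x assume "((\<lambda>t. (\<zeta> (x + t *\<^sub>R v) - \<zeta> x) / t) \<longlongrightarrow> d x) (at 0)"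
    then have "(\<lambda>k. (\<zeta> (x + (- t k) *\<^sub>R v) - \<zeta> x) / (- t k)) \<longlonglongrightarrow> d x"
      using tlim' by (rule filterlim_compose)
    then have "(\<lambda>k. \<psi> x * (- ((\<zeta> (x + (- t k) *\<^sub>R v) - \<zeta> x) / (- t k)))) \<longlonglongrightarrow> \<psi> x * (- d x)"
      by (intro tendsto_intros)
    then show "(\<lambda>k. G k x) \<longlonglongrightarrow> - (\<psi> x * d x)"
      by (simp add: G_def)
  qed
  have Gm: "G k \<in> borel_measurable lebesgue" for k
    unfolding G_def using d(3) cchi by (intro measurable_completion) measurable
  \<comment> \<open>\<open>d\<close> is known only as an a.e. limit; its product with \<psi> is
    measurable because it agrees a.e. with a limit of the measurable functions
    \<open>G k\<close>.\<close>
  have dm: "(\<lambda>x. - (\<psi> x * d x)) \<in> borel_measurable lebesgue"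
  proof -
    have "(\<lambda>x. lim (\<lambda>k. G k x)) \<in> borel_measurable lebesgue"
      using Gm by (rule borel_measurable_lim_metric)
    moreover have "AE x in lebesgue. lim (\<lambda>k. G k x) = - (\<psi> x * d x)"
      using dlim by eventually_elim (rule limI)
    ultimately show ?thesis
      by (rule measurable_lebesgue_AE_cong[rotated])
  qed
  have limG: "(\<lambda>k. LINT x|lebesgue. G k x) \<longlonglongrightarrow> (LINT x|lebesgue. - (\<psi> x * d x))"
  proof (rule integral_dominated_convergence)
    show "integrable lebesgue (\<lambda>x. \<bar>\<psi> x\<bar> * (L * norm v))"
      by (rule compact_support_lebesgue_integrable[OF C(1)])
        (use C(3) d(3) in \<open>auto intro!: continuous_intros\<close>)
    show "AE x in lebesgue. norm (G k x) \<le> \<bar>\<psi> x\<bar> * (L * norm v)" for k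
    proof (rule AE_I2)
      fix x
      have "\<bar>\<zeta> (x - t k *\<^sub>R v) - \<zeta> x\<bar> / t k \<le> L * norm v"
        using lip[of "x - t k *\<^sub>R v" x] t(1)[of k] by (simp add: field_simps)
      then show "norm (G k x) \<le> \<bar>\<psi> x\<bar> * (L * norm v)"
        using t(1)[of k] mult_left_mono[of "\<bar>\<zeta> (x - t k *\<^sub>R v) - \<zeta> x\<bar> / t k" "L * norm v" "\<bar>\<psi> x\<bar>"]
        unfolding G_def by (simp add: abs_mult)
    qed
  qed (use Gm dm dlim in auto)
  have "(LINT x|lebesgue. (\<psi>' x \<bullet> v) * \<zeta> x) = (LINT x|lebesgue. - (\<psi> x * d x))"
    using limF limG unfolding eq by (rule LIMSEQ_unique)
  then show ?thesis by simp
qed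

section \<open>The fundamental lemma of the calculus of variations\<close>

lemma continuous_borel_measurable_lebesgue:
  fixes f :: "'a::euclidean_space \<Rightarrow> 'b::topological_space"
  assumes "continuous_on UNIV f"
  shows "f \<in> borel_measurable lebesgue"
  by (rule measurable_completion) (use borel_measurable_continuous_onI[OF assms] in simp)

text \<open>By Lindelof an open set is a countable union of the members of \<open>G\<close> that it
  contains, so a base of the topology generates the Borel sets.\<close>

lemma borel_eq_sigma_Int_stable:
  fixes G :: "'a::second_countable_topology set set"
  assumes "\<And>U. U \<in> G \<Longrightarrow> open U"
    and "\<And>x e. open e \<Longrightarrow> x \<in> e \<Longrightarrow> \<exists>U\<in>G. x \<in> U \<and> U \<subseteq> e"
  shows "sets borel = sigma_sets UNIV G"
proof
  interpret sigma_algebra UNIV "sigma_sets UNIV G"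
    by (rule sigma_algebra_sigma_sets) auto
  have "T \<in> sigma_sets UNIV G" if "open T" for T
  proof -
    obtain G' where G': "G' \<subseteq> {U \<in> G. U \<subseteq> T}" "countable G'" "\<Union>G' = \<Union>{U \<in> G. U \<subseteq> T}"
      using Lindelof[of "{U \<in> G. U \<subseteq> T}"] assms(1) by blast
    moreover have "\<Union>{U \<in> G. U \<subseteq> T} = T"
      using assms(2)[OF that] by blast
    moreover have "\<Union>G' \<in> sigma_sets UNIV G"
      using G'(1,2) by (intro countable_Union) (auto intro: sigma_sets.Basic)
    ultimately show ?thesis by simp
  qed
  then have "sigma_sets UNIV {S. open S} \<subseteq> sigma_sets UNIV G"
    by (intro sigma_sets_mono) auto
  then show "sets borel \<subseteq> sigma_sets UNIV G"
    unfolding borel_def by simp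
  show "sigma_sets UNIV G \<subseteq> sets borel"
    using sets.sigma_sets_subset[of G borel] assms(1) by (simp add: subset_iff)
qed

text \<open>The squared positive part is the C^1 profile of the bump functions below; at 0 its
  difference quotient is bounded by |h|.\<close>

lemma DERIV_pos_square: "DERIV (\<lambda>s::real. (max 0 s)\<^sup>2) s :> 2 * max 0 s"
proof (cases "s = 0")
  case True
  have "((\<lambda>h::real. (max 0 h)\<^sup>2 / h) \<longlongrightarrow> 0) (at 0)"
  proof (rule Lim_null_comparison)
    show "\<forall>\<^sub>F h in at (0::real). norm ((max 0 h)\<^sup>2 / h) \<le> \<bar>h\<bar>"
      by (rule always_eventually) (auto simp: max_def power2_eq_square)
    show "((\<lambda>h::real. \<bar>h\<bar>) \<longlongrightarrow> 0) (at 0)"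
      by (rule tendsto_rabs_zero) (rule tendsto_ident_at)
  qed
  with True show ?thesis
    by (simp add: DERIV_def)
next
  case False
  show ?thesis
  proof (cases "s > 0")
    case True
    have "DERIV (\<lambda>s. s\<^sup>2) s :> 2 * s"
      by (auto intro!: derivative_eq_intros)
    then have "DERIV (\<lambda>s. (max 0 s)\<^sup>2) s :> 2 * s"
      by (rule DERIV_cong_ev[THEN iffD1, OF refl _ refl, rotated])
        (use True in \<open>auto intro: eventually_mono[OF order_tendstoD(1)[OF tendsto_ident_at True]]
          simp: eventually_nhds_conv_at elim: eventually_mono\<close>)
    with True show ?thesis by simp
  next
    case F: False
    then have "s < 0" using False by simp
    have "DERIV (\<lambda>s. 0) s :> 0" by simp
    then have "DERIV (\<lambda>s. (max 0 s)\<^sup>2) s :> 0"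
    proof (rule has_field_derivative_transform_within_open[of _ _ _ "{..<0}"])
    qed (use \<open>s < 0\<close> in auto)
    with F show ?thesis by simp
  qed
qed

text \<open>The bump is the square of the positive part of r^2 - |x - c|^2. Its positivity set is
  the open ball, while its support is the closed ball, which is why the latter has to lie in
  \<open>S\<close>.\<close>

lemma exists_test_function_positive_on_ball:
  fixes c :: "'a::euclidean_space"
  assumes "r > 0" "cball c r \<subseteq> S"
  shows "\<exists>\<rho> \<rho>'. test_function S \<rho> \<rho>' \<and> (\<forall>x. \<rho> x \<ge> 0) \<and> {x. \<rho> x > 0} = ball c r"
proof -
  define q where "q x = r\<^sup>2 - (x - c) \<bullet> (x - c)" for x
  have "(norm (x - c))\<^sup>2 < r\<^sup>2 \<longleftrightarrow> norm (x - c) < r" for x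
    using assms(1) power2_less_imp_less[of "norm (x - c)" r] power_strict_mono[of "norm (x - c)" r 2] by auto
  then have q: "q x > 0 \<longleftrightarrow> x \<in> ball c r" for x
    unfolding q_def by (simp add: dot_square_norm dist_norm norm_minus_commute[of c])
  have "test_function S (\<lambda>x. (max 0 (q x))\<^sup>2) (\<lambda>x. (2 * max 0 (q x)) *\<^sub>R (- 2 *\<^sub>R (x - c)))"
    unfolding test_function_def
  proof (intro conjI allI exI[of _ "cball c r"])
    fix x
    have "GDERIV q x :> - 2 *\<^sub>R (x - c)"
      unfolding q_def gderiv_def
      by (auto intro!: derivative_eq_intros simp: algebra_simps inner_commute fun_eq_iff)
    then show "GDERIV (\<lambda>x. (max 0 (q x))\<^sup>2) x :> (2 * max 0 (q x)) *\<^sub>R (- 2 *\<^sub>R (x - c))"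
      using DERIV_pos_square by (rule GDERIV_DERIV_compose)
    show "x \<notin> cball c r \<longrightarrow> (max 0 (q x))\<^sup>2 = 0"
      using q[of x] by (auto simp: max_def)
  next
    show "continuous_on UNIV (\<lambda>x. (2 * max 0 (q x)) *\<^sub>R (- 2 *\<^sub>R (x - c)))"
      unfolding q_def by (intro continuous_intros)
  qed (use assms(2) in auto)
  moreover have "{x. (max 0 (q x))\<^sup>2 > 0} = ball c r"
  proof -
    have "ball c r = {x. q x > 0}" using q by blast
    moreover have "(max 0 (q x))\<^sup>2 > 0 \<longleftrightarrow> q x > 0" for x
      by (auto simp: max_def)
    ultimately show ?thesis by simp
  qed
  ultimately show ?thesis
    by (intro exI[of _ "\<lambda>x. (max 0 (q x))\<^sup>2"] exI[of _ "\<lambda>x. (2 * max 0 (q x)) *\<^sub>R (- 2 *\<^sub>R (x - c))"]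
        conjI allI zero_le_power2) assumption+
qed

text \<open>The functions 1 - (1 + \<rho>)^(-k) are again test functions and increase to the
  indicator of the positivity set of \<rho>, so a function orthogonal to all test functions has
  integral 0 there by dominated convergence.\<close>

lemma set_integral_eq_zero_of_test_functions:
  fixes g :: "'a::euclidean_space \<Rightarrow> real"
  assumes \<rho>: "test_function S \<rho> \<rho>'" "\<And>x. \<rho> x \<ge> 0"
    and loc: "\<And>C. compact C \<Longrightarrow> C \<subseteq> S \<Longrightarrow> set_integrable lebesgue C g"
    and zero: "\<And>\<psi> \<psi>'. test_function S \<psi> \<psi>' \<Longrightarrow> (LINT x:S|lebesgue. \<psi> x * g x) = 0"
  shows "(LINT x:{x. \<rho> x > 0}|lebesgue. g x) = 0" "set_integrable lebesgue {x. \<rho> x > 0} g"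
proof -
  obtain C where C: "compact C" "C \<subseteq> S" "\<And>x. x \<notin> C \<Longrightarrow> \<rho> x = 0"
    using test_functionE[OF \<rho>(1)] by metis
  have sub: "{x. \<rho> x > 0} \<subseteq> C" using C(3) by force
  have "open {x. \<rho> x > 0}"
    using test_functionD(3)[OF \<rho>(1)] by (intro open_Collect_less) auto
  then have "{x. \<rho> x > 0} \<in> sets lebesgue" by auto
  then show int: "set_integrable lebesgue {x. \<rho> x > 0} g"
    using set_integrable_subset[OF loc[OF C(1,2)]] sub by blast
  define \<psi> where "\<psi> k x = 1 - inverse (1 + \<rho> x) ^ k" for k x
  have tf: "test_function S (\<psi> k) (\<lambda>x. (real k * inverse (1 + \<rho> x) ^ Suc k) *\<^sub>R \<rho>' x)" for k
    unfolding \<psi>_def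
  proof (rule test_function_compose[OF \<rho>(1), where q = "\<lambda>s. 1 - inverse (1 + s) ^ k"
        and q' = "\<lambda>s. real k * inverse (1 + s) ^ Suc k"])
    fix y assume "y \<in> range \<rho>"
    then have y: "y \<ge> 0" using \<rho>(2) by auto
    show "((\<lambda>s. 1 - inverse (1 + s) ^ k) has_real_derivative real k * inverse (1 + y) ^ Suc k) (at y)"
    proof -
      have "((\<lambda>s. inverse (1 + s)) has_real_derivative - (inverse (1 + y))\<^sup>2) (at y)"
        using y by (auto intro!: derivative_eq_intros simp: power2_eq_square)
      from DERIV_diff[OF DERIV_const[of 1] DERIV_power[OF this, of k]] show ?thesis
        by (rule DERIV_cong) (cases k; simp add: power2_eq_square)
    qed
  next
    show "continuous_on (range \<rho>) (\<lambda>s. real k * inverse (1 + s) ^ Suc k)"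
    proof (intro continuous_intros ballI)
      fix s assume "s \<in> range \<rho>"
      then have "s \<ge> 0" using \<rho>(2) by auto
      then show "1 + s \<noteq> 0" by simp
    qed
  qed simp
  have cpsi: "continuous_on UNIV (\<psi> k)" for k
    using test_functionD(3)[OF tf] .
  have psi01: "0 \<le> \<psi> k x" "\<psi> k x \<le> 1" for k x
    using \<rho>(2)[of x] by (auto simp: \<psi>_def inverse_le_1_iff power_le_one)
  have eq: "(LINT x|lebesgue. \<psi> k x * (indicator {x. \<rho> x > 0} x * g x)) = 0" for k
  proof -
    have "\<psi> k x = 0" if "\<not> \<rho> x > 0" for x
      using \<rho>(2)[of x] that by (simp add: \<psi>_def)
    then have "(LINT x:S|lebesgue. \<psi> k x * g x) = (LINT x:{x. \<rho> x > 0}|lebesgue. \<psi> k x * g x)"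
      using sub C(2) by (intro set_lint_supported) auto
    then show ?thesis
      using zero[OF tf, of k] unfolding set_lebesgue_integral_def by (simp add: mult.left_commute)
  qed
  have int': "integrable lebesgue (\<lambda>x. indicator {x. \<rho> x > 0} x * g x)"
    using int unfolding set_integrable_def by simp
  have "(\<lambda>k. LINT x|lebesgue. \<psi> k x * (indicator {x. \<rho> x > 0} x * g x)) \<longlonglongrightarrow>
      (LINT x|lebesgue. indicator {x. \<rho> x > 0} x * g x)"
  proof (rule integral_dominated_convergence)
    show "integrable lebesgue (\<lambda>x. \<bar>indicator {x. \<rho> x > 0} x * g x\<bar>)"
      using int' by (rule integrable_abs)
    show "(\<lambda>x. indicator {x. \<rho> x > 0} x * g x) \<in> borel_measurable lebesgue"
      using int' by (rule borel_measurable_integrable)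
    then show "(\<lambda>x. \<psi> k x * (indicator {x. \<rho> x > 0} x * g x)) \<in> borel_measurable lebesgue" for k
      using continuous_borel_measurable_lebesgue[OF cpsi] by (rule borel_measurable_times[rotated])
    show "AE x in lebesgue. norm (\<psi> k x * (indicator {x. \<rho> x > 0} x * g x)) \<le> \<bar>indicator {x. \<rho> x > 0} x * g x\<bar>" for k
      using psi01 by (intro AE_I2) (auto simp: abs_mult intro!: mult_left_le_one_le)
    show "AE x in lebesgue. (\<lambda>k. \<psi> k x * (indicator {x. \<rho> x > 0} x * g x)) \<longlonglongrightarrow> indicator {x. \<rho> x > 0} x * g x"
    proof (rule AE_I2)
      fix x
      show "(\<lambda>k. \<psi> k x * (indicator {x. \<rho> x > 0} x * g x)) \<longlonglongrightarrow> indicator {x. \<rho> x > 0} x * g x"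
      proof (cases "\<rho> x > 0")
        case True
        have "norm (inverse (1 + \<rho> x)) < 1"
          using True by (simp add: inverse_less_1_iff)
        then have "(\<lambda>k. inverse (1 + \<rho> x) ^ k) \<longlonglongrightarrow> 0"
          by (rule LIMSEQ_power_zero)
        then have "(\<lambda>k. \<psi> k x) \<longlonglongrightarrow> 1 - 0"
          unfolding \<psi>_def by (rule tendsto_diff[OF tendsto_const])
        then show ?thesis
          using tendsto_mult_right[of "\<lambda>k. \<psi> k x" 1 sequentially "indicator {x. \<rho> x > 0} x * g x"] by simp
      qed auto
    qed
  qed
  then show "(LINT x:{x. \<rho> x > 0}|lebesgue. g x) = 0"
    unfolding eq set_lebesgue_integral_def using LIMSEQ_unique[OF _ tendsto_const] by fastforce
qed

text \<open>Positivity sets of nonnegative test functions form a pi-system (products give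
  intersections) that generates the Borel sets. On a ball inside \<open>S\<close> the signed measure
  with density \<open>g\<close> vanishes on this system, hence on all Borel sets, which forces
  \<open>g\<close> to be 0 a.e. there; countably many balls cover \<open>S\<close>.\<close>

lemma fundamental_lemma_real:
  fixes g :: "'a::euclidean_space \<Rightarrow> real"
  assumes "open S"
    and loc: "\<And>C. compact C \<Longrightarrow> C \<subseteq> S \<Longrightarrow> set_integrable lebesgue C g"
    and zero: "\<And>\<psi> \<psi>'. test_function S \<psi> \<psi>' \<Longrightarrow> (LINT x:S|lebesgue. \<psi> x * g x) = 0"
  shows "AE x in lebesgue. x \<in> S \<longrightarrow> g x = 0"
proof -
  \<comment> \<open>Test functions on the whole space are taken so that \<open>G\<close> generates
    all Borel sets; multiplication by a bump \<rho> of the ball brings them back to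
    \<open>S\<close>.\<close>
  define G :: "'a set set" where
    "G = {U. \<exists>\<rho> \<rho>'. test_function UNIV \<rho> \<rho>' \<and> (\<forall>x. \<rho> x \<ge> 0) \<and> {x. \<rho> x > 0} = U}"
  have GE: "\<exists>\<rho> \<rho>'. test_function UNIV \<rho> \<rho>' \<and> (\<forall>x. \<rho> x \<ge> 0) \<and> {x. \<rho> x > 0} = U" if "U \<in> G" for U
    using that unfolding G_def by (rule CollectD)
  have sets_G: "sets borel = sigma_sets UNIV G"
  proof (rule borel_eq_sigma_Int_stable)
    show "open U" if "U \<in> G" for U
    proof -
      from GE[OF that] obtain \<rho> where "\<exists>\<rho>'. test_function UNIV \<rho> \<rho>' \<and> (\<forall>x. \<rho> x \<ge> 0) \<and> {x. \<rho> x > 0} = U" ..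
      then obtain \<rho>' where "test_function UNIV \<rho> \<rho>' \<and> (\<forall>x. \<rho> x \<ge> 0) \<and> {x. \<rho> x > 0} = U" ..
      then have "continuous_on UNIV \<rho>" "U = {x. \<rho> x > 0}"
        using test_functionD(3) by auto
      then show ?thesis
        using open_Collect_less[of "\<lambda>_. 0" \<rho>] by simp
    qed
    show "\<exists>U\<in>G. x \<in> U \<and> U \<subseteq> e" if "open e" "x \<in> e" for x e
    proof -
      from that obtain r where r: "r > 0" "ball x r \<subseteq> e"
        by (rule openE)
      have "ball x r \<in> G" unfolding G_def
        by (rule CollectI) (rule exists_test_function_positive_on_ball[OF r(1) subset_UNIV])
      then show ?thesis
        using r by (intro bexI[of _ "ball x r"] conjI) simp_all
    qed
  qed
  have stable: "Int_stable G"
  proof (rule Int_stableI)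
    fix U V assume "U \<in> G" "V \<in> G"
    from GE[OF \<open>U \<in> G\<close>] obtain \<rho> where "\<exists>\<rho>'. test_function UNIV \<rho> \<rho>' \<and> (\<forall>x. \<rho> x \<ge> 0) \<and> {x. \<rho> x > 0} = U" ..
    then obtain \<rho>' where "test_function UNIV \<rho> \<rho>' \<and> (\<forall>x. \<rho> x \<ge> 0) \<and> {x. \<rho> x > 0} = U" ..
    moreover from GE[OF \<open>V \<in> G\<close>] obtain \<tau> where "\<exists>\<tau>'. test_function UNIV \<tau> \<tau>' \<and> (\<forall>x. \<tau> x \<ge> 0) \<and> {x. \<tau> x > 0} = V" ..
    then obtain \<tau>' where "test_function UNIV \<tau> \<tau>' \<and> (\<forall>x. \<tau> x \<ge> 0) \<and> {x. \<tau> x > 0} = V" ..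
    ultimately have *: "test_function UNIV \<rho> \<rho>'" "\<forall>x. \<rho> x \<ge> 0" "U = {x. \<rho> x > 0}"
      "test_function UNIV \<tau> \<tau>'" "\<forall>x. \<tau> x \<ge> 0" "V = {x. \<tau> x > 0}"
      by simp_all
    then have "U \<inter> V = {x. \<rho> x * \<tau> x > 0}"
      by (auto simp: zero_less_mult_iff) (meson not_less)+
    then show "U \<inter> V \<in> G"
      using test_function_mult[OF *(1,4)] *(2,5) unfolding G_def
      by (intro CollectI exI[of _ "\<lambda>x. \<rho> x * \<tau> x"] exI[of _ "\<lambda>x. \<rho> x *\<^sub>R \<tau>' x + \<tau> x *\<^sub>R \<rho>' x"]) simp
  qed
  have local: "AE x in lebesgue. x \<in> ball c r \<longrightarrow> g x = 0" if r: "r > 0" "cball c r \<subseteq> S" for c r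
  proof -
    from exists_test_function_positive_on_ball[OF r]
    obtain \<rho> where "\<exists>\<rho>'. test_function S \<rho> \<rho>' \<and> (\<forall>y. \<rho> y \<ge> 0) \<and> {y. \<rho> y > 0} = ball c r" ..
    then obtain \<rho>' where "test_function S \<rho> \<rho>' \<and> (\<forall>y. \<rho> y \<ge> 0) \<and> {y. \<rho> y > 0} = ball c r" ..
    then have \<rho>: "test_function S \<rho> \<rho>'" "\<And>y. \<rho> y \<ge> 0" "{y. \<rho> y > 0} = ball c r"
      by simp_all
    define h where "h x = indicator (ball c r) x * g x" for x
    have inth: "integrable lebesgue h"
      using set_integral_eq_zero_of_test_functions(2)[OF \<rho>(1,2) loc zero] \<rho>(3)
      unfolding set_integrable_def h_def by simp
    have total: "integral\<^sup>L lebesgue h = 0"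
      using set_integral_eq_zero_of_test_functions(1)[OF \<rho>(1,2) loc zero] \<rho>(3)
      unfolding set_lebesgue_integral_def h_def by simp
    have seth: "set_integrable lebesgue A h" if "A \<in> sets borel" for A
      using that integrable_mult_indicator[OF _ inth, of A] unfolding set_integrable_def by auto
    have borel0: "(LINT x:A|lebesgue. h x) = 0" if "A \<in> sigma_sets UNIV G" for A
      using stable subset_UNIV[of G, folded Pow_UNIV] that
    proof (induction rule: sigma_sets_induct_disjoint)
      case (basic A)
      from GE[OF this] obtain \<tau> where "\<exists>\<tau>'. test_function UNIV \<tau> \<tau>' \<and> (\<forall>x. \<tau> x \<ge> 0) \<and> {x. \<tau> x > 0} = A" ..
      then obtain \<tau>' where "test_function UNIV \<tau> \<tau>' \<and> (\<forall>x. \<tau> x \<ge> 0) \<and> {x. \<tau> x > 0} = A" ..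
      then have \<tau>: "test_function UNIV \<tau> \<tau>'" "\<forall>x. \<tau> x \<ge> 0" "A = {x. \<tau> x > 0}"
        by simp_all
      have tf: "test_function S (\<lambda>x. \<rho> x * \<tau> x) (\<lambda>x. \<rho> x *\<^sub>R \<tau>' x + \<tau> x *\<^sub>R \<rho>' x)"
        using test_function_mult[OF \<rho>(1) \<tau>(1)] by simp
      have "x \<in> A \<inter> ball c r \<longleftrightarrow> \<rho> x * \<tau> x > 0" for x
        using \<rho>(2)[of x] \<tau>(2) unfolding \<rho>(3)[symmetric] \<tau>(3)
        by (auto simp: zero_less_mult_iff)
      then have eq: "A \<inter> ball c r = {x. \<rho> x * \<tau> x > 0}" by blast
      have "(LINT x:A \<inter> ball c r|lebesgue. g x) = 0"
        unfolding eq using \<rho>(2) \<tau>(2)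
        by (intro set_integral_eq_zero_of_test_functions(1)[OF tf _ loc zero]) auto
      then show ?case
        unfolding set_lebesgue_integral_def h_def by (simp add: indicator_inter_arith mult.assoc)
    next
      case empty
      then show ?case by (simp add: set_lebesgue_integral_def)
    next
      case (compl A)
      have A: "A \<in> sets borel" using compl(1) sets_G by blast
      have "(LINT x:A \<union> (UNIV - A)|lebesgue. h x) = (LINT x:A|lebesgue. h x) + (LINT x:UNIV - A|lebesgue. h x)"
        by (rule set_integral_Un) (use A seth in auto)
      moreover have "(LINT x:A \<union> (UNIV - A)|lebesgue. h x) = 0"
        using total by (simp add: set_lebesgue_integral_def)
      ultimately show ?case using compl by simp
    next
      case (union A)
      have Ab: "A i \<in> sets borel" for i
        using union(2) unfolding sets_G by blast
      have "(LINT x:(\<Union>i. A i)|lebesgue. h x) = (\<Sum>i. (LINT x:(A i)|lebesgue. h x))"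
      proof (rule lebesgue_integral_countable_add)
        show "A i \<in> sets lebesgue" for i
          using Ab[of i] by simp
        show "A i \<inter> A j = {}" if "i \<noteq> j" for i j
          using union(1) that unfolding disjoint_family_on_def by simp
        show "set_integrable lebesgue (\<Union>i. A i) h"
          by (intro seth sets.countable_UN') (use Ab in auto)
      qed
      then show ?case using union(3) by simp
    qed
    \<comment> \<open>\<open>h\<close> is merely Lebesgue measurable; uniqueness of densities is
      applied over \<open>lborel\<close>, to a Borel version of it.\<close>
    obtain h' where h': "h' \<in> borel_measurable lborel" "AE x in lborel. h x = h' x"
      using completion_ex_borel_measurable_real[OF borel_measurable_integrable[OF inth]] by blast
    have ae: "AE x in lebesgue. h x = h' x"
      using h'(2) by (rule AE_completion)
    have inth': "integrable lborel h'"
      using lebesgue_integrable_cong_AE[OF ae inth] h'(1) integrable_completion by blast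
    have "AE x in lborel. h' x = 0"
    proof (rule density_unique_real[OF inth'])
      fix A :: "'a set" assume A: "A \<in> sets lborel"
      have "(LINT x:A|lborel. h' x) = (LINT x:A|lebesgue. h' x)"
        unfolding set_lebesgue_integral_def
        by (rule integral_completion[symmetric]) (use A h'(1) in measurable)
      also have "\<dots> = (LINT x:A|lebesgue. h x)"
        by (rule set_lint_cong_AE) (use ae in auto)
      also have "\<dots> = 0"
        using borel0 A sets_G by auto
      finally show "(LINT x:A|lborel. h' x) = (LINT x:A|lborel. 0)"
        by (simp add: set_lebesgue_integral_def)
    qed auto
    then have "AE x in lebesgue. h' x = 0"
      by (rule AE_completion)
    then show ?thesis
      using ae by eventually_elim (auto simp: h_def)
  qed
  define B where "B = {ball c r |c r. r > 0 \<and> cball c r \<subseteq> S}"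
  obtain B' where B': "B' \<subseteq> B" "countable B'" "\<Union>B' = \<Union>B"
    using Lindelof[of B] unfolding B_def by auto
  have "S \<subseteq> \<Union>B"
  proof
    fix x assume "x \<in> S"
    then obtain r where "r > 0" "cball x r \<subseteq> S"
      using assms(1) open_contains_cball by blast
    then show "x \<in> \<Union>B" unfolding B_def by (auto intro!: exI[of _ "ball x r"])
  qed
  moreover have "AE x in lebesgue. \<forall>U\<in>B'. x \<in> U \<longrightarrow> g x = 0"
    using B'(1) local unfolding B_def by (intro AE_ball_countable'[OF _ B'(2)]) auto
  ultimately show ?thesis
    using B'(3) by (auto elim!: eventually_mono)
qed

lemma fundamental_lemma:
  fixes g :: "'a::euclidean_space \<Rightarrow> 'b::euclidean_space"
  assumes "open S"
    and loc: "\<And>C. compact C \<Longrightarrow> C \<subseteq> S \<Longrightarrow> set_integrable lebesgue C g"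
    and zero: "\<And>\<psi> \<psi>'. test_function S \<psi> \<psi>' \<Longrightarrow> (LINT x:S|lebesgue. \<psi> x *\<^sub>R g x) = 0"
  shows "AE x in lebesgue. x \<in> S \<longrightarrow> g x = 0"
proof -
  have "AE x in lebesgue. x \<in> S \<longrightarrow> g x \<bullet> b = 0" for b
  proof (rule fundamental_lemma_real[OF assms(1)])
    show "set_integrable lebesgue C (\<lambda>x. g x \<bullet> b)" if "compact C" "C \<subseteq> S" for C
      using integrable_inner_left[of b, OF loc[OF that, unfolded set_integrable_def]]
      unfolding set_integrable_def by simp
    fix \<psi> \<psi>' assume tf: "test_function S \<psi> \<psi>'"
    obtain C where C: "compact C" "C \<subseteq> S" "\<And>x. x \<notin> C \<Longrightarrow> \<psi> x = 0"
      using test_functionE[OF tf] by metis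
    obtain M where M: "\<And>x. norm (\<psi> x) \<le> M"
      using compact_support_bounded[OF C(1) test_functionD(3)[OF tf] C(3)] by metis
    have "set_integrable lebesgue C (\<lambda>x. \<psi> x *\<^sub>R g x)"
      by (rule set_integrable_scaleR_bounded[OF loc[OF C(1,2)], of _ M])
        (use M test_functionD(3)[OF tf] in \<open>auto intro: continuous_borel_measurable_lebesgue\<close>)
    also have "?this \<longleftrightarrow> set_integrable lebesgue S (\<lambda>x. \<psi> x *\<^sub>R g x)"
      by (rule set_integrable_supported) (use C in auto)
    finally have "(LINT x|lebesgue. (indicator S x *\<^sub>R \<psi> x *\<^sub>R g x) \<bullet> b) = (LINT x:S|lebesgue. \<psi> x *\<^sub>R g x) \<bullet> b"
      unfolding set_integrable_def set_lebesgue_integral_def by (intro integral_inner_left) auto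
    then show "(LINT x:S|lebesgue. \<psi> x * (g x \<bullet> b)) = 0"
      using zero[OF tf] unfolding set_lebesgue_integral_def by (simp del: scaleR_scaleR)
  qed
  then have "AE x in lebesgue. \<forall>b\<in>Basis. x \<in> S \<longrightarrow> g x \<bullet> b = 0"
    by (intro AE_finite_allI) auto
  then show ?thesis
    by eventually_elim (simp add: euclidean_all_zero_iff)
qed

section \<open>Weak gradients\<close>

lemma has_weak_grad_loc:
  assumes "has_weak_grad S f g" "compact C" "C \<subseteq> S"
  shows "set_integrable lebesgue C f" "set_integrable lebesgue C g"
  using assms unfolding has_weak_grad_def by auto

lemma has_weak_gradD:
  assumes "has_weak_grad S f g" "test_function S \<psi> \<psi>'"
  shows "(LINT x:S|lebesgue. f x *\<^sub>R \<psi>' x) = - (LINT x:S|lebesgue. \<psi> x *\<^sub>R g x)"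
  using assms unfolding has_weak_grad_def by auto

lemma set_integrable_test_function_scaleR:
  fixes g :: "'a::euclidean_space \<Rightarrow> 'b::euclidean_space"
  assumes "test_function S \<psi> \<psi>'" "\<And>C. compact C \<Longrightarrow> C \<subseteq> S \<Longrightarrow> set_integrable lebesgue C g"
  shows "set_integrable lebesgue S (\<lambda>x. \<psi> x *\<^sub>R g x)"
proof -
  obtain C where C: "compact C" "C \<subseteq> S" "\<And>x. x \<notin> C \<Longrightarrow> \<psi> x = 0"
    using test_functionE[OF assms(1)] by metis
  obtain M where M: "\<And>x. norm (\<psi> x) \<le> M"
    using compact_support_bounded[OF C(1) test_functionD(3)[OF assms(1)] C(3)] by metis
  have "set_integrable lebesgue C (\<lambda>x. \<psi> x *\<^sub>R g x)"
    by (rule set_integrable_scaleR_bounded[OF assms(2)[OF C(1,2)], of _ M])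
      (use M test_functionD(3)[OF assms(1)] in \<open>auto intro: continuous_borel_measurable_lebesgue\<close>)
  also have "?this \<longleftrightarrow> set_integrable lebesgue S (\<lambda>x. \<psi> x *\<^sub>R g x)"
    by (rule set_integrable_supported) (use C in auto)
  finally show ?thesis .
qed

text \<open>The difference of two weak gradients is orthogonal to every test function. As
  \<open>weak_grad\<close> selects an arbitrary representative, this is what turns an explicitly
  computed gradient into a statement about \<open>weak_grad\<close>, \<open>grad_h\<close> and
  \<open>jac_h\<close>.\<close>

lemma has_weak_grad_unique:
  assumes "open S" "has_weak_grad S f g" "has_weak_grad S f g'"
  shows "AE x in lebesgue. x \<in> S \<longrightarrow> g x = g' x"
proof -
  have "AE x in lebesgue. x \<in> S \<longrightarrow> g x - g' x = 0"
  proof (rule fundamental_lemma[OF assms(1)])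
    show "set_integrable lebesgue C (\<lambda>x. g x - g' x)" if "compact C" "C \<subseteq> S" for C
      using has_weak_grad_loc[OF assms(2) that] has_weak_grad_loc[OF assms(3) that] by auto
    fix \<psi> \<psi>' assume tf: "test_function S \<psi> \<psi>'"
    have "(LINT x:S|lebesgue. \<psi> x *\<^sub>R g x - \<psi> x *\<^sub>R g' x) =
        (LINT x:S|lebesgue. \<psi> x *\<^sub>R g x) - (LINT x:S|lebesgue. \<psi> x *\<^sub>R g' x)"
      using set_integrable_test_function_scaleR[OF tf] has_weak_grad_loc(2) assms(2,3)
      by (intro set_integral_diff(2)) blast+
    also have "\<dots> = 0"
      using has_weak_gradD[OF assms(2) tf] has_weak_gradD[OF assms(3) tf] by simp
    finally show "(LINT x:S|lebesgue. \<psi> x *\<^sub>R (g x - g' x)) = 0"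
      by (simp add: scaleR_diff_right)
  qed
  then show ?thesis by eventually_elim simp
qed

lemma has_weak_grad_weak_grad:
  assumes "has_weak_grad S f g"
  shows "has_weak_grad S f (weak_grad S f)"
  unfolding weak_grad_def using assms by (rule someI[of "has_weak_grad S f" g])

lemma weak_grad_AE_eq:
  assumes "open S" "has_weak_grad S f g"
  shows "AE x in lebesgue. x \<in> S \<longrightarrow> weak_grad S f x = g x"
  using has_weak_grad_unique[OF assms(1) has_weak_grad_weak_grad[OF assms(2)] assms(2)] .

text \<open>Test functions are defined on the whole space, so one for \<open>T\<close> is one for
  \<open>S\<close>, and only the domain of integration is enlarged across points where it
  vanishes.\<close>

lemma has_weak_grad_mono:
  assumes "has_weak_grad S f g" "T \<subseteq> S"
  shows "has_weak_grad T f g"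
  unfolding has_weak_grad_def
proof (intro conjI allI impI)
  fix C assume "compact C \<and> C \<subseteq> T"
  then show "set_integrable lebesgue C f" "set_integrable lebesgue C g"
    using has_weak_grad_loc[OF assms(1), of C] assms(2) by auto
next
  fix \<psi> \<psi>' assume tf: "test_function T \<psi> \<psi>'"
  obtain C where C: "compact C" "C \<subseteq> T" "\<And>x. x \<notin> C \<Longrightarrow> \<psi> x = 0" "\<And>x. x \<notin> C \<Longrightarrow> \<psi>' x = 0"
    using test_functionE[OF tf] by metis
  have "(LINT x:T|lebesgue. f x *\<^sub>R \<psi>' x) = (LINT x:S|lebesgue. f x *\<^sub>R \<psi>' x)"
    "(LINT x:T|lebesgue. \<psi> x *\<^sub>R g x) = (LINT x:S|lebesgue. \<psi> x *\<^sub>R g x)"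
    by (rule set_lint_supported; use C assms(2) in auto)+
  then show "(LINT x:T|lebesgue. f x *\<^sub>R \<psi>' x) = - (LINT x:T|lebesgue. \<psi> x *\<^sub>R g x)"
    using has_weak_gradD[OF assms(1) test_function_mono[OF tf assms(2)]] by simp
qed

lemma has_weak_grad_cong_AE:
  assumes "has_weak_grad S f g"
    "AE x in lebesgue. x \<in> S \<longrightarrow> f x = f' x" "AE x in lebesgue. x \<in> S \<longrightarrow> g x = g' x"
  shows "has_weak_grad S f' g'"
  unfolding has_weak_grad_def
proof (intro conjI allI impI)
  fix C assume "compact C \<and> C \<subseteq> S"
  then have C: "compact C" "C \<subseteq> S" by auto
  show "set_integrable lebesgue C f'"
    by (rule set_integrable_lebesgue_cong_AE[OF _ has_weak_grad_loc(1)[OF assms(1) C]])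
      (use assms(2) C in \<open>auto elim!: eventually_mono\<close>)
  show "set_integrable lebesgue C g'"
    by (rule set_integrable_lebesgue_cong_AE[OF _ has_weak_grad_loc(2)[OF assms(1) C]])
      (use assms(3) C in \<open>auto elim!: eventually_mono\<close>)
next
  fix \<psi> \<psi>' assume tf: "test_function S \<psi> \<psi>'"
  have "(LINT x:S|lebesgue. f x *\<^sub>R \<psi>' x) = (LINT x:S|lebesgue. f' x *\<^sub>R \<psi>' x)"
    by (rule set_lint_cong_AE) (use assms(2) in \<open>auto elim!: eventually_mono\<close>)
  moreover have "(LINT x:S|lebesgue. \<psi> x *\<^sub>R g x) = (LINT x:S|lebesgue. \<psi> x *\<^sub>R g' x)"
    by (rule set_lint_cong_AE) (use assms(3) in \<open>auto elim!: eventually_mono\<close>)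
  ultimately show "(LINT x:S|lebesgue. f' x *\<^sub>R \<psi>' x) = - (LINT x:S|lebesgue. \<psi> x *\<^sub>R g' x)"
    using has_weak_gradD[OF assms(1) tf] by simp
qed

section \<open>Square integrable functions and convergence of products\<close>

lemma set_lint_lebesgue_on:
  fixes f :: "'a::euclidean_space \<Rightarrow> 'b::euclidean_space"
  assumes "S \<in> sets lebesgue"
  shows "(LINT x:S|lebesgue. f x) = integral\<^sup>L (lebesgue_on S) f"
  unfolding set_lebesgue_integral_def using assms by (subst integral_restrict_space) auto

lemma set_integrable_lebesgue_on:
  fixes f :: "'a::euclidean_space \<Rightarrow> 'b::euclidean_space"
  assumes "S \<in> sets lebesgue"
  shows "set_integrable lebesgue S f \<longleftrightarrow> integrable (lebesgue_on S) f"
  unfolding set_integrable_def using assms by (subst integrable_restrict_space) auto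

lemma integrable_square_diff:
  fixes f g :: "'a \<Rightarrow> 'b::euclidean_space"
  assumes [measurable]: "f \<in> borel_measurable M" "g \<in> borel_measurable M"
    and "integrable M (\<lambda>x. (norm (f x))\<^sup>2)" "integrable M (\<lambda>x. (norm (g x))\<^sup>2)"
  shows "integrable M (\<lambda>x. (norm (f x - g x))\<^sup>2)"
proof (rule Bochner_Integration.integrable_bound)
  show "integrable M (\<lambda>x. 2 * (norm (f x))\<^sup>2 + 2 * (norm (g x))\<^sup>2)"
    using assms by auto
  have "(norm (f x - g x))\<^sup>2 \<le> 2 * (norm (f x))\<^sup>2 + 2 * (norm (g x))\<^sup>2" for x
  proof -
    have "(norm (f x - g x))\<^sup>2 \<le> (norm (f x) + norm (g x))\<^sup>2"
      by (intro power_mono norm_triangle_ineq4) auto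
    also have "\<dots> \<le> 2 * (norm (f x))\<^sup>2 + 2 * (norm (g x))\<^sup>2"
      using sum_squares_bound[of "norm (f x)" "norm (g x)"] by (simp add: power2_sum)
    finally show ?thesis .
  qed
  then show "AE x in M. norm ((norm (f x - g x))\<^sup>2) \<le> norm (2 * (norm (f x))\<^sup>2 + 2 * (norm (g x))\<^sup>2)"
    by (intro AE_I2) auto
qed measurable

lemma integrable_mult_of_squares:
  fixes f g :: "'a \<Rightarrow> real"
  assumes [measurable]: "f \<in> borel_measurable M" "g \<in> borel_measurable M"
    and "integrable M (\<lambda>x. (f x)\<^sup>2)" "integrable M (\<lambda>x. (g x)\<^sup>2)"
  shows "integrable M (\<lambda>x. f x * g x)"
proof (rule Bochner_Integration.integrable_bound)
  show "integrable M (\<lambda>x. (f x)\<^sup>2 + (g x)\<^sup>2)"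
    using assms by auto
  have "\<bar>f x * g x\<bar> \<le> (f x)\<^sup>2 + (g x)\<^sup>2" for x
  proof -
    have "2 * \<bar>f x\<bar> * \<bar>g x\<bar> \<le> (f x)\<^sup>2 + (g x)\<^sup>2"
      using sum_squares_bound[of "\<bar>f x\<bar>" "\<bar>g x\<bar>"] by simp
    moreover have "0 \<le> \<bar>f x\<bar> * \<bar>g x\<bar>" by simp
    ultimately show ?thesis unfolding abs_mult by linarith
  qed
  then show "AE x in M. norm (f x * g x) \<le> norm ((f x)\<^sup>2 + (g x)\<^sup>2)"
    by (intro AE_I2) auto
qed measurable

text \<open>The quadratic polynomial \<integral> (|f| - t |g|)^2 in t is nonnegative, so its
  discriminant is not positive.\<close>

lemma Cauchy_Schwarz_integral_abs:
  fixes f g :: "'a \<Rightarrow> real"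
  assumes meas: "f \<in> borel_measurable M" "g \<in> borel_measurable M"
    and sq: "integrable M (\<lambda>x. (f x)\<^sup>2)" "integrable M (\<lambda>x. (g x)\<^sup>2)"
  shows "(LINT x|M. \<bar>f x * g x\<bar>) \<le> sqrt (LINT x|M. (f x)\<^sup>2) * sqrt (LINT x|M. (g x)\<^sup>2)"
proof -
  define P W H where "P = (LINT x|M. \<bar>f x * g x\<bar>)" and "W = (LINT x|M. (f x)\<^sup>2)" and "H = (LINT x|M. (g x)\<^sup>2)"
  have int: "integrable M (\<lambda>x. \<bar>f x * g x\<bar>)"
    using integrable_mult_of_squares[OF meas sq] by (rule integrable_abs)
  have "0 \<le> (LINT x|M. (\<bar>f x\<bar> - t * \<bar>g x\<bar>)\<^sup>2)" for t
    by (rule integral_nonneg_AE) auto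
  also have "(LINT x|M. (\<bar>f x\<bar> - t * \<bar>g x\<bar>)\<^sup>2) = (LINT x|M. (f x)\<^sup>2 + t\<^sup>2 * (g x)\<^sup>2 - 2 * t * \<bar>f x * g x\<bar>)" for t
    by (intro Bochner_Integration.integral_cong) (auto simp: power2_diff power_mult_distrib abs_mult)
  also have "\<dots> t = W + t\<^sup>2 * H - 2 * t * P" for t
    unfolding P_def W_def H_def using sq int by simp
  finally have quad: "0 \<le> W + t\<^sup>2 * H - 2 * t * P" for t .
  have nn: "0 \<le> W" "0 \<le> H" "0 \<le> P"
    unfolding W_def H_def P_def by (auto intro!: integral_nonneg_AE)
  have "P\<^sup>2 \<le> W * H"
  proof (cases "H = 0")
    case True
    have "P = 0"
    proof (rule ccontr)
      assume "P \<noteq> 0"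
      then have "P > 0" using nn by simp
      \<comment> \<open>With H = 0 the quadratic takes the value -W - 2 at this t.\<close>
      then show False using quad[of "(W + 1) / P"] True nn by simp
    qed
    then show ?thesis using nn by simp
  next
    case False
    then have "H > 0" using nn by simp
    then show ?thesis using quad[of "P / H"] by (simp add: field_simps power2_eq_square)
  qed
  then have "P \<le> sqrt (W * H)"
    using real_le_rsqrt by blast
  then show ?thesis
    unfolding P_def W_def H_def by (simp add: real_sqrt_mult)
qed

text \<open>The error ab - a'b' splits into (a - a')(b - b') + (a - a')b' + a'(b - b'), and
  Cauchy-Schwarz applies to each term. This is how the product rule for squares survives the passage
  to the limit.\<close>

lemma L2_tendsto_mult_L1:
  fixes a b :: "nat \<Rightarrow> 'a \<Rightarrow> real"
  assumes meas: "\<And>k. a k \<in> borel_measurable M" "\<And>k. b k \<in> borel_measurable M"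
      "a' \<in> borel_measurable M" "b' \<in> borel_measurable M"
    and sq: "\<And>k. integrable M (\<lambda>x. (a k x - a' x)\<^sup>2)" "\<And>k. integrable M (\<lambda>x. (b k x - b' x)\<^sup>2)"
      "integrable M (\<lambda>x. (a' x)\<^sup>2)" "integrable M (\<lambda>x. (b' x)\<^sup>2)"
    and lim: "(\<lambda>k. LINT x|M. (a k x - a' x)\<^sup>2) \<longlonglongrightarrow> 0" "(\<lambda>k. LINT x|M. (b k x - b' x)\<^sup>2) \<longlonglongrightarrow> 0"
  shows "(\<lambda>k. LINT x|M. \<bar>a k x * b k x - a' x * b' x\<bar>) \<longlonglongrightarrow> 0"
    and "integrable M (\<lambda>x. a k x * b k x)" "integrable M (\<lambda>x. a' x * b' x)"
proof -
  note [measurable] = meas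
  note m = integrable_mult_of_squares
  have i: "integrable M (\<lambda>x. (a k x - a' x) * (b k x - b' x))" "integrable M (\<lambda>x. (a k x - a' x) * b' x)"
    "integrable M (\<lambda>x. a' x * (b k x - b' x))" "integrable M (\<lambda>x. a' x * b' x)" for k
    by (intro m sq; measurable)+
  then show "integrable M (\<lambda>x. a' x * b' x)" by blast
  have eq: "a k x * b k x = (a k x - a' x) * (b k x - b' x) + (a k x - a' x) * b' x + a' x * (b k x - b' x) + a' x * b' x" for k x
    by (simp add: algebra_simps)
  have iab: "integrable M (\<lambda>x. a k x * b k x)" for k
    unfolding eq using i by (intro Bochner_Integration.integrable_add)
  then show "integrable M (\<lambda>x. a k x * b k x)" by blast
  let ?A = "\<lambda>k. sqrt (LINT x|M. (a k x - a' x)\<^sup>2)" and ?B = "\<lambda>k. sqrt (LINT x|M. (b k x - b' x)\<^sup>2)"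
  have bound: "(LINT x|M. \<bar>a k x * b k x - a' x * b' x\<bar>) \<le> ?A k * ?B k + ?A k * sqrt (LINT x|M. (b' x)\<^sup>2) + sqrt (LINT x|M. (a' x)\<^sup>2) * ?B k" for k
  proof -
    have "(LINT x|M. \<bar>a k x * b k x - a' x * b' x\<bar>) \<le>
      (LINT x|M. \<bar>(a k x - a' x) * (b k x - b' x)\<bar> + \<bar>(a k x - a' x) * b' x\<bar> + \<bar>a' x * (b k x - b' x)\<bar>)"
    proof (rule integral_mono)
      show "integrable M (\<lambda>x. \<bar>a k x * b k x - a' x * b' x\<bar>)"
        using iab i(4) by auto
      show "integrable M (\<lambda>x. \<bar>(a k x - a' x) * (b k x - b' x)\<bar> + \<bar>(a k x - a' x) * b' x\<bar> + \<bar>a' x * (b k x - b' x)\<bar>)"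
        using i by (intro Bochner_Integration.integrable_add integrable_abs)
      show "\<bar>a k x * b k x - a' x * b' x\<bar> \<le> \<bar>(a k x - a' x) * (b k x - b' x)\<bar> + \<bar>(a k x - a' x) * b' x\<bar> + \<bar>a' x * (b k x - b' x)\<bar>" for x
        using eq[of k x] by linarith
    qed
    also have "\<dots> = (LINT x|M. \<bar>(a k x - a' x) * (b k x - b' x)\<bar>) + (LINT x|M. \<bar>(a k x - a' x) * b' x\<bar>) + (LINT x|M. \<bar>a' x * (b k x - b' x)\<bar>)"
      using i by (subst Bochner_Integration.integral_add; (intro Bochner_Integration.integrable_add integrable_abs)?; simp)+
    also have "\<dots> \<le> ?A k * ?B k + ?A k * sqrt (LINT x|M. (b' x)\<^sup>2) + sqrt (LINT x|M. (a' x)\<^sup>2) * ?B k"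
      by (intro add_mono Cauchy_Schwarz_integral_abs sq; measurable)
    finally show ?thesis .
  qed
  have A: "?A \<longlonglongrightarrow> 0" "?B \<longlonglongrightarrow> 0"
    using tendsto_real_sqrt[OF lim(1)] tendsto_real_sqrt[OF lim(2)] by simp_all
  show "(\<lambda>k. LINT x|M. \<bar>a k x * b k x - a' x * b' x\<bar>) \<longlonglongrightarrow> 0"
  proof (rule Lim_null_comparison)
    show "\<forall>\<^sub>F k in sequentially. norm (LINT x|M. \<bar>a k x * b k x - a' x * b' x\<bar>) \<le> ?A k * ?B k + ?A k * sqrt (LINT x|M. (b' x)\<^sup>2) + sqrt (LINT x|M. (a' x)\<^sup>2) * ?B k"
      using bound by (intro always_eventually allI) (subst real_norm_def, subst abs_of_nonneg, auto intro: integral_nonneg_AE)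
    show "(\<lambda>k. ?A k * ?B k + ?A k * sqrt (LINT x|M. (b' x)\<^sup>2) + sqrt (LINT x|M. (a' x)\<^sup>2) * ?B k) \<longlonglongrightarrow> 0"
      by (intro tendsto_add_zero tendsto_mult_zero A tendsto_mult_left_zero tendsto_mult_right_zero)
  qed
qed

lemma L1_tendsto_weighted:
  fixes F :: "nat \<Rightarrow> 'a \<Rightarrow> real"
  assumes "\<And>k. integrable M (F k)" "integrable M F'"
    and "(\<lambda>k. LINT x|M. \<bar>F k x - F' x\<bar>) \<longlonglongrightarrow> 0"
    and w: "w \<in> borel_measurable M" "\<And>x. \<bar>w x\<bar> \<le> B"
  shows "(\<lambda>k. LINT x|M. F k x * w x) \<longlonglongrightarrow> (LINT x|M. F' x * w x)"
proof -
  have i: "integrable M (\<lambda>x. f x * w x)" if "integrable M f" for f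
  proof (rule Bochner_Integration.integrable_bound[of M "\<lambda>x. B * f x"])
    show "AE x in M. norm (f x * w x) \<le> norm (B * f x)"
    proof (rule AE_I2)
      fix x
      have "\<bar>f x\<bar> * \<bar>w x\<bar> \<le> \<bar>f x\<bar> * \<bar>B\<bar>"
        using w(2)[of x] by (intro mult_left_mono) auto
      then show "norm (f x * w x) \<le> norm (B * f x)"
        by (simp add: abs_mult mult.commute)
    qed
  qed (use that w(1) borel_measurable_integrable[OF that] in auto)
  have "(\<lambda>k. (LINT x|M. F' x * w x) - (LINT x|M. F k x * w x)) \<longlonglongrightarrow> 0"
  proof (rule Lim_null_comparison)
    show "(\<lambda>k. B * (LINT x|M. \<bar>F k x - F' x\<bar>)) \<longlonglongrightarrow> 0"
      using tendsto_mult_right_zero[OF assms(3)] by simp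
    show "\<forall>\<^sub>F k in sequentially. norm ((LINT x|M. F' x * w x) - (LINT x|M. F k x * w x)) \<le> B * (LINT x|M. \<bar>F k x - F' x\<bar>)"
    proof (intro always_eventually allI)
      fix k
      have "(LINT x|M. F' x * w x) - (LINT x|M. F k x * w x) = (LINT x|M. (F' x - F k x) * w x)"
        using Bochner_Integration.integral_diff[OF i[OF assms(2)] i[OF assms(1)[of k]]]
        by (simp add: left_diff_distrib)
      also have "norm \<dots> \<le> (LINT x|M. norm ((F' x - F k x) * w x))"
        by (rule integral_norm_bound)
      also have "\<dots> \<le> (LINT x|M. B * \<bar>F k x - F' x\<bar>)"
      proof (rule integral_mono)
        show "integrable M (\<lambda>x. norm ((F' x - F k x) * w x))"
          using assms(1,2) by (intro integrable_norm i) auto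
        show "integrable M (\<lambda>x. B * \<bar>F k x - F' x\<bar>)"
          using assms(1,2) by auto
        show "norm ((F' x - F k x) * w x) \<le> B * \<bar>F k x - F' x\<bar>" for x
          using mult_left_mono[OF w(2)[of x], of "\<bar>F k x - F' x\<bar>"]
          by (simp add: abs_mult mult.commute abs_minus_commute)
      qed
      finally show "norm ((LINT x|M. F' x * w x) - (LINT x|M. F k x * w x)) \<le> B * (LINT x|M. \<bar>F k x - F' x\<bar>)"
        by simp
    qed
  qed
  from tendsto_diff[OF tendsto_const[of "LINT x|M. F' x * w x"] this] show ?thesis
    by simp
qed

section \<open>Gradients of explicit functions, sums and gluing\<close>

lemma gderiv_directional:
  fixes f :: "'a::euclidean_space \<Rightarrow> real"
  assumes "GDERIV f x :> D"
  shows "((\<lambda>t. (f (x + t *\<^sub>R v) - f x) / t) \<longlongrightarrow> D \<bullet> v) (at 0)"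
proof -
  have 1: "((\<lambda>s. x + s *\<^sub>R v) has_derivative (\<lambda>s. s *\<^sub>R v)) (at 0)"
    by (auto intro!: derivative_eq_intros)
  have 2: "(f has_derivative (\<lambda>h. h \<bullet> D)) (at (x + 0 *\<^sub>R v))"
    using assms unfolding gderiv_def by simp
  have "((\<lambda>s. f (x + s *\<^sub>R v)) has_derivative (\<lambda>s. (s *\<^sub>R v) \<bullet> D)) (at 0)"
    by (rule has_derivative_compose[OF 1 2])
  then have "((\<lambda>s. f (x + s *\<^sub>R v)) has_real_derivative (D \<bullet> v)) (at 0)"
    unfolding has_field_derivative_def
    by (rule has_derivative_eq_rhs) (rule ext, simp add: inner_commute[of v])
  then show ?thesis
    unfolding DERIV_def by simp
qed

text \<open>Integration by parts is available direction by direction; the vector identity follows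
  from its inner products with basis vectors once both vector integrals are known to exist.\<close>

lemma has_weak_gradI_directional:
  fixes f :: "'a::euclidean_space \<Rightarrow> real"
  assumes loc: "\<And>C. compact C \<Longrightarrow> C \<subseteq> S \<Longrightarrow> set_integrable lebesgue C f"
      "\<And>C. compact C \<Longrightarrow> C \<subseteq> S \<Longrightarrow> set_integrable lebesgue C g"
    and eq: "\<And>\<psi> \<psi>' v. test_function S \<psi> \<psi>' \<Longrightarrow>
      (LINT x:S|lebesgue. f x * (\<psi>' x \<bullet> v)) = - (LINT x:S|lebesgue. \<psi> x * (g x \<bullet> v))"
  shows "has_weak_grad S f g"
  unfolding has_weak_grad_def
proof (intro conjI allI impI)
  fix \<psi> \<psi>' assume tf: "test_function S \<psi> \<psi>'"
  have i1: "set_integrable lebesgue S (\<lambda>x. \<psi> x *\<^sub>R g x)"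
    by (rule set_integrable_test_function_scaleR[OF tf loc(2)])
  obtain C where C: "compact C" "C \<subseteq> S" "\<And>x. x \<notin> C \<Longrightarrow> \<psi> x = 0" "\<And>x. x \<notin> C \<Longrightarrow> \<psi>' x = 0"
    using test_functionE[OF tf] by metis
  obtain B where B: "\<And>x. norm (\<psi>' x) \<le> B"
    using compact_support_bounded[OF C(1) test_functionD(2)[OF tf] C(4)] by metis
  have "set_integrable lebesgue C (\<lambda>x. f x *\<^sub>R \<psi>' x)"
  proof -
    have "integrable lebesgue (\<lambda>x. (indicator C x * f x) *\<^sub>R \<psi>' x)"
    proof (rule Bochner_Integration.integrable_bound)
      have "integrable lebesgue (\<lambda>x. indicator C x * f x)"
        using loc(1)[OF C(1,2)] unfolding set_integrable_def by simp
      then show "integrable lebesgue (\<lambda>x. B * (indicator C x * f x))"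
        "(\<lambda>x. (indicator C x * f x) *\<^sub>R \<psi>' x) \<in> borel_measurable lebesgue"
        using continuous_borel_measurable_lebesgue[OF test_functionD(2)[OF tf]]
        by (auto intro: borel_measurable_scaleR dest: borel_measurable_integrable)
      have "norm ((indicator C x * f x) *\<^sub>R \<psi>' x) \<le> norm (B * (indicator C x * f x))" for x
        using mult_left_mono[OF order_trans[OF B[of x] abs_ge_self], of "\<bar>indicator C x * f x\<bar>"]
        by (simp add: abs_mult mult_ac)
      then show "AE x in lebesgue. norm ((indicator C x * f x) *\<^sub>R \<psi>' x) \<le> norm (B * (indicator C x * f x))"
        by blast
    qed
    then show ?thesis unfolding set_integrable_def by simp
  qed
  also have "?this \<longleftrightarrow> set_integrable lebesgue S (\<lambda>x. f x *\<^sub>R \<psi>' x)"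
    by (rule set_integrable_supported) (use C in auto)
  finally have i2: "set_integrable lebesgue S (\<lambda>x. f x *\<^sub>R \<psi>' x)" .
  show "(LINT x:S|lebesgue. f x *\<^sub>R \<psi>' x) = - (LINT x:S|lebesgue. \<psi> x *\<^sub>R g x)"
  proof (rule euclidean_eqI)
    fix v :: 'a assume "v \<in> Basis"
    have "(LINT x:S|lebesgue. f x *\<^sub>R \<psi>' x) \<bullet> v = (LINT x:S|lebesgue. f x * (\<psi>' x \<bullet> v))"
      using integral_inner_left[OF i2[unfolded set_integrable_def], of v]
      unfolding set_lebesgue_integral_def by (simp del: scaleR_scaleR)
    moreover have "(LINT x:S|lebesgue. \<psi> x *\<^sub>R g x) \<bullet> v = (LINT x:S|lebesgue. \<psi> x * (g x \<bullet> v))"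
      using integral_inner_left[OF i1[unfolded set_integrable_def], of v]
      unfolding set_lebesgue_integral_def by (simp del: scaleR_scaleR)
    ultimately show "(LINT x:S|lebesgue. f x *\<^sub>R \<psi>' x) \<bullet> v = (- (LINT x:S|lebesgue. \<psi> x *\<^sub>R g x)) \<bullet> v"
      using eq[OF tf] by (simp add: inner_minus_left)
  qed
qed (use loc in auto)

text \<open>Classical derivatives of a Lipschitz function are weak ones by
  \<open>integration_by_parts_lipschitz\<close>. Test functions and affine functions are the two
  instances.\<close>

lemma has_weak_grad_lipschitz:
  fixes f :: "'a::euclidean_space \<Rightarrow> real"
  assumes lip: "\<And>x y. \<bar>f x - f y\<bar> \<le> L * norm (x - y)"
    and der: "\<And>x v. ((\<lambda>t. (f (x + t *\<^sub>R v) - f x) / t) \<longlongrightarrow> g x \<bullet> v) (at 0)"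
    and cont: "continuous_on UNIV f" "continuous_on UNIV g"
  shows "has_weak_grad S f g"
proof (rule has_weak_gradI_directional)
  show "set_integrable lebesgue C f" "set_integrable lebesgue C g" if "compact C" for C
    using set_integrable_continuous_compact[OF that _ subset_refl] cont that
      continuous_on_subset[OF _ subset_UNIV] lmeasurable_compact[OF that] by auto
  fix \<psi> \<psi>' v assume tf: "test_function S \<psi> \<psi>'"
  obtain C where C: "compact C" "C \<subseteq> S" "\<And>x. x \<notin> C \<Longrightarrow> \<psi> x = 0" "\<And>x. x \<notin> C \<Longrightarrow> \<psi>' x = 0"
    using test_functionE[OF tf] by metis
  have off: "\<psi> x = 0" "\<psi>' x = 0" if "x \<notin> S" for x
    using C that by blast+
  have "(LINT x:S|lebesgue. f x * (\<psi>' x \<bullet> v)) = (LINT x:UNIV|lebesgue. f x * (\<psi>' x \<bullet> v))"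
    by (rule set_lint_supported) (use off in auto)
  moreover have "(LINT x:S|lebesgue. \<psi> x * (g x \<bullet> v)) = (LINT x:UNIV|lebesgue. \<psi> x * (g x \<bullet> v))"
    by (rule set_lint_supported) (use off in auto)
  moreover have "(LINT x|lebesgue. (\<psi>' x \<bullet> v) * f x) = - (LINT x|lebesgue. \<psi> x * (g x \<bullet> v))"
    using integration_by_parts_lipschitz[OF tf lip, of v "\<lambda>x. g x \<bullet> v"] der by auto
  ultimately show "(LINT x:S|lebesgue. f x * (\<psi>' x \<bullet> v)) = - (LINT x:S|lebesgue. \<psi> x * (g x \<bullet> v))"
    by (simp add: set_lebesgue_integral_def mult.commute)
qed

lemma has_weak_grad_test_function:
  assumes "test_function T \<psi> \<psi>'"
  shows "has_weak_grad S \<psi> \<psi>'"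
proof -
  obtain B where "\<And>x y. \<bar>\<psi> x - \<psi> y\<bar> \<le> B * norm (x - y)"
    using test_function_lipschitz[OF assms] by metis
  then show ?thesis
    using has_weak_grad_lipschitz[of \<psi> B \<psi>' S] gderiv_directional test_functionD[OF assms] by blast
qed

lemma has_weak_grad_affine:
  fixes a :: "'a::euclidean_space"
  shows "has_weak_grad S (\<lambda>x. a \<bullet> x + b) (\<lambda>_. a)"
proof (rule has_weak_grad_lipschitz[of _ "norm a"])
  show "\<bar>a \<bullet> x + b - (a \<bullet> y + b)\<bar> \<le> norm a * norm (x - y)" for x y
    using Cauchy_Schwarz_ineq2[of a "x - y"] by (simp add: inner_diff_right)
  have "(a \<bullet> (x + t *\<^sub>R v) + b - (a \<bullet> x + b)) / t = a \<bullet> v" if "t \<noteq> 0" for x v and t :: real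
    using that by (simp add: inner_add_right)
  then show "((\<lambda>t. (a \<bullet> (x + t *\<^sub>R v) + b - (a \<bullet> x + b)) / t) \<longlongrightarrow> a \<bullet> v) (at 0)" for x v
    by (intro tendsto_eventually) (auto simp: eventually_at_filter)
qed (auto intro!: continuous_intros)

lemma has_weak_grad_scale:
  assumes "has_weak_grad S f g"
  shows "has_weak_grad S (\<lambda>x. c * f x) (\<lambda>x. c *\<^sub>R g x)"
  unfolding has_weak_grad_def
proof (intro conjI allI impI)
  fix C assume "compact C \<and> C \<subseteq> S"
  then show "set_integrable lebesgue C (\<lambda>x. c * f x)" "set_integrable lebesgue C (\<lambda>x. c *\<^sub>R g x)"
    using has_weak_grad_loc[OF assms, of C] by auto
next
  fix \<psi> \<psi>' assume "test_function S \<psi> \<psi>'"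
  from has_weak_gradD[OF assms this]
  have "c *\<^sub>R (LINT x:S|lebesgue. f x *\<^sub>R \<psi>' x) = - (c *\<^sub>R (LINT x:S|lebesgue. \<psi> x *\<^sub>R g x))"
    by simp
  then show "(LINT x:S|lebesgue. (c * f x) *\<^sub>R \<psi>' x) = - (LINT x:S|lebesgue. \<psi> x *\<^sub>R c *\<^sub>R g x)"
    unfolding set_lebesgue_integral_def integral_scaleR_right[symmetric]
    by (simp add: mult_ac)
qed

text \<open>Most of the proof secures integrability: the Lebesgue integral is additive only on
  integrable functions, and \<open>has_weak_grad\<close> grants integrability on compact sets
  alone.\<close>

lemma has_weak_grad_add:
  assumes "has_weak_grad S f g" "has_weak_grad S f' g'"
  shows "has_weak_grad S (\<lambda>x. f x + f' x) (\<lambda>x. g x + g' x)"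
proof (rule has_weak_gradI_directional)
  fix C assume "compact C" "C \<subseteq> S"
  then show "set_integrable lebesgue C (\<lambda>x. f x + f' x)" "set_integrable lebesgue C (\<lambda>x. g x + g' x)"
    using has_weak_grad_loc[OF assms(1), of C] has_weak_grad_loc[OF assms(2), of C] by auto
next
  fix \<psi> \<psi>' v assume tf: "test_function S \<psi> \<psi>'"
  obtain C where C: "compact C" "C \<subseteq> S" "\<And>x. x \<notin> C \<Longrightarrow> \<psi> x = 0" "\<And>x. x \<notin> C \<Longrightarrow> \<psi>' x = 0"
    using test_functionE[OF tf] by metis
  obtain B where B: "\<And>x. norm (\<psi>' x) \<le> B"
    using compact_support_bounded[OF C(1) test_functionD(2)[OF tf] C(4)] by metis
  have i: "set_integrable lebesgue S (\<lambda>x. h x * (\<psi>' x \<bullet> v)) \<and>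
      set_integrable lebesgue S (\<lambda>x. \<psi> x * (k x \<bullet> v)) \<and>
      (LINT x:S|lebesgue. h x * (\<psi>' x \<bullet> v)) = - (LINT x:S|lebesgue. \<psi> x * (k x \<bullet> v))"
    if "has_weak_grad S h k" for h k
  proof (intro conjI)
    have "set_integrable lebesgue C (\<lambda>x. (\<psi>' x \<bullet> v) *\<^sub>R h x)"
    proof (rule set_integrable_scaleR_bounded[OF has_weak_grad_loc(1)[OF that C(1,2)], of _ "B * norm v"])
      show "(\<lambda>x. \<psi>' x \<bullet> v) \<in> borel_measurable lebesgue"
        using test_functionD(2)[OF tf] by (intro continuous_borel_measurable_lebesgue continuous_intros)
      show "\<bar>\<psi>' x \<bullet> v\<bar> \<le> B * norm v" for x
        using order_trans[OF Cauchy_Schwarz_ineq2 mult_right_mono[OF B[of x] norm_ge_zero[of v]]] .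
    qed
    also have "?this \<longleftrightarrow> set_integrable lebesgue S (\<lambda>x. (\<psi>' x \<bullet> v) *\<^sub>R h x)"
      by (rule set_integrable_supported) (use C in auto)
    finally show s1: "set_integrable lebesgue S (\<lambda>x. h x * (\<psi>' x \<bullet> v))"
      by (simp add: mult.commute)
    have s2: "set_integrable lebesgue S (\<lambda>x. \<psi> x *\<^sub>R k x)"
      using set_integrable_test_function_scaleR[OF tf has_weak_grad_loc(2)[OF that]] by blast
    from integrable_inner_left[of v, OF this[unfolded set_integrable_def]]
    show "set_integrable lebesgue S (\<lambda>x. \<psi> x * (k x \<bullet> v))"
      unfolding set_integrable_def by (simp del: scaleR_scaleR)
    have "set_integrable lebesgue C (\<lambda>x. h x *\<^sub>R \<psi>' x)"
    proof -
      have "integrable lebesgue (\<lambda>x. (indicator C x * h x) *\<^sub>R \<psi>' x)"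
      proof (rule Bochner_Integration.integrable_bound)
        have "integrable lebesgue (\<lambda>x. indicator C x * h x)"
          using has_weak_grad_loc(1)[OF that C(1,2)] unfolding set_integrable_def by simp
        then show "integrable lebesgue (\<lambda>x. B * (indicator C x * h x))"
          "(\<lambda>x. (indicator C x * h x) *\<^sub>R \<psi>' x) \<in> borel_measurable lebesgue"
          using continuous_borel_measurable_lebesgue[OF test_functionD(2)[OF tf]]
          by (auto intro: borel_measurable_scaleR dest: borel_measurable_integrable)
        have "norm ((indicator C x * h x) *\<^sub>R \<psi>' x) \<le> norm (B * (indicator C x * h x))" for x
          using mult_left_mono[OF order_trans[OF B[of x] abs_ge_self], of "\<bar>indicator C x * h x\<bar>"]
          by (simp add: abs_mult mult_ac)
        then show "AE x in lebesgue. norm ((indicator C x * h x) *\<^sub>R \<psi>' x) \<le> norm (B * (indicator C x * h x))"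
          by blast
      qed
      then show ?thesis unfolding set_integrable_def by simp
    qed
    also have "?this \<longleftrightarrow> set_integrable lebesgue S (\<lambda>x. h x *\<^sub>R \<psi>' x)"
      by (rule set_integrable_supported) (use C in auto)
    finally have "(LINT x:S|lebesgue. h x *\<^sub>R \<psi>' x) \<bullet> v = (LINT x:S|lebesgue. h x * (\<psi>' x \<bullet> v))"
      using integral_inner_left[of v lebesgue "\<lambda>x. indicator S x *\<^sub>R h x *\<^sub>R \<psi>' x"]
      unfolding set_lebesgue_integral_def set_integrable_def by (simp del: scaleR_scaleR)
    moreover have "(LINT x:S|lebesgue. \<psi> x *\<^sub>R k x) \<bullet> v = (LINT x:S|lebesgue. \<psi> x * (k x \<bullet> v))"
      using integral_inner_left[OF s2[unfolded set_integrable_def], of v]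
      unfolding set_lebesgue_integral_def by (simp del: scaleR_scaleR)
    ultimately show "(LINT x:S|lebesgue. h x * (\<psi>' x \<bullet> v)) = - (LINT x:S|lebesgue. \<psi> x * (k x \<bullet> v))"
      using arg_cong[OF has_weak_gradD[OF that tf], of "\<lambda>z. z \<bullet> v"] by (simp add: inner_minus_left)
  qed
  show "(LINT x:S|lebesgue. (f x + f' x) * (\<psi>' x \<bullet> v)) = - (LINT x:S|lebesgue. \<psi> x * ((g x + g' x) \<bullet> v))"
    using i[OF assms(1)] i[OF assms(2)] by (simp add: distrib_left distrib_right inner_add_left)
qed

lemma has_weak_grad_sum:
  assumes "finite I" "\<And>i. i \<in> I \<Longrightarrow> has_weak_grad S (f i) (g i)"
  shows "has_weak_grad S (\<lambda>x. \<Sum>i\<in>I. f i x) (\<lambda>x. \<Sum>i\<in>I. g i x)"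
  using assms
proof (induction I rule: finite_induct)
  case empty
  show ?case using has_weak_grad_affine[of S 0 0] by simp
next
  case (insert i I)
  then show ?case
    using has_weak_grad_add[of S "f i" "g i"] by simp
qed

text \<open>A compact subset C of a disjoint union of two open sets splits into compact pieces, as C
  \<inter> U = C - V. Hence \<psi> stays C^1 with compact support when it is set to 0 outside
  \<open>U\<close>.\<close>

lemma test_function_restrict_open:
  assumes tf: "test_function (U \<union> V) \<psi> \<psi>'" and "open U" "open V" "U \<inter> V = {}"
  shows "test_function U (\<lambda>x. if x \<in> U then \<psi> x else 0) (\<lambda>x. if x \<in> U then \<psi>' x else 0)"
proof -
  obtain C where C: "compact C" "C \<subseteq> U \<union> V" "\<And>x. x \<notin> C \<Longrightarrow> \<psi> x = 0" "\<And>x. x \<notin> C \<Longrightarrow> \<psi>' x = 0"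
    using test_functionE[OF tf] by metis
  have CU: "C \<inter> U = C - V"
    using C(2) assms(4) by auto
  have out: "open (V \<union> - C)"
    using assms(3) compact_imp_closed[OF C(1)] by auto
  have cover: "x \<in> U \<or> x \<in> V \<union> - C" for x
    using C(2) by auto
  have "GDERIV (\<lambda>x. if x \<in> U then \<psi> x else 0) x :> (if x \<in> U then \<psi>' x else 0)" for x
  proof (cases "x \<in> U")
    case True
    have "((\<lambda>x. if x \<in> U then \<psi> x else 0) has_derivative (\<lambda>h. h \<bullet> \<psi>' x)) (at x)"
      by (rule has_derivative_transform_within_open[of \<psi> _ _ _ U])
        (use True assms(2) test_functionD(1)[OF tf, of x] in \<open>auto simp: gderiv_def\<close>)
    then show ?thesis using True by (simp add: gderiv_def)
  next
    case False
    then have x: "x \<in> V \<union> - C" using cover by blast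
    have "((\<lambda>x. if x \<in> U then \<psi> x else 0) has_derivative (\<lambda>h. 0)) (at x)"
      by (rule has_derivative_transform_within_open[of "\<lambda>_. 0" _ _ _ "V \<union> - C"])
        (use x out assms(4) C(3) in auto)
    then show ?thesis using False by (simp add: gderiv_def)
  qed
  moreover have "continuous_on UNIV (\<lambda>x. if x \<in> U then \<psi>' x else 0)"
  proof -
    have "continuous_on U (\<lambda>x. if x \<in> U then \<psi>' x else 0)"
      by (rule continuous_on_eq[OF continuous_on_subset[OF test_functionD(2)[OF tf] subset_UNIV]]) simp
    moreover have "continuous_on (V \<union> - C) (\<lambda>x. if x \<in> U then \<psi>' x else 0)"
      by (rule continuous_on_eq[OF continuous_on_const[of _ 0]]) (use assms(4) C(4) in auto)
    ultimately have "continuous_on (U \<union> (V \<union> - C)) (\<lambda>x. if x \<in> U then \<psi>' x else 0)"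
      using continuous_on_open_Un[OF assms(2) out] by blast
    moreover have "U \<union> (V \<union> - C) = UNIV" using cover by auto
    ultimately show ?thesis by simp
  qed
  moreover have "compact (C \<inter> U)"
    unfolding CU using compact_diff[OF C(1) assms(3)] .
  moreover have "(if x \<in> U then \<psi> x else 0) = 0" if "x \<notin> C \<inter> U" for x
    using that C(3) by auto
  ultimately show ?thesis
    unfolding test_function_def by (intro conjI allI exI[of _ "C \<inter> U"]) auto
qed

text \<open>A test function on \<open>U \<union> V\<close> is the sum of its restrictions to the two
  disjoint open sets. This assembles the elementwise gradient from single open cells.\<close>

lemma has_weak_grad_Un:
  assumes w: "has_weak_grad U f g" "has_weak_grad V f g" and o: "open U" "open V" "U \<inter> V = {}"
  shows "has_weak_grad (U \<union> V) f g"
  unfolding has_weak_grad_def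
proof (intro conjI allI impI)
  fix C assume "compact C \<and> C \<subseteq> U \<union> V"
  then have C: "compact C" "C \<subseteq> U \<union> V" by auto
  have eq: "C = (C - V) \<union> (C - U)" using o(3) by auto
  have c: "compact (C - V)" "C - V \<subseteq> U" "compact (C - U)" "C - U \<subseteq> V"
    using C o compact_diff by auto
  show "set_integrable lebesgue C f" "set_integrable lebesgue C g"
    using has_weak_grad_loc[OF w(1) c(1,2)] has_weak_grad_loc[OF w(2) c(3,4)]
      lmeasurable_compact[OF c(1)] lmeasurable_compact[OF c(3)]
    by (subst eq, intro set_integrable_Un; auto)+
next
  fix \<psi> \<psi>' assume tf: "test_function (U \<union> V) \<psi> \<psi>'"
  obtain C where C: "compact C" "C \<subseteq> U \<union> V" "\<And>x. x \<notin> C \<Longrightarrow> \<psi> x = 0" "\<And>x. x \<notin> C \<Longrightarrow> \<psi>' x = 0"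
    using test_functionE[OF tf] by metis
  have tfU: "test_function U (\<lambda>x. if x \<in> U then \<psi> x else 0) (\<lambda>x. if x \<in> U then \<psi>' x else 0)"
    by (rule test_function_restrict_open[OF tf o])
  have tfV: "test_function V (\<lambda>x. if x \<in> V then \<psi> x else 0) (\<lambda>x. if x \<in> V then \<psi>' x else 0)"
    by (rule test_function_restrict_open[of V U]) (use tf o in \<open>auto simp: Un_commute Int_commute\<close>)
  have swap: "(LINT x:A|lebesgue. F x) = (LINT x:A|lebesgue. G x)" if "\<And>x. x \<in> A \<Longrightarrow> F x = G x" for A and F G :: "'a \<Rightarrow> 'a"
    unfolding set_lebesgue_integral_def using that
    by (intro Bochner_Integration.integral_cong) (auto simp: indicator_def)
  have UV: "(LINT x:U \<union> V|lebesgue. F x) = (LINT x:U|lebesgue. F x) + (LINT x:V|lebesgue. F x)"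
    if "set_integrable lebesgue U F" "set_integrable lebesgue V F" for F :: "'a \<Rightarrow> 'a"
    using that o by (intro set_integral_Un) auto
  have int1: "set_integrable lebesgue A (\<lambda>x. \<psi> x *\<^sub>R g x)" if "has_weak_grad A f g"
    "test_function A (\<lambda>x. if x \<in> A then \<psi> x else 0) (\<lambda>x. if x \<in> A then \<psi>' x else 0)" for A
  proof -
    have "set_integrable lebesgue A (\<lambda>x. (if x \<in> A then \<psi> x else 0) *\<^sub>R g x)"
      using set_integrable_test_function_scaleR[OF that(2) has_weak_grad_loc(2)[OF that(1)]] by blast
    then show ?thesis
      unfolding set_integrable_def
      by (rule Bochner_Integration.integrable_cong[OF refl, THEN iffD1, rotated]) (auto simp: indicator_def)
  qed
  have int2: "set_integrable lebesgue A (\<lambda>x. f x *\<^sub>R \<psi>' x)" if A: "has_weak_grad A f g"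
    "test_function A (\<lambda>x. if x \<in> A then \<psi> x else 0) (\<lambda>x. if x \<in> A then \<psi>' x else 0)" for A
  proof -
    let ?p = "\<lambda>x. if x \<in> A then \<psi>' x else 0"
    obtain D where D: "compact D" "D \<subseteq> A" "\<And>x. x \<notin> D \<Longrightarrow> ?p x = 0"
      using test_functionE[OF A(2)] by metis
    obtain B where B: "\<And>x. norm (?p x) \<le> B"
      using compact_support_bounded[OF D(1) test_functionD(2)[OF A(2)] D(3)] by metis
    have "integrable lebesgue (\<lambda>x. (indicator D x * f x) *\<^sub>R ?p x)"
    proof (rule Bochner_Integration.integrable_bound)
      have "integrable lebesgue (\<lambda>x. indicator D x * f x)"
        using has_weak_grad_loc(1)[OF A(1) D(1,2)] unfolding set_integrable_def by simp
      then show "integrable lebesgue (\<lambda>x. B * (indicator D x * f x))"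
        "(\<lambda>x. (indicator D x * f x) *\<^sub>R ?p x) \<in> borel_measurable lebesgue"
        using continuous_borel_measurable_lebesgue[OF test_functionD(2)[OF A(2)]]
        by (auto intro: borel_measurable_scaleR dest: borel_measurable_integrable simp del: if_distrib)
      have "norm ((indicator D x * f x) *\<^sub>R ?p x) \<le> norm (B * (indicator D x * f x))" for x
        using mult_left_mono[OF order_trans[OF B[of x] abs_ge_self], of "\<bar>indicator D x * f x\<bar>"]
        by (simp add: abs_mult mult_ac)
      then show "AE x in lebesgue. norm ((indicator D x * f x) *\<^sub>R ?p x) \<le> norm (B * (indicator D x * f x))"
        by blast
    qed
    then show ?thesis
      unfolding set_integrable_def
      by (rule Bochner_Integration.integrable_cong[OF refl, THEN iffD1, rotated])
        (use D(2,3) in \<open>fastforce simp: indicator_def\<close>)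
  qed
  have "(LINT x:U|lebesgue. f x *\<^sub>R \<psi>' x) = - (LINT x:U|lebesgue. \<psi> x *\<^sub>R g x)"
    using has_weak_gradD[OF w(1) tfU]
      swap[of U "\<lambda>x. f x *\<^sub>R (if x \<in> U then \<psi>' x else 0)" "\<lambda>x. f x *\<^sub>R \<psi>' x"]
      swap[of U "\<lambda>x. (if x \<in> U then \<psi> x else 0) *\<^sub>R g x" "\<lambda>x. \<psi> x *\<^sub>R g x"] by simp
  moreover have "(LINT x:V|lebesgue. f x *\<^sub>R \<psi>' x) = - (LINT x:V|lebesgue. \<psi> x *\<^sub>R g x)"
    using has_weak_gradD[OF w(2) tfV]
      swap[of V "\<lambda>x. f x *\<^sub>R (if x \<in> V then \<psi>' x else 0)" "\<lambda>x. f x *\<^sub>R \<psi>' x"]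
      swap[of V "\<lambda>x. (if x \<in> V then \<psi> x else 0) *\<^sub>R g x" "\<lambda>x. \<psi> x *\<^sub>R g x"] by simp
  ultimately show "(LINT x:U \<union> V|lebesgue. f x *\<^sub>R \<psi>' x) = - (LINT x:U \<union> V|lebesgue. \<psi> x *\<^sub>R g x)"
    using UV int1 int2 w tfU tfV by simp
qed

lemma has_weak_grad_Union:
  assumes "finite \<U>" "\<And>U. U \<in> \<U> \<Longrightarrow> open U" "disjoint \<U>" "\<And>U. U \<in> \<U> \<Longrightarrow> has_weak_grad U f g"
  shows "has_weak_grad (\<Union>\<U>) f g"
  using assms
proof (induction \<U> rule: finite_induct)
  case empty
  then show ?case
    by (auto simp: has_weak_grad_def set_integrable_def set_lebesgue_integral_def)
next
  case (insert U \<U>)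
  have "U \<inter> \<Union>\<U> = {}"
    using insert.prems(2) insert.hyps(2) unfolding disjoint_def by (auto; metis disjoint_iff)
  moreover have "disjoint \<U>"
    using insert.prems(2) by (simp add: pairwise_insert)
  ultimately show ?case
    using has_weak_grad_Un[of U f g "\<Union>\<U>"] insert by auto
qed

section \<open>The spaces H1 and H1_0\<close>

lemma L2_space_iff:
  fixes f :: "'a::euclidean_space \<Rightarrow> 'b::euclidean_space"
  assumes "S \<in> sets lebesgue"
  shows "f \<in> L2_space S \<longleftrightarrow> f \<in> borel_measurable (lebesgue_on S) \<and>
    integrable (lebesgue_on S) (\<lambda>x. (norm (f x))\<^sup>2)"
proof -
  have "set_borel_measurable lebesgue S f \<longleftrightarrow> f \<in> borel_measurable (lebesgue_on S)"
    unfolding set_borel_measurable_def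
    by (rule borel_measurable_restrict_space_iff[symmetric]) (use assms in simp)
  then show ?thesis
    unfolding L2_space_def using set_integrable_lebesgue_on[OF assms] by auto
qed

lemma L2_nrm_square:
  fixes f :: "'a::euclidean_space \<Rightarrow> 'b::euclidean_space"
  assumes "S \<in> sets lebesgue"
  shows "(L2_nrm S f)\<^sup>2 = (LINT x|lebesgue_on S. (norm (f x))\<^sup>2)" "L2_nrm S f \<ge> 0"
proof -
  have "L2_prod S f f = (LINT x|lebesgue_on S. (norm (f x))\<^sup>2)"
    unfolding L2_prod_def set_lint_lebesgue_on[OF assms] by (simp add: power2_norm_eq_inner)
  moreover have "\<dots> \<ge> 0"
    by (rule integral_nonneg_AE) auto
  ultimately show "(L2_nrm S f)\<^sup>2 = (LINT x|lebesgue_on S. (norm (f x))\<^sup>2)" "L2_nrm S f \<ge> 0"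
    unfolding L2_nrm_def by simp_all
qed

lemma L2_space_test_function:
  fixes \<psi> :: "'a::euclidean_space \<Rightarrow> real"
  assumes "S \<in> sets lebesgue" "test_function T \<psi> \<psi>'"
  shows "\<psi> \<in> L2_space S" "\<psi>' \<in> L2_space S"
proof -
  obtain C where C: "compact C" "\<And>x. x \<notin> C \<Longrightarrow> \<psi> x = 0" "\<And>x. x \<notin> C \<Longrightarrow> \<psi>' x = 0"
    using test_functionE[OF assms(2)] by metis
  have L: "f \<in> L2_space S" if f: "continuous_on UNIV f" "\<And>x. x \<notin> C \<Longrightarrow> f x = 0" for f :: "'a \<Rightarrow> 'b::euclidean_space"
    unfolding L2_space_iff[OF assms(1)]
  proof
    show "f \<in> borel_measurable (lebesgue_on S)"
      using continuous_borel_measurable_lebesgue[OF f(1)] by (rule measurable_restrict_space1)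
    have "integrable lebesgue (\<lambda>x. (norm (f x))\<^sup>2)"
      by (rule compact_support_lebesgue_integrable[OF C(1)]) (use f in \<open>auto intro!: continuous_intros\<close>)
    then show "integrable (lebesgue_on S) (\<lambda>x. (norm (f x))\<^sup>2)"
      using integrable_mult_indicator[OF assms(1)] set_integrable_lebesgue_on[OF assms(1)]
      unfolding set_integrable_def by blast
  qed
  show "\<psi> \<in> L2_space S" "\<psi>' \<in> L2_space S"
    using L C test_functionD[OF assms(2)] by blast+
qed

lemma L2_space_diff:
  fixes f g :: "'a::euclidean_space \<Rightarrow> 'b::euclidean_space"
  assumes "S \<in> sets lebesgue" "f \<in> L2_space S" "g \<in> L2_space S"
  shows "(\<lambda>x. f x - g x) \<in> L2_space S"
  using assms(2,3) integrable_square_diff[of f "lebesgue_on S" g]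
  unfolding L2_space_iff[OF assms(1)] by auto

lemma L2_space_inner_left:
  fixes f :: "'a::euclidean_space \<Rightarrow> 'b::euclidean_space"
  assumes S: "S \<in> sets lebesgue" and f: "f \<in> L2_space S"
  shows "(\<lambda>x. f x \<bullet> v) \<in> L2_space S"
    and "(LINT x|lebesgue_on S. (f x \<bullet> v)\<^sup>2) \<le> (norm v)\<^sup>2 * (LINT x|lebesgue_on S. (norm (f x))\<^sup>2)"
proof -
  have le: "(f x \<bullet> v)\<^sup>2 \<le> (norm v)\<^sup>2 * (norm (f x))\<^sup>2" for x
    using power_mono[OF Cauchy_Schwarz_ineq2[of "f x" v], of 2] by (simp add: power_mult_distrib mult.commute)
  have m: "f \<in> borel_measurable (lebesgue_on S)" and i: "integrable (lebesgue_on S) (\<lambda>x. (norm (f x))\<^sup>2)"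
    using f unfolding L2_space_iff[OF S] by auto
  have i': "integrable (lebesgue_on S) (\<lambda>x. (norm v)\<^sup>2 * (norm (f x))\<^sup>2)"
    using i by simp
  have i2: "integrable (lebesgue_on S) (\<lambda>x. (f x \<bullet> v)\<^sup>2)"
    by (rule Bochner_Integration.integrable_bound[OF i']) (use m le in auto)
  show "(\<lambda>x. f x \<bullet> v) \<in> L2_space S"
    unfolding L2_space_iff[OF S] using m i2 by auto
  have "(LINT x|lebesgue_on S. (f x \<bullet> v)\<^sup>2) \<le> (LINT x|lebesgue_on S. (norm v)\<^sup>2 * (norm (f x))\<^sup>2)"
    by (rule integral_mono[OF i2 i' le])
  then show "(LINT x|lebesgue_on S. (f x \<bullet> v)\<^sup>2) \<le> (norm v)\<^sup>2 * (LINT x|lebesgue_on S. (norm (f x))\<^sup>2)"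
    by simp
qed

text \<open>The representative chosen by \<open>weak_grad\<close> agrees a.e. with a square
  integrable gradient, and completeness of Lebesgue measure transfers measurability to it.\<close>

lemma H1_space_weak_grad:
  assumes "open \<Omega>" "f \<in> H1_space \<Omega>"
  shows "has_weak_grad \<Omega> f (weak_grad \<Omega> f)" "weak_grad \<Omega> f \<in> L2_space \<Omega>" "f \<in> L2_space \<Omega>"
proof -
  obtain g where g: "g \<in> L2_space \<Omega>" "has_weak_grad \<Omega> f g" and "f \<in> L2_space \<Omega>"
    using assms(2) unfolding H1_space_def by blast
  then show "has_weak_grad \<Omega> f (weak_grad \<Omega> f)" "f \<in> L2_space \<Omega>"
    using has_weak_grad_weak_grad by blast+
  have ae: "AE x in lebesgue. x \<in> \<Omega> \<longrightarrow> g x = weak_grad \<Omega> f x"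
    using weak_grad_AE_eq[OF assms(1) g(2)] by eventually_elim simp
  have "set_borel_measurable lebesgue \<Omega> (weak_grad \<Omega> f)"
    unfolding set_borel_measurable_def
  proof (rule measurable_lebesgue_AE_cong)
    show "(\<lambda>x. indicator \<Omega> x *\<^sub>R g x) \<in> borel_measurable lebesgue"
      using g(1) unfolding L2_space_def set_borel_measurable_def by simp
    show "AE x in lebesgue. indicator \<Omega> x *\<^sub>R g x = indicator \<Omega> x *\<^sub>R weak_grad \<Omega> f x"
      using ae by eventually_elim (auto simp: indicator_def)
  qed
  moreover have "set_integrable lebesgue \<Omega> (\<lambda>x. (norm (weak_grad \<Omega> f x))\<^sup>2)"
    by (rule set_integrable_lebesgue_cong_AE[of _ "\<lambda>x. (norm (g x))\<^sup>2"])
      (use ae g(1) in \<open>auto simp: L2_space_def elim!: eventually_mono\<close>)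
  ultimately show "weak_grad \<Omega> f \<in> L2_space \<Omega>"
    unfolding L2_space_def by blast
qed

text \<open>\<open>H1_nrm\<close> involves \<open>weak_grad\<close> of the difference, which is
  identified a.e. with the difference of the gradients. Each of the two squared L2 norms is then
  squeezed between 0 and the squared H1 norm.\<close>

lemma H10_approximation:
  assumes \<Omega>: "open \<Omega>" and f: "f \<in> H10_space \<Omega>"
  obtains \<psi> \<psi>' where "\<And>k::nat. test_function \<Omega> (\<psi> k) (\<psi>' k)"
    "(\<lambda>k. LINT x|lebesgue_on \<Omega>. (\<psi> k x - f x)\<^sup>2) \<longlonglongrightarrow> 0"
    "\<And>v. (\<lambda>k. LINT x|lebesgue_on \<Omega>. (\<psi>' k x \<bullet> v - weak_grad \<Omega> f x \<bullet> v)\<^sup>2) \<longlonglongrightarrow> 0"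
proof -
  have S: "\<Omega> \<in> sets lebesgue"
    using \<Omega> by auto
  obtain \<psi> \<psi>' where tf: "\<And>k::nat. test_function \<Omega> (\<psi> k) (\<psi>' k)"
    and lim: "(\<lambda>k. H1_nrm \<Omega> (\<lambda>x. \<psi> k x - f x)) \<longlonglongrightarrow> 0"
    using f unfolding H10_space_def by blast
  have H1: "f \<in> H1_space \<Omega>"
    using f unfolding H10_space_def by blast
  note w = H1_space_weak_grad[OF \<Omega> H1]
  let ?g = "weak_grad \<Omega> f"
  have sq: "(H1_nrm \<Omega> (\<lambda>x. \<psi> k x - f x))\<^sup>2 =
      (LINT x|lebesgue_on \<Omega>. (\<psi> k x - f x)\<^sup>2) + (LINT x|lebesgue_on \<Omega>. (norm (\<psi>' k x - ?g x))\<^sup>2)" for k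
  proof -
    have "has_weak_grad \<Omega> (\<lambda>x. \<psi> k x - f x) (\<lambda>x. \<psi>' k x - ?g x)"
      using has_weak_grad_add[OF has_weak_grad_test_function[OF tf[of k]] has_weak_grad_scale[OF w(1), of "-1"]]
      by simp
    then have ae: "AE x in lebesgue. x \<in> \<Omega> \<longrightarrow> weak_grad \<Omega> (\<lambda>x. \<psi> k x - f x) x = \<psi>' k x - ?g x"
      by (rule weak_grad_AE_eq[OF \<Omega>])
    have "(LINT x:\<Omega>|lebesgue. (norm (weak_grad \<Omega> (\<lambda>x. \<psi> k x - f x) x))\<^sup>2) = (LINT x:\<Omega>|lebesgue. (norm (\<psi>' k x - ?g x))\<^sup>2)"
      by (rule set_lint_cong_AE) (use ae in \<open>auto elim!: eventually_mono\<close>)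
    then show ?thesis
      unfolding H1_nrm_def by (simp add: set_lint_lebesgue_on[OF S] L2_nrm_square(1)[OF S])
  qed
  have lim2: "(\<lambda>k. (H1_nrm \<Omega> (\<lambda>x. \<psi> k x - f x))\<^sup>2) \<longlonglongrightarrow> 0"
    using tendsto_power[OF lim, of 2] by simp
  have nn: "0 \<le> (LINT x|lebesgue_on \<Omega>. (\<psi> k x - f x)\<^sup>2)" "0 \<le> (LINT x|lebesgue_on \<Omega>. (norm (\<psi>' k x - ?g x))\<^sup>2)" for k
    by (auto intro!: integral_nonneg_AE)
  have "(\<lambda>k. LINT x|lebesgue_on \<Omega>. (\<psi> k x - f x)\<^sup>2) \<longlonglongrightarrow> 0"
    by (rule tendsto_sandwich[OF _ _ tendsto_const lim2]) (use sq nn in \<open>auto intro!: always_eventually\<close>)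
  moreover have G: "(\<lambda>k. LINT x|lebesgue_on \<Omega>. (norm (\<psi>' k x - ?g x))\<^sup>2) \<longlonglongrightarrow> 0"
    by (rule tendsto_sandwich[OF _ _ tendsto_const lim2]) (use sq nn in \<open>auto intro!: always_eventually\<close>)
  moreover have "(\<lambda>k. LINT x|lebesgue_on \<Omega>. (\<psi>' k x \<bullet> v - ?g x \<bullet> v)\<^sup>2) \<longlonglongrightarrow> 0" for v
  proof (rule tendsto_sandwich[OF _ _ tendsto_const])
    show "\<forall>\<^sub>F k in sequentially. (LINT x|lebesgue_on \<Omega>. (\<psi>' k x \<bullet> v - ?g x \<bullet> v)\<^sup>2) \<le> (norm v)\<^sup>2 * (LINT x|lebesgue_on \<Omega>. (norm (\<psi>' k x - ?g x))\<^sup>2)"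
      using L2_space_inner_left(2)[OF S L2_space_diff[OF S L2_space_test_function(2)[OF S tf] w(2)], of _ v]
      by (intro always_eventually allI) (simp add: inner_diff_left)
    show "(\<lambda>k. (norm v)\<^sup>2 * (LINT x|lebesgue_on \<Omega>. (norm (\<psi>' k x - ?g x))\<^sup>2)) \<longlonglongrightarrow> 0"
      by (rule tendsto_mult_right_zero[OF G])
  qed (auto intro!: always_eventually integral_nonneg_AE)
  ultimately show ?thesis
    using that tf by blast
qed

text \<open>The zero boundary values of \<open>f\<close> enter here: the cutoff \<open>\<zeta>\<close> need not vanish on \<open>\<partial>\<Omega>\<close>.\<close>

lemma H10_integration_by_parts:
  assumes \<Omega>: "open \<Omega>" "bounded \<Omega>" and f: "f \<in> H10_space \<Omega>"
    and lip: "\<And>x y. \<bar>\<zeta> x - \<zeta> y\<bar> \<le> L * norm (x - y)"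
    and der: "AE x in lebesgue. ((\<lambda>t. (\<zeta> (x + t *\<^sub>R v) - \<zeta> x) / t) \<longlongrightarrow> d x) (at 0)"
    and bdd: "\<And>x. \<bar>\<zeta> x\<bar> \<le> B" "\<And>x. \<bar>d x\<bar> \<le> B"
    and meas: "\<zeta> \<in> borel_measurable lebesgue" "d \<in> borel_measurable lebesgue"
  shows "(LINT x:\<Omega>|lebesgue. (weak_grad \<Omega> f x \<bullet> v) * \<zeta> x) = - (LINT x:\<Omega>|lebesgue. f x * d x)"
proof -
  have S: "\<Omega> \<in> sets lebesgue"
    using \<Omega>(1) by auto
  interpret finite_measure "lebesgue_on \<Omega>"
    by (rule finite_measure_lebesgue_on) (use \<Omega> in \<open>simp add: bounded_set_imp_lmeasurable\<close>)
  obtain \<psi> \<psi>' where tf: "\<And>k::nat. test_function \<Omega> (\<psi> k) (\<psi>' k)"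
    and lim: "(\<lambda>k. LINT x|lebesgue_on \<Omega>. (\<psi> k x - f x)\<^sup>2) \<longlonglongrightarrow> 0"
    "\<And>v. (\<lambda>k. LINT x|lebesgue_on \<Omega>. (\<psi>' k x \<bullet> v - weak_grad \<Omega> f x \<bullet> v)\<^sup>2) \<longlonglongrightarrow> 0"
    using H10_approximation[OF \<Omega>(1) f] by blast
  have H1: "f \<in> H1_space \<Omega>"
    using f unfolding H10_space_def by blast
  note w = H1_space_weak_grad[OF \<Omega>(1) H1]
  have conv: "(\<lambda>k. LINT x|lebesgue_on \<Omega>. a k x * h x) \<longlonglongrightarrow> (LINT x|lebesgue_on \<Omega>. a' x * h x)"
    if a: "\<And>k. a k \<in> L2_space \<Omega>" "a' \<in> L2_space \<Omega>" "(\<lambda>k. LINT x|lebesgue_on \<Omega>. (a k x - a' x)\<^sup>2) \<longlonglongrightarrow> 0"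
      and h: "h \<in> borel_measurable lebesgue" "\<And>x. \<bar>h x\<bar> \<le> B" for a :: "nat \<Rightarrow> 'a \<Rightarrow> real" and a' h
  proof -
    have m: "a k \<in> borel_measurable (lebesgue_on \<Omega>)" "a' \<in> borel_measurable (lebesgue_on \<Omega>)" for k
      using a(1)[of k] a(2) unfolding L2_space_iff[OF S] by simp_all
    have i: "integrable (lebesgue_on \<Omega>) (\<lambda>x. (a k x - a' x)\<^sup>2)" "integrable (lebesgue_on \<Omega>) (\<lambda>x. (a' x)\<^sup>2)" for k
      using L2_space_diff[OF S a(1)[of k] a(2)] a(2) unfolding L2_space_iff[OF S] by simp_all
    \<comment> \<open>The constant 1 as second factor turns L2 convergence into L1 convergence, as
      \<Omega> has finite measure.\<close>
    have one: "(\<lambda>k. LINT x|lebesgue_on \<Omega>. \<bar>a k x * 1 - a' x * 1\<bar>) \<longlonglongrightarrow> 0"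
      "integrable (lebesgue_on \<Omega>) (\<lambda>x. a k x * 1)" "integrable (lebesgue_on \<Omega>) (\<lambda>x. a' x * 1)" for k
      by (rule L2_tendsto_mult_L1[of a "lebesgue_on \<Omega>" "\<lambda>_ _. 1" a' "\<lambda>_. 1"]; use m i a(3) in simp)+
    show ?thesis
      by (rule L1_tendsto_weighted[of "lebesgue_on \<Omega>" a a' h B])
        (use one h measurable_restrict_space1[OF h(1)] in auto)
  qed
  have eq: "(LINT x|lebesgue_on \<Omega>. (\<psi>' k x \<bullet> v) * \<zeta> x) = - (LINT x|lebesgue_on \<Omega>. \<psi> k x * d x)" for k
  proof -
    obtain C where C: "compact C" "C \<subseteq> \<Omega>" "\<And>x. x \<notin> C \<Longrightarrow> \<psi> k x = 0" "\<And>x. x \<notin> C \<Longrightarrow> \<psi>' k x = 0"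
      using test_functionE[OF tf[of k]] by metis
    have off: "\<psi> k x = 0" "\<psi>' k x = 0" if "x \<notin> \<Omega>" for x
      using C that by blast+
    have "(LINT x:\<Omega>|lebesgue. (\<psi>' k x \<bullet> v) * \<zeta> x) = (LINT x:UNIV|lebesgue. (\<psi>' k x \<bullet> v) * \<zeta> x)"
      by (rule set_lint_supported) (use off in auto)
    moreover have "(LINT x:\<Omega>|lebesgue. \<psi> k x * d x) = (LINT x:UNIV|lebesgue. \<psi> k x * d x)"
      by (rule set_lint_supported) (use off in auto)
    ultimately show ?thesis
      using integration_by_parts_lipschitz[OF tf[of k] lip der]
      unfolding set_lint_lebesgue_on[OF S, symmetric] by (simp add: set_lebesgue_integral_def)
  qed
  have "(\<lambda>k. LINT x|lebesgue_on \<Omega>. (\<psi>' k x \<bullet> v) * \<zeta> x) \<longlonglongrightarrow> (LINT x|lebesgue_on \<Omega>. (weak_grad \<Omega> f x \<bullet> v) * \<zeta> x)"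
    by (rule conv) (use L2_space_inner_left(1)[OF S] L2_space_test_function(2)[OF S tf] w lim(2) meas bdd in auto)
  moreover have "(\<lambda>k. LINT x|lebesgue_on \<Omega>. \<psi> k x * d x) \<longlonglongrightarrow> (LINT x|lebesgue_on \<Omega>. f x * d x)"
    by (rule conv) (use L2_space_test_function(1)[OF S tf] w lim(1) meas bdd in auto)
  ultimately have "(LINT x|lebesgue_on \<Omega>. (weak_grad \<Omega> f x \<bullet> v) * \<zeta> x) = - (LINT x|lebesgue_on \<Omega>. f x * d x)"
    unfolding eq using LIMSEQ_unique tendsto_minus by blast
  then show ?thesis
    by (simp add: set_lint_lebesgue_on[OF S])
qed

text \<open>The product rule holds for the squares of approximating test functions and passes to the
  limit, since products of L2-convergent sequences converge in L1. It serves the gradient of |u|^2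
  in the convection term.\<close>

lemma H10_square_weak_grad:
  assumes \<Omega>: "open \<Omega>" and f: "f \<in> H10_space \<Omega>"
  shows "has_weak_grad \<Omega> (\<lambda>x. f x * f x) (\<lambda>x. (2 * f x) *\<^sub>R weak_grad \<Omega> f x)"
proof (rule has_weak_gradI_directional)
  have S: "\<Omega> \<in> sets lebesgue" using \<Omega> by auto
  have H1: "f \<in> H1_space \<Omega>"
    using f unfolding H10_space_def by blast
  note w = H1_space_weak_grad[OF \<Omega> H1]
  let ?M = "lebesgue_on \<Omega>" and ?g = "weak_grad \<Omega> f"
  have m: "f \<in> borel_measurable ?M" "?g \<in> borel_measurable ?M"
    and i: "integrable ?M (\<lambda>x. (f x)\<^sup>2)" "integrable ?M (\<lambda>x. (norm (?g x))\<^sup>2)"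
    using w(2,3) unfolding L2_space_iff[OF S] by auto
  have iff: "integrable ?M (\<lambda>x. f x * f x)"
    using i(1) by (simp add: power2_eq_square)
  have ifg: "integrable ?M (\<lambda>x. (2 * f x) *\<^sub>R ?g x)"
  proof (rule Bochner_Integration.integrable_bound)
    show "integrable ?M (\<lambda>x. (f x)\<^sup>2 + (norm (?g x))\<^sup>2)"
      using i by simp
    show "AE x in ?M. norm ((2 * f x) *\<^sub>R ?g x) \<le> norm ((f x)\<^sup>2 + (norm (?g x))\<^sup>2)"
    proof (rule AE_I2)
      fix x
      have "2 * \<bar>f x\<bar> * norm (?g x) \<le> (f x)\<^sup>2 + (norm (?g x))\<^sup>2"
        using sum_squares_bound[of "\<bar>f x\<bar>" "norm (?g x)"] by simp
      then show "norm ((2 * f x) *\<^sub>R ?g x) \<le> norm ((f x)\<^sup>2 + (norm (?g x))\<^sup>2)"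
        by (simp add: abs_mult)
    qed
  qed (use m in auto)
  show "set_integrable lebesgue C (\<lambda>x. f x * f x)" "set_integrable lebesgue C (\<lambda>x. (2 * f x) *\<^sub>R ?g x)"
    if C: "compact C" "C \<subseteq> \<Omega>" for C
    using iff ifg set_integrable_lebesgue_on[OF S] set_integrable_subset[OF _ _ C(2)] lmeasurable_compact[OF C(1)]
    by blast+
  fix \<tau> \<tau>' v assume tau: "test_function \<Omega> \<tau> \<tau>'"
  obtain \<psi> \<psi>' where tf: "\<And>k::nat. test_function \<Omega> (\<psi> k) (\<psi>' k)"
    and lim: "(\<lambda>k. LINT x|?M. (\<psi> k x - f x)\<^sup>2) \<longlonglongrightarrow> 0"
    "\<And>v. (\<lambda>k. LINT x|?M. (\<psi>' k x \<bullet> v - ?g x \<bullet> v)\<^sup>2) \<longlonglongrightarrow> 0"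
    using H10_approximation[OF \<Omega> f] by blast
  obtain C where C: "compact C" "C \<subseteq> \<Omega>" "\<And>x. x \<notin> C \<Longrightarrow> \<tau> x = 0" "\<And>x. x \<notin> C \<Longrightarrow> \<tau>' x = 0"
    using test_functionE[OF tau] by metis
  obtain B1 where B1: "\<And>x. norm (\<tau> x) \<le> B1"
    using compact_support_bounded[OF C(1) test_functionD(3)[OF tau] C(3)] by metis
  obtain B2 where B2: "\<And>x. norm (\<tau>' x \<bullet> v) \<le> B2"
    by (rule compact_support_bounded[OF C(1), of "\<lambda>x. \<tau>' x \<bullet> v"])
      (use C(4) test_functionD(2)[OF tau] in \<open>auto intro!: continuous_intros\<close>)
  note conv = L2_tendsto_mult_L1[of _ ?M]
  have L2: "\<psi> k \<in> L2_space \<Omega>" "(\<lambda>x. \<psi>' k x \<bullet> v) \<in> L2_space \<Omega>" "(\<lambda>x. ?g x \<bullet> v) \<in> L2_space \<Omega>" for k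
    using L2_space_test_function[OF S tf] L2_space_inner_left(1)[OF S] w(2) by auto
  have d: "(\<lambda>x. \<psi> k x - f x) \<in> L2_space \<Omega>" "(\<lambda>x. \<psi>' k x \<bullet> v - ?g x \<bullet> v) \<in> L2_space \<Omega>" for k
    using L2_space_diff[OF S] L2 w(3) by auto
  have ms: "\<psi> k \<in> borel_measurable ?M" "(\<lambda>x. \<psi>' k x \<bullet> v) \<in> borel_measurable ?M" "(\<lambda>x. ?g x \<bullet> v) \<in> borel_measurable ?M"
    "integrable ?M (\<lambda>x. (\<psi> k x - f x)\<^sup>2)" "integrable ?M (\<lambda>x. (\<psi>' k x \<bullet> v - ?g x \<bullet> v)\<^sup>2)" "integrable ?M (\<lambda>x. (?g x \<bullet> v)\<^sup>2)" for k
    using L2(1,2)[of k] L2(3) d(1,2)[of k] unfolding L2_space_iff[OF S] by simp_all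
  have c1: "(\<lambda>k. LINT x|?M. \<bar>\<psi> k x * \<psi> k x - f x * f x\<bar>) \<longlonglongrightarrow> 0" "\<And>k. integrable ?M (\<lambda>x. \<psi> k x * \<psi> k x)"
    by (rule conv[of \<psi> \<psi> f f]; use ms m i lim in simp)+
  have c2: "(\<lambda>k. LINT x|?M. \<bar>\<psi> k x * (\<psi>' k x \<bullet> v) - f x * (?g x \<bullet> v)\<bar>) \<longlonglongrightarrow> 0"
    "\<And>k. integrable ?M (\<lambda>x. \<psi> k x * (\<psi>' k x \<bullet> v))" "integrable ?M (\<lambda>x. f x * (?g x \<bullet> v))"
    by (rule conv[of \<psi> "\<lambda>k x. \<psi>' k x \<bullet> v" f "\<lambda>x. ?g x \<bullet> v"]; use ms m i lim in simp)+
  have mt: "(\<lambda>x. \<tau>' x \<bullet> v) \<in> borel_measurable ?M" "\<tau> \<in> borel_measurable ?M"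
    using test_functionD(2,3)[OF tau]
    by (auto intro!: measurable_restrict_space1 continuous_borel_measurable_lebesgue continuous_intros)
  have l1: "(\<lambda>k. LINT x|?M. (\<psi> k x * \<psi> k x) * (\<tau>' x \<bullet> v)) \<longlonglongrightarrow> (LINT x|?M. (f x * f x) * (\<tau>' x \<bullet> v))"
    by (rule L1_tendsto_weighted[OF c1(2) iff c1(1), of _ B2]) (use mt B2 in auto)
  have l2: "(\<lambda>k. LINT x|?M. (\<psi> k x * (\<psi>' k x \<bullet> v)) * \<tau> x) \<longlonglongrightarrow> (LINT x|?M. (f x * (?g x \<bullet> v)) * \<tau> x)"
    by (rule L1_tendsto_weighted[OF c2(2,3,1), of _ B1]) (use mt B1 in auto)
  \<comment> \<open>\<tau> is the test function here, and the square of \<open>\<psi> k\<close>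
    takes the place of the Lipschitz function.\<close>
  have eq: "(LINT x|?M. (\<psi> k x * \<psi> k x) * (\<tau>' x \<bullet> v)) = - 2 * (LINT x|?M. (\<psi> k x * (\<psi>' k x \<bullet> v)) * \<tau> x)" for k
  proof -
    have tf2: "test_function \<Omega> (\<lambda>x. \<psi> k x * \<psi> k x) (\<lambda>x. \<psi> k x *\<^sub>R \<psi>' k x + \<psi> k x *\<^sub>R \<psi>' k x)"
      using test_function_mult[OF tf[of k] tf[of k]] by simp
    have off: "\<tau> x = 0" "\<tau>' x = 0" if "x \<notin> \<Omega>" for x
      using C that by blast+
    obtain L where L: "\<And>x y. \<bar>\<psi> k x * \<psi> k x - \<psi> k y * \<psi> k y\<bar> \<le> L * norm (x - y)"
      using test_function_lipschitz[OF tf2] by metis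
    have "(LINT x|lebesgue. (\<tau>' x \<bullet> v) * (\<psi> k x * \<psi> k x)) = - (LINT x|lebesgue. \<tau> x * ((\<psi> k x *\<^sub>R \<psi>' k x + \<psi> k x *\<^sub>R \<psi>' k x) \<bullet> v))"
      by (rule integration_by_parts_lipschitz[OF tau L])
        (use gderiv_directional[OF test_functionD(1)[OF tf2]] in auto)
    moreover have "(LINT x:\<Omega>|lebesgue. (\<psi> k x * \<psi> k x) * (\<tau>' x \<bullet> v)) = (LINT x:UNIV|lebesgue. (\<tau>' x \<bullet> v) * (\<psi> k x * \<psi> k x))"
      unfolding mult.commute[of "_ \<bullet> v" "_ * _"] by (rule set_lint_supported) (use off in auto)
    moreover have "(LINT x:\<Omega>|lebesgue. 2 * ((\<psi> k x * (\<psi>' k x \<bullet> v)) * \<tau> x)) = (LINT x:UNIV|lebesgue. 2 * ((\<psi> k x * (\<psi>' k x \<bullet> v)) * \<tau> x))"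
      by (rule set_lint_supported) (use off in auto)
    moreover have "(LINT x:UNIV|lebesgue. 2 * ((\<psi> k x * (\<psi>' k x \<bullet> v)) * \<tau> x)) = (LINT x|lebesgue. \<tau> x * ((\<psi> k x *\<^sub>R \<psi>' k x + \<psi> k x *\<^sub>R \<psi>' k x) \<bullet> v))"
      unfolding set_lebesgue_integral_def
      by (intro Bochner_Integration.integral_cong) (auto simp: inner_add_left algebra_simps)
    ultimately show ?thesis
      unfolding set_lint_lebesgue_on[OF S, symmetric] by (simp add: set_lebesgue_integral_def)
  qed
  have "(LINT x|?M. (f x * f x) * (\<tau>' x \<bullet> v)) = - 2 * (LINT x|?M. (f x * (?g x \<bullet> v)) * \<tau> x)"
    using LIMSEQ_unique[OF l1[unfolded eq] tendsto_mult_left[OF l2]] .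
  also have "\<dots> = - (LINT x|?M. \<tau> x * ((2 * f x) *\<^sub>R ?g x \<bullet> v))"
    by (simp add: mult_ac flip: integral_mult_right_zero)
  finally show "(LINT x:\<Omega>|lebesgue. f x * f x * (\<tau>' x \<bullet> v)) = - (LINT x:\<Omega>|lebesgue. \<tau> x * ((2 * f x) *\<^sub>R ?g x \<bullet> v))"
    by (simp add: set_lint_lebesgue_on[OF S])
qed

section \<open>Facets of polyhedra\<close>

text \<open>A facet is encoded by its outer unit normal and its offset. For a polyhedron with
  nonempty interior the facet determines the pair, so sums over facets become sums over a finite set
  of pairs.\<close>

definition facet_data :: "'a::euclidean_space set \<Rightarrow> ('a \<times> real) set" where
  "facet_data K = {(n, c). norm n = 1 \<and> (\<forall>x\<in>K. n \<bullet> x \<le> c) \<and> (K \<inter> {x. n \<bullet> x = c}) facet_of K}"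

text \<open>\<open>C\<close> spans a hyperplane, so the component w of \<nu> orthogonal to n is a
  tangent vector of it and therefore orthogonal to \<nu>. Being orthogonal to n as well, w is
  orthogonal to itself, and \<nu> is a multiple of n.\<close>

lemma unit_normal_unique:
  fixes n \<nu> :: "'a::euclidean_space"
  assumes dim: "aff_dim C = int DIM('a) - 1" and C: "C \<noteq> {}"
    and n: "norm n = 1" "\<And>x. x \<in> C \<Longrightarrow> n \<bullet> x = c"
    and nu: "norm \<nu> = 1" "\<And>x y. x \<in> C \<Longrightarrow> y \<in> C \<Longrightarrow> \<nu> \<bullet> (x - y) = 0"
  shows "\<nu> = n \<or> \<nu> = - n" and "affine hull C = {x. n \<bullet> x = c}"
proof -
  have n0: "n \<noteq> 0" using n(1) by auto
  show hull: "affine hull C = {x. n \<bullet> x = c}"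
  proof (rule affine_dim_equal)
    show "affine hull C \<subseteq> {x. n \<bullet> x = c}"
      by (rule hull_minimal) (use n(2) in \<open>auto simp: affine_hyperplane\<close>)
    show "aff_dim (affine hull C) = aff_dim {x. n \<bullet> x = c}"
      using dim n0 by simp
  qed (use C in \<open>auto simp: affine_hyperplane\<close>)
  obtain y where y: "y \<in> C" using C by blast
  have sub: "affine hull C \<subseteq> {x. \<nu> \<bullet> x = \<nu> \<bullet> y}"
    by (rule hull_minimal) (use nu(2)[OF _ y] in \<open>auto simp: affine_hyperplane inner_diff_right\<close>)
  define w where "w = \<nu> - (n \<bullet> \<nu>) *\<^sub>R n"
  have nn: "n \<bullet> n = 1" using n(1) by (simp add: dot_square_norm)
  have nw: "n \<bullet> w = 0"
    unfolding w_def by (simp add: inner_diff_right nn)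
  have "y + w \<in> affine hull C"
    unfolding hull using n(2)[OF y] nw by (simp add: inner_add_right)
  then have "\<nu> \<bullet> w = 0"
    using sub by (auto simp: inner_add_right)
  then have "w \<bullet> w = 0"
    using nw by (subst w_def) (simp add: inner_diff_left)
  then have eq: "\<nu> = (n \<bullet> \<nu>) *\<^sub>R n"
    by (simp add: w_def)
  have "\<bar>n \<bullet> \<nu>\<bar> = 1"
    using arg_cong[OF eq, of norm] nu(1) n(1) by simp
  then have "n \<bullet> \<nu> = 1 \<or> n \<bullet> \<nu> = -1" by linarith
  then show "\<nu> = n \<or> \<nu> = - n"
  proof
    assume "n \<bullet> \<nu> = 1"
    with eq have "\<nu> = n" by (metis scaleR_one)
    then show ?thesis ..
  next
    assume "n \<bullet> \<nu> = -1"
    with eq have "\<nu> = - n" by (metis scaleR_minus1_left)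
    then show ?thesis ..
  qed
qed

lemma facet_dataD:
  assumes "(n, c) \<in> facet_data K"
  shows "norm n = 1" "n \<noteq> 0" "n \<bullet> n = 1" "\<And>x. x \<in> K \<Longrightarrow> n \<bullet> x \<le> c" "(K \<inter> {x. n \<bullet> x = c}) facet_of K"
  using assms unfolding facet_data_def by (auto simp: dot_square_norm)

lemma interior_not_subset_hyperplane:
  fixes K :: "'a::euclidean_space set"
  assumes "interior K \<noteq> {}" "n \<noteq> 0"
  shows "\<not> K \<subseteq> {x. n \<bullet> x = c}"
  using assms interior_mono interior_hyperplane by blast

text \<open>A common facet determines the normal up to sign, and opposite normals would squeeze
  \<open>K\<close> into a hyperplane.\<close>

lemma facet_data_inj:
  fixes K :: "'a::euclidean_space set"
  assumes K: "interior K \<noteq> {}" and p: "(n, c) \<in> facet_data K" "(n', c') \<in> facet_data K"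
    and eq: "K \<inter> {x. n \<bullet> x = c} = K \<inter> {x. n' \<bullet> x = c'}"
  shows "n = n' \<and> c = c'"
proof -
  let ?C = "K \<inter> {x. n \<bullet> x = c}"
  have C: "?C facet_of K" by (rule facet_dataD(5)[OF p(1)])
  then obtain y where y: "y \<in> ?C" unfolding facet_of_def by blast
  have y': "n \<bullet> y = c" "n' \<bullet> y = c'" "y \<in> K" using y eq by auto
  have "n' = n \<or> n' = - n"
  proof (rule unit_normal_unique(1)[of ?C])
    show "aff_dim ?C = int DIM('a) - 1"
      using C aff_dim_nonempty_interior[OF K] unfolding facet_of_def by simp
    show "n' \<bullet> (x - z) = 0" if "x \<in> ?C" "z \<in> ?C" for x z
      using that unfolding eq by (simp add: inner_diff_right)
  qed (use y facet_dataD(1)[OF p(1)] facet_dataD(1)[OF p(2)] in auto)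
  moreover have "n' \<noteq> - n"
  proof
    assume n': "n' = - n"
    then have "c' = - c" using y' by simp
    then have "K \<subseteq> {x. n \<bullet> x = c}"
      using facet_dataD(4)[OF p(1)] facet_dataD(4)[OF p(2)] n' by (force intro: antisym)
    then show False
      using interior_not_subset_hyperplane[OF K facet_dataD(2)[OF p(1)]] by blast
  qed
  ultimately show ?thesis using y' by auto
qed

lemma finite_facet_data:
  fixes K :: "'a::euclidean_space set"
  assumes "polyhedron K" "interior K \<noteq> {}"
  shows "finite (facet_data K)"
proof (rule finite_imageD)
  show "finite ((\<lambda>(n, c). K \<inter> {x. n \<bullet> x = c}) ` facet_data K)"
    by (rule finite_subset[OF _ finite_polyhedron_facets[OF assms(1)]])
      (auto dest: facet_dataD(5))
  show "inj_on (\<lambda>(n, c). K \<inter> {x. n \<bullet> x = c}) (facet_data K)"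
    using facet_data_inj[OF assms(2)] by (auto simp: inj_on_def)
qed

text \<open>The pairs come from normalising the half-spaces of a minimal representation of
  \<open>K\<close>: by minimality each of them cuts out a facet, and every facet arises in this
  way.\<close>

lemma polyhedron_facet_data:
  fixes K :: "'a::euclidean_space set"
  assumes K: "polyhedron K" "interior K \<noteq> {}"
  shows "K = {x. \<forall>(n, c)\<in>facet_data K. n \<bullet> x \<le> c}"
    and "C facet_of K \<Longrightarrow> \<exists>(n, c)\<in>facet_data K. C = K \<inter> {x. n \<bullet> x = c}"
proof -
  have aff: "affine hull K = UNIV"
    using K(2) affine_hull_nonempty_interior by blast
  obtain F where F: "finite F" "K = affine hull K \<inter> \<Inter>F"
    "\<forall>h\<in>F. \<exists>a b. a \<noteq> 0 \<and> h = {x. a \<bullet> x \<le> b}" "\<forall>F'. F' \<subset> F \<longrightarrow> K \<subset> affine hull K \<inter> \<Inter>F'"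
    using K(1) unfolding polyhedron_Int_affine_minimal by blast
  then obtain a b where ab: "\<And>h. h \<in> F \<Longrightarrow> a h \<noteq> 0 \<and> h = {x. a h \<bullet> x \<le> b h}"
    by metis
  have ex: "C facet_of K \<longleftrightarrow> (\<exists>h. h \<in> F \<and> C = K \<inter> {x. a h \<bullet> x = b h})" for C
  proof (rule facet_of_polyhedron_explicit[OF F(1,2)])
    show "a h \<noteq> 0 \<and> h = {x. a h \<bullet> x \<le> b h}" if "h \<in> F" for h
      by (rule ab[OF that])
    show "K \<subset> affine hull K \<inter> \<Inter>F'" if "F' \<subset> F" for F'
      using F(4) that by simp
  qed
  have in_data: "(a h /\<^sub>R norm (a h), b h / norm (a h)) \<in> facet_data K"
    and eq: "K \<inter> {x. (a h /\<^sub>R norm (a h)) \<bullet> x = b h / norm (a h)} = K \<inter> {x. a h \<bullet> x = b h}" if h: "h \<in> F" for h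
  proof -
    have pos: "norm (a h) > 0" using ab[OF h] by simp
    have le: "(a h /\<^sub>R norm (a h)) \<bullet> x \<le> b h / norm (a h) \<longleftrightarrow> a h \<bullet> x \<le> b h" for x
      using pos by (simp add: field_simps)
    show eq: "K \<inter> {x. (a h /\<^sub>R norm (a h)) \<bullet> x = b h / norm (a h)} = K \<inter> {x. a h \<bullet> x = b h}"
      using pos by (auto simp: field_simps)
    have inh: "a h \<bullet> x \<le> b h" if "x \<in> K" for x
    proof -
      have "x \<in> h" using F(2) h that by blast
      then show ?thesis using ab[OF h] by blast
    qed
    have f: "(K \<inter> {x. a h \<bullet> x = b h}) facet_of K"
      unfolding ex using h by blast
    show "(a h /\<^sub>R norm (a h), b h / norm (a h)) \<in> facet_data K"
      unfolding facet_data_def mem_Collect_eq prod.case eq le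
      using f pos inh by simp
  qed
  show "K = {x. \<forall>(n, c)\<in>facet_data K. n \<bullet> x \<le> c}"
  proof
    show "K \<subseteq> {x. \<forall>(n, c)\<in>facet_data K. n \<bullet> x \<le> c}"
      using facet_dataD(4) by fastforce
    show "{x. \<forall>(n, c)\<in>facet_data K. n \<bullet> x \<le> c} \<subseteq> K"
    proof
      fix x assume x: "x \<in> {x. \<forall>(n, c)\<in>facet_data K. n \<bullet> x \<le> c}"
      have "x \<in> h" if h: "h \<in> F" for h
      proof -
        have "(a h /\<^sub>R norm (a h)) \<bullet> x \<le> b h / norm (a h)"
          using x in_data[OF h] by blast
        then have "a h \<bullet> x \<le> b h"
          using ab[OF h] by (simp add: field_simps)
        then show ?thesis using ab[OF h] by blast
      qed
      then show "x \<in> K" using F(2) aff by blast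
    qed
  qed
  show "\<exists>(n, c)\<in>facet_data K. C = K \<inter> {x. n \<bullet> x = c}" if "C facet_of K"
  proof -
    from that obtain h where h: "h \<in> F" "C = K \<inter> {x. a h \<bullet> x = b h}"
      unfolding ex by blast
    have "C = K \<inter> {x. (a h /\<^sub>R norm (a h)) \<bullet> x = b h / norm (a h)}"
      using h(2) eq[OF h(1)] by (rule trans[OF _ sym])
    then have "case (a h /\<^sub>R norm (a h), b h / norm (a h)) of (n, c) \<Rightarrow> C = K \<inter> {x. n \<bullet> x = c}"
      by (simp only: prod.case)
    then show ?thesis
      using in_data[OF h(1)] by (rule bexI)
  qed
qed

lemma interior_polyhedron_facet_data:
  fixes K :: "'a::euclidean_space set"
  assumes K: "polyhedron K" "interior K \<noteq> {}" and strict: "\<forall>(n, c)\<in>facet_data K. n \<bullet> x < c"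
  shows "x \<in> interior K"
proof (rule interiorI)
  show "open (\<Inter>(n, c)\<in>facet_data K. {x. n \<bullet> x < c})"
    by (rule open_INT[OF finite_facet_data[OF K]]) (auto simp: open_halfspace_lt)
  show "x \<in> (\<Inter>(n, c)\<in>facet_data K. {x. n \<bullet> x < c})"
    using strict by auto
  show "(\<Inter>(n, c)\<in>facet_data K. {x. n \<bullet> x < c}) \<subseteq> K"
    using polyhedron_facet_data(1)[OF K] by (auto intro: less_imp_le)
qed

text \<open>A relative interior point of one facet lying on a second would make the first a face of
  the second; having the same dimension, they would coincide.\<close>

lemma rel_interior_facet_strict:
  fixes K :: "'a::euclidean_space set"
  assumes K: "polyhedron K" "interior K \<noteq> {}" and p: "(n, c) \<in> facet_data K" "(n', c') \<in> facet_data K"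
    and ne: "(n, c) \<noteq> (n', c')" and x: "x \<in> rel_interior (K \<inter> {x. n \<bullet> x = c})"
  shows "n' \<bullet> x < c'"
proof (rule ccontr)
  let ?e = "K \<inter> {x. n \<bullet> x = c}" and ?e' = "K \<inter> {x. n' \<bullet> x = c'}"
  assume "\<not> n' \<bullet> x < c'"
  moreover have xK: "x \<in> K" using x rel_interior_subset by blast
  ultimately have "x \<in> ?e'" using facet_dataD(4)[OF p(2) xK] by simp
  moreover have f: "?e face_of K" "?e' face_of K" "aff_dim ?e = aff_dim K - 1" "aff_dim ?e' = aff_dim K - 1"
    using facet_dataD(5)[OF p(1)] facet_dataD(5)[OF p(2)] unfolding facet_of_def by auto
  ultimately have "?e \<subseteq> ?e'"
    using subset_of_face_of[OF f(2), of ?e] x by blast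
  then have "?e face_of ?e'"
    using f face_of_face[OF f(2)] by blast
  then have "?e = ?e'"
    using face_of_aff_dim_lt[of ?e' ?e] f face_of_imp_convex[OF f(2)] by auto
  then show False
    using facet_data_inj[OF K(2) p] ne by blast
qed

text \<open>At a relative interior point of a facet all other constraints are strict and remain so
  in a small ball, where the constraint of the facet itself decides.\<close>

lemma facet_inner_halfball:
  fixes K :: "'a::euclidean_space set"
  assumes K: "polyhedron K" "interior K \<noteq> {}" and p: "(n, c) \<in> facet_data K"
    and x: "x \<in> rel_interior (K \<inter> {x. n \<bullet> x = c})"
  obtains r where "r > 0" "\<And>z. z \<in> ball x r \<Longrightarrow> n \<bullet> z < c \<Longrightarrow> z \<in> interior K"
proof -
  let ?U = "\<Inter>(n', c')\<in>facet_data K - {(n, c)}. {x. n' \<bullet> x < c'}"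
  have "open ?U"
    by (rule open_INT) (use finite_facet_data[OF K] in \<open>auto simp: open_halfspace_lt\<close>)
  moreover have "x \<in> ?U"
    using rel_interior_facet_strict[OF K p _ _ x] by blast
  ultimately obtain r where r: "r > 0" "ball x r \<subseteq> ?U"
    by (meson openE)
  have "z \<in> interior K" if z: "z \<in> ball x r" "n \<bullet> z < c" for z
  proof (rule interior_polyhedron_facet_data[OF K])
    have "n' \<bullet> z < c'" if "(n', c') \<in> facet_data K" for n' c'
    proof (cases "(n', c') = (n, c)")
      case False
      then show ?thesis using r(2) z(1) that by blast
    qed (use z in simp)
    then show "\<forall>(n', c')\<in>facet_data K. n' \<bullet> z < c'" by blast
  qed
  then show ?thesis using that r(1) by blast
qed

definition hyperplane_proj :: "'a::euclidean_space \<Rightarrow> real \<Rightarrow> 'a \<Rightarrow> 'a" where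
  "hyperplane_proj n c x = x - (n \<bullet> x - c) *\<^sub>R n"

lemma inner_hyperplane_proj:
  assumes "norm n = 1"
  shows "n \<bullet> hyperplane_proj n c x = c"
  using assms unfolding hyperplane_proj_def by (simp add: inner_diff_right dot_square_norm)

text \<open>As a function of x, the inner product of n' with the projection has as linear part the
  component w of n' tangential to the hyperplane. If w is nonzero, the value c' is taken on a null
  set only; if w = 0, the function is constant, and the constant c' would make the two facets
  equal.\<close>

lemma AE_hyperplane_proj_off_facets:
  fixes K :: "'a::euclidean_space set"
  assumes K: "polyhedron K" "interior K \<noteq> {}" and p: "(n, c) \<in> facet_data K"
  shows "AE x in lebesgue. \<forall>(n', c')\<in>facet_data K - {(n, c)}. n' \<bullet> hyperplane_proj n c x \<noteq> c'"
proof -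
  have *: "AE x in lebesgue. n' \<bullet> hyperplane_proj n c x \<noteq> c'" if p': "(n', c') \<in> facet_data K" "(n', c') \<noteq> (n, c)" for n' c'
  proof -
    define w where "w = n' - (n' \<bullet> n) *\<^sub>R n"
    have eq: "n' \<bullet> hyperplane_proj n c x = w \<bullet> x + c * (n' \<bullet> n)" for x
      unfolding hyperplane_proj_def w_def
      by (simp add: inner_diff_left inner_diff_right algebra_simps inner_commute)
    show ?thesis
    proof (cases "w = 0")
      case False
      then have "negligible {x. w \<bullet> x = c' - c * (n' \<bullet> n)}"
        by (intro negligible_hyperplane) auto
      then have "AE x in lebesgue. x \<notin> {x. w \<bullet> x = c' - c * (n' \<bullet> n)}"
        unfolding negligible_iff_null_sets by (rule AE_not_in)
      then show ?thesis
        by eventually_elim (auto simp: eq)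
    next
      case True
      have "c * (n' \<bullet> n) \<noteq> c'"
      proof
        assume c': "c * (n' \<bullet> n) = c'"
        have n': "n' = (n' \<bullet> n) *\<^sub>R n" using True by (simp add: w_def)
        have "(n' \<bullet> n) \<noteq> 0" using n' facet_dataD(2)[OF p'(1)] by auto
        have "n' \<bullet> x = c' \<longleftrightarrow> n \<bullet> x = c" for x
        proof -
          have "n' \<bullet> x = (n' \<bullet> n) * (n \<bullet> x)"
            using arg_cong[OF n', of "\<lambda>z. z \<bullet> x"] by simp
          then show ?thesis
            using c' \<open>(n' \<bullet> n) \<noteq> 0\<close> by (auto simp: mult.commute)
        qed
        then have "K \<inter> {x. n \<bullet> x = c} = K \<inter> {x. n' \<bullet> x = c'}" by simp
        then show False
          using facet_data_inj[OF K(2) p p'(1)] p'(2) by blast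
      qed
      then show ?thesis by (simp add: eq True)
    qed
  qed
  then show ?thesis
  proof (intro AE_finite_allI)
    fix q assume "q \<in> facet_data K - {(n, c)}"
    then have "(fst q, snd q) \<in> facet_data K" "(fst q, snd q) \<noteq> (n, c)" by auto
    from *[OF this] show "AE x in lebesgue. case q of (n', c') \<Rightarrow> n' \<bullet> hyperplane_proj n c x \<noteq> c'"
      by (simp add: case_prod_beta)
  qed (use finite_facet_data[OF K] in simp)
qed

text \<open>With all other constraints strict at x, the points near x in the affine hull of the
  facet stay in \<open>K\<close>, since that hull lies in the hyperplane.\<close>

lemma rel_interior_facetI:
  fixes K :: "'a::euclidean_space set"
  assumes K: "polyhedron K" "interior K \<noteq> {}"
    and x: "x \<in> K" "n \<bullet> x = c" and off: "\<forall>(n', c')\<in>facet_data K - {(n, c)}. n' \<bullet> x \<noteq> c'"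
  shows "x \<in> rel_interior (K \<inter> {x. n \<bullet> x = c})"
proof -
  let ?U = "\<Inter>(n', c')\<in>facet_data K - {(n, c)}. {x. n' \<bullet> x < c'}"
  have "n' \<bullet> x < c'" if "(n', c') \<in> facet_data K - {(n, c)}" for n' c'
  proof -
    have "n' \<bullet> x \<le> c'" "n' \<bullet> x \<noteq> c'"
      using facet_dataD(4)[OF _ x(1), of n' c'] off that by auto
    then show ?thesis by simp
  qed
  then have "x \<in> ?U" by auto
  moreover have "open ?U"
    by (rule open_INT) (use finite_facet_data[OF K] in \<open>auto simp: open_halfspace_lt\<close>)
  moreover have "?U \<inter> affine hull (K \<inter> {x. n \<bullet> x = c}) \<subseteq> K \<inter> {x. n \<bullet> x = c}"
  proof
    fix z assume z: "z \<in> ?U \<inter> affine hull (K \<inter> {x. n \<bullet> x = c})"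
    have "affine hull (K \<inter> {x. n \<bullet> x = c}) \<subseteq> {x. n \<bullet> x = c}"
      by (rule hull_minimal) (auto simp: affine_hyperplane)
    then have nz: "n \<bullet> z = c" using z by blast
    have "n' \<bullet> z \<le> c'" if "(n', c') \<in> facet_data K" for n' c'
      by (cases "(n', c') = (n, c)") (use z nz that in \<open>auto intro: less_imp_le\<close>)
    then show "z \<in> K \<inter> {x. n \<bullet> x = c}"
      using polyhedron_facet_data(1)[OF K] nz by blast
  qed
  ultimately show ?thesis
    unfolding mem_rel_interior using x by blast
qed

section \<open>Simplicial meshes\<close>

locale domain_mesh =
  fixes \<Omega> :: "'a::euclidean_space set" and \<T> :: "'a set set"
  assumes domain: "polyhedral_domain \<Omega>" and mesh: "simplicial_mesh \<Omega> \<T>"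
begin

abbreviation "cells \<equiv> \<Union>K\<in>\<T>. interior K"

lemma finite_mesh: "finite \<T>"
  using mesh unfolding simplicial_mesh_def triangulation_def by blast

lemma cell_simplex: "K \<in> \<T> \<Longrightarrow> int DIM('a) simplex K"
  using mesh unfolding simplicial_mesh_def by blast

lemma face_of_cell: "K \<in> \<T> \<Longrightarrow> L \<in> \<T> \<Longrightarrow> (K \<inter> L) face_of K"
  using mesh unfolding simplicial_mesh_def triangulation_def by blast

lemma Union_mesh: "\<Union>\<T> = closure \<Omega>"
  using mesh unfolding simplicial_mesh_def by blast

lemma open_domain: "open \<Omega>"
  using domain unfolding polyhedral_domain_def by auto

lemma cell_compact: "K \<in> \<T> \<Longrightarrow> compact K"
  using cell_simplex compact_simplex by blast

lemma cell_convex: "K \<in> \<T> \<Longrightarrow> convex K"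
  using cell_simplex convex_simplex by blast

lemma cell_polyhedron: "K \<in> \<T> \<Longrightarrow> polyhedron K"
  using cell_simplex simplex_imp_polyhedron by blast

lemma cell_aff_dim: "K \<in> \<T> \<Longrightarrow> aff_dim K = int DIM('a)"
  using cell_simplex aff_dim_simplex by blast

lemma cell_interior_nonempty: "K \<in> \<T> \<Longrightarrow> interior K \<noteq> {}"
proof
  assume K: "K \<in> \<T>" and "interior K = {}"
  then obtain a b where ab: "a \<noteq> 0" "K \<subseteq> {x. a \<bullet> x = b}"
    using empty_interior_subset_hyperplane[OF cell_convex[OF K]] by blast
  then have "aff_dim K \<le> int DIM('a) - 1"
    using aff_dim_subset[OF ab(2)] by simp
  then show False
    using cell_aff_dim[OF K] by simp
qed

lemma compact_closure_domain: "compact (closure \<Omega>)"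
  using Union_mesh finite_mesh cell_compact by (metis compact_Union)

lemma bounded_domain: "bounded \<Omega>"
  using compact_closure_domain compact_imp_bounded bounded_subset closure_subset by blast

text \<open>The domain is the interior of a finite union of closed polytopes; its closure stays in
  that union and adds no interior point. This puts the open cells inside \<Omega>.\<close>

lemma interior_closure_domain: "interior (closure \<Omega>) = \<Omega>"
proof
  obtain P where P: "finite P" "\<And>p. p \<in> P \<Longrightarrow> polytope p" "\<Omega> = interior (\<Union>P)"
    using domain unfolding polyhedral_domain_def by blast
  have "closed (\<Union>P)"
    using P(1,2) by (intro closed_Union) (auto intro: polytope_imp_closed)
  then have "closure \<Omega> \<subseteq> \<Union>P"
    using P(3) closure_minimal interior_subset by metis
  then show "interior (closure \<Omega>) \<subseteq> \<Omega>"
    using P(3) interior_mono by metis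
  show "\<Omega> \<subseteq> interior (closure \<Omega>)"
    using open_domain closure_subset interior_maximal by blast
qed

lemma interior_cell_subset: "K \<in> \<T> \<Longrightarrow> interior K \<subseteq> \<Omega>"
  using interior_closure_domain Union_mesh interior_mono by (metis Union_upper)

lemma cells_subset: "cells \<subseteq> \<Omega>"
  using interior_cell_subset by blast

lemma open_cells: "open cells"
  by auto

lemma closure_interior_cell: "K \<in> \<T> \<Longrightarrow> closure (interior K) = K"
  using convex_closure_interior[OF cell_convex cell_interior_nonempty] cell_compact
  by (simp add: compact_imp_closed)

lemma negligible_skeleton: "negligible (closure \<Omega> - cells)"
proof (rule negligible_subset)
  show "negligible (\<Union>K\<in>\<T>. frontier K)"
    using finite_mesh cell_convex negligible_convex_frontier by (intro negligible_Union) auto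
  show "closure \<Omega> - cells \<subseteq> (\<Union>K\<in>\<T>. frontier K)"
    unfolding Union_mesh[symmetric] frontier_def using closure_subset by blast
qed

lemma AE_cells: "AE x in lebesgue. x \<in> closure \<Omega> \<longrightarrow> x \<in> cells"
proof -
  have "AE x in lebesgue. x \<notin> closure \<Omega> - cells"
    using negligible_skeleton unfolding negligible_iff_null_sets by (rule AE_not_in)
  then show ?thesis by eventually_elim auto
qed

text \<open>Cells meet in a common face, and a proper face misses the interior; used from both sides
  this gives K = L.\<close>

lemma interior_cells_meet:
  assumes "K \<in> \<T>" "L \<in> \<T>" "x \<in> interior K" "x \<in> L"
  shows "K = L"
proof -
  have "K \<inter> L = K"
  proof (rule ccontr)
    assume "K \<inter> L \<noteq> K"
    then have "(K \<inter> L) \<inter> interior K = {}"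
      by (rule face_of_disjoint_interior[OF face_of_cell[OF assms(1,2)]])
    then show False using assms(3,4) interior_subset by blast
  qed
  then have KL: "K \<subseteq> L" by blast
  then have "x \<in> interior L" using assms(3) interior_mono by blast
  have "L \<inter> K = L"
  proof (rule ccontr)
    assume "L \<inter> K \<noteq> L"
    then have "(L \<inter> K) \<inter> interior L = {}"
      by (rule face_of_disjoint_interior[OF face_of_cell[OF assms(2,1)]])
    then show False using \<open>x \<in> interior L\<close> assms(3) interior_subset KL by blast
  qed
  then show ?thesis using KL by blast
qed

lemma disjoint_cell_interiors: "disjoint (interior ` \<T>)"
  using interior_cells_meet interior_subset unfolding disjoint_def by fastforce

lemma interior_faceE:
  assumes "e \<in> interior_faces \<T>"
  obtains K L where "K \<in> \<T>" "L \<in> \<T>" "K \<noteq> L" "e = K \<inter> L" "e facet_of K" "e facet_of L"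
    "aff_dim e = int DIM('a) - 1" "e \<noteq> {}"
proof -
  obtain K L where KL: "e = K \<inter> L" "K \<in> \<T>" "L \<in> \<T>" "K \<noteq> L" "aff_dim (K \<inter> L) = int DIM('a) - 1"
    using assms unfolding interior_faces_def by blast
  have "aff_dim e \<ge> 0"
    using KL(1,5) by (simp add: DIM_positive Suc_leI)
  then have ne: "e \<noteq> {}" by auto
  have "e facet_of K" "e facet_of L"
    unfolding facet_of_def
    using face_of_cell[OF KL(2,3)] face_of_cell[OF KL(3,2)] ne KL cell_aff_dim by (auto simp: Int_commute)
  then show ?thesis using that KL ne by blast
qed

lemma finite_interior_faces: "finite (interior_faces \<T>)"
proof (rule finite_subset)
  show "interior_faces \<T> \<subseteq> (\<lambda>(K, L). K \<inter> L) ` (\<T> \<times> \<T>)"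
    unfolding interior_faces_def by auto
qed (use finite_mesh in simp)

text \<open>Dimension count: if e is a facet of a cell A different from \<open>K\<close>, then A
  \<inter> K is a proper face of A that contains the (d-1)-dimensional e, hence equals it.\<close>

lemma interior_face_facet:
  assumes e: "e \<in> interior_faces \<T>" and K: "K \<in> \<T>" "e \<subseteq> K"
  shows "e facet_of K"
proof -
  obtain A B where AB: "A \<in> \<T>" "B \<in> \<T>" "A \<noteq> B" "e = A \<inter> B" "e facet_of A" "aff_dim e = int DIM('a) - 1" "e \<noteq> {}"
    using interior_faceE[OF e] by metis
  show ?thesis
  proof (cases "K = A")
    case False
    have f: "(A \<inter> K) face_of A" "(K \<inter> A) face_of K"
      using face_of_cell AB K by blast+
    have "A \<inter> K \<noteq> A"
    proof
      assume "A \<inter> K = A"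
      then have "A = K"
        using interior_cells_meet[OF AB(1) K(1)] cell_interior_nonempty[OF AB(1)] interior_subset by blast
      then show False using False by simp
    qed
    then have "aff_dim (A \<inter> K) < aff_dim A"
      using face_of_aff_dim_lt[OF cell_convex[OF AB(1)] f(1)] by simp
    have "e face_of (A \<inter> K)"
      using AB(4,5) K(2) face_of_face[OF f(1)] unfolding facet_of_def by blast
    have "e = A \<inter> K"
    proof (rule ccontr)
      assume "e \<noteq> A \<inter> K"
      then have "aff_dim e < aff_dim (A \<inter> K)"
        using face_of_aff_dim_lt[OF face_of_imp_convex[OF f(1)] \<open>e face_of (A \<inter> K)\<close>] cell_convex[OF AB(1)] by blast
      then show False
        using \<open>aff_dim (A \<inter> K) < aff_dim A\<close> AB(6) cell_aff_dim[OF AB(1)] by simp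
    qed
    then show ?thesis
      unfolding facet_of_def using f(2) AB(6,7) cell_aff_dim[OF K(1)] by (simp add: Int_commute)
  qed (use AB in simp)
qed

text \<open>The relative interior point forces the whole facet into the face K \<inter> L, and the
  dimensions leave no room between them. Thus a facet that is not an interior face has no relative
  interior point in another cell.\<close>

lemma facet_of_two_cells:
  assumes "K \<in> \<T>" "L \<in> \<T>" "K \<noteq> L" "e facet_of K" "x \<in> rel_interior e" "x \<in> L"
  shows "e = K \<inter> L" "e \<in> interior_faces \<T>"
proof -
  have f: "(K \<inter> L) face_of K" using face_of_cell assms by blast
  have "e \<subseteq> K \<inter> L"
  proof (rule subset_of_face_of[OF f])
    show "e \<subseteq> K" using assms(4) facet_of_imp_subset by blast
    then show "K \<inter> L \<inter> rel_interior e \<noteq> {}"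
      using assms(5,6) rel_interior_subset by blast
  qed
  then have ef: "e face_of (K \<inter> L)"
    using face_of_face[OF f] assms(4) unfolding facet_of_def by blast
  have "K \<inter> L \<noteq> K"
    using interior_cells_meet[OF assms(1,2)] cell_interior_nonempty[OF assms(1)] interior_subset assms(3) by blast
  then have lt: "aff_dim (K \<inter> L) < aff_dim K"
    using face_of_aff_dim_lt[OF cell_convex[OF assms(1)] f] by simp
  have e: "aff_dim e = int DIM('a) - 1"
    using assms(4) cell_aff_dim[OF assms(1)] unfolding facet_of_def by simp
  show eq: "e = K \<inter> L"
  proof (rule ccontr)
    assume "e \<noteq> K \<inter> L"
    then have "aff_dim e < aff_dim (K \<inter> L)"
      using face_of_aff_dim_lt[OF face_of_imp_convex[OF f] ef] by blast
    then show False using lt e cell_aff_dim[OF assms(1)] by simp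
  qed
  show "e \<in> interior_faces \<T>"
    unfolding interior_faces_def using eq e assms(1-3) by blast
qed

end

section \<open>Orientation of the interior faces\<close>

locale oriented_mesh = domain_mesh \<Omega> \<T> for \<Omega> :: "'a::euclidean_space set" and \<T> +
  fixes \<nu> :: "'a set \<Rightarrow> 'a"
  assumes normals: "face_normals \<T> \<nu>"
begin

lemma interior_face_facet_data:
  assumes e: "e \<in> interior_faces \<T>" and K: "K \<in> \<T>" "e \<subseteq> K"
  obtains n c where "(n, c) \<in> facet_data K" "e = K \<inter> {x. n \<bullet> x = c}" "\<nu> e = n \<or> \<nu> e = - n"
proof -
  have f: "e facet_of K" by (rule interior_face_facet[OF assms])
  then obtain n c where nc: "(n, c) \<in> facet_data K" "e = K \<inter> {x. n \<bullet> x = c}"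
    using polyhedron_facet_data(2)[OF cell_polyhedron[OF K(1)] cell_interior_nonempty[OF K(1)]] by blast
  moreover have "\<nu> e = n \<or> \<nu> e = - n"
  proof (rule unit_normal_unique(1)[of e])
    show "aff_dim e = int DIM('a) - 1" "e \<noteq> {}"
      using f cell_aff_dim[OF K(1)] unfolding facet_of_def by auto
  qed (use nc e normals facet_dataD(1)[OF nc(1)] in \<open>auto simp: face_normals_def\<close>)
  ultimately show ?thesis using that by blast
qed

lemma norm_face_normal: "e \<in> interior_faces \<T> \<Longrightarrow> norm (\<nu> e) = 1"
  using normals unfolding face_normals_def by blast

text \<open>Two cells on the same side of e share a half ball at a relative interior point of
  e.\<close>

lemma outer_normal_unique_cell:
  assumes e: "e \<in> interior_faces \<T>" and K: "K \<in> \<T>" "e \<subseteq> K" and L: "L \<in> \<T>" "e \<subseteq> L"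
    and n: "(n, c) \<in> facet_data K" "(n, c') \<in> facet_data L"
    and eq: "e = K \<inter> {x. n \<bullet> x = c}" "e = L \<inter> {x. n \<bullet> x = c'}"
  shows "K = L"
proof -
  note PK = cell_polyhedron[OF K(1)] cell_interior_nonempty[OF K(1)]
  note PL = cell_polyhedron[OF L(1)] cell_interior_nonempty[OF L(1)]
  have f: "e facet_of K" by (rule interior_face_facet[OF e K])
  then have "e \<noteq> {}" unfolding facet_of_def by blast
  have "convex e"
    using f cell_convex[OF K(1)] face_of_imp_convex unfolding facet_of_def by blast
  then obtain x where x: "x \<in> rel_interior e"
    using \<open>e \<noteq> {}\<close> rel_interior_eq_empty by blast
  have "x \<in> e" using x rel_interior_subset by blast
  then have nx: "n \<bullet> x = c" "c' = c" using eq by auto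
  obtain r where r: "r > 0" "\<And>z. z \<in> ball x r \<Longrightarrow> n \<bullet> z < c \<Longrightarrow> z \<in> interior K"
    using facet_inner_halfball[OF PK n(1)] x eq(1) by metis
  obtain s where s: "s > 0" "\<And>z. z \<in> ball x s \<Longrightarrow> n \<bullet> z < c' \<Longrightarrow> z \<in> interior L"
    using facet_inner_halfball[OF PL n(2)] x eq(2) by metis
  \<comment> \<open>Half of the smaller radius inwards from x, so that z lies in both half
    balls.\<close>
  define z where "z = x - (min r s / 2) *\<^sub>R n"
  have "n \<bullet> z < c"
    using nx facet_dataD(3)[OF n(1)] r(1) s(1) by (simp add: z_def inner_diff_right)
  moreover have "dist x z = min r s / 2"
    using facet_dataD(1)[OF n(1)] r(1) s(1) by (simp add: z_def dist_norm)
  then have "z \<in> ball x r" "z \<in> ball x s"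
    using r(1) s(1) by auto
  ultimately have "z \<in> interior K" "z \<in> L"
    using r s nx interior_subset by auto
  then show ?thesis
    using interior_cells_meet[OF K(1) L(1)] by blast
qed

text \<open>This makes the descriptions \<open>cell_K\<close> and \<open>cell_L\<close> meaningful:
  a cell containing e has outer normal \<nu> or -\<nu> there, each sign occurs for at most one cell,
  and e lies in two distinct cells. In the proof the sign s = 1 stands for \<open>cell_K\<close> and
  s = -1 for \<open>cell_L\<close>.\<close>

lemma face_cells:
  assumes e: "e \<in> interior_faces \<T>"
  shows "cell_K \<T> \<nu> e \<in> \<T>" "cell_L \<T> \<nu> e \<in> \<T>" "e \<subseteq> cell_K \<T> \<nu> e" "e \<subseteq> cell_L \<T> \<nu> e"
    "cell_K \<T> \<nu> e \<noteq> cell_L \<T> \<nu> e" "e = cell_K \<T> \<nu> e \<inter> cell_L \<T> \<nu> e"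
    "\<exists>c. (\<nu> e, c) \<in> facet_data (cell_K \<T> \<nu> e) \<and> e = cell_K \<T> \<nu> e \<inter> {x. \<nu> e \<bullet> x = c}"
    "\<exists>c. (- \<nu> e, c) \<in> facet_data (cell_L \<T> \<nu> e) \<and> e = cell_L \<T> \<nu> e \<inter> {x. - \<nu> e \<bullet> x = c}"
    "K \<in> \<T> \<Longrightarrow> e \<subseteq> K \<Longrightarrow> K = cell_K \<T> \<nu> e \<or> K = cell_L \<T> \<nu> e"
proof -
  let ?out = "\<lambda>s K. \<exists>c. (s *\<^sub>R \<nu> e, c) \<in> facet_data K \<and> e = K \<inter> {x. (s *\<^sub>R \<nu> e) \<bullet> x = c}"
  have cases: "?out 1 K \<or> ?out (-1) K" if K: "K \<in> \<T>" "e \<subseteq> K" for K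
  proof -
    obtain n c where "(n, c) \<in> facet_data K" "e = K \<inter> {x. n \<bullet> x = c}" "\<nu> e = n \<or> \<nu> e = - n"
      using interior_face_facet_data[OF e K] by metis
    then show ?thesis by auto
  qed
  have uniq: "K = L" if "K \<in> \<T>" "e \<subseteq> K" "?out s K" "L \<in> \<T>" "e \<subseteq> L" "?out s L" for K L s
    using outer_normal_unique_cell[OF e that(1,2,4,5)] that(3,6) by blast
  \<comment> \<open>The one-sided condition of the descriptions says that the outer normal is s
    \<nu>; with the opposite normal the cell would lie in the hyperplane of e.\<close>
  have side: "(\<forall>x\<in>K. \<forall>y\<in>e. (x - y) \<bullet> (s *\<^sub>R \<nu> e) \<le> 0) \<longleftrightarrow> ?out s K"
    if K: "K \<in> \<T>" "e \<subseteq> K" and s: "s = 1 \<or> s = -1" for K s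
  proof
    assume "?out s K"
    then obtain c where "(s *\<^sub>R \<nu> e, c) \<in> facet_data K" "e = K \<inter> {x. (s *\<^sub>R \<nu> e) \<bullet> x = c}" by blast
    note c = this
    show "\<forall>x\<in>K. \<forall>y\<in>e. (x - y) \<bullet> (s *\<^sub>R \<nu> e) \<le> 0"
    proof (intro ballI)
      fix x y assume "x \<in> K" "y \<in> e"
      then have "(s *\<^sub>R \<nu> e) \<bullet> x \<le> c" "(s *\<^sub>R \<nu> e) \<bullet> y = c"
        using facet_dataD(4)[OF c(1)] c(2) by blast+
      then show "(x - y) \<bullet> (s *\<^sub>R \<nu> e) \<le> 0"
        unfolding inner_commute[of "x - y"] inner_diff_right by linarith
    qed
  next
    assume le: "\<forall>x\<in>K. \<forall>y\<in>e. (x - y) \<bullet> (s *\<^sub>R \<nu> e) \<le> 0"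
    show "?out s K"
    proof (rule ccontr)
      assume "\<not> ?out s K"
      then have "?out (- s) K" using cases[OF K] s by auto
      then obtain c where c: "((- s) *\<^sub>R \<nu> e, c) \<in> facet_data K" "e = K \<inter> {x. ((- s) *\<^sub>R \<nu> e) \<bullet> x = c}" by blast
      have "e \<noteq> {}" using interior_faceE[OF e] by metis
      then obtain y where y: "y \<in> e" by blast
      have "K \<subseteq> {x. ((- s) *\<^sub>R \<nu> e) \<bullet> x = c}"
      proof
        fix x assume x: "x \<in> K"
        have "((- s) *\<^sub>R \<nu> e) \<bullet> x \<le> c" by (rule facet_dataD(4)[OF c(1) x])
        moreover have "((- s) *\<^sub>R \<nu> e) \<bullet> y = c" using y c(2) by blast
        moreover have "(x - y) \<bullet> (s *\<^sub>R \<nu> e) \<le> 0" using le x y by blast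
        ultimately show "x \<in> {x. ((- s) *\<^sub>R \<nu> e) \<bullet> x = c}"
          by (simp add: inner_diff_left inner_commute algebra_simps)
      qed
      then show False
        using interior_not_subset_hyperplane[OF cell_interior_nonempty[OF K(1)] facet_dataD(2)[OF c(1)]] by blast
    qed
  qed
  obtain A B where AB: "A \<in> \<T>" "B \<in> \<T>" "A \<noteq> B" "e = A \<inter> B"
    using interior_faceE[OF e] by metis
  then have sub: "e \<subseteq> A" "e \<subseteq> B" by auto
  obtain K L where KL: "K \<in> \<T>" "L \<in> \<T>" "e = K \<inter> L" "K \<noteq> L" "?out 1 K" "?out (-1) L"
  proof (cases "?out 1 A")
    case True
    then have "\<not> ?out 1 B" using uniq[OF AB(1) sub(1) _ AB(2) sub(2)] AB(3) by blast
    then have "?out (-1) B" using cases[OF AB(2) sub(2)] by blast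
    then show ?thesis using that[of A B] AB True by blast
  next
    case False
    then have A: "?out (-1) A" using cases[OF AB(1) sub(1)] by blast
    then have "\<not> ?out (-1) B" using uniq[OF AB(1) sub(1) _ AB(2) sub(2)] AB(3) by blast
    then have "?out 1 B" using cases[OF AB(2) sub(2)] by blast
    then show ?thesis using that[of B A] AB A by (auto simp: Int_commute)
  qed
  have KLs: "e \<subseteq> K" "e \<subseteq> L" using KL(3) by auto
  have K: "cell_K \<T> \<nu> e = K"
    unfolding cell_K_def
  proof (rule the_equality)
    show "K \<in> \<T> \<and> e \<subseteq> K \<and> (\<forall>x\<in>K. \<forall>y\<in>e. (x - y) \<bullet> \<nu> e \<le> 0)"
      using side[OF KL(1) KLs(1), of 1] KL(1,5) KLs(1) by simp
    fix K' assume "K' \<in> \<T> \<and> e \<subseteq> K' \<and> (\<forall>x\<in>K'. \<forall>y\<in>e. (x - y) \<bullet> \<nu> e \<le> 0)"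
    then have K': "K' \<in> \<T>" "e \<subseteq> K'" and "?out 1 K'"
      using side[of K' 1] by auto
    then show "K' = K" using uniq[OF K' _ KL(1) KLs(1) KL(5)] by blast
  qed
  have L: "cell_L \<T> \<nu> e = L"
    unfolding cell_L_def
  proof (rule the_equality)
    show "L \<in> \<T> \<and> e \<subseteq> L \<and> (\<forall>x\<in>L. \<forall>y\<in>e. (x - y) \<bullet> \<nu> e \<ge> 0)"
      using side[OF KL(2) KLs(2), of "-1"] KL(2,6) KLs(2) by simp
    fix L' assume "L' \<in> \<T> \<and> e \<subseteq> L' \<and> (\<forall>x\<in>L'. \<forall>y\<in>e. (x - y) \<bullet> \<nu> e \<ge> 0)"
    then have L': "L' \<in> \<T>" "e \<subseteq> L'" and "?out (-1) L'"
      using side[of L' "-1"] by auto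
    then show "L' = L" using uniq[OF L' _ KL(2) KLs(2) KL(6)] by blast
  qed
  show "cell_K \<T> \<nu> e \<in> \<T>" "cell_L \<T> \<nu> e \<in> \<T>" "e \<subseteq> cell_K \<T> \<nu> e" "e \<subseteq> cell_L \<T> \<nu> e"
    "cell_K \<T> \<nu> e \<noteq> cell_L \<T> \<nu> e" "e = cell_K \<T> \<nu> e \<inter> cell_L \<T> \<nu> e"
    "\<exists>c. (\<nu> e, c) \<in> facet_data (cell_K \<T> \<nu> e) \<and> e = cell_K \<T> \<nu> e \<inter> {x. \<nu> e \<bullet> x = c}"
    "\<exists>c. (- \<nu> e, c) \<in> facet_data (cell_L \<T> \<nu> e) \<and> e = cell_L \<T> \<nu> e \<inter> {x. - \<nu> e \<bullet> x = c}"
    unfolding K L using KL KLs by simp_all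
  show "K' = cell_K \<T> \<nu> e \<or> K' = cell_L \<T> \<nu> e" if K': "K' \<in> \<T>" "e \<subseteq> K'" for K'
    unfolding K L using cases[OF K'] uniq[OF K' _ KL(1) KLs(1) KL(5)] uniq[OF K' _ KL(2) KLs(2) KL(6)] by blast
qed

end

section \<open>The divergence theorem on a cell\<close>

text \<open>The slab of height 1 consists of N translates of the thin layer. Adding up N equal
  integrals amounts to moving each point of the slab down by the number of full layers below it,
  which is the ceiling minus 1. Up to a null set the slab is the one behind
  \<open>hyperplane_measure\<close>.\<close>

lemma layer_integral:
  fixes g :: "'a::euclidean_space \<Rightarrow> real"
  assumes n: "norm n = 1" and N: "N > 0" and g: "g \<in> borel_measurable borel"
    and int: "integrable lebesgue (\<lambda>x. indicator {x. 0 < n \<bullet> x - c \<and> n \<bullet> x - c \<le> 1 / real N} x * g x)"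
  shows "(LINT x|lebesgue. indicator {x. 0 < n \<bullet> x - c \<and> n \<bullet> x - c \<le> 1 / real N} x * (real N * g x)) =
    (LINT x|lebesgue. indicator {x. 0 < n \<bullet> x - c \<and> n \<bullet> x - c \<le> 1} x *
      g (x - ((real_of_int \<lceil>real N * (n \<bullet> x - c)\<rceil> - 1) / real N) *\<^sub>R n))"
proof -
  define s where "s x = n \<bullet> x - c" for x
  define f0 where "f0 x = indicator {x. 0 < s x \<and> s x \<le> 1 / real N} x * g x" for x
  define f where "f k x = f0 (- ((real k / real N) *\<^sub>R n) + x)" for k x
  have nn: "n \<bullet> n = 1" using n by (simp add: dot_square_norm)
  have [measurable]: "f0 \<in> borel_measurable borel"
    unfolding f0_def s_def using g by measurable
  have i0: "integrable lebesgue f0"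
    using int unfolding f0_def s_def .
  have "integrable lebesgue (f k)" for k
    using lebesgue_integrable_translate[of f0 "- ((real k / real N) *\<^sub>R n)"] i0 unfolding f_def by simp
  then have "(LINT x|lebesgue. (\<Sum>k<N. f k x)) = (\<Sum>k<N. LINT x|lebesgue. f k x)"
    by (intro Bochner_Integration.integral_sum)
  also have "\<dots> = (\<Sum>k<N. LINT x|lebesgue. f0 x)"
    unfolding f_def by (intro sum.cong refl lebesgue_integral_translate) measurable
  also have "\<dots> = (LINT x|lebesgue. real N * f0 x)"
    by simp
  also have "\<dots> = (LINT x|lebesgue. indicator {x. 0 < s x \<and> s x \<le> 1 / real N} x * (real N * g x))"
    by (intro Bochner_Integration.integral_cong) (auto simp: f0_def)
  finally have eq: "(LINT x|lebesgue. indicator {x. 0 < s x \<and> s x \<le> 1 / real N} x * (real N * g x)) = (LINT x|lebesgue. (\<Sum>k<N. f k x))" ..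
  have "(\<Sum>k<N. f k x) = indicator {x. 0 < s x \<and> s x \<le> 1} x * g (x - ((real_of_int \<lceil>real N * s x\<rceil> - 1) / real N) *\<^sub>R n)" for x
  proof -
    \<comment> \<open>Index of the layer containing x; the ceiling fits layers that are open below
      and closed above.\<close>
    define m where "m = \<lceil>real N * s x\<rceil> - 1"
    have shift: "s (x - (real k / real N) *\<^sub>R n) = s x - real k / real N" for k
      by (simp add: s_def inner_diff_right nn)
    have iff: "0 < s x - real k / real N \<and> s x - real k / real N \<le> 1 / real N \<longleftrightarrow> int k = m" for k
    proof -
      have "int k = m \<longleftrightarrow> \<lceil>real N * s x\<rceil> = int k + 1" by (auto simp: m_def)
      also have "\<dots> \<longleftrightarrow> real k < real N * s x \<and> real N * s x \<le> real k + 1"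
        by (simp add: ceiling_eq_iff)
      also have "real k < real N * s x \<longleftrightarrow> 0 < s x - real k / real N"
        using N by (simp add: pos_divide_less_eq mult.commute)
      also have "real N * s x \<le> real k + 1 \<longleftrightarrow> s x \<le> (real k + 1) / real N"
        using N by (simp add: pos_le_divide_eq mult.commute)
      also have "\<dots> \<longleftrightarrow> s x - real k / real N \<le> 1 / real N"
        by (auto simp: add_divide_distrib)
      finally show ?thesis ..
    qed
    have fk: "f k x = (if int k = m then g (x - (real k / real N) *\<^sub>R n) else 0)" for k
      unfolding f_def f0_def using iff[of k] by (simp add: shift indicator_def)
    have range: "0 < s x \<and> s x \<le> 1 \<longleftrightarrow> 0 \<le> m \<and> m < int N"
    proof -
      have "0 \<le> m \<longleftrightarrow> 0 < real N * s x"
        unfolding m_def by linarith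
      moreover have "m < int N \<longleftrightarrow> real N * s x \<le> real N"
        unfolding m_def by linarith
      ultimately show ?thesis
        using N by (simp add: zero_less_mult_iff)
    qed
    show ?thesis
    proof (cases "0 \<le> m \<and> m < int N")
      case True
      then have m: "m = int (nat m)" "nat m < N" by auto
      have "(\<Sum>k<N. f k x) = (\<Sum>k<N. if k = nat m then g (x - (real k / real N) *\<^sub>R n) else 0)"
        unfolding fk using m by (intro sum.cong refl if_cong) auto
      also have "\<dots> = g (x - (real (nat m) / real N) *\<^sub>R n)"
        using m(2) by simp
      also have "real (nat m) = real_of_int \<lceil>real N * s x\<rceil> - 1"
        using True unfolding m_def by simp
      finally show ?thesis
        using True range by simp
    next
      case False
      then have "f k x = 0" if "k < N" for k
        unfolding fk using that by auto
      then show ?thesis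
        using False range by simp
    qed
  qed
  then show ?thesis
    using eq unfolding s_def by simp
qed

lemma set_integrable_sum_finite:
  fixes f :: "'i \<Rightarrow> 'a \<Rightarrow> 'b::euclidean_space"
  assumes "\<And>i. i \<in> I \<Longrightarrow> set_integrable M S (f i)"
  shows "set_integrable M S (\<lambda>x. \<Sum>i\<in>I. f i x)"
  using assms unfolding set_integrable_def scaleR_sum_right
  by (intro Bochner_Integration.integrable_sum)

lemma set_lint_sum:
  fixes f :: "'i \<Rightarrow> 'a \<Rightarrow> 'b::euclidean_space"
  assumes "\<And>i. i \<in> I \<Longrightarrow> set_integrable M S (f i)"
  shows "(LINT x:S|M. (\<Sum>i\<in>I. f i x)) = (\<Sum>i\<in>I. LINT x:S|M. f i x)"
  using assms unfolding set_integrable_def set_lebesgue_integral_def scaleR_sum_right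
  by (intro Bochner_Integration.integral_sum)

lemma AE_not_in_hyperplane:
  fixes n :: "'a::euclidean_space"
  assumes "n \<noteq> 0"
  shows "AE x in lebesgue. n \<bullet> x \<noteq> r"
proof -
  have "negligible {x. n \<bullet> x = r}"
    using assms by (intro negligible_hyperplane) auto
  then have "AE x in lebesgue. x \<notin> {x. n \<bullet> x = r}"
    unfolding negligible_iff_null_sets by (rule AE_not_in)
  then show ?thesis by eventually_elim auto
qed

section \<open>Lipschitz cutoffs of a polyhedron\<close>

definition ramp :: "real \<Rightarrow> real" where "ramp t = max 0 (min 1 (1 - t))"

lemma ramp_bounds: "0 \<le> ramp t" "ramp t \<le> 1" "\<bar>ramp t\<bar> \<le> 1"
  by (auto simp: ramp_def)

lemma ramp_eq: "t \<le> 0 \<Longrightarrow> ramp t = 1" "t \<ge> 1 \<Longrightarrow> ramp t = 0"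
  by (auto simp: ramp_def)

lemma ramp_lipschitz: "\<bar>ramp s - ramp t\<bar> \<le> \<bar>s - t\<bar>"
  unfolding ramp_def by (auto simp: max_def min_def abs_if)

lemma continuous_on_ramp [continuous_intros]:
  "continuous_on S f \<Longrightarrow> continuous_on S (\<lambda>x. ramp (f x))"
  unfolding ramp_def by (intro continuous_intros)

text \<open>The derivative is written with the half-open condition 0 < t \<le> 1 to match the layers
  of \<open>layer_integral\<close>; the kinks themselves are excluded.\<close>

lemma DERIV_ramp:
  assumes "t \<noteq> 0" "t \<noteq> 1"
  shows "(ramp has_real_derivative (if 0 < t \<and> t \<le> 1 then - 1 else 0)) (at t)"
proof -
  consider "t < 0" | "0 < t" "t < 1" | "t > 1" using assms by linarith
  then show ?thesis
  proof cases
    case 1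
    have "((\<lambda>_. 1) has_real_derivative 0) (at t)" by simp
    then have "(ramp has_real_derivative 0) (at t)"
      by (rule has_field_derivative_transform_within_open[of _ _ _ "{..<0}"]) (use 1 in \<open>auto simp: ramp_def\<close>)
    with 1 show ?thesis by simp
  next
    case 2
    have "((\<lambda>t. 1 - t) has_real_derivative - 1) (at t)" by (auto intro!: derivative_eq_intros)
    then have "(ramp has_real_derivative - 1) (at t)"
      by (rule has_field_derivative_transform_within_open[of _ _ _ "{0<..<1}"]) (use 2 in \<open>auto simp: ramp_def\<close>)
    with 2 show ?thesis by simp
  next
    case 3
    have "((\<lambda>_. 0) has_real_derivative 0) (at t)" by simp
    then have "(ramp has_real_derivative 0) (at t)"
      by (rule has_field_derivative_transform_within_open[of _ _ _ "{1<..}"]) (use 3 in \<open>auto simp: ramp_def\<close>)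
    with 3 show ?thesis by simp
  qed
qed

text \<open>The cutoff equals 1 on the polyhedron described by \<open>F\<close> and falls off in a layer of width
  \<open>1 / N\<close> outside of it.\<close>

definition cutoff :: "('a::euclidean_space \<times> real) set \<Rightarrow> real \<Rightarrow> 'a \<Rightarrow> real" where
  "cutoff F N x = (\<Prod>p\<in>F. ramp (N * (fst p \<bullet> x - snd p)))"

text \<open>Multiplied by the normal, this is the contribution of the facet p to the negative
  gradient of \<open>cutoff\<close>: in its layer the ramp of p has slope -N, and the other factors
  are left undifferentiated.\<close>

definition cutoff_layer :: "('a::euclidean_space \<times> real) set \<Rightarrow> real \<Rightarrow> 'a \<times> real \<Rightarrow> 'a \<Rightarrow> real" where
  "cutoff_layer F N p x = indicator {x. 0 < N * (fst p \<bullet> x - snd p) \<and> N * (fst p \<bullet> x - snd p) \<le> 1} x * (N * cutoff (F - {p}) N x)"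

lemma cutoff_bounds: "0 \<le> cutoff F N x" "cutoff F N x \<le> 1" "\<bar>cutoff F N x\<bar> \<le> 1"
proof -
  show "0 \<le> cutoff F N x" unfolding cutoff_def by (intro prod_nonneg) (auto intro: ramp_bounds)
  show "cutoff F N x \<le> 1" unfolding cutoff_def by (intro prod_le_1) (auto intro: ramp_bounds)
  with \<open>0 \<le> cutoff F N x\<close> show "\<bar>cutoff F N x\<bar> \<le> 1" by simp
qed

lemma continuous_on_cutoff: "continuous_on S (cutoff F N)"
  unfolding cutoff_def by (intro continuous_intros)

text \<open>All factors lie in [0, 1], so the product varies at most by the sum of their
  variations.\<close>

lemma cutoff_lipschitz:
  fixes F :: "('a::euclidean_space \<times> real) set"
  assumes "\<And>p. p \<in> F \<Longrightarrow> norm (fst p) = 1" "N \<ge> 0"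
  shows "\<bar>cutoff F N x - cutoff F N y\<bar> \<le> (real (card F) * N) * norm (x - y)"
proof -
  have "norm (cutoff F N x - cutoff F N y) \<le> (\<Sum>p\<in>F. norm (ramp (N * (fst p \<bullet> x - snd p)) - ramp (N * (fst p \<bullet> y - snd p))))"
    unfolding cutoff_def by (rule norm_prod_diff) (auto intro: ramp_bounds)
  also have "\<dots> \<le> (\<Sum>p\<in>F. N * norm (x - y))"
  proof (rule sum_mono)
    fix p assume p: "p \<in> F"
    have "\<bar>ramp (N * (fst p \<bullet> x - snd p)) - ramp (N * (fst p \<bullet> y - snd p))\<bar> \<le> \<bar>N * (fst p \<bullet> x - snd p) - N * (fst p \<bullet> y - snd p)\<bar>"
      by (rule ramp_lipschitz)
    also have "\<dots> = N * \<bar>fst p \<bullet> (x - y)\<bar>"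
      using assms(2) by (simp add: inner_diff_right abs_mult flip: right_diff_distrib)
    also have "\<dots> \<le> N * norm (x - y)"
      using Cauchy_Schwarz_ineq2[of "fst p" "x - y"] assms p by (simp add: mult_left_mono)
    finally show "norm (ramp (N * (fst p \<bullet> x - snd p)) - ramp (N * (fst p \<bullet> y - snd p))) \<le> N * norm (x - y)"
      by simp
  qed
  finally show ?thesis by (simp add: mult.assoc)
qed

text \<open>A ramp has kinks only where its argument is 0 or 1, that is on finitely many hyperplanes
  in total; elsewhere the product rule applies along the line through x.\<close>

lemma AE_cutoff_directional_derivative:
  fixes F :: "('a::euclidean_space \<times> real) set"
  assumes F: "finite F" "\<And>p. p \<in> F \<Longrightarrow> norm (fst p) = 1" and N: "N > 0"
  shows "AE x in lebesgue. ((\<lambda>t. (cutoff F N (x + t *\<^sub>R v) - cutoff F N x) / t) \<longlongrightarrow>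
    - (\<Sum>p\<in>F. (fst p \<bullet> v) * cutoff_layer F N p x)) (at 0)"
proof -
  have "AE x in lebesgue. \<forall>p\<in>F. fst p \<bullet> x \<noteq> snd p \<and> fst p \<bullet> x \<noteq> snd p + 1 / N"
  proof (rule AE_finite_allI[OF F(1)])
    fix p assume "p \<in> F"
    then have "fst p \<noteq> 0" using F(2)[of p] by auto
    then show "AE x in lebesgue. fst p \<bullet> x \<noteq> snd p \<and> fst p \<bullet> x \<noteq> snd p + 1 / N"
      by (intro AE_conjI AE_not_in_hyperplane)
  qed
  then show ?thesis
  proof eventually_elim
    fix x assume x: "\<forall>p\<in>F. fst p \<bullet> x \<noteq> snd p \<and> fst p \<bullet> x \<noteq> snd p + 1 / N"
    define h where "h p = N * (fst p \<bullet> x - snd p)" for p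
    define D where "D p = (if 0 < h p \<and> h p \<le> 1 then - 1 else 0) * (N * (fst p \<bullet> v))" for p
    have d: "((\<lambda>t. ramp (N * (fst p \<bullet> (x + t *\<^sub>R v) - snd p))) has_derivative (\<lambda>t. t * D p)) (at 0)" if p: "p \<in> F" for p
    proof -
      have "h p \<noteq> 0" "h p \<noteq> 1"
        using x p N by (auto simp: h_def field_simps)
      then have r: "(ramp has_real_derivative (if 0 < h p \<and> h p \<le> 1 then - 1 else 0)) (at (h p))"
        by (rule DERIV_ramp)
      have h0: "N * (fst p \<bullet> (x + 0 *\<^sub>R v) - snd p) = h p"
        by (simp add: h_def)
      have i: "((\<lambda>t. N * (fst p \<bullet> (x + t *\<^sub>R v) - snd p)) has_real_derivative N * (fst p \<bullet> v)) (at 0)"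
        by (auto intro!: derivative_eq_intros simp: inner_add_right)
      have "((\<lambda>t. ramp (N * (fst p \<bullet> (x + t *\<^sub>R v) - snd p))) has_real_derivative D p) (at 0)"
        unfolding D_def by (rule DERIV_chain2[OF _ i]) (use r h0 in simp)
      then have "((\<lambda>t. ramp (N * (fst p \<bullet> (x + t *\<^sub>R v) - snd p))) has_derivative (*) (D p)) (at 0)"
        unfolding has_field_derivative_def .
      then show ?thesis
        by (rule has_derivative_eq_rhs) (simp add: fun_eq_iff)
    qed
    have "((\<lambda>t. cutoff F N (x + t *\<^sub>R v)) has_derivative
        (\<lambda>t. \<Sum>p\<in>F. (t * D p) * (\<Prod>q\<in>F - {p}. ramp (N * (fst q \<bullet> (x + 0 *\<^sub>R v) - snd q))))) (at 0)"
      unfolding cutoff_def by (rule has_derivative_prod[OF d])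
    then have "((\<lambda>t. cutoff F N (x + t *\<^sub>R v)) has_derivative (*) (- (\<Sum>p\<in>F. (fst p \<bullet> v) * cutoff_layer F N p x))) (at 0)"
    proof (rule has_derivative_eq_rhs)
      show "(\<lambda>t. \<Sum>p\<in>F. (t * D p) * (\<Prod>q\<in>F - {p}. ramp (N * (fst q \<bullet> (x + 0 *\<^sub>R v) - snd q)))) =
          (*) (- (\<Sum>p\<in>F. (fst p \<bullet> v) * cutoff_layer F N p x))"
        unfolding fun_eq_iff sum_negf[symmetric] sum_distrib_right
        by (intro allI sum.cong refl) (auto simp: D_def h_def cutoff_layer_def cutoff_def indicator_def)
    qed
    then have "((\<lambda>t. cutoff F N (x + t *\<^sub>R v)) has_real_derivative - (\<Sum>p\<in>F. (fst p \<bullet> v) * cutoff_layer F N p x)) (at 0)"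
      unfolding has_field_derivative_def .
    then show "((\<lambda>t. (cutoff F N (x + t *\<^sub>R v) - cutoff F N x) / t) \<longlongrightarrow>
        - (\<Sum>p\<in>F. (fst p \<bullet> v) * cutoff_layer F N p x)) (at 0)"
      unfolding DERIV_def by simp
  qed
qed

lemma cutoff_layer_bounds:
  assumes "N \<ge> 0" shows "0 \<le> cutoff_layer F N p x" "\<bar>cutoff_layer F N p x\<bar> \<le> N"
proof -
  show nn: "0 \<le> cutoff_layer F N p x"
    unfolding cutoff_layer_def using assms cutoff_bounds(1) by (auto intro!: mult_nonneg_nonneg)
  have "cutoff_layer F N p x \<le> N"
    unfolding cutoff_layer_def using assms cutoff_bounds(2)[of "F - {p}" N x] cutoff_bounds(1)[of "F - {p}" N x]
    by (auto simp: indicator_def intro: mult_left_le)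
  then show "\<bar>cutoff_layer F N p x\<bar> \<le> N" using nn by simp
qed

lemma measurable_cutoff [measurable]: "cutoff F N \<in> borel_measurable borel"
  by (intro borel_measurable_continuous_onI continuous_on_cutoff)

lemma measurable_cutoff_layer [measurable]: "cutoff_layer F N p \<in> borel_measurable borel"
  unfolding cutoff_layer_def by measurable

lemma eventually_le_Suc_mult:
  assumes "d > 0"
  shows "\<forall>\<^sub>F N in sequentially. r \<le> real (Suc N) * d"
proof -
  obtain N0 where N0: "r / d \<le> real N0" using real_arch_simple by blast
  have "r \<le> real (Suc N) * d" if "N0 \<le> N" for N
  proof -
    have "r / d \<le> real (Suc N)" using N0 that by simp
    then show ?thesis using assms by (simp add: field_simps)
  qed
  then show ?thesis by (rule eventually_sequentiallyI)
qed

text \<open>The integrand depends on the projection only, so translation by the normal carries the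
  slab on one side of the hyperplane to the slab on the other. Thus both cells at a face see the
  same face integral; open and closed ends differ by null hyperplanes.\<close>

lemma lebesgue_integral_layer_flip:
  fixes \<phi> :: "'a::euclidean_space \<Rightarrow> real"
  assumes n: "norm n = 1" and m: "\<phi> \<in> borel_measurable borel"
  shows "(LINT x|lebesgue. indicator {x. 0 < n \<bullet> x - c \<and> n \<bullet> x - c \<le> 1} x * \<phi> (hyperplane_proj n c x)) =
      (LINT x|lebesgue. indicator {x. 0 \<le> n \<bullet> x - c \<and> n \<bullet> x - c \<le> 1} x * \<phi> (hyperplane_proj n c x))"
    "(LINT x|lebesgue. indicator {x. 0 < (- n) \<bullet> x - (- c) \<and> (- n) \<bullet> x - (- c) \<le> 1} x * \<phi> (hyperplane_proj (- n) (- c) x)) =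
      (LINT x|lebesgue. indicator {x. 0 \<le> n \<bullet> x - c \<and> n \<bullet> x - c \<le> 1} x * \<phi> (hyperplane_proj n c x))"
proof -
  have n0: "n \<noteq> 0" using n by auto
  have nn: "n \<bullet> n = 1" using n by (simp add: dot_square_norm)
  have pm [measurable]: "hyperplane_proj n c \<in> borel_measurable borel"
    unfolding hyperplane_proj_def by measurable
  have pn: "hyperplane_proj (- n) (- c) x = hyperplane_proj n c x" for x
    unfolding hyperplane_proj_def by (simp add: algebra_simps)
  note [measurable] = m
  show "(LINT x|lebesgue. indicator {x. 0 < n \<bullet> x - c \<and> n \<bullet> x - c \<le> 1} x * \<phi> (hyperplane_proj n c x)) =
      (LINT x|lebesgue. indicator {x. 0 \<le> n \<bullet> x - c \<and> n \<bullet> x - c \<le> 1} x * \<phi> (hyperplane_proj n c x))"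
    using AE_not_in_hyperplane[OF n0, of c]
    by (intro lebesgue_integral_cong_AE) (auto elim!: eventually_mono simp: indicator_def)
  define G where "G x = indicator {x. 0 < (- n) \<bullet> x - (- c) \<and> (- n) \<bullet> x - (- c) \<le> 1} x * \<phi> (hyperplane_proj n c x)" for x
  have [measurable]: "G \<in> borel_measurable borel"
    unfolding G_def by measurable
  have tr: "hyperplane_proj n c (x - n) = hyperplane_proj n c x" for x
    unfolding hyperplane_proj_def by (simp add: inner_diff_right nn algebra_simps)
  have "(LINT x|lebesgue. G x) = (LINT x|lebesgue. G (- n + x))"
    by (rule lebesgue_integral_translate[symmetric]) measurable
  also have "\<dots> = (LINT x|lebesgue. indicator {x. 0 \<le> n \<bullet> x - c \<and> n \<bullet> x - c \<le> 1} x * \<phi> (hyperplane_proj n c x))"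
    using AE_not_in_hyperplane[OF n0, of "c + 1"]
    by (intro lebesgue_integral_cong_AE) (auto elim!: eventually_mono simp: indicator_def G_def tr inner_diff_right nn)
  finally show "(LINT x|lebesgue. indicator {x. 0 < (- n) \<bullet> x - (- c) \<and> (- n) \<bullet> x - (- c) \<le> 1} x * \<phi> (hyperplane_proj (- n) (- c) x)) =
      (LINT x|lebesgue. indicator {x. 0 \<le> n \<bullet> x - c \<and> n \<bullet> x - c \<le> 1} x * \<phi> (hyperplane_proj n c x))"
    unfolding G_def pn .
qed

text \<open>All points of e have the same offset c, so it stands in for the base point selected in
  \<open>face_int\<close>.\<close>

lemma face_int_eq_layer_integral:
  fixes e :: "'a::euclidean_space set"
  assumes e: "e \<noteq> {}" "\<And>x. x \<in> e \<Longrightarrow> \<nu> e \<bullet> x = c"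
    and m: "(\<lambda>x. indicator e x * h x) \<in> borel_measurable borel"
  shows "face_int \<nu> e h = (LINT x|lebesgue. indicator {x. 0 \<le> \<nu> e \<bullet> x - c \<and> \<nu> e \<bullet> x - c \<le> 1} x *
    (indicator e (hyperplane_proj (\<nu> e) c x) * h (hyperplane_proj (\<nu> e) c x)))"
proof -
  define a where "a = (SOME a. a \<in> e)"
  have "a \<in> e" unfolding a_def using e(1) by (simp add: some_in_eq)
  then have c: "\<nu> e \<bullet> a = c" by (rule e(2))
  let ?A = "{x. 0 \<le> (x - a) \<bullet> \<nu> e \<and> (x - a) \<bullet> \<nu> e \<le> 1}"
  have A: "(x - a) \<bullet> \<nu> e = \<nu> e \<bullet> x - c" for x
    unfolding inner_commute[of "x - a"] by (simp add: inner_diff_right c)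
  have P: "x - ((x - a) \<bullet> \<nu> e) *\<^sub>R \<nu> e = hyperplane_proj (\<nu> e) c x" for x
    unfolding hyperplane_proj_def A ..
  have pm [measurable]: "hyperplane_proj (\<nu> e) c \<in> borel_measurable borel"
    unfolding hyperplane_proj_def by measurable
  have Am: "?A \<in> sets borel" unfolding A by measurable
  have hm: "hyperplane_measure a (\<nu> e) = distr (restrict_space lborel ?A) borel (hyperplane_proj (\<nu> e) c)"
    unfolding hyperplane_measure_def P ..
  have "face_int \<nu> e h = (LINT x|hyperplane_measure a (\<nu> e). indicator e x * h x)"
    unfolding face_int_def a_def set_lebesgue_integral_def by simp
  also have "\<dots> = (LINT x|restrict_space lborel ?A. indicator e (hyperplane_proj (\<nu> e) c x) * h (hyperplane_proj (\<nu> e) c x))"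
    unfolding hm by (rule integral_distr[OF measurable_restrict_space1 m]) simp
  also have "\<dots> = (LINT x|lborel. indicator ?A x *\<^sub>R (indicator e (hyperplane_proj (\<nu> e) c x) * h (hyperplane_proj (\<nu> e) c x)))"
    by (rule integral_restrict_space) (use Am in simp)
  also have "\<dots> = (LINT x|lebesgue. indicator ?A x *\<^sub>R (indicator e (hyperplane_proj (\<nu> e) c x) * h (hyperplane_proj (\<nu> e) c x)))"
  proof (rule integral_completion[symmetric])
    have "(\<lambda>x. indicator e (hyperplane_proj (\<nu> e) c x) * h (hyperplane_proj (\<nu> e) c x)) \<in> borel_measurable borel"
      using measurable_compose[OF pm m] by simp
    then show "(\<lambda>x. indicator ?A x *\<^sub>R (indicator e (hyperplane_proj (\<nu> e) c x) * h (hyperplane_proj (\<nu> e) c x))) \<in> borel_measurable lborel"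
      using Am by (simp add: borel_measurable_times borel_measurable_indicator)
  qed
  finally show ?thesis unfolding A by simp
qed

section \<open>Boundary fluxes as limits of layer integrals\<close>

context oriented_mesh
begin

text \<open>After rescaling to the slab, the argument of the integrand tends to the projection onto
  the hyperplane, from outside of \<open>K\<close>. The remaining ramps tend to 1 over the relative
  interior of the facet and to 0 outside of \<open>K\<close>; the velocity, extended by 0, tends to
  its value on the facet or to 0, according to whether a neighbouring cell lies beyond.\<close>

lemma facet_layer_limit:
  assumes u: "continuous_on (closure \<Omega>) u" and K: "K \<in> \<T>" and p: "(n, c) \<in> facet_data K"
  defines "e \<equiv> K \<inter> {x. n \<bullet> x = c}"
  shows "(\<lambda>N. LINT x:\<Omega>|lebesgue. (u x \<bullet> n) * cutoff_layer (facet_data K) (real (Suc N)) (n, c) x) \<longlonglongrightarrow>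
    (LINT x|lebesgue. indicator {x. 0 < n \<bullet> x - c \<and> n \<bullet> x - c \<le> 1} x *
      (if e \<in> interior_faces \<T> then indicator e (hyperplane_proj n c x) * (u (hyperplane_proj n c x) \<bullet> n) else 0))"
proof -
  note PK = cell_polyhedron[OF K] cell_interior_nonempty[OF K]
  have unit: "norm n = 1" "n \<bullet> n = 1" by (rule facet_dataD[OF p])+
  have fin: "finite (facet_data K)" by (rule finite_facet_data[OF PK])
  let ?F = "facet_data K - {(n, c)}" and ?cl = "closure \<Omega>" and ?P = "hyperplane_proj n c"
  let ?slab = "{x. 0 < n \<bullet> x - c \<and> n \<bullet> x - c \<le> 1}"
  \<comment> \<open>Extension by 0, as the translated points may leave the domain.\<close>
  define w where "w x = indicator ?cl x * (u x \<bullet> n)" for x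
  have wm [measurable]: "w \<in> borel_measurable borel"
  proof -
    have "(\<lambda>x. indicator ?cl x *\<^sub>R (u x \<bullet> n)) \<in> borel_measurable borel"
      using u by (intro borel_measurable_continuous_on_indicator continuous_intros) auto
    then show ?thesis unfolding w_def by simp
  qed
  obtain B where B: "\<And>x. \<bar>w x\<bar> \<le> B" "B > 0"
  proof -
    have "compact ((\<lambda>x. u x \<bullet> n) ` ?cl)"
      using u compact_closure_domain by (intro compact_continuous_image continuous_intros)
    then obtain B where "B > 0" "\<And>x. x \<in> ?cl \<Longrightarrow> \<bar>u x \<bullet> n\<bar> \<le> B"
      using compact_imp_bounded bounded_pos by (metis (no_types, lifting) image_eqI real_norm_def)
    then show ?thesis using that[of B] by (auto simp: w_def indicator_def)
  qed
  obtain R where R: "\<And>x. x \<in> ?cl \<Longrightarrow> norm x \<le> R"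
    using compact_imp_bounded[OF compact_closure_domain] unfolding bounded_iff by blast
  have w0: "w x = 0" if "norm x > R" for x
    using R[of x] that by (auto simp: w_def indicator_def)
  define g where "g N x = w x * cutoff ?F (real (Suc N)) x" for N x
  have gm [measurable]: "g N \<in> borel_measurable borel" for N
    unfolding g_def by measurable
  have gB: "\<bar>g N x\<bar> \<le> B" "norm x > R \<Longrightarrow> g N x = 0" for N x
  proof -
    have "\<bar>g N x\<bar> \<le> B * 1"
      unfolding g_def abs_mult using B cutoff_bounds(3) by (intro mult_mono) auto
    then show "\<bar>g N x\<bar> \<le> B" by simp
    show "norm x > R \<Longrightarrow> g N x = 0" by (simp add: g_def w0)
  qed
  define z where "z N x = x - ((real_of_int \<lceil>real (Suc N) * (n \<bullet> x - c)\<rceil> - 1) / real (Suc N)) *\<^sub>R n" for N x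
  have zm [measurable]: "z N \<in> borel_measurable borel" for N
    unfolding z_def by measurable
  \<comment> \<open>Height of the folded point \<open>z N x\<close> above the hyperplane: positive
    and at most 1/(N+1).\<close>
  define t where "t N x = n \<bullet> x - c - (real_of_int \<lceil>real (Suc N) * (n \<bullet> x - c)\<rceil> - 1) / real (Suc N)" for N x
  have zt: "z N x = ?P x + t N x *\<^sub>R n" for N x
    unfolding z_def t_def hyperplane_proj_def by (simp add: algebra_simps)
  have t: "0 < t N x" "real (Suc N) * t N x \<le> 1" for N x
  proof -
    have eq: "real (Suc N) * t N x = real (Suc N) * (n \<bullet> x - c) - (real_of_int \<lceil>real (Suc N) * (n \<bullet> x - c)\<rceil> - 1)"
      unfolding t_def right_diff_distrib by simp
    have "0 < real (Suc N) * t N x" unfolding eq by linarith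
    then show "0 < t N x" by (simp add: zero_less_mult_iff)
    show "real (Suc N) * t N x \<le> 1" unfolding eq by linarith
  qed
  have tlim: "(\<lambda>N. t N x) \<longlonglongrightarrow> 0" for x
  proof (rule tendsto_sandwich[OF _ _ tendsto_const LIMSEQ_inverse_real_of_nat])
    show "\<forall>\<^sub>F N in sequentially. t N x \<le> inverse (real (Suc N))"
      using t(2)[of _ x] by (intro always_eventually allI) (simp add: field_simps)
  qed (use t(1) in \<open>auto intro!: always_eventually less_imp_le\<close>)
  have zlim: "(\<lambda>N. z N x) \<longlonglongrightarrow> ?P x" for x
    unfolding zt using tendsto_add[OF tendsto_const[of "?P x"] tendsto_scaleR[OF tlim[of x] tendsto_const[of n]]] by simp
  have nz: "n \<bullet> z N x = c + t N x" for N x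
    unfolding zt by (simp add: inner_add_right inner_hyperplane_proj[OF unit(1)] unit(2))
  have lhs: "(LINT x:\<Omega>|lebesgue. (u x \<bullet> n) * cutoff_layer (facet_data K) (real (Suc N)) (n, c) x) =
      (LINT x|lebesgue. indicator ?slab x * g N (z N x))" for N
  proof -
    let ?thin = "{x. 0 < n \<bullet> x - c \<and> n \<bullet> x - c \<le> 1 / real (Suc N)}"
    have thin: "x \<in> ?thin \<longleftrightarrow> 0 < real (Suc N) * (n \<bullet> x - c) \<and> real (Suc N) * (n \<bullet> x - c) \<le> 1" for x
    proof -
      have "0 < real (Suc N) * (n \<bullet> x - c) \<longleftrightarrow> 0 < n \<bullet> x - c"
        by (simp add: zero_less_mult_iff)
      moreover have "real (Suc N) * (n \<bullet> x - c) \<le> 1 \<longleftrightarrow> n \<bullet> x - c \<le> 1 / real (Suc N)"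
        by (simp add: field_simps)
      ultimately show ?thesis by simp
    qed
    have "integrable lebesgue (\<lambda>x. indicator ?thin x * g N x)"
    proof (rule Bochner_Integration.integrable_bound)
      show "integrable lebesgue (\<lambda>x. indicator (cball 0 R) x * B)"
        using lmeasurable_cball[of 0 R] unfolding lmeasurable_iff_integrable
        by (intro integrable_mult_left)
      show "(\<lambda>x. indicator ?thin x * g N x) \<in> borel_measurable lebesgue"
        by (rule measurable_completion) measurable
      show "AE x in lebesgue. norm (indicator ?thin x * g N x) \<le> norm (indicator (cball 0 R) x * B)"
        using gB B(2) by (intro AE_I2) (auto simp: indicator_def not_le)
    qed
    then have "(LINT x|lebesgue. indicator ?thin x * (real (Suc N) * g N x)) = (LINT x|lebesgue. indicator ?slab x * g N (z N x))"
      unfolding z_def by (intro layer_integral[OF unit(1) _ gm]) auto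
    moreover have "(LINT x|lebesgue. indicator ?thin x * (real (Suc N) * g N x)) =
      (LINT x|lebesgue. indicator \<Omega> x *\<^sub>R ((u x \<bullet> n) * cutoff_layer (facet_data K) (real (Suc N)) (n, c) x))"
    proof (rule lebesgue_integral_cong_AE)
      show "AE x in lebesgue. indicator ?thin x * (real (Suc N) * g N x) =
          indicator \<Omega> x *\<^sub>R ((u x \<bullet> n) * cutoff_layer (facet_data K) (real (Suc N)) (n, c) x)"
        using AE_cells
      proof eventually_elim
        fix x assume x: "x \<in> ?cl \<longrightarrow> x \<in> cells"
        have "x \<in> ?cl \<longleftrightarrow> x \<in> \<Omega>" using x cells_subset closure_subset by blast
        moreover have "indicator {x. 0 < real (Suc N) * (n \<bullet> x - c) \<and> real (Suc N) * (n \<bullet> x - c) \<le> 1} x = (indicator ?thin x :: real)"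
          using thin[of x] by (simp only: indicator_def mem_Collect_eq)
        ultimately show "indicator ?thin x * (real (Suc N) * g N x) =
          indicator \<Omega> x *\<^sub>R ((u x \<bullet> n) * cutoff_layer (facet_data K) (real (Suc N)) (n, c) x)"
          unfolding g_def w_def cutoff_layer_def fst_conv snd_conv by (simp add: indicator_def)
      qed
    qed
    ultimately show ?thesis unfolding set_lebesgue_integral_def by simp
  qed
  let ?lim = "\<lambda>x. indicator ?slab x * (if e \<in> interior_faces \<T> then indicator e (?P x) * (u (?P x) \<bullet> n) else 0)"
  have pointwise: "AE x in lebesgue. (\<lambda>N. indicator ?slab x * g N (z N x)) \<longlonglongrightarrow> ?lim x"
    using AE_hyperplane_proj_off_facets[OF PK p]
  proof eventually_elim
    fix x assume off: "\<forall>(n', c')\<in>?F. n' \<bullet> ?P x \<noteq> c'"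
    \<comment> \<open>Leaving the hyperplane changes another scaled constraint by at most 1,
      independently of N, while its value at the projection, nonzero by \<open>off\<close>, grows in
      modulus linearly in N + 1.\<close>
    have shift: "real (Suc N) * (n' \<bullet> z N x - c') = real (Suc N) * (n' \<bullet> ?P x - c') + (real (Suc N) * t N x) * (n' \<bullet> n)" for N n' c'
      unfolding zt by (simp add: inner_add_right algebra_simps)
    have small: "\<bar>(real (Suc N) * t N x) * (n' \<bullet> n)\<bar> \<le> 1" if "norm n' = 1" for N n'
    proof -
      have "\<bar>n' \<bullet> n\<bar> \<le> 1" using Cauchy_Schwarz_ineq2[of n' n] that unit(1) by simp
      moreover have "\<bar>real (Suc N) * t N x\<bar> \<le> 1" using t[of N x] by (simp add: abs_mult)
      ultimately show ?thesis unfolding abs_mult[of "real (Suc N) * t N x"] by (intro mult_le_one) auto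
    qed
    have nP: "n \<bullet> ?P x = c" by (rule inner_hyperplane_proj[OF unit(1)])
    have "(\<lambda>N. g N (z N x)) \<longlonglongrightarrow> (if e \<in> interior_faces \<T> then indicator e (?P x) * (u (?P x) \<bullet> n) else 0)"
    proof (cases "?P x \<in> K")
      case True
      then have Pe: "?P x \<in> e" unfolding e_def using nP by simp
      have rel: "?P x \<in> rel_interior e"
        unfolding e_def by (rule rel_interior_facetI[OF PK True nP off])
      have "\<forall>\<^sub>F N in sequentially. \<forall>q\<in>?F. ramp (real (Suc N) * (fst q \<bullet> z N x - snd q)) = 1"
      proof (rule eventually_ball_finite)
        show "\<forall>q\<in>?F. \<forall>\<^sub>F N in sequentially. ramp (real (Suc N) * (fst q \<bullet> z N x - snd q)) = 1"
        proof
          fix q assume q: "q \<in> ?F"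
          then have q': "(fst q, snd q) \<in> facet_data K" by simp
          have "fst q \<bullet> ?P x \<le> snd q" "fst q \<bullet> ?P x \<noteq> snd q"
            using facet_dataD(4)[OF q' True] off q by auto
          then have "0 < snd q - fst q \<bullet> ?P x" by simp
          from eventually_le_Suc_mult[OF this, of 1]
          show "\<forall>\<^sub>F N in sequentially. ramp (real (Suc N) * (fst q \<bullet> z N x - snd q)) = 1"
          proof eventually_elim
            fix N assume "1 \<le> real (Suc N) * (snd q - fst q \<bullet> ?P x)"
            then have "real (Suc N) * (fst q \<bullet> z N x - snd q) \<le> 0"
              using small[OF facet_dataD(1)[OF q'], of N] unfolding shift by (simp add: right_diff_distrib)
            then show "ramp (real (Suc N) * (fst q \<bullet> z N x - snd q)) = 1" by (rule ramp_eq)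
          qed
        qed
      qed (use fin in simp)
      then have gw: "\<forall>\<^sub>F N in sequentially. w (z N x) = g N (z N x)"
        by eventually_elim (simp add: g_def cutoff_def)
      have "(\<lambda>N. w (z N x)) \<longlonglongrightarrow> (if e \<in> interior_faces \<T> then indicator e (?P x) * (u (?P x) \<bullet> n) else 0)"
      proof (cases "e \<in> interior_faces \<T>")
        case eI: True
        have eK: "e \<subseteq> K" unfolding e_def by blast
        \<comment> \<open>The neighbour has outer normal -n, so its half ball at the projection
          eventually contains \<open>z N x\<close>, and continuity on the closed domain
          applies.\<close>
        obtain L where L: "L \<in> \<T>" "L \<noteq> K" "e \<subseteq> L"
          using face_cells[OF eI] by metis
        obtain m d where md: "(m, d) \<in> facet_data L" "e = L \<inter> {x. m \<bullet> x = d}" "\<nu> e = m \<or> \<nu> e = - m"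
          using interior_face_facet_data[OF eI L(1,3)] by metis
        obtain m' d' where md': "(m', d') \<in> facet_data K" "e = K \<inter> {x. m' \<bullet> x = d'}" "\<nu> e = m' \<or> \<nu> e = - m'"
          using interior_face_facet_data[OF eI K eK] by metis
        have "m' = n" "d' = c"
          using facet_data_inj[OF PK(2) p md'(1)] md'(2) e_def by auto
        then have "m = n \<or> m = - n" using md(3) md'(3) by auto
        moreover have "m \<noteq> n"
          using outer_normal_unique_cell[OF eI K eK L(1,3) p _ e_def[THEN meta_eq_to_obj_eq], of d] md L(2) by blast
        ultimately have m: "m = - n" by blast
        have "m \<bullet> ?P x = d" using Pe md(2) by blast
        then have d: "d = - c" using m nP by simp
        obtain r where r: "r > 0" "\<And>y. y \<in> ball (?P x) r \<Longrightarrow> m \<bullet> y < d \<Longrightarrow> y \<in> interior L"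
          using facet_inner_halfball[OF cell_polyhedron[OF L(1)] cell_interior_nonempty[OF L(1)] md(1)] rel md(2) by metis
        have "\<forall>\<^sub>F N in sequentially. z N x \<in> ball (?P x) r"
          using zlim[of x] r(1) by (intro topological_tendstoD) auto
        then have ev: "\<forall>\<^sub>F N in sequentially. z N x \<in> ?cl"
        proof eventually_elim
          fix N assume "z N x \<in> ball (?P x) r"
          moreover have "m \<bullet> z N x < d" unfolding m d using nz[of N x] t(1)[of N x] by simp
          ultimately have "z N x \<in> L" using r(2) interior_subset by blast
          then show "z N x \<in> ?cl" using L(1) Union_mesh by blast
        qed
        have Pcl: "?P x \<in> ?cl" using True K Union_mesh by blast
        have "(\<lambda>N. u (z N x)) \<longlonglongrightarrow> u (?P x)"
          by (rule continuous_on_tendsto_compose[OF u zlim Pcl ev])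
        then have "(\<lambda>N. u (z N x) \<bullet> n) \<longlonglongrightarrow> u (?P x) \<bullet> n"
          by (intro tendsto_intros)
        moreover have "\<forall>\<^sub>F N in sequentially. u (z N x) \<bullet> n = w (z N x)"
          using ev by eventually_elim (simp add: w_def)
        ultimately have "(\<lambda>N. w (z N x)) \<longlonglongrightarrow> u (?P x) \<bullet> n"
          by (rule Lim_transform_eventually)
        then show ?thesis using eI Pe by simp
      next
        \<comment> \<open>Without a neighbour beyond the facet, \<open>z N x\<close> eventually
          avoids every cell: it is never in \<open>K\<close>, and the other closed cells miss the
          projection.\<close>
        case eB: False
        have "\<forall>\<^sub>F N in sequentially. \<forall>L\<in>\<T>. z N x \<notin> L"
        proof (rule eventually_ball_finite[OF finite_mesh], rule)
          fix L assume L: "L \<in> \<T>"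
          show "\<forall>\<^sub>F N in sequentially. z N x \<notin> L"
          proof (cases "L = K")
            case True
            have "z N x \<notin> K" for N
              using facet_dataD(4)[OF p, of "z N x"] nz[of N x] t(1)[of N x] by auto
            then show ?thesis using True by simp
          next
            case False
            have "e facet_of K" unfolding e_def by (rule facet_dataD(5)[OF p])
            then have "?P x \<notin> L"
              using facet_of_two_cells(2)[OF K L _ _ rel] eB False by blast
            moreover have "open (- L)" using compact_imp_closed[OF cell_compact[OF L]] by blast
            ultimately have "\<forall>\<^sub>F N in sequentially. z N x \<in> - L"
              using topological_tendstoD[OF zlim[of x]] by blast
            then show ?thesis by eventually_elim simp
          qed
        qed
        then have "\<forall>\<^sub>F N in sequentially. 0 = w (z N x)"
        proof eventually_elim
          fix N assume "\<forall>L\<in>\<T>. z N x \<notin> L"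
          then have "z N x \<notin> ?cl" using Union_mesh by blast
          then show "0 = w (z N x)" by (simp add: w_def)
        qed
        then have "(\<lambda>N. w (z N x)) \<longlonglongrightarrow> 0"
          by (rule Lim_transform_eventually[OF tendsto_const])
        then show ?thesis using eB by simp
      qed
      then show ?thesis using gw by (rule Lim_transform_eventually)
    next
      case False
      then obtain n' c' where q: "(n', c') \<in> facet_data K" "n' \<bullet> ?P x > c'"
        using polyhedron_facet_data(1)[OF PK] by force
      then have q': "(n', c') \<in> ?F" using nP by auto
      have "0 < n' \<bullet> ?P x - c'" using q(2) by simp
      \<comment> \<open>A margin of 2 survives the perturbation by at most 1 and leaves at least 1,
        where the ramp vanishes.\<close>
      from eventually_le_Suc_mult[OF this, of 2]
      have "\<forall>\<^sub>F N in sequentially. 0 = g N (z N x)"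
      proof eventually_elim
        fix N assume "2 \<le> real (Suc N) * (n' \<bullet> ?P x - c')"
        then have "real (Suc N) * (n' \<bullet> z N x - c') \<ge> 1"
          using small[OF facet_dataD(1)[OF q(1)], of N] unfolding shift by linarith
        then have "ramp (real (Suc N) * (n' \<bullet> z N x - c')) = 0" by (rule ramp_eq)
        then have "cutoff ?F (real (Suc N)) (z N x) = 0"
          unfolding cutoff_def using q' fin by (intro prod_zero bexI[of _ "(n', c')"]) auto
        then show "0 = g N (z N x)" by (simp add: g_def)
      qed
      then have "(\<lambda>N. g N (z N x)) \<longlonglongrightarrow> 0"
        by (rule Lim_transform_eventually[OF tendsto_const])
      moreover have "?P x \<notin> e" using False unfolding e_def by blast
      ultimately show ?thesis by simp
    qed
    then show "(\<lambda>N. indicator ?slab x * g N (z N x)) \<longlonglongrightarrow> ?lim x"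
      by (rule tendsto_mult_left)
  qed
  have gzm: "(\<lambda>x. indicator ?slab x * g N (z N x)) \<in> borel_measurable lebesgue" for N
  proof (rule measurable_completion)
    have "(\<lambda>x. g N (z N x)) \<in> borel_measurable borel"
      using measurable_compose[OF zm gm] .
    then show "(\<lambda>x. indicator ?slab x * g N (z N x)) \<in> borel_measurable lborel"
      by measurable
  qed
  show ?thesis
    unfolding lhs
  proof (rule integral_dominated_convergence)
    \<comment> \<open>A point x of the slab is less than 1 away from \<open>z N x\<close>, which has
      norm at most R wherever the integrand is nonzero.\<close>
    show "integrable lebesgue (\<lambda>x. indicator (cball 0 (R + 1)) x * B)"
      using lmeasurable_cball[of 0 "R + 1"] unfolding lmeasurable_iff_integrable
      by (intro integrable_mult_left)
    show "(\<lambda>x. indicator ?slab x * g N (z N x)) \<in> borel_measurable lebesgue" for N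
      by (rule gzm)
    show "?lim \<in> borel_measurable lebesgue"
    proof (rule measurable_lebesgue_AE_cong)
      show "(\<lambda>x. lim (\<lambda>N. indicator ?slab x * g N (z N x))) \<in> borel_measurable lebesgue"
        using gzm by (rule borel_measurable_lim_metric)
      show "AE x in lebesgue. lim (\<lambda>N. indicator ?slab x * g N (z N x)) = ?lim x"
        using pointwise by eventually_elim (rule limI)
    qed
    show "AE x in lebesgue. norm (indicator ?slab x * g N (z N x)) \<le> indicator (cball 0 (R + 1)) x * B" for N
    proof (rule AE_I2)
      fix x
      show "norm (indicator ?slab x * g N (z N x)) \<le> indicator (cball 0 (R + 1)) x * B"
      proof (cases "x \<in> ?slab \<and> norm (z N x) \<le> R")
        case True
        have "x = z N x + (n \<bullet> x - c - t N x) *\<^sub>R n"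
          unfolding zt hyperplane_proj_def by (simp add: algebra_simps)
        then have "norm x \<le> norm (z N x) + \<bar>n \<bullet> x - c - t N x\<bar>"
          using norm_triangle_ineq[of "z N x" "(n \<bullet> x - c - t N x) *\<^sub>R n"] unit(1) by simp
        moreover have "t N x \<le> n \<bullet> x - c"
        proof -
          have "0 < real (Suc N) * (n \<bullet> x - c)" using True by simp
          then have "1 \<le> \<lceil>real (Suc N) * (n \<bullet> x - c)\<rceil>" by linarith
          then have "0 \<le> (real_of_int \<lceil>real (Suc N) * (n \<bullet> x - c)\<rceil> - 1) / real (Suc N)" by simp
          then show ?thesis unfolding t_def by linarith
        qed
        ultimately have "norm x \<le> R + 1" using True t(1)[of N x] by auto
        then show ?thesis using gB(1)[of N "z N x"] True by simp
      next
        case False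
        then have "indicator ?slab x * g N (z N x) = 0"
          using gB(2)[of "z N x" N] by (auto simp: indicator_def)
        moreover have "0 \<le> indicator (cball 0 (R + 1)) x * B" using B(2) by simp
        ultimately show ?thesis by (simp only: norm_zero)
      qed
    qed
  qed (use pointwise in simp)
qed

text \<open>The outer normal n of \<open>K\<close> is \<nu> or -\<nu>. In the second case the slab
  lies on the other side of the face, which \<open>lebesgue_integral_layer_flip\<close> corrects,
  and the sign survives as the inner product of n and \<nu>.\<close>

lemma facet_flux:
  assumes u: "continuous_on (closure \<Omega>) u" and K: "K \<in> \<T>" and p: "(n, c) \<in> facet_data K"
    and e: "e = K \<inter> {x. n \<bullet> x = c}" "e \<in> interior_faces \<T>"
  shows "(LINT x|lebesgue. indicator {x. 0 < n \<bullet> x - c \<and> n \<bullet> x - c \<le> 1} x *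
      (indicator e (hyperplane_proj n c x) * (u (hyperplane_proj n c x) \<bullet> n))) =
    (n \<bullet> \<nu> e) * face_int \<nu> e (\<lambda>x. u x \<bullet> \<nu> e)"
proof -
  have eK: "e \<subseteq> K" using e(1) by blast
  have unit: "norm (\<nu> e) = 1" by (rule norm_face_normal[OF e(2)])
  have nn: "\<nu> e \<bullet> \<nu> e = 1" using unit by (simp add: dot_square_norm)
  obtain m d where md: "(m, d) \<in> facet_data K" "e = K \<inter> {x. m \<bullet> x = d}" "\<nu> e = m \<or> \<nu> e = - m"
    using interior_face_facet_data[OF e(2) K eK] by metis
  have "n = m"
    using facet_data_inj[OF cell_interior_nonempty[OF K] p md(1)] md(2) e(1) by auto
  then have nu: "n = \<nu> e \<or> n = - \<nu> e" using md(3) by auto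
  have ne: "e \<noteq> {}" using interior_faceE[OF e(2)] by metis
  have "e = K \<inter> {x. n \<bullet> x = c}" by (rule e(1))
  then have ce: "closed e"
    using compact_imp_closed[OF cell_compact[OF K]] by (simp add: closed_Int closed_hyperplane)
  have ue: "continuous_on e u"
    using continuous_on_subset[OF u] eK K Union_mesh by blast
  have m: "(\<lambda>x. indicator e x * (u x \<bullet> v)) \<in> borel_measurable borel" for v
  proof -
    have "(\<lambda>x. indicator e x *\<^sub>R (u x \<bullet> v)) \<in> borel_measurable borel"
      using ue ce by (intro borel_measurable_continuous_on_indicator continuous_intros) auto
    then show ?thesis by simp
  qed
  from nu show ?thesis
  proof
    assume n: "n = \<nu> e"
    have c: "\<nu> e \<bullet> x = c" if "x \<in> e" for x
    proof -
      have "n \<bullet> x = c" using that e(1) by blast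
      then show ?thesis using n by simp
    qed
    show ?thesis
      using lebesgue_integral_layer_flip(1)[OF unit m[of "\<nu> e"], of c] n nn
        face_int_eq_layer_integral[where \<nu> = \<nu> and h = "\<lambda>x. u x \<bullet> \<nu> e", OF ne c m] by simp
  next
    assume n: "n = - \<nu> e"
    have c: "\<nu> e \<bullet> x = - c" if "x \<in> e" for x
    proof -
      have "n \<bullet> x = c" using that e(1) by blast
      then show ?thesis using n by simp
    qed
    have "(LINT x|lebesgue. indicator {x. 0 < n \<bullet> x - c \<and> n \<bullet> x - c \<le> 1} x *
      (indicator e (hyperplane_proj n c x) * (u (hyperplane_proj n c x) \<bullet> n))) =
      (LINT x|lebesgue. - (indicator {x. 0 < n \<bullet> x - c \<and> n \<bullet> x - c \<le> 1} x *
      (indicator e (hyperplane_proj n c x) * (u (hyperplane_proj n c x) \<bullet> \<nu> e))))"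
      unfolding n by (intro Bochner_Integration.integral_cong) auto
    also have "\<dots> = - (LINT x|lebesgue. indicator {x. 0 < n \<bullet> x - c \<and> n \<bullet> x - c \<le> 1} x *
      (indicator e (hyperplane_proj n c x) * (u (hyperplane_proj n c x) \<bullet> \<nu> e)))"
      by simp
    also have "\<dots> = - face_int \<nu> e (\<lambda>x. u x \<bullet> \<nu> e)"
      using lebesgue_integral_layer_flip(2)[OF unit m[of "\<nu> e"], of "- c"] n
        face_int_eq_layer_integral[where \<nu> = \<nu> and h = "\<lambda>x. u x \<bullet> \<nu> e", OF ne c m] by simp
    finally show ?thesis using n nn by simp
  qed
qed

text \<open>The cutoffs lie outside of \<open>K\<close>, so that a face on \<open>\<partial>\<Omega>\<close> contributes nothing to the limit:
  its layer does not meet \<open>\<Omega>\<close>.\<close>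

theorem divergence_theorem_cell:
  assumes u: "continuous_on (closure \<Omega>) u" "\<And>b. b \<in> Basis \<Longrightarrow> (\<lambda>x. u x \<bullet> b) \<in> H10_space \<Omega>"
    and K: "K \<in> \<T>"
  shows "(LINT x:K|lebesgue. (\<Sum>b\<in>Basis. weak_grad \<Omega> (\<lambda>x. u x \<bullet> b) x \<bullet> b)) =
    (\<Sum>e\<in>interior_faces \<T>. ((if cell_K \<T> \<nu> e = K then 1 else 0) - (if cell_L \<T> \<nu> e = K then 1 else 0)) *
       face_int \<nu> e (\<lambda>x. u x \<bullet> \<nu> e))"
proof -
  note PK = cell_polyhedron[OF K] cell_interior_nonempty[OF K]
  let ?F = "facet_data K" and ?g = "\<lambda>b. weak_grad \<Omega> (\<lambda>x. u x \<bullet> b)"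
  define face where "face p = K \<inter> {x. fst p \<bullet> x = snd p}" for p
  have fin: "finite ?F" by (rule finite_facet_data[OF PK])
  have unit: "norm (fst p) = 1" if "p \<in> ?F" for p
    using that facet_dataD(1)[of "fst p" "snd p" K] by simp
  have S: "\<Omega> \<in> sets lebesgue" using open_domain by auto
  have lm: "\<Omega> \<in> lmeasurable"
    using bounded_domain S by (simp add: bounded_set_imp_lmeasurable)
  interpret fm: finite_measure "lebesgue_on \<Omega>"
    by (rule finite_measure_lebesgue_on[OF lm])
  have gi: "set_integrable lebesgue \<Omega> (\<lambda>x. ?g b x \<bullet> b)" if b: "b \<in> Basis" for b
  proof -
    have "(\<lambda>x. u x \<bullet> b) \<in> H1_space \<Omega>"
      using u(2)[OF b] unfolding H10_space_def by blast
    then have "(\<lambda>x. ?g b x \<bullet> b) \<in> L2_space \<Omega>"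
      by (intro L2_space_inner_left(1)[OF S] H1_space_weak_grad(2)[OF open_domain])
    then have "integrable (lebesgue_on \<Omega>) (\<lambda>x. (?g b x \<bullet> b) * 1)"
      unfolding L2_space_iff[OF S] by (intro integrable_mult_of_squares) simp_all
    then show ?thesis unfolding set_integrable_lebesgue_on[OF S] by simp
  qed
  have ui: "set_integrable lebesgue \<Omega> (\<lambda>x. u x \<bullet> v)" for v
    by (rule set_integrable_continuous_compact[OF compact_closure_domain _ closure_subset S])
      (use u(1) in \<open>auto intro!: continuous_intros\<close>)
  have bounded_mult: "set_integrable lebesgue \<Omega> (\<lambda>x. f x * h x)"
    if "set_integrable lebesgue \<Omega> f" "h \<in> borel_measurable borel" "\<And>x. \<bar>h x\<bar> \<le> B" for f h :: "'a \<Rightarrow> real" and B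
  proof -
    have "h \<in> borel_measurable lebesgue"
      by (rule measurable_completion) (use that(2) in simp)
    from set_integrable_scaleR_bounded[OF that(1) this that(3)] show ?thesis
      by (simp add: mult.commute)
  qed
  \<comment> \<open>Integration by parts in every coordinate direction; summation over the
    directions recombines the components into the normal component of u on each layer.\<close>
  have step: "(LINT x:\<Omega>|lebesgue. (\<Sum>b\<in>Basis. ?g b x \<bullet> b) * cutoff ?F N x) =
      (\<Sum>p\<in>?F. LINT x:\<Omega>|lebesgue. (u x \<bullet> fst p) * cutoff_layer ?F N p x)" if N: "N > 0" for N
  proof -
    have N0: "N \<ge> 0" using N by simp
    let ?d = "\<lambda>b x. - (\<Sum>p\<in>?F. (fst p \<bullet> b) * cutoff_layer ?F N p x)"
    have dB: "\<bar>?d b x\<bar> \<le> real (card ?F) * N" if b: "b \<in> Basis" for b x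
    proof -
      have "\<bar>?d b x\<bar> \<le> (\<Sum>p\<in>?F. \<bar>(fst p \<bullet> b) * cutoff_layer ?F N p x\<bar>)"
        using sum_abs by (simp only: abs_minus_cancel)
      also have "\<dots> \<le> (\<Sum>p\<in>?F. N)"
      proof (rule sum_mono)
        fix p assume p: "p \<in> ?F"
        have "\<bar>fst p \<bullet> b\<bar> \<le> 1"
          using Cauchy_Schwarz_ineq2[of "fst p" b] unit[OF p] b by simp
        then have "\<bar>fst p \<bullet> b\<bar> * \<bar>cutoff_layer ?F N p x\<bar> \<le> 1 * N"
          by (intro mult_mono cutoff_layer_bounds(2)[OF N0]) auto
        then show "\<bar>(fst p \<bullet> b) * cutoff_layer ?F N p x\<bar> \<le> N" by (simp add: abs_mult)
      qed
      finally show ?thesis by simp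
    qed
    have dm: "?d b \<in> borel_measurable borel" for b by measurable
    have ibp: "(LINT x:\<Omega>|lebesgue. (?g b x \<bullet> b) * cutoff ?F N x) = - (LINT x:\<Omega>|lebesgue. (u x \<bullet> b) * ?d b x)"
      if b: "b \<in> Basis" for b
    proof (rule H10_integration_by_parts[OF open_domain bounded_domain u(2)[OF b]
          cutoff_lipschitz[of ?F N, OF unit N0] AE_cutoff_directional_derivative[OF fin unit N]])
      show "\<bar>cutoff ?F N x\<bar> \<le> max 1 (real (card ?F) * N)" "\<bar>?d b x\<bar> \<le> max 1 (real (card ?F) * N)" for x
        using cutoff_bounds(3)[of ?F N x] dB[OF b, of x] by auto
      show "cutoff ?F N \<in> borel_measurable lebesgue" "?d b \<in> borel_measurable lebesgue"
        by (rule measurable_completion; measurable)+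
    qed
    have "(LINT x:\<Omega>|lebesgue. (\<Sum>b\<in>Basis. ?g b x \<bullet> b) * cutoff ?F N x) =
        (\<Sum>b\<in>Basis. LINT x:\<Omega>|lebesgue. (?g b x \<bullet> b) * cutoff ?F N x)"
      unfolding sum_distrib_right
      by (rule set_lint_sum) (auto intro!: bounded_mult[OF gi] cutoff_bounds(3) measurable_cutoff)
    also have "\<dots> = (\<Sum>b\<in>Basis. LINT x:\<Omega>|lebesgue. - ((u x \<bullet> b) * ?d b x))"
      using ibp by (simp add: set_lebesgue_integral_def)
    also have "\<dots> = (LINT x:\<Omega>|lebesgue. \<Sum>b\<in>Basis. - ((u x \<bullet> b) * ?d b x))"
    proof (rule set_lint_sum[symmetric])
      fix b :: 'a assume b: "b \<in> Basis"
      have "set_integrable lebesgue \<Omega> (\<lambda>x. (u x \<bullet> b) * (- ?d b x))"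
        by (rule bounded_mult[OF ui, of _ "real (card ?F) * N"]) (use dm dB[OF b] in auto)
      then show "set_integrable lebesgue \<Omega> (\<lambda>x. - ((u x \<bullet> b) * ?d b x))"
        by simp
    qed
    also have "\<dots> = (LINT x:\<Omega>|lebesgue. \<Sum>p\<in>?F. (u x \<bullet> fst p) * cutoff_layer ?F N p x)"
    proof -
      have "(\<Sum>b\<in>Basis. - ((u x \<bullet> b) * ?d b x)) = (\<Sum>p\<in>?F. (u x \<bullet> fst p) * cutoff_layer ?F N p x)" for x
      proof -
        have "(\<Sum>b\<in>Basis. - ((u x \<bullet> b) * ?d b x)) = (\<Sum>b\<in>Basis. \<Sum>p\<in>?F. (u x \<bullet> b) * (fst p \<bullet> b) * cutoff_layer ?F N p x)"
          by (simp add: sum_distrib_left mult.assoc)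
        also have "\<dots> = (\<Sum>p\<in>?F. \<Sum>b\<in>Basis. (u x \<bullet> b) * (fst p \<bullet> b) * cutoff_layer ?F N p x)"
          by (rule sum.swap)
        also have "\<dots> = (\<Sum>p\<in>?F. (u x \<bullet> fst p) * cutoff_layer ?F N p x)"
        proof (rule sum.cong[OF refl])
          fix p
          show "(\<Sum>b\<in>Basis. (u x \<bullet> b) * (fst p \<bullet> b) * cutoff_layer ?F N p x) = (u x \<bullet> fst p) * cutoff_layer ?F N p x"
            by (subst euclidean_inner[of "u x" "fst p"]) (rule sum_distrib_right[symmetric])
        qed
        finally show ?thesis .
      qed
      then show ?thesis by simp
    qed
    also have "\<dots> = (\<Sum>p\<in>?F. LINT x:\<Omega>|lebesgue. (u x \<bullet> fst p) * cutoff_layer ?F N p x)"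
      by (rule set_lint_sum) (auto intro!: bounded_mult[OF ui _ cutoff_layer_bounds(2)[OF N0]] measurable_cutoff_layer)
    finally show ?thesis .
  qed
  let ?lim = "\<lambda>p. if face p \<in> interior_faces \<T> then (fst p \<bullet> \<nu> (face p)) * face_int \<nu> (face p) (\<lambda>x. u x \<bullet> \<nu> (face p)) else 0"
  have "(\<lambda>N. LINT x:\<Omega>|lebesgue. (u x \<bullet> fst p) * cutoff_layer ?F (real (Suc N)) p x) \<longlonglongrightarrow> ?lim p" if p: "p \<in> ?F" for p
  proof -
    have p': "(fst p, snd p) \<in> ?F" using p by simp
    have "(LINT x|lebesgue. indicator {x. 0 < fst p \<bullet> x - snd p \<and> fst p \<bullet> x - snd p \<le> 1} x *
      (if face p \<in> interior_faces \<T> then indicator (face p) (hyperplane_proj (fst p) (snd p) x) * (u (hyperplane_proj (fst p) (snd p) x) \<bullet> fst p) else 0)) = ?lim p"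
      using facet_flux[OF u(1) K p' face_def] by simp
    then show ?thesis
      using facet_layer_limit[OF u(1) K p'] unfolding face_def by simp
  qed
  then have l1: "(\<lambda>N. \<Sum>p\<in>?F. LINT x:\<Omega>|lebesgue. (u x \<bullet> fst p) * cutoff_layer ?F (real (Suc N)) p x) \<longlonglongrightarrow> (\<Sum>p\<in>?F. ?lim p)"
    by (rule tendsto_sum)
  have sumi: "set_integrable lebesgue \<Omega> (\<lambda>x. \<Sum>b\<in>Basis. ?g b x \<bullet> b)"
    using gi by (intro set_integrable_sum_finite) auto
  \<comment> \<open>The cutoffs equal 1 on \<open>K\<close> and vanish eventually at each point
    outside; the modulus of the divergence dominates.\<close>
  have l2: "(\<lambda>N. LINT x:\<Omega>|lebesgue. (\<Sum>b\<in>Basis. ?g b x \<bullet> b) * cutoff ?F (real (Suc N)) x) \<longlonglongrightarrow>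
      (LINT x:\<Omega>|lebesgue. (\<Sum>b\<in>Basis. ?g b x \<bullet> b) * indicator K x)"
    unfolding set_lebesgue_integral_def
  proof (rule integral_dominated_convergence)
    have mD: "(\<lambda>x. indicator \<Omega> x *\<^sub>R (\<Sum>b\<in>Basis. ?g b x \<bullet> b)) \<in> borel_measurable lebesgue"
      using sumi unfolding set_integrable_def by (rule borel_measurable_integrable)
    have mult: "(\<lambda>x. indicator \<Omega> x *\<^sub>R ((\<Sum>b\<in>Basis. ?g b x \<bullet> b) * h x)) \<in> borel_measurable lebesgue"
      if "h \<in> borel_measurable borel" for h :: "'a \<Rightarrow> real"
    proof -
      have "h \<in> borel_measurable lebesgue"
        by (rule measurable_completion) (use that in simp)
      from borel_measurable_times[OF mD this] show ?thesis by (simp add: mult.assoc)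
    qed
    show "(\<lambda>x. indicator \<Omega> x *\<^sub>R ((\<Sum>b\<in>Basis. ?g b x \<bullet> b) * indicator K x)) \<in> borel_measurable lebesgue"
      using compact_imp_closed[OF cell_compact[OF K]] by (intro mult borel_measurable_indicator) auto
    show "(\<lambda>x. indicator \<Omega> x *\<^sub>R ((\<Sum>b\<in>Basis. ?g b x \<bullet> b) * cutoff ?F (real (Suc N)) x)) \<in> borel_measurable lebesgue" for N
      by (rule mult) (rule measurable_cutoff)
    show "integrable lebesgue (\<lambda>x. \<bar>indicator \<Omega> x *\<^sub>R (\<Sum>b\<in>Basis. ?g b x \<bullet> b)\<bar>)"
      using sumi unfolding set_integrable_def by (rule integrable_abs)
    show "AE x in lebesgue. norm (indicator \<Omega> x *\<^sub>R ((\<Sum>b\<in>Basis. ?g b x \<bullet> b) * cutoff ?F (real (Suc N)) x)) \<le>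
        \<bar>indicator \<Omega> x *\<^sub>R (\<Sum>b\<in>Basis. ?g b x \<bullet> b)\<bar>" for N
      using cutoff_bounds(3)[of ?F "real (Suc N)"]
      by (intro AE_I2) (auto simp: abs_mult indicator_def intro!: mult_left_le)
    show "AE x in lebesgue. (\<lambda>N. indicator \<Omega> x *\<^sub>R ((\<Sum>b\<in>Basis. ?g b x \<bullet> b) * cutoff ?F (real (Suc N)) x)) \<longlonglongrightarrow>
        indicator \<Omega> x *\<^sub>R ((\<Sum>b\<in>Basis. ?g b x \<bullet> b) * indicator K x)"
    proof (rule AE_I2)
      fix x
      have "(\<lambda>N. cutoff ?F (real (Suc N)) x) \<longlonglongrightarrow> indicator K x"
      proof (cases "x \<in> K")
        case True
        have "ramp (real (Suc N) * (fst p \<bullet> x - snd p)) = 1" if "p \<in> ?F" for p N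
        proof (rule ramp_eq(1))
          have "fst p \<bullet> x \<le> snd p"
            using facet_dataD(4)[of "fst p" "snd p" K x] that True by simp
          then show "real (Suc N) * (fst p \<bullet> x - snd p) \<le> 0"
            by (intro mult_nonneg_nonpos) auto
        qed
        then have "cutoff ?F (real (Suc N)) x = 1" for N
          unfolding cutoff_def by (intro prod.neutral) blast
        then show ?thesis using True by simp
      next
        case False
        then obtain n c where q: "(n, c) \<in> ?F" "n \<bullet> x > c"
          using polyhedron_facet_data(1)[OF PK] by force
        have "0 < n \<bullet> x - c" using q(2) by simp
        from eventually_le_Suc_mult[OF this, of 1]
        have "\<forall>\<^sub>F N in sequentially. 0 = cutoff ?F (real (Suc N)) x"
        proof eventually_elim
          fix N assume "1 \<le> real (Suc N) * (n \<bullet> x - c)"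
          then have "ramp (real (Suc N) * (n \<bullet> x - c)) = 0" by (rule ramp_eq)
          then show "0 = cutoff ?F (real (Suc N)) x"
            unfolding cutoff_def using q(1) fin by (intro prod_zero[symmetric] bexI[of _ "(n, c)"]) auto
        qed
        then have "(\<lambda>N. cutoff ?F (real (Suc N)) x) \<longlonglongrightarrow> 0"
          by (rule Lim_transform_eventually[OF tendsto_const])
        then show ?thesis using False by simp
      qed
      then show "(\<lambda>N. indicator \<Omega> x *\<^sub>R ((\<Sum>b\<in>Basis. ?g b x \<bullet> b) * cutoff ?F (real (Suc N)) x)) \<longlonglongrightarrow>
        indicator \<Omega> x *\<^sub>R ((\<Sum>b\<in>Basis. ?g b x \<bullet> b) * indicator K x)"
        by (intro tendsto_intros)
    qed
  qed
  have "(LINT x:\<Omega>|lebesgue. (\<Sum>b\<in>Basis. ?g b x \<bullet> b) * indicator K x) = (\<Sum>p\<in>?F. ?lim p)"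
  proof (rule LIMSEQ_unique)
    have "(LINT x:\<Omega>|lebesgue. (\<Sum>b\<in>Basis. ?g b x \<bullet> b) * cutoff ?F (real (Suc N)) x) =
      (\<Sum>p\<in>?F. LINT x:\<Omega>|lebesgue. (u x \<bullet> fst p) * cutoff_layer ?F (real (Suc N)) p x)" for N
      by (rule step) simp
    with l2 show "(\<lambda>N. \<Sum>p\<in>?F. LINT x:\<Omega>|lebesgue. (u x \<bullet> fst p) * cutoff_layer ?F (real (Suc N)) p x) \<longlonglongrightarrow>
      (LINT x:\<Omega>|lebesgue. (\<Sum>b\<in>Basis. ?g b x \<bullet> b) * indicator K x)"
      by (simp only:)
  qed (rule l1)
  moreover have "(LINT x:\<Omega>|lebesgue. (\<Sum>b\<in>Basis. ?g b x \<bullet> b) * indicator K x) = (LINT x:K|lebesgue. (\<Sum>b\<in>Basis. ?g b x \<bullet> b))"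
  proof -
    have "AE x in lebesgue. indicator \<Omega> x *\<^sub>R ((\<Sum>b\<in>Basis. ?g b x \<bullet> b) * indicator K x) = indicator K x *\<^sub>R (\<Sum>b\<in>Basis. ?g b x \<bullet> b)"
      using AE_cells
    proof eventually_elim
      fix x assume x: "x \<in> closure \<Omega> \<longrightarrow> x \<in> cells"
      have "x \<in> K \<Longrightarrow> x \<in> \<Omega>" using x K Union_mesh cells_subset by blast
      then show "indicator \<Omega> x *\<^sub>R ((\<Sum>b\<in>Basis. ?g b x \<bullet> b) * indicator K x) = indicator K x *\<^sub>R (\<Sum>b\<in>Basis. ?g b x \<bullet> b)"
        by (auto simp: indicator_def)
    qed
    then show ?thesis
      unfolding set_lebesgue_integral_def by (rule lebesgue_integral_cong_AE)
  qed
  moreover have "(\<Sum>p\<in>?F. ?lim p) = (\<Sum>e\<in>interior_faces \<T>. ((if cell_K \<T> \<nu> e = K then 1 else 0) - (if cell_L \<T> \<nu> e = K then 1 else 0)) *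
       face_int \<nu> e (\<lambda>x. u x \<bullet> \<nu> e))"
  proof -
    let ?G = "\<lambda>e. ((if cell_K \<T> \<nu> e = K then 1 else 0) - (if cell_L \<T> \<nu> e = K then 1 else 0)) * face_int \<nu> e (\<lambda>x. u x \<bullet> \<nu> e)"
    have inj: "inj_on face ?F"
      using facet_data_inj[OF PK(2)] unfolding inj_on_def face_def by (metis prod.collapse)
    \<comment> \<open>A face contained in \<open>K\<close> has \<open>K\<close> on exactly one of
      its sides, and the sign of the outer normal relative to \<nu> reproduces the difference of the
      two case distinctions.\<close>
    have lim: "?lim p = ?G (face p)" if p: "p \<in> ?F" "face p \<in> interior_faces \<T>" for p
    proof -
      have p': "(fst p, snd p) \<in> ?F" using p by simp
      let ?e = "face p"
      have eK: "?e \<subseteq> K" unfolding face_def by blast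
      have nn: "\<nu> ?e \<bullet> \<nu> ?e = 1" using norm_face_normal[OF p(2)] by (simp add: dot_square_norm)
      note fc = face_cells[OF p(2)]
      show ?thesis
      proof (cases "cell_K \<T> \<nu> ?e = K")
        case True
        then obtain c where "(\<nu> ?e, c) \<in> ?F" "?e = K \<inter> {x. \<nu> ?e \<bullet> x = c}"
          using fc(7) by blast
        then have "fst p = \<nu> ?e"
          using facet_data_inj[OF PK(2) p'] unfolding face_def by metis
        then show ?thesis using True fc(5) p(2) nn by auto
      next
        case False
        then have L: "cell_L \<T> \<nu> ?e = K" using fc(9)[OF K eK] by blast
        then obtain c where "(- \<nu> ?e, c) \<in> ?F" "?e = K \<inter> {x. - \<nu> ?e \<bullet> x = c}"
          using fc(8) by blast
        then have "fst p = - \<nu> ?e"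
          using facet_data_inj[OF PK(2) p'] unfolding face_def by metis
        then show ?thesis using False L p(2) nn by auto
      qed
    qed
    have "(\<Sum>p\<in>?F. ?lim p) = (\<Sum>p\<in>{p \<in> ?F. face p \<in> interior_faces \<T>}. ?lim p)"
      using fin by (intro sum.mono_neutral_right) auto
    also have "\<dots> = (\<Sum>p\<in>{p \<in> ?F. face p \<in> interior_faces \<T>}. ?G (face p))"
      by (rule sum.cong[OF refl]) (use lim in blast)
    also have "\<dots> = sum ?G (face ` {p \<in> ?F. face p \<in> interior_faces \<T>})"
      using inj_on_subset[OF inj] by (intro sum.reindex[symmetric, unfolded o_def]) auto
    also have "\<dots> = sum ?G (interior_faces \<T>)"
    proof (rule sum.mono_neutral_left[OF finite_interior_faces])
      show "\<forall>e\<in>interior_faces \<T> - face ` {p \<in> ?F. face p \<in> interior_faces \<T>}. ?G e = 0"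
      proof
        fix e assume e: "e \<in> interior_faces \<T> - face ` {p \<in> ?F. face p \<in> interior_faces \<T>}"
        have "\<not> e \<subseteq> K"
        proof
          assume "e \<subseteq> K"
          have "e \<in> interior_faces \<T>" using e by blast
          then obtain n c where "(n, c) \<in> ?F" "e = K \<inter> {x. n \<bullet> x = c}"
            using interior_face_facet_data[OF _ K \<open>e \<subseteq> K\<close>] by metis
          then have "e = face (n, c)" "(n, c) \<in> ?F" unfolding face_def by auto
          then show False using e by blast
        qed
        then show "?G e = 0" using face_cells(3,4)[of e] e by auto
      qed
    qed auto
    finally show ?thesis .
  qed
  ultimately show ?thesis by simp
qed

end

section \<open>Piecewise constant and piecewise linear functions\<close>

text \<open>The Fubini argument behind uniqueness of Haar measure, applied to f(T x + y) g(y): the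
  image measure under T is translation invariant, because a translation of T x is absorbed by one of
  x. For an affine T, L is the inverse of its linear part.\<close>

lemma lborel_translation_duality:
  fixes T :: "'a::euclidean_space \<Rightarrow> 'a"
  assumes Tm [measurable]: "T \<in> borel_measurable borel"
    and T: "\<And>x h. T x + h = T (x + L h)"
    and f [measurable]: "f \<in> borel_measurable borel" and g [measurable]: "g \<in> borel_measurable borel"
  shows "(\<integral>\<^sup>+x. f (T x) \<partial>lborel) * (\<integral>\<^sup>+y. g y \<partial>lborel) = (\<integral>\<^sup>+y. f y \<partial>lborel) * (\<integral>\<^sup>+x. g (- T x) \<partial>lborel)"
proof -
  have tr: "(\<integral>\<^sup>+x. h (c + x) \<partial>lborel) = (\<integral>\<^sup>+x. h x \<partial>lborel)" if [measurable]: "h \<in> borel_measurable borel" for h :: "'a \<Rightarrow> ennreal" and c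
  proof -
    have "(\<integral>\<^sup>+x. h x \<partial>lborel) = (\<integral>\<^sup>+x. h x \<partial>distr lborel borel ((+) c))"
      by (simp add: lborel_distr_plus)
    also have "\<dots> = (\<integral>\<^sup>+x. h (c + x) \<partial>lborel)"
      by (subst nn_integral_distr) auto
    finally show ?thesis ..
  qed
  have inv: "(\<integral>\<^sup>+x. h (T x + c) \<partial>lborel) = (\<integral>\<^sup>+x. h (T x) \<partial>lborel)" if [measurable]: "h \<in> borel_measurable borel" for h :: "'a \<Rightarrow> ennreal" and c
    unfolding T using tr[of "\<lambda>x. h (T x)" "L c"] by (simp add: add.commute)
  have "(\<integral>\<^sup>+x. f (T x) \<partial>lborel) * (\<integral>\<^sup>+y. g y \<partial>lborel) = (\<integral>\<^sup>+y. (\<integral>\<^sup>+x. f (T x) \<partial>lborel) * g y \<partial>lborel)"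
    by (rule nn_integral_cmult[symmetric]) simp
  also have "\<dots> = (\<integral>\<^sup>+y. (\<integral>\<^sup>+x. f (T x + y) * g y \<partial>lborel) \<partial>lborel)"
    by (intro nn_integral_cong) (simp add: nn_integral_multc inv[OF f])
  also have "\<dots> = (\<integral>\<^sup>+x. (\<integral>\<^sup>+y. f (T x + y) * g y \<partial>lborel) \<partial>lborel)"
    using lborel_pair.Fubini'[of "\<lambda>x y. f (T x + y) * g y"] by simp
  also have "\<dots> = (\<integral>\<^sup>+x. (\<integral>\<^sup>+y. f y * g (- T x + y) \<partial>lborel) \<partial>lborel)"
  proof (rule nn_integral_cong)
    fix x
    show "(\<integral>\<^sup>+y. f (T x + y) * g y \<partial>lborel) = (\<integral>\<^sup>+y. f y * g (- T x + y) \<partial>lborel)"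
      using tr[of "\<lambda>y. f y * g (- T x + y)" "T x"] by (simp add: add.assoc[symmetric])
  qed
  also have "\<dots> = (\<integral>\<^sup>+y. (\<integral>\<^sup>+x. f y * g (- T x + y) \<partial>lborel) \<partial>lborel)"
    using lborel_pair.Fubini'[of "\<lambda>x y. f y * g (- T x + y)"] by simp
  also have "\<dots> = (\<integral>\<^sup>+y. f y * (\<integral>\<^sup>+x. g (- T x) \<partial>lborel) \<partial>lborel)"
  proof (rule nn_integral_cong)
    fix y
    have "(\<integral>\<^sup>+x. g (- T x + y) \<partial>lborel) = (\<integral>\<^sup>+x. g (- T x) \<partial>lborel)"
      using inv[of "\<lambda>z. g (- z)" "- y"] by simp
    then show "(\<integral>\<^sup>+x. f y * g (- T x + y) \<partial>lborel) = f y * (\<integral>\<^sup>+x. g (- T x) \<partial>lborel)"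
      by (simp add: nn_integral_cmult)
  qed
  also have "\<dots> = (\<integral>\<^sup>+y. f y \<partial>lborel) * (\<integral>\<^sup>+x. g (- T x) \<partial>lborel)"
    by (rule nn_integral_multc) simp
  finally show ?thesis .
qed

text \<open>By uniqueness of Haar measure the image measure is a multiple of Lebesgue measure, and
  the invariant set \<open>K\<close> shows that the factor is 1.\<close>

lemma lborel_distr_affine_invariant_set:
  fixes T :: "'a::euclidean_space \<Rightarrow> 'a"
  assumes Tm [measurable]: "T \<in> borel_measurable borel"
    and T: "\<And>x h. T x + h = T (x + L h)"
    and K: "K \<in> sets borel" "T -` K = K" "emeasure lborel K \<noteq> 0" "emeasure lborel K \<noteq> \<infinity>"
  shows "distr lborel borel T = lborel"
proof -
  have cancel: "a = b" if "k * a = k * b" "k \<noteq> 0" "k \<noteq> \<infinity>" for k a b :: ennreal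
    using that by (auto simp: ennreal_mult_cancel_left)
  have fK: "(\<lambda>x. indicator K x :: ennreal) \<in> borel_measurable borel"
    using K(1) by simp
  have iK: "(\<integral>\<^sup>+x. indicator K x \<partial>lborel) = emeasure lborel K"
    using K(1) by simp
  have "indicator K (T x) = (indicator K x :: ennreal)" for x
    using K(2) by (auto simp: indicator_def)
  then have iKT: "(\<integral>\<^sup>+x. indicator K (T x) \<partial>lborel) = emeasure lborel K"
    using iK by simp
  have eq: "(\<integral>\<^sup>+y. g y \<partial>lborel) = (\<integral>\<^sup>+x. g (T x) \<partial>lborel)" if [measurable]: "g \<in> borel_measurable borel" for g :: "'a \<Rightarrow> ennreal"
  proof -
    have gm: "(\<lambda>y. g (- y)) \<in> borel_measurable borel" by measurable
    have "emeasure lborel K * (\<integral>\<^sup>+y. g (- y) \<partial>lborel) = emeasure lborel K * (\<integral>\<^sup>+x. g (T x) \<partial>lborel)"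
      using lborel_translation_duality[OF Tm T fK gm] unfolding iK iKT minus_minus .
    then have 1: "(\<integral>\<^sup>+y. g (- y) \<partial>lborel) = (\<integral>\<^sup>+x. g (T x) \<partial>lborel)"
      by (rule cancel[OF _ K(3,4)])
    \<comment> \<open>The duality leaves a reflection in the argument of g; with the identity in
      place of T it shows that Lebesgue measure is invariant under reflection.\<close>
    have "emeasure lborel K * (\<integral>\<^sup>+y. g (- y) \<partial>lborel) = emeasure lborel K * (\<integral>\<^sup>+x. g x \<partial>lborel)"
    proof -
      have "(\<integral>\<^sup>+x. indicator K x \<partial>lborel) * (\<integral>\<^sup>+y. g (- y) \<partial>lborel) =
          (\<integral>\<^sup>+x. indicator K x \<partial>lborel) * (\<integral>\<^sup>+x. g (- (- x)) \<partial>lborel)"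
        by (rule lborel_translation_duality[where T = "\<lambda>x. x" and L = "\<lambda>h. h"]) (use fK gm in simp_all)
      then show ?thesis unfolding iK minus_minus .
    qed
    then have 2: "(\<integral>\<^sup>+y. g (- y) \<partial>lborel) = (\<integral>\<^sup>+x. g x \<partial>lborel)"
      by (rule cancel[OF _ K(3,4)])
    show ?thesis using 1 2 by simp
  qed
  show ?thesis
  proof (rule measure_eqI)
    fix A :: "'a set" assume "A \<in> sets (distr lborel borel T)"
    then have A: "A \<in> sets borel" by simp
    have "emeasure (distr lborel borel T) A = (\<integral>\<^sup>+x. indicator A x \<partial>distr lborel borel T)"
      using A by simp
    also have "\<dots> = (\<integral>\<^sup>+x. indicator A (T x) \<partial>lborel)"
      by (rule nn_integral_distr) (use A in auto)
    also have "\<dots> = emeasure lborel A"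
      using eq[of "indicator A"] A by simp
    finally show "emeasure (distr lborel borel T) A = emeasure lborel A" .
  qed simp
qed

lemma affine_eq_on_convex_hull:
  fixes a a' :: "'a::euclidean_space"
  assumes "\<And>x. x \<in> C \<Longrightarrow> a \<bullet> x + b = a' \<bullet> x + b'" "x \<in> convex hull C"
  shows "a \<bullet> x + b = a' \<bullet> x + b'"
proof -
  have "convex hull C \<subseteq> {x. (a - a') \<bullet> x = b' - b}"
  proof (rule hull_minimal)
    show "C \<subseteq> {x. (a - a') \<bullet> x = b' - b}"
    proof
      fix y assume "y \<in> C"
      from assms(1)[OF this] show "y \<in> {x. (a - a') \<bullet> x = b' - b}"
        by (simp add: inner_diff_left algebra_simps)
    qed
  qed (rule convex_hyperplane)
  then show ?thesis using assms(2) by (auto simp: inner_diff_left algebra_simps)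
qed

lemma affine_le_on_convex_hull:
  fixes a :: "'a::euclidean_space"
  assumes "\<And>x. x \<in> C \<Longrightarrow> a \<bullet> x + b \<le> d" "x \<in> convex hull C"
  shows "a \<bullet> x + b \<le> d"
proof -
  have "convex hull C \<subseteq> {x. a \<bullet> x \<le> d - b}"
  proof (rule hull_minimal)
    show "C \<subseteq> {x. a \<bullet> x \<le> d - b}"
      using assms(1) by (auto simp: le_diff_eq)
  qed (rule convex_halfspace_le)
  then show ?thesis using assms(2) by auto
qed

text \<open>With one point of \<open>C\<close> moved to the origin the others become linearly
  independent, so some linear functional takes the prescribed values; \<open>adjoint g 1\<close>
  represents it by an inner product.\<close>

lemma affine_interpolation:
  fixes C :: "'a::euclidean_space set"
  assumes "\<not> affine_dependent C"
  shows "\<exists>a b. \<forall>x\<in>C. a \<bullet> x + b = f x"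
proof (cases "C = {}")
  case False
  then obtain c where c: "c \<in> C" by blast
  let ?B = "(\<lambda>x. - c + x) ` (C - {c})"
  have "\<not> affine_dependent (insert c (C - {c}))"
    using assms c by (simp add: insert_absorb)
  then have "independent ?B"
    using affine_dependent_iff_dependent[of c "C - {c}"] by simp
  from linear_independent_extend[OF this, of "\<lambda>w. f (w + c) - f c"]
  obtain g where g: "linear g" "\<And>w. w \<in> ?B \<Longrightarrow> g w = f (w + c) - f c" by blast
  have inner: "adjoint g 1 \<bullet> x = g x" for x
    using adjoint_works[OF g(1), of x 1] by (simp add: inner_commute)
  have "adjoint g 1 \<bullet> x + (f c - g c) = f x" if x: "x \<in> C" for x
  proof (cases "x = c")
    case False
    then have "g (- c + x) = f x - f c" using g(2)[of "- c + x"] x by simp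
    moreover have "g (- c + x) = g x - g c"
      using linear_diff[OF g(1), of x c] by simp
    ultimately show ?thesis by (simp add: inner)
  qed (simp add: inner)
  then show ?thesis by blast
qed simp

context domain_mesh
begin

lemma cell_eq_convex_hull_vertices:
  assumes "K \<in> \<T>"
  shows "K = convex hull (vertices K)" "\<not> affine_dependent (vertices K)" "finite (vertices K)"
    "card (vertices K) = DIM('a) + 1"
proof -
  obtain C where C: "finite C" "\<not> affine_dependent C" "int (card C) = int DIM('a) + 1" "K = convex hull C"
    using cell_simplex[OF assms] unfolding simplex by blast
  have "vertices K = C"
    unfolding vertices_def C(4) using extreme_point_of_convex_hull_affine_independent[OF C(2)] by blast
  then show "K = convex hull (vertices K)" "\<not> affine_dependent (vertices K)" "finite (vertices K)"
    "card (vertices K) = DIM('a) + 1"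
    using C by simp_all
qed

lemma cell_measure_pos:
  assumes "K \<in> \<T>"
  shows "0 < measure lebesgue K"
proof -
  obtain x where "x \<in> interior K"
    using cell_interior_nonempty[OF assms] by blast
  then obtain r where r: "r > 0" "ball x r \<subseteq> K"
    using mem_interior by blast
  have "0 < measure lebesgue (ball x r)"
    using content_ball_pos[OF r(1), of x] by simp
  also have "\<dots> \<le> measure lebesgue K"
    by (rule measure_mono_fmeasurable[OF r(2) _ lmeasurable_compact[OF cell_compact[OF assms]]]) simp
  finally show ?thesis .
qed

text \<open>All d + 1 barycentric coordinates of a simplex have the same integral, because the
  affine map swapping two vertices preserves \<open>K\<close> and hence Lebesgue measure; and they
  add up to 1.\<close>

lemma integral_barycentric_coordinate:
  assumes K: "K \<in> \<T>" and c: "c \<in> vertices K"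
    and ab: "\<And>y. y \<in> vertices K \<Longrightarrow> a \<bullet> y + b = (if y = c then 1 else 0)"
  shows "(LINT x:K|lebesgue. a \<bullet> x + b) = measure lebesgue K / (real DIM('a) + 1)"
proof -
  note V = cell_eq_convex_hull_vertices[OF K]
  have "\<exists>p q. \<forall>y\<in>vertices K. p \<bullet> y + q = (if y = i then 1 else 0)" for i
    by (rule affine_interpolation[OF V(2)])
  then obtain p q where pq: "\<And>i y. i \<in> vertices K \<Longrightarrow> y \<in> vertices K \<Longrightarrow> p i \<bullet> y + q i = (if y = i then 1 else 0 :: real)"
    by metis
  define l where "l i x = p i \<bullet> x + q i" for i x
  have li: "set_integrable lebesgue K (l i)" for i
    unfolding l_def by (rule set_integrable_continuous_compact[OF cell_compact[OF K] _ subset_refl])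
      (use lmeasurable_compact[OF cell_compact[OF K]] in \<open>auto intro!: continuous_intros\<close>)
  have cK: "closed K" using compact_imp_closed cell_compact[OF K] by blast
  have swap: "(LINT x:K|lebesgue. l i x) = (LINT x:K|lebesgue. l j x)"
    if i: "i \<in> vertices K" and j: "j \<in> vertices K" and ij: "i \<noteq> j" for i j
  proof -
    \<comment> \<open>The affine involution that swaps the vertices i and j and fixes the others; it
      exchanges \<open>l i\<close> and \<open>l j\<close>.\<close>
    define T where "T x = x + (l i x - l j x) *\<^sub>R (j - i)" for x
    have pi: "p i \<bullet> (j - i) = -1" "p j \<bullet> (j - i) = 1"
      using pq[OF i i] pq[OF i j] pq[OF j i] pq[OF j j] ij by (auto simp: inner_diff_right)
    have lT: "l i (T x) = l j x" "l j (T x) = l i x" for x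
      unfolding T_def l_def inner_add_right inner_scaleR_right pi by simp_all
    have TT: "T (T x) = x" for x
    proof -
      have "T (T x) = T x + (l j x - l i x) *\<^sub>R (j - i)"
        unfolding T_def[of "T x"] lT ..
      then show ?thesis unfolding T_def by (simp add: algebra_simps)
    qed
    have Tv: "T y \<in> vertices K" if y: "y \<in> vertices K" for y
    proof -
      have "l i y = (if y = i then 1 else 0)" "l j y = (if y = j then 1 else 0)"
        unfolding l_def using pq i j y by auto
      then show ?thesis using i j y ij by (auto simp: T_def)
    qed
    have TK: "T x \<in> K" if x: "x \<in> K" for x
    proof -
      define A where "A x = x + (p i \<bullet> x - p j \<bullet> x) *\<^sub>R (j - i)" for x
      have lin: "linear A"
        unfolding A_def by (rule linearI) (simp_all add: inner_add_right algebra_simps)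
      have TA: "T x = (q i - q j) *\<^sub>R (j - i) + A x" for x
        unfolding T_def A_def l_def by (simp add: algebra_simps)
      have "T ` (convex hull vertices K) = convex hull (T ` vertices K)"
      proof -
        have T2: "T = (\<lambda>x. (q i - q j) *\<^sub>R (j - i) + x) \<circ> A" using TA by (simp add: fun_eq_iff)
        show ?thesis
          unfolding T2 image_comp[symmetric] convex_hull_linear_image[OF lin] convex_hull_translation ..
      qed
      also have "\<dots> \<subseteq> convex hull (vertices K)"
        by (rule hull_mono) (use Tv in blast)
      finally show ?thesis using x V(1) by blast
    qed
    have vim: "T -` K = K"
      using TK TT by (metis (no_types, lifting) equalityI subsetI vimageE vimageI)
    have Tm: "T \<in> borel_measurable borel"
      unfolding T_def l_def by measurable
    \<comment> \<open>The linear part of the involution is its own inverse, so it also supplies the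
      map L.\<close>
    have shift: "T x + h = T (x + (h + (p i \<bullet> h - p j \<bullet> h) *\<^sub>R (j - i)))" for x h
      unfolding T_def l_def inner_add_right inner_scaleR_right pi by (simp add: algebra_simps)
    have em: "emeasure lborel K = ennreal (measure lebesgue K)"
    proof -
      have "emeasure lborel K = emeasure lebesgue K"
        using cK by simp
      also have "\<dots> = ennreal (measure lebesgue K)"
        using fmeasurableD2[OF lmeasurable_compact[OF cell_compact[OF K]]]
        by (simp add: emeasure_eq_ennreal_measure)
      finally show ?thesis .
    qed
    have d: "distr lborel borel T = lborel"
      by (rule lborel_distr_affine_invariant_set[OF Tm shift _ vim])
        (use cK em cell_measure_pos[OF K] in auto)
    have lm: "(\<lambda>x. indicator K x * l i x) \<in> borel_measurable borel" for i
      unfolding l_def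
      by (intro borel_measurable_times borel_measurable_indicator borel_measurable_continuous_onI continuous_intros)
        (use cK in auto)
    have "(LINT x:K|lebesgue. l i x) = (LINT x|lborel. indicator K x * l i x)"
      unfolding set_lebesgue_integral_def using lm[of i] by (simp add: integral_completion)
    also have "\<dots> = (LINT x|distr lborel borel T. indicator K x * l i x)"
      unfolding d ..
    also have "\<dots> = (LINT x|lborel. indicator K (T x) * l i (T x))"
      by (rule integral_distr) (use Tm lm in auto)
    also have "\<dots> = (LINT x|lborel. indicator K x * l j x)"
    proof -
      have "indicator K (T x) = (indicator K x :: real)" for x
        using vim by (auto simp: indicator_def)
      then show ?thesis by (simp add: lT)
    qed
    also have "\<dots> = (LINT x:K|lebesgue. l j x)"
      unfolding set_lebesgue_integral_def using lm[of j] by (simp add: integral_completion)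
    finally show ?thesis .
  qed
  have one: "(\<Sum>i\<in>vertices K. l i x) = 1" if x: "x \<in> K" for x
  proof -
    have "(\<Sum>i\<in>vertices K. p i) \<bullet> x + (\<Sum>i\<in>vertices K. q i) = 0 \<bullet> x + 1"
    proof (rule affine_eq_on_convex_hull[of "vertices K"])
      fix y assume y: "y \<in> vertices K"
      have "(\<Sum>i\<in>vertices K. p i) \<bullet> y + (\<Sum>i\<in>vertices K. q i) = (\<Sum>i\<in>vertices K. if y = i then 1 else 0)"
        unfolding inner_sum_left sum.distrib[symmetric] by (rule sum.cong) (use pq y in auto)
      then show "(\<Sum>i\<in>vertices K. p i) \<bullet> y + (\<Sum>i\<in>vertices K. q i) = 0 \<bullet> y + 1"
        using y V(3) by simp
    qed (use x V(1) in simp)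
    then show ?thesis
      unfolding l_def sum.distrib by (simp add: inner_sum_left)
  qed
  have "measure lebesgue K = (LINT x:K|lebesgue. 1)"
    using lmeasurable_compact[OF cell_compact[OF K]] by (simp add: set_lebesgue_integral_def)
  also have "\<dots> = (LINT x:K|lebesgue. (\<Sum>i\<in>vertices K. l i x))"
    by (rule set_lint_cong_AE) (use one in auto)
  also have "\<dots> = (\<Sum>i\<in>vertices K. LINT x:K|lebesgue. l i x)"
    by (rule set_lint_sum) (rule li)
  also have "\<dots> = (\<Sum>i\<in>vertices K. LINT x:K|lebesgue. l c x)"
    using swap[OF _ c] by (intro sum.cong refl) metis
  also have "\<dots> = (real DIM('a) + 1) * (LINT x:K|lebesgue. l c x)"
    using V(4) by simp
  also have "(LINT x:K|lebesgue. l c x) = (LINT x:K|lebesgue. a \<bullet> x + b)"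
  proof (rule set_lint_cong_AE)
    have "l c x = a \<bullet> x + b" if "x \<in> K" for x
      unfolding l_def by (rule affine_eq_on_convex_hull[of "vertices K"]) (use ab pq[OF c] that V(1) in auto)
    then show "AE x in lebesgue. x \<in> K \<longrightarrow> l c x = a \<bullet> x + b" by auto
  qed
  finally show ?thesis
    by (simp add: field_simps)
qed

section \<open>Nodal values, mass lumping and the projections\<close>

definition mesh_vertices :: "'a set" where "mesh_vertices = (\<Union>K\<in>\<T>. vertices K)"

lemma finite_mesh_vertices: "finite mesh_vertices"
  unfolding mesh_vertices_def using finite_mesh cell_eq_convex_hull_vertices(3) by blast

lemma vertices_subset_cell: "K \<in> \<T> \<Longrightarrow> vertices K \<subseteq> K"
  using cell_eq_convex_hull_vertices(1) hull_subset by metis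

text \<open>Extreme points of a face are extreme points of the cell, and the compact convex set K
  \<inter> L is the hull of its extreme points. This is conformity in the form that allows affine
  functions to be glued.\<close>

lemma vertices_Int_cells:
  assumes "K \<in> \<T>" "L \<in> \<T>"
  shows "K \<inter> L = convex hull (vertices K \<inter> vertices L)"
proof
  have f: "(K \<inter> L) face_of K" "(L \<inter> K) face_of L"
    using face_of_cell assms by blast+
  have "K \<inter> L = convex hull {x. x extreme_point_of (K \<inter> L)}"
    using cell_compact[OF assms(1)] cell_compact[OF assms(2)] cell_convex[OF assms(1)] cell_convex[OF assms(2)]
    by (intro Krein_Milman_Minkowski compact_Int convex_Int)
  also have "\<dots> \<subseteq> convex hull (vertices K \<inter> vertices L)"
    using extreme_point_of_face[OF f(1)] extreme_point_of_face[OF f(2)]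
    by (intro hull_mono) (auto simp: vertices_def Int_commute)
  finally show "K \<inter> L \<subseteq> convex hull (vertices K \<inter> vertices L)" .
  show "convex hull (vertices K \<inter> vertices L) \<subseteq> K \<inter> L"
    using vertices_subset_cell[OF assms(1)] vertices_subset_cell[OF assms(2)] cell_convex[OF assms(1)] cell_convex[OF assms(2)]
    by (intro hull_minimal convex_Int) auto
qed

lemma P1cont_interpolation: "\<exists>v\<in>P1cont \<T>. \<forall>x\<in>mesh_vertices. v x = f x"
proof -
  have "\<forall>K\<in>\<T>. \<exists>a b. \<forall>x\<in>vertices K. a \<bullet> x + b = f x"
    using affine_interpolation cell_eq_convex_hull_vertices(2) by blast
  then obtain a b where ab: "\<And>K x. K \<in> \<T> \<Longrightarrow> x \<in> vertices K \<Longrightarrow> a K \<bullet> x + b K = f x"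
    by metis
  \<comment> \<open>The choice of the cell is immaterial: the interpolants of two cells agree at
    common vertices and therefore on the intersection.\<close>
  define v where "v x = (let K = SOME K. K \<in> \<T> \<and> x \<in> K in a K \<bullet> x + b K)" for x
  have v: "v x = a K \<bullet> x + b K" if K: "K \<in> \<T>" "x \<in> K" for K x
  proof -
    define L where "L = (SOME L. L \<in> \<T> \<and> x \<in> L)"
    have L: "L \<in> \<T>" "x \<in> L"
      using someI[of "\<lambda>L. L \<in> \<T> \<and> x \<in> L" K] K unfolding L_def by blast+
    have "a L \<bullet> x + b L = a K \<bullet> x + b K"
      by (rule affine_eq_on_convex_hull[of "vertices K \<inter> vertices L"])
        (use ab K L vertices_Int_cells[OF K(1) L(1)] in auto)
    then show ?thesis unfolding v_def Let_def L_def .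
  qed
  have "v \<in> P1cont \<T>"
    unfolding P1cont_def mem_Collect_eq
  proof
    have "continuous_on (\<Union>K\<in>\<T>. K) v"
    proof (rule continuous_on_closed_Union[OF finite_mesh])
      fix K assume K: "K \<in> \<T>"
      show "closed K" using cell_compact[OF K] compact_imp_closed by blast
      have "continuous_on K (\<lambda>x. a K \<bullet> x + b K)" by (intro continuous_intros)
      then show "continuous_on K v"
        by (rule continuous_on_eq) (use v K in simp)
    qed
    then show "continuous_on (\<Union>\<T>) v" by simp
    show "\<forall>K\<in>\<T>. \<exists>a b. \<forall>x\<in>K. v x = a \<bullet> x + b" using v by blast
  qed
  moreover have "v x = f x" if "x \<in> mesh_vertices" for x
    using that v ab vertices_subset_cell unfolding mesh_vertices_def by fastforce
  ultimately show ?thesis by blast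
qed

lemma P1cont_linear_combination:
  assumes "v \<in> P1cont \<T>" "w \<in> P1cont \<T>"
  shows "(\<lambda>x. r * v x + s * w x) \<in> P1cont \<T>"
  unfolding P1cont_def mem_Collect_eq
proof
  show "continuous_on (\<Union>\<T>) (\<lambda>x. r * v x + s * w x)"
    using assms unfolding P1cont_def by (auto intro!: continuous_intros)
  show "\<forall>K\<in>\<T>. \<exists>a b. \<forall>x\<in>K. r * v x + s * w x = a \<bullet> x + b"
  proof
    fix K assume K: "K \<in> \<T>"
    obtain a b where "\<forall>x\<in>K. v x = a \<bullet> x + b"
      using assms(1) K unfolding P1cont_def by blast
    moreover obtain a' b' where "\<forall>x\<in>K. w x = a' \<bullet> x + b'"
      using assms(2) K unfolding P1cont_def by blast
    ultimately have "\<forall>x\<in>K. r * v x + s * w x = (r *\<^sub>R a + s *\<^sub>R a') \<bullet> x + (r * b + s * b')"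
      by (simp add: inner_add_left algebra_simps)
    then show "\<exists>a b. \<forall>x\<in>K. r * v x + s * w x = a \<bullet> x + b" by blast
  qed
qed

lemma P1cont_eqI:
  assumes "v \<in> P1cont \<T>" "w \<in> P1cont \<T>" "\<And>x. x \<in> mesh_vertices \<Longrightarrow> v x = w x" "x \<in> closure \<Omega>"
  shows "v x = w x"
proof -
  obtain K where K: "K \<in> \<T>" "x \<in> K"
    using assms(4) Union_mesh by blast
  obtain a b where ab: "\<forall>x\<in>K. v x = a \<bullet> x + b"
    using assms(1) K unfolding P1cont_def by blast
  obtain a' b' where ab': "\<forall>x\<in>K. w x = a' \<bullet> x + b'"
    using assms(2) K unfolding P1cont_def by blast
  have vK: "y \<in> K \<and> y \<in> mesh_vertices" if "y \<in> vertices K" for y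
    using that vertices_subset_cell[OF K(1)] K(1) unfolding mesh_vertices_def by blast
  have "a \<bullet> x + b = a' \<bullet> x + b'"
  proof (rule affine_eq_on_convex_hull[of "vertices K"])
    show "a \<bullet> y + b = a' \<bullet> y + b'" if "y \<in> vertices K" for y
      using vK[OF that] assms(3)[of y] ab ab' by simp
  qed (use K cell_eq_convex_hull_vertices(1)[OF K(1)] in simp)
  then show ?thesis using ab ab' K by simp
qed

lemma P1cont_le:
  assumes "v \<in> P1cont \<T>" "\<And>x. x \<in> mesh_vertices \<Longrightarrow> v x \<le> d" "x \<in> closure \<Omega>"
  shows "v x \<le> d"
proof -
  obtain K where K: "K \<in> \<T>" "x \<in> K"
    using assms(3) Union_mesh by blast
  obtain a b where ab: "\<forall>x\<in>K. v x = a \<bullet> x + b"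
    using assms(1) K unfolding P1cont_def by blast
  have "a \<bullet> x + b \<le> d"
  proof (rule affine_le_on_convex_hull[of "vertices K"])
    show "a \<bullet> y + b \<le> d" if "y \<in> vertices K" for y
    proof -
      have "y \<in> K" "y \<in> mesh_vertices"
        using that vertices_subset_cell[OF K(1)] K(1) unfolding mesh_vertices_def by blast+
      then show ?thesis using assms(2)[of y] ab by simp
    qed
  qed (use K cell_eq_convex_hull_vertices(1)[OF K(1)] in simp)
  then show ?thesis using ab K by simp
qed

lemma P1cont_continuous: "v \<in> P1cont \<T> \<Longrightarrow> continuous_on (closure \<Omega>) v"
  unfolding P1cont_def Union_mesh[symmetric] by blast

lemma domain_sets: "\<Omega> \<in> sets lebesgue"
  using open_domain by auto

lemma set_integrable_continuous_domain:
  fixes f :: "'a \<Rightarrow> 'b::euclidean_space"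
  assumes "continuous_on (closure \<Omega>) f"
  shows "set_integrable lebesgue \<Omega> f"
  by (rule set_integrable_continuous_compact[OF compact_closure_domain assms closure_subset domain_sets])

text \<open>Closed cells overlap, and open cells leave gaps, only in the null skeleton; integrals
  over the domain thus become sums over cells.\<close>

lemma indicator_domain_AE:
  "AE x in lebesgue. (indicator \<Omega> x :: real) = (\<Sum>K\<in>\<T>. indicator (interior K) x)"
  "AE x in lebesgue. (indicator \<Omega> x :: real) = (\<Sum>K\<in>\<T>. indicator K x)"
proof -
  have unique: "(\<Sum>K\<in>\<T>. indicator (F K) x) = (1 :: real)"
    if x: "K \<in> \<T>" "x \<in> interior K" and F: "\<And>L. interior L \<subseteq> F L" "\<And>L. F L \<subseteq> L" for F K x
  proof -
    have "(\<Sum>L\<in>\<T>. indicator (F L) x) = (\<Sum>L\<in>\<T>. if L = K then 1 else 0 :: real)"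
    proof (rule sum.cong[OF refl])
      fix L assume L: "L \<in> \<T>"
      show "indicator (F L) x = (if L = K then 1 else 0 :: real)"
        using F x interior_cells_meet[OF x(1) L x(2)] by (auto simp: indicator_def)
    qed
    then show ?thesis using x(1) finite_mesh by simp
  qed
  have none: "(\<Sum>K\<in>\<T>. indicator (F K) x) = (0 :: real)" if "x \<notin> closure \<Omega>" "\<And>L. F L \<subseteq> L" for F x
    using that Union_mesh by (intro sum.neutral) (auto simp: indicator_def)
  have "AE x in lebesgue. (indicator \<Omega> x :: real) = (\<Sum>K\<in>\<T>. indicator (F K) x)"
    if F: "\<And>L. interior L \<subseteq> F L" "\<And>L. F L \<subseteq> L" for F
    using AE_cells
  proof eventually_elim
    fix x assume x: "x \<in> closure \<Omega> \<longrightarrow> x \<in> cells"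
    show "(indicator \<Omega> x :: real) = (\<Sum>K\<in>\<T>. indicator (F K) x)"
    proof (cases "x \<in> closure \<Omega>")
      case True
      then obtain K where K: "K \<in> \<T>" "x \<in> interior K" using x by blast
      then have "x \<in> \<Omega>" using interior_cell_subset by blast
      then show ?thesis using unique[OF K F] by simp
    next
      case False
      then have "x \<notin> \<Omega>" using closure_subset by blast
      then show ?thesis using none[OF False F(2)] by simp
    qed
  qed
  from this[of interior] this[of "\<lambda>K. K"]
  show "AE x in lebesgue. (indicator \<Omega> x :: real) = (\<Sum>K\<in>\<T>. indicator (interior K) x)"
    "AE x in lebesgue. (indicator \<Omega> x :: real) = (\<Sum>K\<in>\<T>. indicator K x)"
    using interior_subset by blast+
qed

lemma set_integrable_cell:
  fixes f :: "'a \<Rightarrow> real"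
  assumes "set_integrable lebesgue \<Omega> f" "K \<in> \<T>"
  shows "set_integrable lebesgue K f"
proof -
  have "set_integrable lebesgue (interior K) f"
    by (rule set_integrable_subset[OF assms(1) _ interior_cell_subset[OF assms(2)]]) auto
  then show ?thesis
    unfolding set_integrable_def
  proof (rule lebesgue_integrable_cong_AE[rotated])
    show "AE x in lebesgue. indicator (interior K) x *\<^sub>R f x = indicator K x *\<^sub>R f x"
      using AE_cells
    proof eventually_elim
      fix x assume x: "x \<in> closure \<Omega> \<longrightarrow> x \<in> cells"
      have "x \<in> interior K" if "x \<in> K"
      proof -
        have "x \<in> closure \<Omega>" using that assms(2) Union_mesh by blast
        then obtain L where "L \<in> \<T>" "x \<in> interior L" using x by blast
        then show ?thesis using interior_cells_meet[of L K x] assms(2) that by blast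
      qed
      then show "indicator (interior K) x *\<^sub>R f x = indicator K x *\<^sub>R f x"
        using interior_subset by (auto simp: indicator_def)
    qed
  qed
qed

lemma integral_domain_cells:
  fixes f :: "'a \<Rightarrow> real"
  assumes "set_integrable lebesgue \<Omega> f"
  shows "(LINT x:\<Omega>|lebesgue. f x) = (\<Sum>K\<in>\<T>. LINT x:K|lebesgue. f x)"
proof -
  have "(LINT x:\<Omega>|lebesgue. f x) = (LINT x|lebesgue. (\<Sum>K\<in>\<T>. indicator K x *\<^sub>R f x))"
    unfolding set_lebesgue_integral_def
    by (rule lebesgue_integral_cong_AE)
      (use indicator_domain_AE(2) in \<open>auto elim!: eventually_mono simp: sum_distrib_right\<close>)
  also have "\<dots> = (\<Sum>K\<in>\<T>. LINT x:K|lebesgue. f x)"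
    unfolding set_lebesgue_integral_def
    by (rule Bochner_Integration.integral_sum) (use set_integrable_cell[OF assms] in \<open>simp add: set_integrable_def\<close>)
  finally show ?thesis .
qed

lemma cellwise_constant_AE_eq:
  fixes f :: "'a \<Rightarrow> 'b::euclidean_space"
  assumes "AE x in lebesgue. \<forall>K\<in>\<T>. x \<in> interior K \<longrightarrow> f x = c K"
  shows "AE x in lebesgue. x \<in> \<Omega> \<longrightarrow> f x = (\<Sum>K\<in>\<T>. indicator (interior K) x *\<^sub>R c K)"
  using assms AE_cells
proof eventually_elim
  fix x assume f: "\<forall>K\<in>\<T>. x \<in> interior K \<longrightarrow> f x = c K" and x: "x \<in> closure \<Omega> \<longrightarrow> x \<in> cells"
  show "x \<in> \<Omega> \<longrightarrow> f x = (\<Sum>K\<in>\<T>. indicator (interior K) x *\<^sub>R c K)"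
  proof
    assume "x \<in> \<Omega>"
    then obtain K where K: "K \<in> \<T>" "x \<in> interior K" using x closure_subset by blast
    have "(\<Sum>L\<in>\<T>. indicator (interior L) x *\<^sub>R c L) = (\<Sum>L\<in>\<T>. if L = K then c K else 0)"
    proof (rule sum.cong[OF refl])
      fix L assume L: "L \<in> \<T>"
      show "indicator (interior L) x *\<^sub>R c L = (if L = K then c K else 0)"
        using K interior_cells_meet[OF K(1) L K(2)] interior_subset[of L] by (auto simp: indicator_def)
    qed
    then show "f x = (\<Sum>K\<in>\<T>. indicator (interior K) x *\<^sub>R c K)"
      using f K finite_mesh by simp
  qed
qed

lemma set_integrable_cellwise_constant_mult:
  fixes f g :: "'a \<Rightarrow> real"
  assumes f: "AE x in lebesgue. \<forall>K\<in>\<T>. x \<in> interior K \<longrightarrow> f x = c K" and g: "set_integrable lebesgue \<Omega> g"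
  shows "set_integrable lebesgue \<Omega> (\<lambda>x. f x * g x)"
proof -
  let ?s = "\<lambda>x. \<Sum>K\<in>\<T>. indicator (interior K) x *\<^sub>R c K"
  have "set_integrable lebesgue \<Omega> (\<lambda>x. ?s x *\<^sub>R g x)"
  proof (rule set_integrable_scaleR_bounded[OF g])
    show "?s \<in> borel_measurable lebesgue"
      by (intro borel_measurable_sum borel_measurable_scaleR borel_measurable_indicator) auto
    show "\<bar>?s x\<bar> \<le> (\<Sum>K\<in>\<T>. \<bar>c K\<bar>)" for x
      by (rule order_trans[OF sum_abs]) (auto intro!: sum_mono simp: indicator_def)
  qed
  then show ?thesis
    by (rule set_integrable_lebesgue_cong_AE[rotated])
      (use cellwise_constant_AE_eq[OF f] in \<open>auto elim!: eventually_mono\<close>)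
qed

lemma set_integrable_cellwise_constant:
  fixes f :: "'a \<Rightarrow> real"
  assumes f: "AE x in lebesgue. \<forall>K\<in>\<T>. x \<in> interior K \<longrightarrow> f x = c K"
  shows "set_integrable lebesgue \<Omega> f"
  using set_integrable_cellwise_constant_mult[OF f set_integrable_continuous_domain[of "\<lambda>_. 1"]] by simp

text \<open>Functions of \<open>P0disc\<close> are arbitrary on the skeleton, hence the reference to
  the open cell.\<close>

definition cell_value :: "('a \<Rightarrow> real) \<Rightarrow> 'a set \<Rightarrow> real" where
  "cell_value w K = (THE c. \<forall>x\<in>interior K. w x = c)"

lemma cell_value:
  assumes "w \<in> P0disc \<T>" "K \<in> \<T>" "x \<in> interior K"
  shows "w x = cell_value w K"
proof -
  obtain c where c: "\<forall>x\<in>interior K. w x = c"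
    using assms(1,2) unfolding P0disc_def by blast
  have "cell_value w K = c"
    unfolding cell_value_def by (rule the_equality) (use c assms(3) in auto)
  then show ?thesis using c assms(3) by simp
qed

lemma P0disc_cellwise_constant:
  "w \<in> P0disc \<T> \<Longrightarrow> AE x in lebesgue. \<forall>K\<in>\<T>. x \<in> interior K \<longrightarrow> w x = cell_value w K"
  using cell_value by auto

lemma P0discI:
  assumes "\<And>K x. K \<in> \<T> \<Longrightarrow> x \<in> interior K \<Longrightarrow> w x = c K"
  shows "w \<in> P0disc \<T>"
  using assms unfolding P0disc_def by blast

lemma set_integrable_P0disc_mult:
  fixes g :: "'a \<Rightarrow> real"
  assumes "w \<in> P0disc \<T>" "set_integrable lebesgue \<Omega> g"
  shows "set_integrable lebesgue \<Omega> (\<lambda>x. w x * g x)"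
  by (rule set_integrable_cellwise_constant_mult[OF P0disc_cellwise_constant[OF assms(1)] assms(2)])

lemma set_integrable_P0disc: "w \<in> P0disc \<T> \<Longrightarrow> set_integrable lebesgue \<Omega> w"
  by (rule set_integrable_cellwise_constant[OF P0disc_cellwise_constant])

lemma integral_cell_P0disc_mult:
  fixes g :: "'a \<Rightarrow> real"
  assumes "w \<in> P0disc \<T>" "K \<in> \<T>"
  shows "(LINT x:K|lebesgue. w x * g x) = cell_value w K * (LINT x:K|lebesgue. g x)"
proof -
  have "(LINT x:K|lebesgue. w x * g x) = (LINT x:K|lebesgue. cell_value w K * g x)"
  proof (rule set_lint_cong_AE)
    show "AE x in lebesgue. x \<in> K \<longrightarrow> w x * g x = cell_value w K * g x"
      using AE_cells
    proof eventually_elim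
      fix x assume x: "x \<in> closure \<Omega> \<longrightarrow> x \<in> cells"
      show "x \<in> K \<longrightarrow> w x * g x = cell_value w K * g x"
      proof
        assume xK: "x \<in> K"
        then obtain L where "L \<in> \<T>" "x \<in> interior L" using x assms(2) Union_mesh by blast
        then have "x \<in> interior K" using interior_cells_meet[of L K x] assms(2) xK by blast
        then show "w x * g x = cell_value w K * g x" using cell_value[OF assms] by simp
      qed
    qed
  qed
  then show ?thesis by simp
qed

text \<open>The cell means have the defining property, so the function chosen by \<open>Pi0\<close>
  has it as well.\<close>

lemma Pi0:
  assumes g: "set_integrable lebesgue \<Omega> g"
  shows "Pi0 \<Omega> \<T> g \<in> P0disc \<T>" "w \<in> P0disc \<T> \<Longrightarrow> L2_prod \<Omega> (Pi0 \<Omega> \<T> g) w = L2_prod \<Omega> g w"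
proof -
  define m where "m K = (LINT x:K|lebesgue. g x) / measure lebesgue K" for K
  define q where "q x = (\<Sum>K\<in>\<T>. indicator (interior K) x * m K)" for x
  have qm: "q x = m K" if K: "K \<in> \<T>" "x \<in> interior K" for K x
  proof -
    have "q x = (\<Sum>L\<in>\<T>. if L = K then m K else 0)"
      unfolding q_def
    proof (rule sum.cong[OF refl])
      fix L assume L: "L \<in> \<T>"
      show "indicator (interior L) x * m L = (if L = K then m K else 0)"
        using K interior_cells_meet[OF K(1) L K(2)] interior_subset[of L] by (auto simp: indicator_def)
    qed
    then show ?thesis using K finite_mesh by simp
  qed
  then have q: "q \<in> P0disc \<T>" by (rule P0discI)
  have "L2_prod \<Omega> q w = L2_prod \<Omega> g w" if w: "w \<in> P0disc \<T>" for w
  proof -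
    have "L2_prod \<Omega> q w = (\<Sum>K\<in>\<T>. LINT x:K|lebesgue. w x * q x)"
      unfolding L2_prod_def inner_real_def mult.commute[of "q _"]
      by (rule integral_domain_cells[OF set_integrable_P0disc_mult[OF w set_integrable_P0disc[OF q]]])
    also have "\<dots> = (\<Sum>K\<in>\<T>. LINT x:K|lebesgue. w x * g x)"
    proof (rule sum.cong[OF refl])
      fix K assume K: "K \<in> \<T>"
      have "(LINT x:K|lebesgue. q x) = m K * measure lebesgue K"
      proof -
        have "(LINT x:K|lebesgue. q x * 1) = cell_value q K * (LINT x:K|lebesgue. 1)"
          by (rule integral_cell_P0disc_mult[OF q K])
        moreover have "(LINT x:K|lebesgue. 1) = measure lebesgue K"
          using lmeasurable_compact[OF cell_compact[OF K]] by (simp add: set_lebesgue_integral_def)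
        moreover obtain x where "x \<in> interior K" using cell_interior_nonempty[OF K] by blast
        then have "cell_value q K = m K" using cell_value[OF q K] qm[OF K] by metis
        ultimately show ?thesis by simp
      qed
      also have "\<dots> = (LINT x:K|lebesgue. g x)"
        using cell_measure_pos[OF K] by (simp add: m_def)
      finally show "(LINT x:K|lebesgue. w x * q x) = (LINT x:K|lebesgue. w x * g x)"
        unfolding integral_cell_P0disc_mult[OF w K] by simp
    qed
    also have "\<dots> = L2_prod \<Omega> g w"
      unfolding L2_prod_def inner_real_def mult.commute[of "g _"]
      by (rule integral_domain_cells[OF set_integrable_P0disc_mult[OF w g], symmetric])
    finally show ?thesis .
  qed
  then have "\<exists>q. q \<in> P0disc \<T> \<and> (\<forall>w \<in> P0disc \<T>. L2_prod \<Omega> q w = L2_prod \<Omega> g w)"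
    using q by (intro exI[of _ q]) simp
  then have "Pi0 \<Omega> \<T> g \<in> P0disc \<T> \<and> (\<forall>w \<in> P0disc \<T>. L2_prod \<Omega> (Pi0 \<Omega> \<T> g) w = L2_prod \<Omega> g w)"
    unfolding Pi0_def by (rule someI_ex)
  then show "Pi0 \<Omega> \<T> g \<in> P0disc \<T>" "w \<in> P0disc \<T> \<Longrightarrow> L2_prod \<Omega> (Pi0 \<Omega> \<T> g) w = L2_prod \<Omega> g w"
    by blast+
qed

text \<open>The nodal basis function of the vertex y.\<close>

definition hat :: "'a \<Rightarrow> 'a \<Rightarrow> real" where
  "hat y = (SOME v. v \<in> P1cont \<T> \<and> (\<forall>x\<in>mesh_vertices. v x = (if x = y then 1 else 0)))"

lemma hat: "hat y \<in> P1cont \<T>" "x \<in> mesh_vertices \<Longrightarrow> hat y x = (if x = y then 1 else 0)"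
proof -
  have "\<exists>v. v \<in> P1cont \<T> \<and> (\<forall>x\<in>mesh_vertices. v x = (if x = y then 1 else 0))"
    using P1cont_interpolation[of "\<lambda>x. if x = y then 1 else 0"] by blast
  then have "hat y \<in> P1cont \<T> \<and> (\<forall>x\<in>mesh_vertices. hat y x = (if x = y then 1 else 0))"
    unfolding hat_def by (rule someI_ex)
  then show "hat y \<in> P1cont \<T>" "x \<in> mesh_vertices \<Longrightarrow> hat y x = (if x = y then 1 else 0)"
    by blast+
qed

lemma hat_nonneg:
  assumes "x \<in> closure \<Omega>" shows "0 \<le> hat y x"
proof -
  have "(-1) * hat y x + 0 * hat y x \<le> 0"
    by (rule P1cont_le[OF P1cont_linear_combination[OF hat(1) hat(1)] _ assms]) (auto simp: hat(2))
  then show ?thesis by simp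
qed

lemma P1cont_sum:
  assumes "finite I" "\<And>i. i \<in> I \<Longrightarrow> v i \<in> P1cont \<T>"
  shows "(\<lambda>x. \<Sum>i\<in>I. r i * v i x) \<in> P1cont \<T>"
  using assms
proof (induction I rule: finite_induct)
  case empty
  show ?case unfolding P1cont_def by (auto intro: exI[of _ 0])
next
  case (insert i I)
  then show ?case
    using P1cont_linear_combination[of "v i" "\<lambda>x. \<Sum>i\<in>I. r i * v i x" "r i" 1] by simp
qed

lemma P1cont_expansion:
  assumes v: "v \<in> P1cont \<T>" and x: "x \<in> closure \<Omega>"
  shows "v x = (\<Sum>y\<in>mesh_vertices. v y * hat y x)"
proof (rule P1cont_eqI[OF v _ _ x])
  show "(\<lambda>x. \<Sum>y\<in>mesh_vertices. v y * hat y x) \<in> P1cont \<T>"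
    by (rule P1cont_sum[OF finite_mesh_vertices hat(1)])
  fix z assume z: "z \<in> mesh_vertices"
  have "(\<Sum>y\<in>mesh_vertices. v y * hat y z) = (\<Sum>y\<in>mesh_vertices. if z = y then v y else 0)"
    by (rule sum.cong) (auto simp: hat(2)[OF z])
  then show "v z = (\<Sum>y\<in>mesh_vertices. v y * hat y z)"
    using z finite_mesh_vertices by simp
qed

text \<open>The diagonal entry of the lumped mass matrix at y.\<close>

definition lump_weight :: "'a \<Rightarrow> real" where
  "lump_weight y = 1 / (real DIM('a) + 1) * (\<Sum>K\<in>{K \<in> \<T>. y \<in> vertices K}. measure lebesgue K)"

lemma lump_weight_pos:
  assumes "y \<in> mesh_vertices" shows "0 < lump_weight y"
proof -
  have "0 < (\<Sum>K\<in>{K \<in> \<T>. y \<in> vertices K}. measure lebesgue K)"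
    by (rule sum_pos) (use finite_mesh assms cell_measure_pos in \<open>auto simp: mesh_vertices_def\<close>)
  then show ?thesis unfolding lump_weight_def by simp
qed

lemma lumped_prod_eq: "lumped_prod \<T> v w = (\<Sum>y\<in>mesh_vertices. lump_weight y * (v y * w y))"
proof -
  have inner: "measure lebesgue K * (\<Sum>y\<in>vertices K. v y * w y) =
      (\<Sum>y\<in>mesh_vertices. if y \<in> vertices K then measure lebesgue K * (v y * w y) else 0)" if K: "K \<in> \<T>" for K
  proof -
    have "vertices K \<subseteq> mesh_vertices" using K unfolding mesh_vertices_def by blast
    then show ?thesis
      using finite_mesh_vertices by (simp add: sum.If_cases Int_absorb1 sum_distrib_left)
  qed
  have outer: "(\<Sum>K\<in>\<T>. if y \<in> vertices K then measure lebesgue K * (v y * w y) else 0) =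
      (\<Sum>K\<in>{K \<in> \<T>. y \<in> vertices K}. measure lebesgue K) * (v y * w y)" for y
    unfolding sum_distrib_right by (rule sum.inter_filter[OF finite_mesh, symmetric])
  have "(\<Sum>K\<in>\<T>. measure lebesgue K * (\<Sum>y\<in>vertices K. v y * w y)) =
      (\<Sum>K\<in>\<T>. \<Sum>y\<in>mesh_vertices. if y \<in> vertices K then measure lebesgue K * (v y * w y) else 0)"
    by (rule sum.cong[OF refl]) (rule inner)
  also have "\<dots> = (\<Sum>y\<in>mesh_vertices. \<Sum>K\<in>\<T>. if y \<in> vertices K then measure lebesgue K * (v y * w y) else 0)"
    by (rule sum.swap)
  finally have eq: "(\<Sum>K\<in>\<T>. measure lebesgue K * (\<Sum>y\<in>vertices K. v y * w y)) =
      (\<Sum>y\<in>mesh_vertices. \<Sum>K\<in>\<T>. if y \<in> vertices K then measure lebesgue K * (v y * w y) else 0)" .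
  show ?thesis
    unfolding lumped_prod_def lump_weight_def eq outer
    by (subst sum_distrib_left, intro sum.cong refl) (rule mult.assoc[symmetric])
qed

text \<open>On a cell with vertex y the hat function is a barycentric coordinate, on the others it
  vanishes. That its integral is the lumped weight makes \<open>Pi1h\<close> an averaging operator
  at the vertices.\<close>

lemma integral_hat:
  assumes y: "y \<in> mesh_vertices"
  shows "(LINT x:\<Omega>|lebesgue. hat y x) = lump_weight y"
proof -
  have "(LINT x:\<Omega>|lebesgue. hat y x) = (\<Sum>K\<in>\<T>. LINT x:K|lebesgue. hat y x)"
    by (rule integral_domain_cells[OF set_integrable_continuous_domain[OF P1cont_continuous[OF hat(1)]]])
  also have "\<dots> = (\<Sum>K\<in>\<T>. if y \<in> vertices K then measure lebesgue K / (real DIM('a) + 1) else 0)"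
  proof (rule sum.cong[OF refl])
    fix K assume K: "K \<in> \<T>"
    obtain a b where ab: "\<forall>x\<in>K. hat y x = a \<bullet> x + b"
      using hat(1)[of y] K unfolding P1cont_def by blast
    have v: "a \<bullet> z + b = (if z = y then 1 else 0)" if z: "z \<in> vertices K" for z
    proof -
      have "z \<in> K" "z \<in> mesh_vertices"
        using z vertices_subset_cell[OF K] K unfolding mesh_vertices_def by blast+
      then show ?thesis using ab hat(2)[of z y] by simp
    qed
    have eq: "(LINT x:K|lebesgue. hat y x) = (LINT x:K|lebesgue. a \<bullet> x + b)"
      by (rule set_lint_cong_AE) (use ab in auto)
    show "(LINT x:K|lebesgue. hat y x) = (if y \<in> vertices K then measure lebesgue K / (real DIM('a) + 1) else 0)"
    proof (cases "y \<in> vertices K")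
      case True
      then show ?thesis using integral_barycentric_coordinate[OF K True v] eq by simp
    next
      case False
      have "a \<bullet> x + b = 0 \<bullet> x + 0" if "x \<in> K" for x
        by (rule affine_eq_on_convex_hull[of "vertices K"])
          (use v False that cell_eq_convex_hull_vertices(1)[OF K] in auto)
      then have "(LINT x:K|lebesgue. a \<bullet> x + b) = (LINT x:K|lebesgue. 0)"
        by (intro set_lint_cong_AE) auto
      then show ?thesis using False eq by (simp add: set_lebesgue_integral_def)
    qed
  qed
  also have "\<dots> = lump_weight y"
    unfolding lump_weight_def sum.inter_filter[OF finite_mesh, symmetric] by (simp add: sum_divide_distrib)
  finally show ?thesis .
qed

text \<open>The lumped mass matrix is diagonal with positive entries, so the vertex values of the
  projection can be written down.\<close>

lemma Pi1h:
  assumes g: "g \<in> P0disc \<T>"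
  shows "Pi1h \<Omega> \<T> g \<in> P1cont \<T>" "v \<in> P1cont \<T> \<Longrightarrow> lumped_prod \<T> (Pi1h \<Omega> \<T> g) v = L2_prod \<Omega> g v"
proof -
  obtain q where q: "q \<in> P1cont \<T>" "\<And>y. y \<in> mesh_vertices \<Longrightarrow> q y = L2_prod \<Omega> g (hat y) / lump_weight y"
    using P1cont_interpolation[of "\<lambda>y. L2_prod \<Omega> g (hat y) / lump_weight y"] by blast
  have "lumped_prod \<T> q v = L2_prod \<Omega> g v" if v: "v \<in> P1cont \<T>" for v
  proof -
    have "lumped_prod \<T> q v = (\<Sum>y\<in>mesh_vertices. v y * L2_prod \<Omega> g (hat y))"
      unfolding lumped_prod_eq
    proof (rule sum.cong[OF refl])
      fix y assume y: "y \<in> mesh_vertices"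
      show "lump_weight y * (q y * v y) = v y * L2_prod \<Omega> g (hat y)"
        using lump_weight_pos[OF y] q(2)[OF y] by simp
    qed
    also have "\<dots> = (\<Sum>y\<in>mesh_vertices. LINT x:\<Omega>|lebesgue. v y * (g x * hat y x))"
      unfolding L2_prod_def by simp
    also have "\<dots> = (LINT x:\<Omega>|lebesgue. (\<Sum>y\<in>mesh_vertices. v y * (g x * hat y x)))"
      by (rule set_lint_sum[symmetric], rule set_integrable_mult_right)
        (rule set_integrable_P0disc_mult[OF g set_integrable_continuous_domain[OF P1cont_continuous[OF hat(1)]]])
    also have "\<dots> = L2_prod \<Omega> g v"
      unfolding L2_prod_def
    proof (rule set_lint_cong_AE, rule AE_I2, rule impI)
      fix x assume "x \<in> \<Omega>"
      then have "v x = (\<Sum>y\<in>mesh_vertices. v y * hat y x)"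
        using P1cont_expansion[OF v] closure_subset by blast
      then show "(\<Sum>y\<in>mesh_vertices. v y * (g x * hat y x)) = g x \<bullet> v x"
        by (simp add: sum_distrib_left mult.left_commute)
    qed
    finally show ?thesis .
  qed
  then have "\<exists>q. q \<in> P1cont \<T> \<and> (\<forall>v \<in> P1cont \<T>. lumped_prod \<T> q v = L2_prod \<Omega> g v)"
    using q(1) by (intro exI[of _ q]) simp
  then have "Pi1h \<Omega> \<T> g \<in> P1cont \<T> \<and> (\<forall>v \<in> P1cont \<T>. lumped_prod \<T> (Pi1h \<Omega> \<T> g) v = L2_prod \<Omega> g v)"
    unfolding Pi1h_def by (rule someI_ex)
  then show "Pi1h \<Omega> \<T> g \<in> P1cont \<T>" "v \<in> P1cont \<T> \<Longrightarrow> lumped_prod \<T> (Pi1h \<Omega> \<T> g) v = L2_prod \<Omega> g v"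
    by blast+
qed

text \<open>At a vertex the projection is the mean of g weighted by the nonnegative hat function,
  whose integral is the lumped weight; on each cell it is affine and so bounded by its vertex
  values.\<close>

lemma Pi1h_bounds:
  assumes g: "g \<in> P0disc \<T>" "\<And>K x. K \<in> \<T> \<Longrightarrow> x \<in> interior K \<Longrightarrow> \<bar>g x\<bar> \<le> 1" and x: "x \<in> closure \<Omega>"
  shows "\<bar>Pi1h \<Omega> \<T> g x\<bar> \<le> 1"
proof -
  let ?q = "Pi1h \<Omega> \<T> g"
  have vert: "\<bar>?q y\<bar> \<le> 1" if y: "y \<in> mesh_vertices" for y
  proof -
    have "(\<Sum>z\<in>mesh_vertices. lump_weight z * (?q z * hat y z)) = (\<Sum>z\<in>mesh_vertices. if z = y then lump_weight y * ?q y else 0)"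
      by (rule sum.cong) (auto simp: hat(2))
    then have "lumped_prod \<T> ?q (hat y) = lump_weight y * ?q y"
      unfolding lumped_prod_eq using y finite_mesh_vertices by simp
    then have eq: "lump_weight y * ?q y = (LINT x:\<Omega>|lebesgue. g x * hat y x)"
      using Pi1h(2)[OF g(1) hat(1)] by (simp add: L2_prod_def)
    have hi: "set_integrable lebesgue \<Omega> (hat y)"
      by (rule set_integrable_continuous_domain[OF P1cont_continuous[OF hat(1)]])
    have gi: "integrable lebesgue (\<lambda>x. indicator \<Omega> x *\<^sub>R (g x * hat y x))"
      using set_integrable_P0disc_mult[OF g(1) hi] unfolding set_integrable_def .
    have "\<bar>LINT x:\<Omega>|lebesgue. g x * hat y x\<bar> \<le> (LINT x|lebesgue. norm (indicator \<Omega> x *\<^sub>R (g x * hat y x)))"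
      unfolding set_lebesgue_integral_def real_norm_def[symmetric] by (rule integral_norm_bound)
    also have "\<dots> \<le> (LINT x:\<Omega>|lebesgue. hat y x)"
      unfolding set_lebesgue_integral_def
    proof (rule integral_mono_AE[OF integrable_norm[OF gi] hi[unfolded set_integrable_def]])
      show "AE x in lebesgue. norm (indicator \<Omega> x *\<^sub>R (g x * hat y x)) \<le> indicator \<Omega> x *\<^sub>R hat y x"
        using AE_cells
      proof eventually_elim
        fix x assume x: "x \<in> closure \<Omega> \<longrightarrow> x \<in> cells"
        show "norm (indicator \<Omega> x *\<^sub>R (g x * hat y x)) \<le> indicator \<Omega> x *\<^sub>R hat y x"
        proof (cases "x \<in> \<Omega>")
          case True
          then have cl: "x \<in> closure \<Omega>" using closure_subset by blast
          then have "\<bar>g x\<bar> \<le> 1" using x g(2) by blast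
          then show ?thesis
            using True hat_nonneg[OF cl, of y] by (simp add: abs_mult mult_left_le_one_le)
        qed simp
      qed
    qed
    finally have "\<bar>LINT x:\<Omega>|lebesgue. g x * hat y x\<bar> \<le> (LINT x:\<Omega>|lebesgue. hat y x)" .
    then show ?thesis
      using lump_weight_pos[OF y] unfolding integral_hat[OF y] eq[symmetric]
      by (simp add: abs_mult)
  qed
  have "1 * ?q x + 0 * ?q x \<le> 1"
    by (rule P1cont_le[OF P1cont_linear_combination[OF Pi1h(1)[OF g(1)] Pi1h(1)[OF g(1)]] _ x])
      (use vert in \<open>auto simp: abs_le_iff\<close>)
  moreover have "(-1) * ?q x + 0 * ?q x \<le> 1"
    by (rule P1cont_le[OF P1cont_linear_combination[OF Pi1h(1)[OF g(1)] Pi1h(1)[OF g(1)]] _ x])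
      (use vert in \<open>auto simp: abs_le_iff\<close>)
  ultimately show ?thesis by (simp add: abs_le_iff)
qed

text \<open>The constant gradients on the single open cells are glued over their disjoint union and
  compared a.e. with the representative chosen by \<open>grad_h\<close>.\<close>

lemma P1cont_weak_grad:
  assumes v: "v \<in> P1cont \<T>"
  shows "has_weak_grad cells v (grad_h \<T> v)"
    and "\<exists>a. AE x in lebesgue. \<forall>K\<in>\<T>. x \<in> interior K \<longrightarrow> grad_h \<T> v x = a K"
proof -
  obtain a b where ab: "\<And>K x. K \<in> \<T> \<Longrightarrow> x \<in> K \<Longrightarrow> v x = a K \<bullet> x + b K"
    using v unfolding P1cont_def mem_Collect_eq by metis
  define G where "G x = (\<Sum>K\<in>\<T>. indicator (interior K) x *\<^sub>R a K)" for x
  have G: "G x = a K" if K: "K \<in> \<T>" "x \<in> interior K" for K x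
  proof -
    have "G x = (\<Sum>L\<in>\<T>. if L = K then a K else 0)"
      unfolding G_def
    proof (rule sum.cong[OF refl])
      fix L assume L: "L \<in> \<T>"
      show "indicator (interior L) x *\<^sub>R a L = (if L = K then a K else 0)"
        using K interior_cells_meet[OF K(1) L K(2)] interior_subset[of L] by (auto simp: indicator_def)
    qed
    then show ?thesis using K finite_mesh by simp
  qed
  have w: "has_weak_grad (\<Union>(interior ` \<T>)) v G"
  proof (rule has_weak_grad_Union)
    fix U assume "U \<in> interior ` \<T>"
    then obtain K where K: "K \<in> \<T>" "U = interior K" by blast
    show "has_weak_grad U v G"
    proof (rule has_weak_grad_cong_AE[OF has_weak_grad_affine[of U "a K" "b K"]])
      have "a K \<bullet> x + b K = v x" if "x \<in> U" for x
        using ab[OF K(1), of x] that K(2) interior_subset[of K] by auto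
      then show "AE x in lebesgue. x \<in> U \<longrightarrow> a K \<bullet> x + b K = v x" by simp
      show "AE x in lebesgue. x \<in> U \<longrightarrow> a K = G x" using G[OF K(1)] K(2) by simp
    qed
  qed (use finite_mesh disjoint_cell_interiors in auto)
  then show "has_weak_grad cells v (grad_h \<T> v)"
    unfolding grad_h_def by (rule has_weak_grad_weak_grad)
  have "AE x in lebesgue. \<forall>K\<in>\<T>. x \<in> interior K \<longrightarrow> grad_h \<T> v x = a K"
    using weak_grad_AE_eq[OF open_cells w] unfolding grad_h_def by eventually_elim (use G in auto)
  then show "\<exists>a. AE x in lebesgue. \<forall>K\<in>\<T>. x \<in> interior K \<longrightarrow> grad_h \<T> v x = a K" by blast
qed

lemma set_integrable_P1cont_grad_inner:
  assumes "v \<in> P1cont \<T>" "w \<in> P1cont \<T>"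
  shows "set_integrable lebesgue \<Omega> (\<lambda>x. grad_h \<T> v x \<bullet> grad_h \<T> w x)"
proof -
  obtain a a' where "AE x in lebesgue. \<forall>K\<in>\<T>. x \<in> interior K \<longrightarrow> grad_h \<T> v x = a K"
    "AE x in lebesgue. \<forall>K\<in>\<T>. x \<in> interior K \<longrightarrow> grad_h \<T> w x = a' K"
    using P1cont_weak_grad(2)[OF assms(1)] P1cont_weak_grad(2)[OF assms(2)] by blast
  then have "AE x in lebesgue. \<forall>K\<in>\<T>. x \<in> interior K \<longrightarrow> grad_h \<T> v x \<bullet> grad_h \<T> w x = a K \<bullet> a' K"
    by eventually_elim simp
  then show ?thesis by (rule set_integrable_cellwise_constant)
qed

lemma P1cont_grad_linear_combination:
  assumes "v \<in> P1cont \<T>" "w \<in> P1cont \<T>"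
  shows "AE x in lebesgue. x \<in> \<Omega> \<longrightarrow> grad_h \<T> (\<lambda>x. r * v x + s * w x) x = r *\<^sub>R grad_h \<T> v x + s *\<^sub>R grad_h \<T> w x"
proof -
  have "has_weak_grad cells (\<lambda>x. r * v x + s * w x) (\<lambda>x. r *\<^sub>R grad_h \<T> v x + s *\<^sub>R grad_h \<T> w x)"
    using P1cont_weak_grad(1)[OF assms(1)] P1cont_weak_grad(1)[OF assms(2)]
    by (intro has_weak_grad_add has_weak_grad_scale)
  from weak_grad_AE_eq[OF open_cells this] AE_cells show ?thesis
    unfolding grad_h_def by eventually_elim (use closure_subset in blast)
qed

text \<open>Every point of \<open>K\<close> is a limit point of its interior, so the limit in
  \<open>trace_from\<close> is taken along a nontrivial filter on which w is constant.\<close>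

lemma trace_from_P0disc:
  assumes w: "w \<in> P0disc \<T>" and K: "K \<in> \<T>" "x \<in> K"
  shows "trace_from K w x = cell_value w K"
proof -
  have "x islimpt interior K"
  proof (cases "x \<in> interior K")
    case True
    then show ?thesis
      using interior_limit_point[of x "interior K"] by simp
  next
    case False
    then show ?thesis
      using K(2) closure_interior_cell[OF K(1)] unfolding closure_def by blast
  qed
  then have nt: "\<not> trivial_limit (at x within interior K)"
    unfolding trivial_limit_within by blast
  have "\<forall>\<^sub>F y in at x within interior K. cell_value w K = w y"
    unfolding eventually_at_filter using cell_value[OF w K(1)] by (auto intro!: always_eventually)
  then have "(w \<longlongrightarrow> cell_value w K) (at x within interior K)"
    by (rule Lim_transform_eventually[OF tendsto_const])
  then show ?thesis
    unfolding trace_from_def by (rule tendsto_Lim[OF nt])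
qed

end

section \<open>Upwind forms\<close>

definition face_integrable :: "('a::euclidean_space set \<Rightarrow> 'a) \<Rightarrow> 'a set \<Rightarrow> ('a \<Rightarrow> real) \<Rightarrow> bool" where
  "face_integrable \<nu> e h \<longleftrightarrow> set_integrable (hyperplane_measure (SOME a. a \<in> e) (\<nu> e)) e h"

lemma face_int_cong:
  assumes "\<And>x. x \<in> e \<Longrightarrow> f x = g x"
  shows "face_int \<nu> e f = face_int \<nu> e g"
  unfolding face_int_def set_lebesgue_integral_def
  by (intro Bochner_Integration.integral_cong) (auto simp: indicator_def assms)

lemma face_int_nonneg:
  assumes "\<And>x. x \<in> e \<Longrightarrow> 0 \<le> f x"
  shows "0 \<le> face_int \<nu> e f"
  unfolding face_int_def set_lebesgue_integral_def
  by (intro integral_nonneg_AE AE_I2) (auto simp: indicator_def assms)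

lemma face_int_cmult: "face_int \<nu> e (\<lambda>x. r * f x) = r * face_int \<nu> e f"
  unfolding face_int_def by simp

lemma face_int_add:
  assumes "face_integrable \<nu> e f" "face_integrable \<nu> e g"
  shows "face_int \<nu> e (\<lambda>x. r * f x + s * g x) = r * face_int \<nu> e f + s * face_int \<nu> e g"
proof -
  have "face_int \<nu> e (\<lambda>x. r * f x + s * g x) = face_int \<nu> e (\<lambda>x. r * f x) + face_int \<nu> e (\<lambda>x. s * g x)"
    unfolding face_int_def
    by (rule set_integral_add(2)) (use assms in \<open>auto simp: face_integrable_def\<close>)
  then show ?thesis by (simp add: face_int_cmult)
qed

text \<open>Both |f| + f and |f| - f are nonnegative on the face.\<close>

lemma abs_face_int_le:
  assumes "face_integrable \<nu> e f" "face_integrable \<nu> e (\<lambda>x. \<bar>f x\<bar>)"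
  shows "\<bar>face_int \<nu> e f\<bar> \<le> face_int \<nu> e (\<lambda>x. \<bar>f x\<bar>)"
proof -
  have "0 \<le> face_int \<nu> e (\<lambda>x. 1 * \<bar>f x\<bar> + s * f x)" if "s = 1 \<or> s = -1" for s
    by (rule face_int_nonneg) (use that in auto)
  from this[of 1] this[of "-1"] show ?thesis
    unfolding face_int_add[OF assms(2,1)] by auto
qed

context oriented_mesh
begin

lemma compact_interior_face:
  assumes "e \<in> interior_faces \<T>" shows "compact e"
  using face_cells(1,2,6)[OF assms] cell_compact compact_Int by metis

text \<open>The cylinder over a compact face is bounded, so the face has finite measure and bounded
  continuous functions are integrable.\<close>

lemma face_integrable_continuous:
  assumes e: "e \<in> interior_faces \<T>" and h: "continuous_on e h"
  shows "face_integrable \<nu> e h"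
proof -
  define a where "a = (SOME a. a \<in> e)"
  have unit: "norm (\<nu> e) = 1" by (rule norm_face_normal[OF e])
  have ce: "compact e" by (rule compact_interior_face[OF e])
  then have cl: "closed e" by (rule compact_imp_closed)
  let ?A = "{x. 0 \<le> (x - a) \<bullet> \<nu> e \<and> (x - a) \<bullet> \<nu> e \<le> 1}"
  let ?P = "\<lambda>x. x - ((x - a) \<bullet> \<nu> e) *\<^sub>R \<nu> e"
  let ?M = "hyperplane_measure a (\<nu> e)"
  have Am: "?A \<in> sets borel" by measurable
  have Pm: "?P \<in> borel_measurable borel" by measurable
  have sM: "sets ?M = sets borel" unfolding hyperplane_measure_def by simp
  obtain R where R: "\<And>x. x \<in> e \<Longrightarrow> norm x \<le> R"
    using compact_imp_bounded[OF ce] unfolding bounded_iff by blast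
  have em: "emeasure ?M e < \<infinity>"
  proof -
    have "emeasure ?M e = emeasure (restrict_space lborel ?A) (?P -` e \<inter> space (restrict_space lborel ?A))"
      unfolding hyperplane_measure_def
      by (rule emeasure_distr) (use Pm cl in \<open>auto intro: measurable_restrict_space1\<close>)
    also have "\<dots> = emeasure lborel (?P -` e \<inter> ?A)"
    proof -
      have "?P -` e \<inter> space borel \<in> sets borel"
        by (rule measurable_sets[OF Pm]) (use cl in simp)
      then show ?thesis
        using Am by (subst emeasure_restrict_space) (auto simp: space_restrict_space Int_commute)
    qed
    also have "\<dots> \<le> emeasure lborel (cball (0::'a) (R + 1))"
    proof (rule emeasure_mono)
      show "?P -` e \<inter> ?A \<subseteq> cball 0 (R + 1)"
      proof
        fix x assume x: "x \<in> ?P -` e \<inter> ?A"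
        have "norm x \<le> norm (?P x) + norm (((x - a) \<bullet> \<nu> e) *\<^sub>R \<nu> e)"
          using norm_triangle_ineq[of "?P x" "((x - a) \<bullet> \<nu> e) *\<^sub>R \<nu> e"] by simp
        also have "\<dots> \<le> R + 1"
          using x R[of "?P x"] unit by (intro add_mono) auto
        finally show "x \<in> cball 0 (R + 1)" by simp
      qed
    qed simp
    also have "\<dots> < \<infinity>"
      using emeasure_lborel_cball_finite by auto
    finally show ?thesis .
  qed
  obtain B where B: "\<And>x. x \<in> e \<Longrightarrow> \<bar>h x\<bar> \<le> B"
    using compact_imp_bounded[OF compact_continuous_image[OF h ce]] unfolding bounded_iff by auto
  have "integrable ?M (\<lambda>x. indicator e x *\<^sub>R h x)"
  proof (rule Bochner_Integration.integrable_bound)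
    show "integrable ?M (\<lambda>x. indicator e x * B)"
      by (rule integrable_mult_left) (use em cl sM in \<open>auto simp: integrable_indicator_iff\<close>)
    have "(\<lambda>x. indicator e x *\<^sub>R h x) \<in> borel_measurable borel"
      by (rule borel_measurable_continuous_on_indicator[OF _ h]) (use cl in simp)
    then show "(\<lambda>x. indicator e x *\<^sub>R h x) \<in> borel_measurable ?M"
      using measurable_cong_sets[OF sM refl] by blast
    show "AE x in ?M. norm (indicator e x *\<^sub>R h x) \<le> norm (indicator e x * B)"
      using B by (intro AE_I2) (auto simp: indicator_def intro: order_trans[OF _ abs_ge_self])
  qed
  then show ?thesis
    unfolding face_integrable_def a_def set_integrable_def .
qed

lemma face_trace:
  assumes e: "e \<in> interior_faces \<T>" and w: "w \<in> P0disc \<T>" and x: "x \<in> e"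
  shows "trace_from (cell_K \<T> \<nu> e) w x = cell_value w (cell_K \<T> \<nu> e)"
    "trace_from (cell_L \<T> \<nu> e) w x = cell_value w (cell_L \<T> \<nu> e)"
    "jump \<T> \<nu> e w x = cell_value w (cell_K \<T> \<nu> e) - cell_value w (cell_L \<T> \<nu> e)"
    "avg \<T> \<nu> e w x = (cell_value w (cell_K \<T> \<nu> e) + cell_value w (cell_L \<T> \<nu> e)) / 2"
proof -
  show "trace_from (cell_K \<T> \<nu> e) w x = cell_value w (cell_K \<T> \<nu> e)"
    "trace_from (cell_L \<T> \<nu> e) w x = cell_value w (cell_L \<T> \<nu> e)"
    using face_cells(1-4)[OF e] x by (auto intro!: trace_from_P0disc[OF w])
  then show "jump \<T> \<nu> e w x = cell_value w (cell_K \<T> \<nu> e) - cell_value w (cell_L \<T> \<nu> e)"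
    "avg \<T> \<nu> e w x = (cell_value w (cell_K \<T> \<nu> e) + cell_value w (cell_L \<T> \<nu> e)) / 2"
    unfolding jump_def avg_def by simp_all
qed

definition face_avg :: "('a \<Rightarrow> real) \<Rightarrow> 'a set \<Rightarrow> real" where
  "face_avg w e = (cell_value w (cell_K \<T> \<nu> e) + cell_value w (cell_L \<T> \<nu> e)) / 2"

definition face_jump :: "('a \<Rightarrow> real) \<Rightarrow> 'a set \<Rightarrow> real" where
  "face_jump w e = cell_value w (cell_K \<T> \<nu> e) - cell_value w (cell_L \<T> \<nu> e)"

definition face_flux :: "('a \<Rightarrow> 'a) \<Rightarrow> 'a set \<Rightarrow> real" where
  "face_flux u e = face_int \<nu> e (\<lambda>x. u x \<bullet> \<nu> e)"

definition face_abs_flux :: "('a \<Rightarrow> 'a) \<Rightarrow> 'a set \<Rightarrow> real" where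
  "face_abs_flux u e = face_int \<nu> e (\<lambda>x. \<bar>u x \<bullet> \<nu> e\<bar>)"

lemma face_integrable_flux:
  assumes u: "continuous_on (closure \<Omega>) u" and e: "e \<in> interior_faces \<T>"
  shows "face_integrable \<nu> e (\<lambda>x. u x \<bullet> \<nu> e)" "face_integrable \<nu> e (\<lambda>x. \<bar>u x \<bullet> \<nu> e\<bar>)"
proof -
  have "e \<subseteq> closure \<Omega>"
    using face_cells(1,3)[OF e] Union_mesh by blast
  then have "continuous_on e u" using continuous_on_subset[OF u] by blast
  then show "face_integrable \<nu> e (\<lambda>x. u x \<bullet> \<nu> e)" "face_integrable \<nu> e (\<lambda>x. \<bar>u x \<bullet> \<nu> e\<bar>)"
    by (auto intro!: face_integrable_continuous[OF e] continuous_intros)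
qed

lemma abs_face_flux_le:
  assumes "continuous_on (closure \<Omega>) u" "e \<in> interior_faces \<T>"
  shows "\<bar>face_flux u e\<bar> \<le> face_abs_flux u e"
  unfolding face_flux_def face_abs_flux_def
  by (rule abs_face_int_le[OF face_integrable_flux[OF assms]])

text \<open>As a test function, the indicator of an open cell localises the divergence constraint
  and (S3) to that cell.\<close>

lemma cell_indicator:
  assumes K: "K \<in> \<T>"
  shows "indicator (interior K) \<in> P0disc \<T>"
    and "L \<in> \<T> \<Longrightarrow> cell_value (indicator (interior K)) L = (if L = K then 1 else 0)"
proof -
  have i: "indicator (interior K) x = (if L = K then 1 else 0 :: real)" if L: "L \<in> \<T>" "x \<in> interior L" for L x
    using L K interior_cells_meet[OF L(1) K L(2)] interior_subset[of K] by (auto simp: indicator_def)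
  show P: "indicator (interior K) \<in> P0disc \<T>"
    by (rule P0discI[where c = "\<lambda>L. if L = K then 1 else 0"]) (rule i)
  show "cell_value (indicator (interior K)) L = (if L = K then 1 else 0)" if L: "L \<in> \<T>"
  proof -
    obtain x where x: "x \<in> interior L" using cell_interior_nonempty[OF L] by blast
    show ?thesis
      using cell_value[OF P L x] i[OF L x] by simp
  qed
qed

lemma integral_cell_indicator:
  fixes g :: "'a \<Rightarrow> real"
  assumes K: "K \<in> \<T>" and g: "set_integrable lebesgue \<Omega> g"
  shows "(LINT x:\<Omega>|lebesgue. indicator (interior K) x * g x) = (LINT x:K|lebesgue. g x)"
proof -
  note P = cell_indicator(1)[OF K]
  have "(LINT x:\<Omega>|lebesgue. indicator (interior K) x * g x) = (\<Sum>L\<in>\<T>. LINT x:L|lebesgue. indicator (interior K) x * g x)"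
    by (rule integral_domain_cells[OF set_integrable_P0disc_mult[OF P g]])
  also have "\<dots> = (\<Sum>L\<in>\<T>. if L = K then (LINT x:L|lebesgue. g x) else 0)"
    by (rule sum.cong[OF refl]) (simp add: integral_cell_P0disc_mult[OF P] cell_indicator(2)[OF K])
  also have "\<dots> = (LINT x:K|lebesgue. g x)"
    using K finite_mesh by simp
  finally show ?thesis .
qed

end

section \<open>The discrete velocity: divergence and upwind transport\<close>

lemma sum_Basis_vec: "(\<Sum>b\<in>(Basis :: (real ^ 'n) set). f b) = (\<Sum>i\<in>UNIV. f (axis i 1))"
proof -
  have eq: "(Basis :: (real ^ 'n) set) = (\<lambda>i. axis i 1) ` UNIV"
    unfolding Basis_vec_def by auto
  have inj: "inj (\<lambda>i. axis i (1::real) :: real ^ 'n)"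
    by (rule injI) (simp add: axis_eq_axis)
  show ?thesis
    unfolding eq sum.reindex[OF inj] o_def ..
qed

locale discrete_velocity = oriented_mesh \<Omega> \<T> \<nu> for \<Omega> :: "(real ^ 'd) set" and \<T> \<nu> +
  fixes u :: "real ^ 'd \<Rightarrow> real ^ 'd"
  assumes u_cont: "continuous_on (closure \<Omega>) u" and u_H10: "\<And>i. (\<lambda>x. u x $ i) \<in> H10_space \<Omega>"
begin

lemma u_weak_grad: "has_weak_grad \<Omega> (\<lambda>x. u x $ i) (weak_grad \<Omega> (\<lambda>x. u x $ i))"
  "weak_grad \<Omega> (\<lambda>x. u x $ i) \<in> L2_space \<Omega>"
proof -
  have "(\<lambda>x. u x $ i) \<in> H1_space \<Omega>" using u_H10[of i] unfolding H10_space_def by blast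
  then show "has_weak_grad \<Omega> (\<lambda>x. u x $ i) (weak_grad \<Omega> (\<lambda>x. u x $ i))"
    "weak_grad \<Omega> (\<lambda>x. u x $ i) \<in> L2_space \<Omega>"
    using H1_space_weak_grad[OF open_domain] by blast+
qed

text \<open>A weak gradient on \<Omega> restricts to one on the union of the open cells, and the
  skeleton is null.\<close>

lemma grad_h_eq_weak_grad:
  assumes "has_weak_grad \<Omega> f g"
  shows "AE x in lebesgue. x \<in> \<Omega> \<longrightarrow> grad_h \<T> f x = g x"
  using weak_grad_AE_eq[OF open_cells has_weak_grad_mono[OF assms cells_subset]] AE_cells
  unfolding grad_h_def by eventually_elim (use closure_subset in blast)

lemma jac_h_AE: "AE x in lebesgue. x \<in> \<Omega> \<longrightarrow> (\<forall>i. jac_h \<T> u x $ i = weak_grad \<Omega> (\<lambda>x. u x $ i) x)"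
proof -
  have "AE x in lebesgue. \<forall>i\<in>UNIV. x \<in> \<Omega> \<longrightarrow> grad_h \<T> (\<lambda>x. u x $ i) x = weak_grad \<Omega> (\<lambda>x. u x $ i) x"
    by (rule AE_finite_allI) (auto intro: grad_h_eq_weak_grad[OF u_weak_grad(1)])
  then show ?thesis
    by eventually_elim (simp add: jac_h_def)
qed

lemma div_h_AE: "AE x in lebesgue. x \<in> \<Omega> \<longrightarrow> div_h \<T> u x = (\<Sum>b\<in>Basis. weak_grad \<Omega> (\<lambda>x. u x \<bullet> b) x \<bullet> b)"
  using jac_h_AE by eventually_elim (simp add: div_h_def trace_def sum_Basis_vec inner_axis)

lemma div_h_integrable: "set_integrable lebesgue \<Omega> (div_h \<T> u)"
proof -
  have lm: "\<Omega> \<in> lmeasurable"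
    using bounded_domain domain_sets by (simp add: bounded_set_imp_lmeasurable)
  interpret fm: finite_measure "lebesgue_on \<Omega>"
    by (rule finite_measure_lebesgue_on[OF lm])
  have "set_integrable lebesgue \<Omega> (\<lambda>x. weak_grad \<Omega> (\<lambda>x. u x $ i) x \<bullet> axis i 1)" for i
  proof -
    have "(\<lambda>x. weak_grad \<Omega> (\<lambda>x. u x $ i) x \<bullet> axis i 1) \<in> L2_space \<Omega>"
      by (intro L2_space_inner_left(1)[OF domain_sets] u_weak_grad(2))
    then have "integrable (lebesgue_on \<Omega>) (\<lambda>x. (weak_grad \<Omega> (\<lambda>x. u x $ i) x \<bullet> axis i 1) * 1)"
      unfolding L2_space_iff[OF domain_sets] by (intro integrable_mult_of_squares) simp_all
    then show ?thesis unfolding set_integrable_lebesgue_on[OF domain_sets] by simp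
  qed
  then have "set_integrable lebesgue \<Omega> (\<lambda>x. \<Sum>i\<in>UNIV. weak_grad \<Omega> (\<lambda>x. u x $ i) x \<bullet> axis i 1)"
    by (rule set_integrable_sum_finite)
  then show ?thesis
    by (rule set_integrable_lebesgue_cong_AE[rotated])
      (use div_h_AE in \<open>auto elim!: eventually_mono simp: sum_Basis_vec inner_axis\<close>)
qed

lemma integral_cell_div_h:
  assumes K: "K \<in> \<T>"
  shows "(LINT x:K|lebesgue. div_h \<T> u x) =
    (\<Sum>e\<in>interior_faces \<T>. ((if cell_K \<T> \<nu> e = K then 1 else 0) - (if cell_L \<T> \<nu> e = K then 1 else 0)) * face_flux u e)"
proof -
  have H: "(\<lambda>x. u x \<bullet> b) \<in> H10_space \<Omega>" if "b \<in> Basis" for b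
  proof -
    obtain i where "b = axis i 1" using \<open>b \<in> Basis\<close> unfolding Basis_vec_def by auto
    then show ?thesis using u_H10[of i] by (simp add: inner_axis)
  qed
  have "(LINT x:K|lebesgue. div_h \<T> u x) = (LINT x:K|lebesgue. (\<Sum>b\<in>Basis. weak_grad \<Omega> (\<lambda>x. u x \<bullet> b) x \<bullet> b))"
  proof (rule set_lint_cong_AE)
    show "AE x in lebesgue. x \<in> K \<longrightarrow> div_h \<T> u x = (\<Sum>b\<in>Basis. weak_grad \<Omega> (\<lambda>x. u x \<bullet> b) x \<bullet> b)"
      using div_h_AE AE_cells
    proof eventually_elim
      fix x assume 1: "x \<in> \<Omega> \<longrightarrow> div_h \<T> u x = (\<Sum>b\<in>Basis. weak_grad \<Omega> (\<lambda>x. u x \<bullet> b) x \<bullet> b)"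
        and 2: "x \<in> closure \<Omega> \<longrightarrow> x \<in> cells"
      show "x \<in> K \<longrightarrow> div_h \<T> u x = (\<Sum>b\<in>Basis. weak_grad \<Omega> (\<lambda>x. u x \<bullet> b) x \<bullet> b)"
        using 1 2 K Union_mesh cells_subset by blast
    qed
  qed
  also have "\<dots> = (\<Sum>e\<in>interior_faces \<T>. ((if cell_K \<T> \<nu> e = K then 1 else 0) - (if cell_L \<T> \<nu> e = K then 1 else 0)) * face_flux u e)"
    unfolding face_flux_def by (rule divergence_theorem_cell[OF u_cont H K])
  finally show ?thesis .
qed

text \<open>On each open cell w is constant, so scaling is the whole product rule; jumps across
  faces are invisible to the elementwise gradient.\<close>

lemma div_h_P0disc_scale:
  assumes w: "w \<in> P0disc \<T>"
  shows "AE x in lebesgue. x \<in> \<Omega> \<longrightarrow> div_h \<T> (\<lambda>y. w y *\<^sub>R u y) x = w x * div_h \<T> u x"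
proof -
  have *: "AE x in lebesgue. x \<in> \<Omega> \<longrightarrow> grad_h \<T> (\<lambda>y. (w y *\<^sub>R u y) $ i) x = w x *\<^sub>R grad_h \<T> (\<lambda>y. u y $ i) x" for i
  proof -
    let ?g = "grad_h \<T> (\<lambda>y. u y $ i)"
    have g: "has_weak_grad cells (\<lambda>y. u y $ i) ?g"
      unfolding grad_h_def by (rule has_weak_grad_weak_grad[OF has_weak_grad_mono[OF u_weak_grad(1) cells_subset]])
    have "has_weak_grad (\<Union>(interior ` \<T>)) (\<lambda>y. (w y *\<^sub>R u y) $ i) (\<lambda>x. w x *\<^sub>R ?g x)"
    proof (rule has_weak_grad_Union)
      fix U assume "U \<in> interior ` \<T>"
      then obtain K where K: "K \<in> \<T>" "U = interior K" by blast
      have "U \<subseteq> cells" using K by blast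
      from has_weak_grad_scale[OF has_weak_grad_mono[OF g this], of "cell_value w K"]
      show "has_weak_grad U (\<lambda>y. (w y *\<^sub>R u y) $ i) (\<lambda>x. w x *\<^sub>R ?g x)"
        by (rule has_weak_grad_cong_AE) (use cell_value[OF w K(1)] K(2) in simp_all)
    qed (use finite_mesh disjoint_cell_interiors in auto)
    from weak_grad_AE_eq[OF open_cells this] AE_cells show ?thesis
      unfolding grad_h_def[symmetric] by eventually_elim (use closure_subset in blast)
  qed
  have "AE x in lebesgue. \<forall>i\<in>UNIV. x \<in> \<Omega> \<longrightarrow> grad_h \<T> (\<lambda>y. (w y *\<^sub>R u y) $ i) x = w x *\<^sub>R grad_h \<T> (\<lambda>y. u y $ i) x"
    by (rule AE_finite_allI) (simp only: finite_class.finite_UNIV, rule *)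
  then show ?thesis
    by eventually_elim (simp add: div_h_def trace_def jac_h_def sum_distrib_left)
qed

text \<open>For a normal velocity s, the upwind flux equals the centered flux s (k + l)/2 plus the
  dissipation |s| (k - l)/2, where k and l are the cell values. These are the parts found in
  \<open>c_h\<close> and \<open>s2_h\<close>.\<close>

lemma a_upw_P0disc:
  assumes \<phi>: "\<phi> \<in> P0disc \<T>" and \<mu>: "\<mu> \<in> P0disc \<T>"
  shows "a_upw \<T> \<nu> u \<phi> \<mu> = (\<Sum>e\<in>interior_faces \<T>.
    face_jump \<mu> e * (face_avg \<phi> e * face_flux u e + face_jump \<phi> e / 2 * face_abs_flux u e))"
  unfolding a_upw_def
proof (rule sum.cong[OF refl])
  fix e assume e: "e \<in> interior_faces \<T>"
  note fi = face_integrable_flux[OF u_cont e]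
  let ?M = "face_jump \<mu> e" and ?A = "face_avg \<phi> e" and ?J = "face_jump \<phi> e"
  have "face_int \<nu> e (\<lambda>x. (pos_part (u x \<bullet> \<nu> e) * trace_from (cell_K \<T> \<nu> e) \<phi> x
      - neg_part (u x \<bullet> \<nu> e) * trace_from (cell_L \<T> \<nu> e) \<phi> x) * jump \<T> \<nu> e \<mu> x) =
    face_int \<nu> e (\<lambda>x. (?M * ?A) * (u x \<bullet> \<nu> e) + (?M * (?J / 2)) * \<bar>u x \<bullet> \<nu> e\<bar>)"
  proof (rule face_int_cong)
    fix x assume x: "x \<in> e"
    define kv lv s where "kv = cell_value \<phi> (cell_K \<T> \<nu> e)" and "lv = cell_value \<phi> (cell_L \<T> \<nu> e)" and "s = u x \<bullet> \<nu> e"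
    have A: "?A = (kv + lv) / 2" "?J = kv - lv"
      unfolding face_avg_def face_jump_def kv_def lv_def by simp_all
    have J: "jump \<T> \<nu> e \<mu> x = ?M"
      unfolding face_trace(3)[OF e \<mu> x] face_jump_def ..
    have "pos_part s * kv - neg_part s * lv = ?A * s + ?J / 2 * \<bar>s\<bar>"
      unfolding A pos_part_def neg_part_def by (cases "s \<ge> 0") (simp_all add: field_simps)
    then have "(pos_part s * kv - neg_part s * lv) * ?M = (?M * ?A) * s + (?M * (?J / 2)) * \<bar>s\<bar>"
      by (simp add: algebra_simps)
    then show "(pos_part (u x \<bullet> \<nu> e) * trace_from (cell_K \<T> \<nu> e) \<phi> x
      - neg_part (u x \<bullet> \<nu> e) * trace_from (cell_L \<T> \<nu> e) \<phi> x) * jump \<T> \<nu> e \<mu> x =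
      (?M * ?A) * (u x \<bullet> \<nu> e) + (?M * (?J / 2)) * \<bar>u x \<bullet> \<nu> e\<bar>"
      unfolding face_trace(1,2)[OF e \<phi> x] J kv_def lv_def s_def .
  qed
  also have "\<dots> = ?M * (?A * face_flux u e + ?J / 2 * face_abs_flux u e)"
    unfolding face_int_add[OF fi] face_flux_def face_abs_flux_def by (simp add: algebra_simps)
  finally show "face_int \<nu> e (\<lambda>x. (pos_part (u x \<bullet> \<nu> e) * trace_from (cell_K \<T> \<nu> e) \<phi> x
      - neg_part (u x \<bullet> \<nu> e) * trace_from (cell_L \<T> \<nu> e) \<phi> x) * jump \<T> \<nu> e \<mu> x) =
      ?M * (?A * face_flux u e + ?J / 2 * face_abs_flux u e)" .
qed

text \<open>The centered coupling in the momentum equation plus its stabilization is minus the upwind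
  transport of the phase equation, up to a multiple of the divergence of \<open>u\<close>.\<close>

lemma c_h_plus_s2_h:
  assumes \<phi>: "\<phi> \<in> P0disc \<T>" and \<mu>: "\<mu> \<in> P0disc \<T>"
  shows "c_h \<Omega> \<T> \<nu> \<phi> \<mu> u + s2_h \<T> \<nu> u \<phi> \<mu> u =
    - (LINT x:\<Omega>|lebesgue. div_h \<T> u x * (\<phi> x * \<mu> x)) - a_upw \<T> \<nu> u \<phi> \<mu>"
proof -
  have c: "face_int \<nu> e (\<lambda>x. (u x \<bullet> \<nu> e) * avg \<T> \<nu> e \<phi> x * jump \<T> \<nu> e \<mu> x) =
      face_jump \<mu> e * face_avg \<phi> e * face_flux u e" if e: "e \<in> interior_faces \<T>" for e
  proof -
    have "face_int \<nu> e (\<lambda>x. (u x \<bullet> \<nu> e) * avg \<T> \<nu> e \<phi> x * jump \<T> \<nu> e \<mu> x) =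
        face_int \<nu> e (\<lambda>x. (face_jump \<mu> e * face_avg \<phi> e) * (u x \<bullet> \<nu> e))"
      by (rule face_int_cong) (simp add: face_trace(3)[OF e \<mu>] face_trace(4)[OF e \<phi>] face_avg_def face_jump_def)
    then show ?thesis by (simp add: face_int_cmult face_flux_def)
  qed
  have s2: "face_int \<nu> e (\<lambda>x. (u x \<bullet> \<nu> e) * sgn (u x \<bullet> \<nu> e) * jump \<T> \<nu> e \<phi> x * jump \<T> \<nu> e \<mu> x) =
      face_jump \<mu> e * face_jump \<phi> e * face_abs_flux u e" if e: "e \<in> interior_faces \<T>" for e
  proof -
    have "face_int \<nu> e (\<lambda>x. (u x \<bullet> \<nu> e) * sgn (u x \<bullet> \<nu> e) * jump \<T> \<nu> e \<phi> x * jump \<T> \<nu> e \<mu> x) =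
        face_int \<nu> e (\<lambda>x. (face_jump \<mu> e * face_jump \<phi> e) * \<bar>u x \<bullet> \<nu> e\<bar>)"
      by (rule face_int_cong) (simp add: face_trace(3)[OF e \<mu>] face_trace(3)[OF e \<phi>] face_jump_def flip: abs_sgn)
    then show ?thesis by (simp add: face_int_cmult face_abs_flux_def)
  qed
  have bulk: "(LINT x:\<Omega>|lebesgue. div_h \<T> (\<lambda>y. \<phi> y *\<^sub>R u y) x * \<mu> x) = (LINT x:\<Omega>|lebesgue. div_h \<T> u x * (\<phi> x * \<mu> x))"
    by (rule set_lint_cong_AE) (use div_h_P0disc_scale[OF \<phi>] in \<open>auto elim!: eventually_mono\<close>)
  have "(\<Sum>e\<in>interior_faces \<T>. face_int \<nu> e (\<lambda>x. (u x \<bullet> \<nu> e) * avg \<T> \<nu> e \<phi> x * jump \<T> \<nu> e \<mu> x)) =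
      (\<Sum>e\<in>interior_faces \<T>. face_jump \<mu> e * face_avg \<phi> e * face_flux u e)"
    by (rule sum.cong[OF refl c])
  moreover have "(\<Sum>e\<in>interior_faces \<T>. face_int \<nu> e (\<lambda>x. (u x \<bullet> \<nu> e) * sgn (u x \<bullet> \<nu> e) * jump \<T> \<nu> e \<phi> x * jump \<T> \<nu> e \<mu> x)) =
      (\<Sum>e\<in>interior_faces \<T>. face_jump \<mu> e * face_jump \<phi> e * face_abs_flux u e)"
    by (rule sum.cong[OF refl s2])
  moreover have "a_upw \<T> \<nu> u \<phi> \<mu> = (\<Sum>e\<in>interior_faces \<T>. face_jump \<mu> e * face_avg \<phi> e * face_flux u e) +
      1/2 * (\<Sum>e\<in>interior_faces \<T>. face_jump \<mu> e * face_jump \<phi> e * face_abs_flux u e)"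
    unfolding a_upw_P0disc[OF \<phi> \<mu>] sum_distrib_left sum.distrib[symmetric]
    by (rule sum.cong) (simp_all add: algebra_simps)
  ultimately show ?thesis
    unfolding c_h_def s2_h_def bulk by simp
qed

text \<open>\<open>s = 1\<close> is the case of a maximal, \<open>s = -1\<close> that of a minimal cell value.\<close>

lemma a_upw_extremal_cell:
  assumes div0: "(LINT x:K|lebesgue. div_h \<T> u x) = 0"
    and \<phi>: "\<phi> \<in> P0disc \<T>" and K: "K \<in> \<T>" and s: "s = 1 \<or> s = -1"
    and ext: "\<And>L. L \<in> \<T> \<Longrightarrow> s * cell_value \<phi> L \<le> s * cell_value \<phi> K"
  shows "0 \<le> s * a_upw \<T> \<nu> u \<phi> (indicator (interior K))"
proof -
  let ?v = "cell_value \<phi> K" and ?M = "face_jump (indicator (interior K))"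
  have M: "?M e = (if cell_K \<T> \<nu> e = K then 1 else 0) - (if cell_L \<T> \<nu> e = K then 1 else 0)" if "e \<in> interior_faces \<T>" for e
    unfolding face_jump_def using face_cells(1,2)[OF that] by (simp add: cell_indicator(2)[OF K])
  have "(\<Sum>e\<in>interior_faces \<T>. ?M e * face_flux u e) = 0"
    using integral_cell_div_h[OF K] div0 M by simp
  \<comment> \<open>The vanishing total flux, weighted with the extremal value, is compared with the
    upwind form face by face.\<close>
  then have "0 = (\<Sum>e\<in>interior_faces \<T>. s * (?v * (?M e * face_flux u e)))"
    unfolding sum_distrib_left[symmetric] by simp
  also have "\<dots> \<le> (\<Sum>e\<in>interior_faces \<T>. s * (?M e * (face_avg \<phi> e * face_flux u e + face_jump \<phi> e / 2 * face_abs_flux u e)))"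
  proof (rule sum_mono)
    fix e assume e: "e \<in> interior_faces \<T>"
    define I I' where "I = face_flux u e" and "I' = face_abs_flux u e"
    have I: "I \<le> I'" "- I \<le> I'"
      using abs_face_flux_le[OF u_cont e] unfolding I_def I'_def by auto
    define kv lv where "kv = cell_value \<phi> (cell_K \<T> \<nu> e)" and "lv = cell_value \<phi> (cell_L \<T> \<nu> e)"
    have kl: "s * kv \<le> s * ?v" "s * lv \<le> s * ?v"
      unfolding kv_def lv_def by (intro ext face_cells(1,2)[OF e])+
    consider "cell_K \<T> \<nu> e = K" "cell_L \<T> \<nu> e \<noteq> K" | "cell_L \<T> \<nu> e = K" "cell_K \<T> \<nu> e \<noteq> K" | "cell_K \<T> \<nu> e \<noteq> K" "cell_L \<T> \<nu> e \<noteq> K"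
      using face_cells(5)[OF e] by metis
    then show "s * (?v * (?M e * face_flux u e)) \<le> s * (?M e * (face_avg \<phi> e * face_flux u e + face_jump \<phi> e / 2 * face_abs_flux u e))"
    proof cases
      case 1
      then have k: "kv = ?v" "?M e = 1" using M[OF e] by (simp_all add: kv_def)
      \<comment> \<open>The difference of the two sides on this face; I' - I is twice the integral
        of the inflow part of the normal velocity.\<close>
      have "0 \<le> (s * ?v - s * lv) / 2 * (I' - I)"
        using kl(2) I(1) by (intro mult_nonneg_nonneg) auto
      then show ?thesis
        unfolding k face_avg_def face_jump_def[of \<phi>] kv_def[symmetric] lv_def[symmetric] I_def[symmetric] I'_def[symmetric]
        using k(1) by (simp add: field_simps)
    next
      case 2
      then have k: "lv = ?v" "?M e = -1" using M[OF e] by (simp_all add: lv_def)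
      have "0 \<le> (s * ?v - s * kv) / 2 * (I' + I)"
        using kl(1) I(2) by (intro mult_nonneg_nonneg) auto
      then show ?thesis
        unfolding k face_avg_def face_jump_def[of \<phi>] kv_def[symmetric] lv_def[symmetric] I_def[symmetric] I'_def[symmetric]
        using k(1) by (simp add: field_simps)
    next
      case 3
      then show ?thesis using M[OF e] by simp
    qed
  qed
  also have "\<dots> = s * a_upw \<T> \<nu> u \<phi> (indicator (interior K))"
    unfolding a_upw_P0disc[OF \<phi> cell_indicator(1)[OF K]] sum_distrib_left ..
  finally show ?thesis .
qed

end

section \<open>The discrete maximum principle\<close>

text \<open>Since M(0) = 1 and M(v) = 0 beyond 1, \<open>mobility_down v\<close> is -1 and outweighs
  \<open>mobility_up\<close>, which is at most 1.\<close>

lemma mobility_split_vanish: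
  assumes "1 < v"
  shows "pos_part (mobility_up z + mobility_down v) = 0"
proof -
  have v: "1 < v\<^sup>2" using assms by (simp add: one_less_power)
  have "mobility_down v = -1"
    using assms v unfolding mobility_down_def mobility_def pos_part_def by simp
  moreover have "mobility_up z \<le> 1"
    unfolding mobility_up_def mobility_def pos_part_def by simp
  ultimately show ?thesis unfolding pos_part_def by simp
qed

text \<open>Below -1 the degenerate mobility gives \<open>mobility_up v\<close> = 0, and
  \<open>mobility_down\<close> is never positive.\<close>

lemma mobility_split_vanish':
  assumes "v < -1"
  shows "pos_part (mobility_up v + mobility_down z) = 0"
proof -
  have v: "1 < v\<^sup>2" using one_less_power[of "- v" 2] assms by simp
  have "mobility_up v = 0"
    using assms v unfolding mobility_up_def mobility_def pos_part_def by simp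
  moreover have "mobility_down z \<le> 0"
    unfolding mobility_down_def mobility_def pos_part_def by simp
  ultimately show ?thesis unfolding pos_part_def by simp
qed

text \<open>A value above 1 in \<open>K\<close> switches off the part of the flux that enters
  \<open>K\<close>, a value below -1 the part that leaves it. What remains has the sign s, whatever
  the chemical potential.\<close>

lemma (in discrete_velocity) b_upw_extremal_cell:
  assumes \<phi>: "\<phi> \<in> P0disc \<T>" and K: "K \<in> \<T>"
    and s: "s = 1 \<or> s = -1" and ext: "1 < s * cell_value \<phi> K"
  shows "0 \<le> s * b_upw \<Omega> \<T> \<nu> \<mu> \<phi> (indicator (interior K))"
proof -
  let ?v = "cell_value \<phi> K" and ?\<chi> = "indicator (interior K) :: real ^ 'd \<Rightarrow> real"
  define F where "F e x = (let \<phi>K = trace_from (cell_K \<T> \<nu> e) \<phi> x;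
              \<phi>L = trace_from (cell_L \<T> \<nu> e) \<phi> x;
              j = jump \<T> \<nu> e (Pi0 \<Omega> \<T> \<mu>) x
          in (pos_part j * pos_part (mobility_up \<phi>K + mobility_down \<phi>L)
              - neg_part j * pos_part (mobility_up \<phi>L + mobility_down \<phi>K))
             * jump \<T> \<nu> e ?\<chi> x)" for e x
  have Fs: "0 \<le> s * F e x" if e: "e \<in> interior_faces \<T>" and x: "x \<in> e" for e x
  proof -
    define kv lv j where "kv = cell_value \<phi> (cell_K \<T> \<nu> e)" and "lv = cell_value \<phi> (cell_L \<T> \<nu> e)"
      and "j = jump \<T> \<nu> e (Pi0 \<Omega> \<T> \<mu>) x"
    define p q where "p = pos_part (mobility_up kv + mobility_down lv)" and "q = pos_part (mobility_up lv + mobility_down kv)"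
    have nn: "0 \<le> pos_part j" "0 \<le> neg_part j" "0 \<le> p" "0 \<le> q"
      unfolding pos_part_def neg_part_def p_def q_def by auto
    have M: "jump \<T> \<nu> e ?\<chi> x = (if cell_K \<T> \<nu> e = K then 1 else 0) - (if cell_L \<T> \<nu> e = K then 1 else 0)"
      unfolding face_trace(3)[OF e cell_indicator(1)[OF K] x]
      using face_cells(1,2)[OF e] by (simp add: cell_indicator(2)[OF K])
    have F: "F e x = (pos_part j * p - neg_part j * q) * jump \<T> \<nu> e ?\<chi> x"
      unfolding F_def Let_def face_trace(1,2)[OF e \<phi> x] p_def q_def kv_def lv_def j_def ..
    consider "cell_K \<T> \<nu> e = K" "cell_L \<T> \<nu> e \<noteq> K" | "cell_L \<T> \<nu> e = K" "cell_K \<T> \<nu> e \<noteq> K" | "cell_K \<T> \<nu> e \<noteq> K" "cell_L \<T> \<nu> e \<noteq> K"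
      using face_cells(5)[OF e] by metis
    then show ?thesis
    proof cases
      case 1
      then have k: "kv = ?v" "jump \<T> \<nu> e ?\<chi> x = 1" using M by (simp_all add: kv_def)
      from s show ?thesis
      proof
        assume s: "s = 1"
        then have "q = 0" unfolding q_def k(1) using ext by (intro mobility_split_vanish) simp
        then show ?thesis unfolding F k s using nn by simp
      next
        assume s: "s = -1"
        then have "p = 0" unfolding p_def k(1) using ext by (intro mobility_split_vanish') simp
        then show ?thesis unfolding F k s using nn by simp
      qed
    next
      case 2
      then have k: "lv = ?v" "jump \<T> \<nu> e ?\<chi> x = -1" using M by (simp_all add: lv_def)
      from s show ?thesis
      proof
        assume s: "s = 1"
        then have "p = 0" unfolding p_def k(1) using ext by (intro mobility_split_vanish) simp
        then show ?thesis unfolding F k s using nn by simp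
      next
        assume s: "s = -1"
        then have "q = 0" unfolding q_def k(1) using ext by (intro mobility_split_vanish') simp
        then show ?thesis unfolding F k s using nn by simp
      qed
    next
      case 3
      then show ?thesis unfolding F M by simp
    qed
  qed
  have "s * b_upw \<Omega> \<T> \<nu> \<mu> \<phi> ?\<chi> = (\<Sum>e\<in>interior_faces \<T>. 1 / bary_dist \<T> \<nu> e * face_int \<nu> e (\<lambda>x. s * F e x))"
    unfolding b_upw_def F_def[symmetric] face_int_cmult sum_distrib_left
    by (rule sum.cong) simp_all
  also have "0 \<le> \<dots>"
    by (intro sum_nonneg mult_nonneg_nonneg face_int_nonneg Fs) (simp_all add: bary_dist_def)
  finally show ?thesis .
qed

text \<open>Multiplied by the jump j, the two parts of the flux yield the squares of the positive
  and of the negative part of j, with nonnegative mobilities.\<close>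

lemma b_upw_nonneg: "0 \<le> b_upw \<Omega> \<T> \<nu> \<mu> \<phi> (Pi0 \<Omega> \<T> \<mu>)"
proof -
  have *: "0 \<le> (pos_part j * pos_part a - neg_part j * pos_part b) * j" for j a b
  proof (cases "j \<ge> 0")
    case True
    then show ?thesis by (simp add: pos_part_def neg_part_def)
  next
    case False
    then have "(pos_part j * pos_part a - neg_part j * pos_part b) * j = (j * j) * pos_part b"
      by (simp add: pos_part_def neg_part_def)
    moreover have "0 \<le> (j * j) * pos_part b"
      by (rule mult_nonneg_nonneg) (simp_all add: pos_part_def)
    ultimately show ?thesis by (simp only:)
  qed
  show ?thesis
    unfolding b_upw_def Let_def
    by (rule sum_nonneg, rule mult_nonneg_nonneg[OF _ face_int_nonneg[OF *]]) (simp add: bary_dist_def)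
qed

text \<open>If the bound failed, (S3) would be tested with the indicator of a cell where s \<phi>1
  is largest: multiplied by s, the transport and mobility terms are nonnegative and the time
  increment is positive, so the sum could not be 0. The lower bound is the case s = -1.\<close>

lemma (in discrete_velocity) discrete_maximum_principle:
  assumes div0: "\<And>w. w \<in> P0disc \<T> \<Longrightarrow> (LINT x:\<Omega>|lebesgue. div_h \<T> u x * w x) = 0"
    and dt: "0 < dt" and \<phi>0: "\<phi>0 \<in> P0disc \<T>" and \<phi>1: "\<phi>1 \<in> P0disc \<T>"
    and bound: "\<And>K x. K \<in> \<T> \<Longrightarrow> x \<in> interior K \<Longrightarrow> \<bar>\<phi>0 x\<bar> \<le> 1"
    and phase: "\<And>\<phi>b. \<phi>b \<in> P0disc \<T> \<Longrightarrow> phase_eq \<Omega> \<T> \<nu> dt \<phi>0 u \<phi>1 \<mu> \<phi>b"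
    and K: "K \<in> \<T>" "x \<in> interior K"
  shows "\<bar>\<phi>1 x\<bar> \<le> 1"
proof -
  have upper: "s * cell_value \<phi>1 L \<le> 1" if s: "s = 1 \<or> s = -1" and L: "L \<in> \<T>" for s L
  proof (rule ccontr)
    assume L1: "\<not> s * cell_value \<phi>1 L \<le> 1"
    let ?V = "(\<lambda>L. s * cell_value \<phi>1 L) ` \<T>"
    have "Max ?V \<in> ?V" using finite_mesh L by (intro Max_in) auto
    then obtain A where A: "A \<in> \<T>" "s * cell_value \<phi>1 A = Max ?V" by auto
    have ext: "s * cell_value \<phi>1 B \<le> s * cell_value \<phi>1 A" if "B \<in> \<T>" for B
      unfolding A(2) using finite_mesh that by (intro Max_ge) auto
    have gt: "1 < s * cell_value \<phi>1 A" using ext[OF L] L1 by linarith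
    let ?\<chi> = "indicator (interior A) :: real ^ 'd \<Rightarrow> real"
    note \<chi> = cell_indicator(1)[OF A(1)]
    have "(LINT x:A|lebesgue. div_h \<T> u x) = 0"
      using div0[OF \<chi>] integral_cell_indicator[OF A(1) div_h_integrable] by (simp add: mult.commute)
    then have a: "0 \<le> s * a_upw \<T> \<nu> u \<phi>1 ?\<chi>"
      by (rule a_upw_extremal_cell[OF _ \<phi>1 A(1) s ext])
    have b: "0 \<le> s * b_upw \<Omega> \<T> \<nu> \<mu> \<phi>1 ?\<chi>"
      by (rule b_upw_extremal_cell[OF \<phi>1 A(1) s gt])
    have P: "(\<lambda>x. (\<phi>1 x - \<phi>0 x) / dt) \<in> P0disc \<T>"
      by (rule P0discI[where c = "\<lambda>K. (cell_value \<phi>1 K - cell_value \<phi>0 K) / dt"])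
        (simp add: cell_value[OF \<phi>0] cell_value[OF \<phi>1])
    have "L2_prod \<Omega> (\<lambda>x. (\<phi>1 x - \<phi>0 x) / dt) ?\<chi> = (LINT x:A|lebesgue. (\<phi>1 x - \<phi>0 x) / dt)"
      unfolding L2_prod_def using integral_cell_indicator[OF A(1) set_integrable_P0disc[OF P]]
      by (simp add: mult.commute)
    also have "\<dots> = cell_value (\<lambda>x. (\<phi>1 x - \<phi>0 x) / dt) A * measure lebesgue A"
      using integral_cell_P0disc_mult[OF P A(1), of "\<lambda>_. 1"] lmeasurable_compact[OF cell_compact[OF A(1)]]
      by (simp add: set_lebesgue_integral_def)
    also have "cell_value (\<lambda>x. (\<phi>1 x - \<phi>0 x) / dt) A = (cell_value \<phi>1 A - cell_value \<phi>0 A) / dt"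
    proof -
      obtain y where y: "y \<in> interior A" using cell_interior_nonempty[OF A(1)] by blast
      show ?thesis
        using cell_value[OF P A(1) y] cell_value[OF \<phi>0 A(1) y] cell_value[OF \<phi>1 A(1) y] by simp
    qed
    finally have t: "L2_prod \<Omega> (\<lambda>x. (\<phi>1 x - \<phi>0 x) / dt) ?\<chi> = (cell_value \<phi>1 A - cell_value \<phi>0 A) / dt * measure lebesgue A" .
    have "s * cell_value \<phi>0 A \<le> 1"
    proof -
      obtain y where y: "y \<in> interior A" using cell_interior_nonempty[OF A(1)] by blast
      show ?thesis
        using bound[OF A(1) y] cell_value[OF \<phi>0 A(1) y] s by auto
    qed
    then have "0 < s * cell_value \<phi>1 A - s * cell_value \<phi>0 A"
      using gt by linarith
    then have "0 < (s * cell_value \<phi>1 A - s * cell_value \<phi>0 A) / dt * measure lebesgue A"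
      using dt cell_measure_pos[OF A(1)] by (intro mult_pos_pos divide_pos_pos)
    also have "\<dots> = s * L2_prod \<Omega> (\<lambda>x. (\<phi>1 x - \<phi>0 x) / dt) ?\<chi>"
      unfolding t by (simp add: field_simps)
    finally have "0 < s * (L2_prod \<Omega> (\<lambda>x. (\<phi>1 x - \<phi>0 x) / dt) ?\<chi> + a_upw \<T> \<nu> u \<phi>1 ?\<chi> + b_upw \<Omega> \<T> \<nu> \<mu> \<phi>1 ?\<chi>)"
      using a b by (simp add: distrib_left)
    then show False
      using phase[OF \<chi>] unfolding phase_eq_def by simp
  qed
  show ?thesis
    using upper[of 1 K] upper[of "-1" K] K(1) cell_value[OF \<phi>1 K] by auto
qed

section \<open>The energy law\<close>

text \<open>Four times the difference of the two sides factors as (a - b)^2 (10 - (a + b)^2 - 2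
  b^2), whose last factor is at least 4 on [-1, 1]. One polynomial identity thus covers the convex
  and the concave part together.\<close>

lemma F_pot_convex_splitting:
  assumes a: "\<bar>a\<bar> \<le> 1" and b: "\<bar>b\<bar> \<le> 1"
  shows "F_pot a - F_pot b \<le> f_split a b * (a - b)"
proof -
  have di: "deriv F_i a = 2 * a"
    unfolding F_i_def[abs_def] by (rule DERIV_imp_deriv) (auto intro!: derivative_eq_intros)
  have de: "deriv F_e b = b ^ 3 - 3 * b"
    unfolding F_e_def[abs_def] by (rule DERIV_imp_deriv) (auto intro!: derivative_eq_intros)
  have "(a + b)\<^sup>2 \<le> 2\<^sup>2"
    using a b by (intro power2_le_iff_abs_le[THEN iffD2]) auto
  moreover have "b\<^sup>2 \<le> 1"
    using b by (simp add: abs_square_le_1)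
  ultimately have "0 \<le> 10 - (a + b)\<^sup>2 - 2 * b\<^sup>2" by simp
  then have "0 \<le> (a - b)\<^sup>2 * (10 - (a + b)\<^sup>2 - 2 * b\<^sup>2)"
    by (intro mult_nonneg_nonneg) auto
  also have "\<dots> = 4 * (f_split a b * (a - b) - (F_pot a - F_pot b))"
    unfolding f_split_def di de F_pot_def by (simp add: power2_eq_square power3_eq_cube algebra_simps)
  finally show ?thesis by simp
qed

text \<open>The two sides differ by r0 |u - v|^2 / (2 dt). The last term on the right is the first
  half of \<open>s1_h\<close>, which compensates the change of density in the kinetic
  energy.\<close>

lemma kinetic_energy_step:
  fixes u v :: "'a::real_inner"
  assumes "0 \<le> r0" "0 < dt"
  shows "(r1 * ((norm u)\<^sup>2 / 2) - r0 * ((norm v)\<^sup>2 / 2)) / dt \<le>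
    (r0 *\<^sub>R ((1 / dt) *\<^sub>R (u - v))) \<bullet> u + 1/2 * ((r1 - r0) / dt * (u \<bullet> u))"
proof -
  have "0 \<le> r0 / (2 * dt) * ((u - v) \<bullet> (u - v))"
    using assms by (intro mult_nonneg_nonneg) auto
  also have "\<dots> = (r0 *\<^sub>R ((1 / dt) *\<^sub>R (u - v))) \<bullet> u + 1/2 * ((r1 - r0) / dt * (u \<bullet> u)) -
      (r1 * ((norm u)\<^sup>2 / 2) - r0 * ((norm v)\<^sup>2 / 2)) / dt"
    using assms(2) unfolding power2_norm_eq_inner
    by (simp add: field_simps inner_diff_left inner_diff_right inner_commute[of v u])
  finally show ?thesis by simp
qed

lemma (in discrete_velocity) convection_skew_symmetric:
  "L2_prod \<Omega> (\<lambda>x. jac_h \<T> u x *v w x) u = 1/2 * L2_prod \<Omega> w (grad_h \<T> (\<lambda>x. u x \<bullet> u x))"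
proof -
  have "has_weak_grad \<Omega> (\<lambda>x. \<Sum>i\<in>UNIV. u x $ i * u x $ i)
      (\<lambda>x. \<Sum>i\<in>UNIV. (2 * u x $ i) *\<^sub>R weak_grad \<Omega> (\<lambda>x. u x $ i) x)"
    by (rule has_weak_grad_sum) (auto intro: H10_square_weak_grad[OF open_domain u_H10])
  then have "has_weak_grad \<Omega> (\<lambda>x. u x \<bullet> u x) (\<lambda>x. \<Sum>i\<in>UNIV. (2 * u x $ i) *\<^sub>R weak_grad \<Omega> (\<lambda>x. u x $ i) x)"
    by (simp add: inner_vec_def)
  note g = grad_h_eq_weak_grad[OF this]
  have "(LINT x:\<Omega>|lebesgue. w x \<bullet> grad_h \<T> (\<lambda>x. u x \<bullet> u x) x) = (LINT x:\<Omega>|lebesgue. 2 * ((jac_h \<T> u x *v w x) \<bullet> u x))"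
  proof (rule set_lint_cong_AE)
    show "AE x in lebesgue. x \<in> \<Omega> \<longrightarrow> w x \<bullet> grad_h \<T> (\<lambda>x. u x \<bullet> u x) x = 2 * ((jac_h \<T> u x *v w x) \<bullet> u x)"
      using g jac_h_AE
    proof eventually_elim
      fix x assume 1: "x \<in> \<Omega> \<longrightarrow> grad_h \<T> (\<lambda>x. u x \<bullet> u x) x = (\<Sum>i\<in>UNIV. (2 * u x $ i) *\<^sub>R weak_grad \<Omega> (\<lambda>x. u x $ i) x)"
        and 2: "x \<in> \<Omega> \<longrightarrow> (\<forall>i. jac_h \<T> u x $ i = weak_grad \<Omega> (\<lambda>x. u x $ i) x)"
      show "x \<in> \<Omega> \<longrightarrow> w x \<bullet> grad_h \<T> (\<lambda>x. u x \<bullet> u x) x = 2 * ((jac_h \<T> u x *v w x) \<bullet> u x)"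
      proof
        assume x: "x \<in> \<Omega>"
        have "(jac_h \<T> u x *v w x) \<bullet> u x = (\<Sum>i\<in>UNIV. (jac_h \<T> u x $ i \<bullet> w x) * u x $ i)"
          unfolding inner_vec_def[of "jac_h \<T> u x *v w x"] matrix_vector_mul_component by simp
        then show "w x \<bullet> grad_h \<T> (\<lambda>x. u x \<bullet> u x) x = 2 * ((jac_h \<T> u x *v w x) \<bullet> u x)"
          using 1 2 x by (simp add: inner_sum_right sum_distrib_left inner_commute[of "w x"] mult_ac)
      qed
    qed
  qed
  then show ?thesis
    unfolding L2_prod_def by simp
qed

theorem corollary3p10:
  fixes \<Omega> :: "(real ^ 'd) set"
    and \<T> :: "(real ^ 'd) set set"
    and \<nu> :: "(real ^ 'd) set \<Rightarrow> real ^ 'd"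
    and U :: "(real ^ 'd \<Rightarrow> real ^ 'd) set"
    and P :: "(real ^ 'd \<Rightarrow> real) set"
    and \<rho>1 \<rho>2 lam eps dt \<sigma> :: real
    and \<eta> :: "real \<Rightarrow> real"
    and u0 u1 :: "real ^ 'd \<Rightarrow> real ^ 'd"
    and p1 \<phi>0 \<phi>1 \<mu>0 \<mu>1 :: "real ^ 'd \<Rightarrow> real"
  assumes dim: "CARD('d) = 2 \<or> CARD('d) = 3"
    and domain: "polyhedral_domain \<Omega>"
    and params: "0 < \<rho>1" "\<rho>1 < \<rho>2" "0 < lam" "0 < eps" "0 < dt"
    and viscosity: "continuous_on {-1..1} \<eta>" "\<exists>C>0. \<forall>z\<in>{-1..1}. \<eta> z \<ge> C"
    and mesh: "simplicial_mesh \<Omega> \<T>" "0 < \<sigma>" "shape_regular \<sigma> \<T>"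
      "barycenters_orthogonal \<T>" "face_normals \<T> \<nu>"
    and spaces: "velocity_pressure_pair \<Omega> \<T> U P"
    and data: "u0 \<in> U" "\<phi>0 \<in> P0disc \<T>" "\<And>K x. K \<in> \<T> \<Longrightarrow> x \<in> interior K \<Longrightarrow> \<phi>0 x \<in> {-1..1}"
      "\<mu>0 \<in> P1cont \<T>"
    and solution:
      "scheme_solution \<Omega> \<T> \<nu> U P \<rho>1 \<rho>2 lam eps dt \<eta> u0 \<phi>0 \<mu>0 u1 p1 \<phi>1 \<mu>1"
  shows "(energy \<Omega> \<T> \<rho>1 \<rho>2 lam eps u1 (Pi1h \<Omega> \<T> \<phi>1)
            - energy \<Omega> \<T> \<rho>1 \<rho>2 lam eps u0 (Pi1h \<Omega> \<T> \<phi>0)) / dt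
           + 2 * viscous_form \<Omega> \<T> \<eta> \<phi>0 u1 u1
           + b_upw \<Omega> \<T> \<nu> \<mu>1 \<phi>1 (Pi0 \<Omega> \<T> \<mu>1) \<le> 0
       \<and> (energy \<Omega> \<T> \<rho>1 \<rho>2 lam eps u1 (Pi1h \<Omega> \<T> \<phi>1)
            - energy \<Omega> \<T> \<rho>1 \<rho>2 lam eps u0 (Pi1h \<Omega> \<T> \<phi>0)) / dt \<le> 0"
proof -
  have sol: "u1 \<in> U" "p1 \<in> P" "\<phi>1 \<in> P0disc \<T>" "\<mu>1 \<in> P1cont \<T>"
    and S1: "momentum_eq \<Omega> \<T> \<nu> \<rho>1 \<rho>2 dt \<eta> u0 \<phi>0 \<mu>0 u1 p1 \<phi>1 \<mu>1 u1"
    and S2: "\<And>pb. pb \<in> P \<Longrightarrow> L2_prod \<Omega> (div_h \<T> u1) pb = 0"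
    and S3: "\<And>\<phi>b. \<phi>b \<in> P0disc \<T> \<Longrightarrow> phase_eq \<Omega> \<T> \<nu> dt \<phi>0 u1 \<phi>1 \<mu>1 \<phi>b"
    and S4: "\<And>\<mu>b. \<mu>b \<in> P1cont \<T> \<Longrightarrow> potential_eq \<Omega> \<T> lam eps \<phi>0 \<phi>1 \<mu>1 \<mu>b"
    using solution unfolding scheme_solution_def incompressibility_eq_def by blast+
  have vel: "continuous_on (closure \<Omega>) u" "(\<lambda>x. u x $ i) \<in> H10_space \<Omega>" if "u \<in> U" for u i
    using spaces that unfolding velocity_pressure_pair_def by blast+
  interpret discrete_velocity \<Omega> \<T> \<nu> u1
    by unfold_locales (use domain mesh vel[OF sol(1)] in auto)
  let ?q1 = "Pi1h \<Omega> \<T> \<phi>1" and ?q0 = "Pi1h \<Omega> \<T> \<phi>0" and ?m = "Pi0 \<Omega> \<T> \<mu>1"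
  let ?r1 = "\<lambda>x. rho \<rho>1 \<rho>2 (?q1 x)" and ?r0 = "\<lambda>x. rho \<rho>1 \<rho>2 (?q0 x)"
  have \<mu>i: "set_integrable lebesgue \<Omega> \<mu>1"
    by (rule set_integrable_continuous_domain[OF P1cont_continuous[OF sol(4)]])
  note m = Pi0[OF \<mu>i]
  note q1 = Pi1h[OF sol(3)] and q0 = Pi1h[OF data(2)]
  \<comment> \<open>Piecewise constants belong to the pressure space only up to null sets, hence the
    detour through p.\<close>
  have div0: "(LINT x:\<Omega>|lebesgue. div_h \<T> u1 x * w x) = 0" if w: "w \<in> P0disc \<T>" for w
  proof -
    obtain p where p: "p \<in> P" "AE x in lebesgue. x \<in> \<Omega> \<longrightarrow> p x = w x"
      using spaces w unfolding velocity_pressure_pair_def by blast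
    have "(LINT x:\<Omega>|lebesgue. div_h \<T> u1 x * w x) = (LINT x:\<Omega>|lebesgue. div_h \<T> u1 x * p x)"
      by (rule set_lint_cong_AE) (use p(2) in \<open>auto elim!: eventually_mono\<close>)
    then show ?thesis using S2[OF p(1)] unfolding L2_prod_def by simp
  qed
  have bound0: "\<bar>\<phi>0 x\<bar> \<le> 1" if "K \<in> \<T>" "x \<in> interior K" for K x
    using data(3)[OF that] by (auto simp: abs_le_iff)
  have bound1: "\<bar>\<phi>1 x\<bar> \<le> 1" if "K \<in> \<T>" "x \<in> interior K" for K x
    by (rule discrete_maximum_principle[OF div0 params(5) data(2) sol(3) bound0 S3 that])
  have qb: "\<bar>?q1 x\<bar> \<le> 1" "\<bar>?q0 x\<bar> \<le> 1" if "x \<in> \<Omega>" for x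
  proof -
    have cl: "x \<in> closure \<Omega>" using that closure_subset by (rule rev_subsetD)
    show "\<bar>?q1 x\<bar> \<le> 1" by (rule Pi1h_bounds[OF sol(3) bound1 cl])
    show "\<bar>?q0 x\<bar> \<le> 1" by (rule Pi1h_bounds[OF data(2) bound0 cl])
  qed
  \<comment> \<open>The density increases with the phase and equals \<rho>1 > 0 at -1.\<close>
  have r0_nonneg: "0 \<le> ?r0 x" if "x \<in> \<Omega>" for x
  proof -
    have "rho_dif \<rho>1 \<rho>2 * (- 1) \<le> rho_dif \<rho>1 \<rho>2 * ?q0 x"
      using qb(2)[OF that] params(2) by (intro mult_left_mono) (auto simp: rho_dif_def)
    then show ?thesis
      using params(1) unfolding rho_def rho_avg_def rho_dif_def by (simp add: field_simps)
  qed
  note cq1 = P1cont_continuous[OF q1(1)] and cq0 = P1cont_continuous[OF q0(1)]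
  note cu1 = vel(1)[OF sol(1)] and cu0 = vel(1)[OF data(1)]
  have cr1: "continuous_on (closure \<Omega>) ?r1" and cr0: "continuous_on (closure \<Omega>) ?r0"
    unfolding rho_def using cq1 cq0 by (auto intro!: continuous_intros)

  define T1 where "T1 = L2_prod \<Omega> (\<lambda>x. ?r0 x *\<^sub>R ((1 / dt) *\<^sub>R (u1 x - u0 x))) u1"
  define Sa where "Sa = L2_prod \<Omega> (\<lambda>x. (?r1 x - ?r0 x) / dt) (\<lambda>x. u1 x \<bullet> u1 x)"
  define a where "a = a_upw \<T> \<nu> u1 \<phi>1 ?m"
  define b where "b = b_upw \<Omega> \<T> \<nu> \<mu>1 \<phi>1 ?m"
  define visc where "visc = viscous_form \<Omega> \<T> \<eta> \<phi>0 u1 u1"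
  \<comment> \<open>The convection cancels the second half of \<open>s1_h\<close>, the pressure
    drops out by (S2), and the divergence term left by \<open>c_h_plus_s2_h\<close> vanishes because
    a product of piecewise constants is piecewise constant.\<close>
  have momentum: "T1 + 1/2 * Sa + 2 * visc - a = 0"
  proof -
    have prod: "(\<lambda>x. \<phi>1 x * ?m x) \<in> P0disc \<T>"
      by (rule P0discI[where c = "\<lambda>K. cell_value \<phi>1 K * cell_value ?m K"])
        (simp add: cell_value[OF sol(3)] cell_value[OF m(1)])
    have "c_h \<Omega> \<T> \<nu> \<phi>1 ?m u1 + s2_h \<T> \<nu> u1 \<phi>1 ?m u1 = - a"
      unfolding c_h_plus_s2_h[OF sol(3) m(1)] div0[OF prod] a_def by simp
    moreover have "L2_prod \<Omega> p1 (div_h \<T> u1) = 0"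
      using S2[OF sol(2)] unfolding L2_prod_def by (simp add: mult.commute)
    moreover note convection_skew_symmetric[of "\<lambda>x. ?r0 x *\<^sub>R u0 x - flux_J \<Omega> \<T> \<rho>1 \<rho>2 \<phi>0 \<mu>0 x"]
    ultimately show ?thesis
      using S1 unfolding momentum_eq_def s1_h_def flux_J_def[symmetric] T1_def Sa_def visc_def
      by (simp add: algebra_simps)
  qed

  let ?d = "\<lambda>x. (1 / dt) * ?q1 x + (- 1 / dt) * ?q0 x"
  have d: "?d \<in> P1cont \<T>"
    by (rule P1cont_linear_combination[OF q1(1) q0(1)])
  \<comment> \<open>The time increment of \<phi> is piecewise constant, so \<open>Pi0\<close> may be
    dropped from its product with \<mu>1; the defining property of \<open>Pi1h\<close> then yields
    the lumped product that also occurs in (S4).\<close>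
  have phase: "lumped_prod \<T> \<mu>1 ?d + a + b = 0"
  proof -
    have P: "(\<lambda>x. (\<phi>1 x - \<phi>0 x) / dt) \<in> P0disc \<T>"
      by (rule P0discI[where c = "\<lambda>K. (cell_value \<phi>1 K - cell_value \<phi>0 K) / dt"])
        (simp add: cell_value[OF data(2)] cell_value[OF sol(3)])
    have "L2_prod \<Omega> (\<lambda>x. (\<phi>1 x - \<phi>0 x) / dt) ?m = L2_prod \<Omega> ?m (\<lambda>x. (\<phi>1 x - \<phi>0 x) / dt)"
      unfolding L2_prod_def by (simp add: mult.commute)
    also have "\<dots> = L2_prod \<Omega> \<mu>1 (\<lambda>x. (\<phi>1 x - \<phi>0 x) / dt)"
      by (rule m(2)[OF P])
    also have "\<dots> = (LINT x:\<Omega>|lebesgue. (1 / dt) * (\<phi>1 x * \<mu>1 x) - (1 / dt) * (\<phi>0 x * \<mu>1 x))"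
      unfolding L2_prod_def by (simp add: algebra_simps diff_divide_distrib)
    also have "\<dots> = (1 / dt) * L2_prod \<Omega> \<phi>1 \<mu>1 - (1 / dt) * L2_prod \<Omega> \<phi>0 \<mu>1"
      unfolding L2_prod_def
      using set_integrable_P0disc_mult[OF sol(3) \<mu>i] set_integrable_P0disc_mult[OF data(2) \<mu>i]
      by (subst set_integral_diff(2)) (auto intro!: set_integrable_mult_right)
    also have "\<dots> = (1 / dt) * lumped_prod \<T> ?q1 \<mu>1 - (1 / dt) * lumped_prod \<T> ?q0 \<mu>1"
      unfolding q1(2)[OF sol(4)] q0(2)[OF sol(4)] ..
    also have "\<dots> = lumped_prod \<T> \<mu>1 ?d"
      unfolding lumped_prod_eq sum_distrib_left sum_subtractf[symmetric]
      by (rule sum.cong) (simp_all add: algebra_simps)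
    finally show ?thesis
      using S3[OF m(1)] unfolding phase_eq_def a_def b_def by simp
  qed

  let ?g1 = "grad_h \<T> ?q1" and ?g0 = "grad_h \<T> ?q0"
  define Gd where "Gd = L2_prod \<Omega> ?g1 (grad_h \<T> ?d)"
  define Fd where "Fd = L2_prod \<Omega> (\<lambda>x. f_split (?q1 x) (?q0 x)) ?d"
  have potential: "lam * eps * Gd + lam / eps * Fd = lumped_prod \<T> \<mu>1 ?d"
    using S4[OF d] unfolding potential_eq_def Gd_def Fd_def by simp

  have kinetic: "((LINT x:\<Omega>|lebesgue. ?r1 x * ((norm (u1 x))\<^sup>2 / 2)) - (LINT x:\<Omega>|lebesgue. ?r0 x * ((norm (u0 x))\<^sup>2 / 2))) / dt \<le> T1 + 1/2 * Sa"
  proof -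
    note sic = set_integrable_continuous_domain
    have i1: "set_integrable lebesgue \<Omega> (\<lambda>x. ?r1 x * ((norm (u1 x))\<^sup>2 / 2))"
      and i0: "set_integrable lebesgue \<Omega> (\<lambda>x. ?r0 x * ((norm (u0 x))\<^sup>2 / 2))"
      and iT: "set_integrable lebesgue \<Omega> (\<lambda>x. (?r0 x *\<^sub>R ((1 / dt) *\<^sub>R (u1 x - u0 x))) \<bullet> u1 x)"
      and iS: "set_integrable lebesgue \<Omega> (\<lambda>x. (?r1 x - ?r0 x) / dt * (u1 x \<bullet> u1 x))"
      by (rule sic, use cr1 cr0 cu1 cu0 params(5) in \<open>auto intro!: continuous_intros\<close>)+
    have "((LINT x:\<Omega>|lebesgue. ?r1 x * ((norm (u1 x))\<^sup>2 / 2)) - (LINT x:\<Omega>|lebesgue. ?r0 x * ((norm (u0 x))\<^sup>2 / 2))) / dt =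
        (LINT x:\<Omega>|lebesgue. (?r1 x * ((norm (u1 x))\<^sup>2 / 2) - ?r0 x * ((norm (u0 x))\<^sup>2 / 2)) / dt)"
      using i1 i0 by (subst set_integral_divide_zero) (simp add: set_integral_diff(2))
    also have "\<dots> \<le> (LINT x:\<Omega>|lebesgue. (?r0 x *\<^sub>R ((1 / dt) *\<^sub>R (u1 x - u0 x))) \<bullet> u1 x + 1/2 * ((?r1 x - ?r0 x) / dt * (u1 x \<bullet> u1 x)))"
    proof (rule set_integral_mono)
      show "set_integrable lebesgue \<Omega> (\<lambda>x. (?r1 x * ((norm (u1 x))\<^sup>2 / 2) - ?r0 x * ((norm (u0 x))\<^sup>2 / 2)) / dt)"
        using i1 i0 by (intro set_integrable_divide set_integral_diff(1))
      show "set_integrable lebesgue \<Omega> (\<lambda>x. (?r0 x *\<^sub>R ((1 / dt) *\<^sub>R (u1 x - u0 x))) \<bullet> u1 x + 1/2 * ((?r1 x - ?r0 x) / dt * (u1 x \<bullet> u1 x)))"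
        using iT iS by (intro set_integral_add(1) set_integrable_mult_right)
    qed (rule kinetic_energy_step[OF r0_nonneg params(5)])
    also have "\<dots> = T1 + 1/2 * Sa"
      unfolding T1_def Sa_def L2_prod_def inner_real_def
      by (subst set_integral_add(2)[OF iT set_integrable_mult_right[OF iS]]) simp
    finally show ?thesis .
  qed

  \<comment> \<open>The slack in the pointwise inequality is |g1 - g0|^2 / (2 dt).\<close>
  have gradient: "1/2 * ((LINT x:\<Omega>|lebesgue. (norm (?g1 x))\<^sup>2) - (LINT x:\<Omega>|lebesgue. (norm (?g0 x))\<^sup>2)) / dt \<le> Gd"
  proof -
    note i11 = set_integrable_P1cont_grad_inner[OF q1(1) q1(1)] and i00 = set_integrable_P1cont_grad_inner[OF q0(1) q0(1)]
      and i10 = set_integrable_P1cont_grad_inner[OF q1(1) q0(1)]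
    have "1/2 * ((LINT x:\<Omega>|lebesgue. (norm (?g1 x))\<^sup>2) - (LINT x:\<Omega>|lebesgue. (norm (?g0 x))\<^sup>2)) / dt =
        (LINT x:\<Omega>|lebesgue. (1 / (2 * dt)) * (?g1 x \<bullet> ?g1 x - ?g0 x \<bullet> ?g0 x))"
      unfolding power2_norm_eq_inner using i11 i00 by (simp add: set_integral_diff(2))
    also have "\<dots> \<le> (LINT x:\<Omega>|lebesgue. (1 / dt) * (?g1 x \<bullet> ?g1 x) - (1 / dt) * (?g1 x \<bullet> ?g0 x))"
    proof (rule set_integral_mono)
      show "set_integrable lebesgue \<Omega> (\<lambda>x. (1 / (2 * dt)) * (?g1 x \<bullet> ?g1 x - ?g0 x \<bullet> ?g0 x))"
        using i11 i00 by (intro set_integrable_mult_right set_integral_diff(1))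
      show "set_integrable lebesgue \<Omega> (\<lambda>x. (1 / dt) * (?g1 x \<bullet> ?g1 x) - (1 / dt) * (?g1 x \<bullet> ?g0 x))"
        using i11 i10 by (intro set_integral_diff(1) set_integrable_mult_right)
      fix x
      have "0 \<le> (1 / (2 * dt)) * ((?g1 x - ?g0 x) \<bullet> (?g1 x - ?g0 x))"
        using params(5) by (intro mult_nonneg_nonneg) auto
      also have "\<dots> = (1 / dt) * (?g1 x \<bullet> ?g1 x) - (1 / dt) * (?g1 x \<bullet> ?g0 x) - (1 / (2 * dt)) * (?g1 x \<bullet> ?g1 x - ?g0 x \<bullet> ?g0 x)"
        using params(5) by (simp add: field_simps inner_diff_left inner_diff_right inner_commute[of "?g0 x" "?g1 x"])
      finally show "(1 / (2 * dt)) * (?g1 x \<bullet> ?g1 x - ?g0 x \<bullet> ?g0 x) \<le> (1 / dt) * (?g1 x \<bullet> ?g1 x) - (1 / dt) * (?g1 x \<bullet> ?g0 x)"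
        by simp
    qed
    also have "\<dots> = Gd"
      unfolding Gd_def L2_prod_def
    proof (rule set_lint_cong_AE)
      show "AE x in lebesgue. x \<in> \<Omega> \<longrightarrow> (1 / dt) * (?g1 x \<bullet> ?g1 x) - (1 / dt) * (?g1 x \<bullet> ?g0 x) = ?g1 x \<bullet> grad_h \<T> ?d x"
        using P1cont_grad_linear_combination[OF q1(1) q0(1), of "1 / dt" "- 1 / dt"]
        by eventually_elim (auto simp: inner_diff_right)
    qed
    finally show ?thesis .
  qed

  have double_well: "((LINT x:\<Omega>|lebesgue. F_pot (?q1 x)) - (LINT x:\<Omega>|lebesgue. F_pot (?q0 x))) / dt \<le> Fd"
  proof -
    have i1: "set_integrable lebesgue \<Omega> (\<lambda>x. F_pot (?q1 x))" and i0: "set_integrable lebesgue \<Omega> (\<lambda>x. F_pot (?q0 x))"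
      unfolding F_pot_def by (rule set_integrable_continuous_domain, use cq1 cq0 in \<open>auto intro!: continuous_intros\<close>)+
    \<comment> \<open>Explicit derivatives show that the integrand is continuous on the closed
      domain.\<close>
    have di: "deriv F_i = (\<lambda>z. 2 * z)" and de: "deriv F_e = (\<lambda>z. z ^ 3 - 3 * z)"
      unfolding F_i_def[abs_def] F_e_def[abs_def]
      by (rule ext, rule DERIV_imp_deriv, auto intro!: derivative_eq_intros)+
    have iF: "set_integrable lebesgue \<Omega> (\<lambda>x. f_split (?q1 x) (?q0 x) * ?d x)"
      unfolding f_split_def di de
      by (rule set_integrable_continuous_domain) (use cq1 cq0 params(5) in \<open>auto intro!: continuous_intros\<close>)
    have "((LINT x:\<Omega>|lebesgue. F_pot (?q1 x)) - (LINT x:\<Omega>|lebesgue. F_pot (?q0 x))) / dt =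
        (LINT x:\<Omega>|lebesgue. (F_pot (?q1 x) - F_pot (?q0 x)) / dt)"
      using i1 i0 by (subst set_integral_divide_zero) (simp add: set_integral_diff(2))
    also have "\<dots> \<le> (LINT x:\<Omega>|lebesgue. f_split (?q1 x) (?q0 x) * ?d x)"
    proof (rule set_integral_mono)
      show "set_integrable lebesgue \<Omega> (\<lambda>x. (F_pot (?q1 x) - F_pot (?q0 x)) / dt)"
        using i1 i0 by (intro set_integrable_divide set_integral_diff(1))
      fix x assume x: "x \<in> \<Omega>"
      have "(F_pot (?q1 x) - F_pot (?q0 x)) / dt \<le> f_split (?q1 x) (?q0 x) * (?q1 x - ?q0 x) / dt"
        using F_pot_convex_splitting[OF qb[OF x]] params(5) by (simp add: divide_right_mono)
      then show "(F_pot (?q1 x) - F_pot (?q0 x)) / dt \<le> f_split (?q1 x) (?q0 x) * ?d x"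
        by (simp add: right_diff_distrib diff_divide_distrib)
    qed (rule iF)
    also have "\<dots> = Fd"
      unfolding Fd_def L2_prod_def by simp
    finally show ?thesis .
  qed

  define E1 E0 where "E1 = energy \<Omega> \<T> \<rho>1 \<rho>2 lam eps u1 ?q1" and "E0 = energy \<Omega> \<T> \<rho>1 \<rho>2 lam eps u0 ?q0"
  \<comment> \<open>The transport term a cancels between \<open>momentum\<close> and
    \<open>phase\<close>, the lumped product between \<open>phase\<close> and
    \<open>potential\<close>.\<close>
  have law: "(E1 - E0) / dt + 2 * visc + b \<le> 0"
  proof -
    have "lam * eps * (1/2 * ((LINT x:\<Omega>|lebesgue. (norm (?g1 x))\<^sup>2) - (LINT x:\<Omega>|lebesgue. (norm (?g0 x))\<^sup>2)) / dt) \<le> lam * eps * Gd"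
      using gradient params(3,4) by (intro mult_left_mono) auto
    moreover have "lam / eps * (((LINT x:\<Omega>|lebesgue. F_pot (?q1 x)) - (LINT x:\<Omega>|lebesgue. F_pot (?q0 x))) / dt) \<le> lam / eps * Fd"
      using double_well params(3,4) by (intro mult_left_mono) auto
    moreover have "(E1 - E0) / dt =
        ((LINT x:\<Omega>|lebesgue. ?r1 x * ((norm (u1 x))\<^sup>2 / 2)) - (LINT x:\<Omega>|lebesgue. ?r0 x * ((norm (u0 x))\<^sup>2 / 2))) / dt
        + lam * eps * (1/2 * ((LINT x:\<Omega>|lebesgue. (norm (?g1 x))\<^sup>2) - (LINT x:\<Omega>|lebesgue. (norm (?g0 x))\<^sup>2)) / dt)
        + lam / eps * (((LINT x:\<Omega>|lebesgue. F_pot (?q1 x)) - (LINT x:\<Omega>|lebesgue. F_pot (?q0 x))) / dt)"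
      unfolding E1_def E0_def energy_def by (simp add: algebra_simps diff_divide_distrib add_divide_distrib)
    ultimately show ?thesis
      using kinetic momentum phase potential by linarith
  qed
  \<comment> \<open>The lower bound on \<eta> holds on [-1, 1], where \<phi>0 takes its values on
    the open cells; the skeleton is null.\<close>
  have "0 \<le> visc"
  proof -
    have "AE x in lebesgue. 0 \<le> indicator \<Omega> x *\<^sub>R ((\<eta> (\<phi>0 x) *\<^sub>R symgrad_h \<T> u1 x) \<bullet> symgrad_h \<T> u1 x)"
      using AE_cells
    proof eventually_elim
      fix x assume x: "x \<in> closure \<Omega> \<longrightarrow> x \<in> cells"
      show "0 \<le> indicator \<Omega> x *\<^sub>R ((\<eta> (\<phi>0 x) *\<^sub>R symgrad_h \<T> u1 x) \<bullet> symgrad_h \<T> u1 x)"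
      proof (cases "x \<in> \<Omega>")
        case True
        then obtain K where "K \<in> \<T>" "x \<in> interior K" using x closure_subset by blast
        then have "\<phi>0 x \<in> {-1..1}" by (rule data(3))
        moreover obtain C where "0 < C" "\<forall>z\<in>{-1..1}. C \<le> \<eta> z" using viscosity(2) by blast
        ultimately have "0 \<le> \<eta> (\<phi>0 x)" by fastforce
        then show ?thesis by simp
      qed simp
    qed
    then show ?thesis
      unfolding visc_def viscous_form_def L2_prod_def set_lebesgue_integral_def by (rule integral_nonneg_AE)
  qed
  moreover have "0 \<le> b"
    unfolding b_def by (rule b_upw_nonneg)
  ultimately show ?thesis
    using law unfolding E1_def E0_def visc_def b_def by linarith
qed

end
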